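(* Let $p\colon A\to B$ be a morphism of rings such that $B$, viewed as a right $A$-module via $p$, is perfect (that is, $B\in \mathrm{K}^{\mathrm b}(\operatorname{proj} A)$). Let $F = -\otimes^{\mathbf L}_B {}_BB_A\colon \mathrm D(B)\to \mathrm D(A)$ be the (derived) restriction of scalars functor. Then the functor $$\mathcal T = \mathbf R\mathrm{Hom}_A({}_A\operatorname{cone}(p)[-1]_A,-)\colon \mathrm D(A)\to \mathrm D(A)$$ is the twist around $F$. Moreover, when $p$ is surjective, $\mathcal T\cong \mathbf R\mathrm{Hom}_A({}_A\ker p_A,-)$.
   Context: Modules are right modules; $\mathrm D(A)$ denotes the unbounded derived category $\mathrm D(\operatorname{Mod} A)$. The cone of $p$ is taken in complexes of $A$-bimodules, so there is a triangle $\operatorname{cone}(p)[-1]\to A\xrightarrow{p} B\to^+$ of $A$-bimodules. The functor $F$ has right adjoint $F^{\mathrm{RA}}=\mathbf R\mathrm{Hom}_A({}_BB_A,-)$ and left adjoint $F^{\mathrm{LA}}=-\otimes^{\mathbf L}_A B_B$. Twist: if $S\colon\mathcal A\to\mathcal B$ is an exact functor between triangulated categories with right adjoint $R$ (and a left adjoint $L$), the twist around $S$ is a functor $T\colon \mathcal B\to\mathcal B$ sitting in a functorial triangle $SR\xrightarrow{\epsilon}1_{\mathcal B}\to T\to^+$, where $\epsilon$ is the counit of the adjunction $(S,R)$. (That is, there are natural transformations giving, for every object $b$, a distinguished triangle $SR(b)\xrightarrow{\epsilon_b} b\to T(b)\to SR(b)[1]$.) *)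

theory Defs
  imports "HOL-Algebra.AbelCoset" "HOL-Algebra.RingHom"
begin

section \<open>Categories, functors, adjunctions\<close>

record ('o, 'm) cat =
  Obj :: "'o set"
  Arr :: "'m set"
  Dom :: "'m \<Rightarrow> 'o"
  Cod :: "'m \<Rightarrow> 'o"
  Cmp :: "'m \<Rightarrow> 'm \<Rightarrow> 'm"
  Idn :: "'o \<Rightarrow> 'm"

record ('o1, 'm1, 'o2, 'm2) funct =
  fob :: "'o1 \<Rightarrow> 'o2"
  far :: "'m1 \<Rightarrow> 'm2"

definition hom_set :: "('o, 'm, 'z) cat_scheme \<Rightarrow> 'o \<Rightarrow> 'o \<Rightarrow> 'm set" where
  "hom_set C x y = {f \<in> Arr C. Dom C f = x \<and> Cod C f = y}"

definition is_iso :: "('o, 'm, 'z) cat_scheme \<Rightarrow> 'o \<Rightarrow> 'o \<Rightarrow> 'm \<Rightarrow> bool" where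
  "is_iso C x y f \<longleftrightarrow> f \<in> hom_set C x y \<and>
     (\<exists>g \<in> hom_set C y x. Cmp C g f = Idn C x \<and> Cmp C f g = Idn C y)"

definition is_functor ::
  "('o1, 'm1, 'z1) cat_scheme \<Rightarrow> ('o2, 'm2, 'z2) cat_scheme \<Rightarrow> ('o1, 'm1, 'o2, 'm2) funct \<Rightarrow> bool"
where
  "is_functor C D F \<longleftrightarrow>
     (\<forall>x \<in> Obj C. fob F x \<in> Obj D \<and> far F (Idn C x) = Idn D (fob F x)) \<and>
     (\<forall>x \<in> Obj C. \<forall>y \<in> Obj C. \<forall>f \<in> hom_set C x y. far F f \<in> hom_set D (fob F x) (fob F y)) \<and>
     (\<forall>x \<in> Obj C. \<forall>y \<in> Obj C. \<forall>z \<in> Obj C. \<forall>f \<in> hom_set C x y. \<forall>g \<in> hom_set C y z.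
        far F (Cmp C g f) = Cmp D (far F g) (far F f))"

definition id_funct :: "('o, 'm, 'o, 'm) funct" where
  "id_funct = \<lparr>fob = (\<lambda>x. x), far = (\<lambda>f. f)\<rparr>"

definition comp_funct ::
  "('o2, 'm2, 'o3, 'm3) funct \<Rightarrow> ('o1, 'm1, 'o2, 'm2) funct \<Rightarrow> ('o1, 'm1, 'o3, 'm3) funct"
  (infixr "\<cdot>\<^sub>F" 70)
where
  "G \<cdot>\<^sub>F F = \<lparr>fob = fob G \<circ> fob F, far = far G \<circ> far F\<rparr>"

definition is_nat ::
  "('o1, 'm1, 'z1) cat_scheme \<Rightarrow> ('o2, 'm2, 'z2) cat_scheme \<Rightarrow>
   ('o1, 'm1, 'o2, 'm2) funct \<Rightarrow> ('o1, 'm1, 'o2, 'm2) funct \<Rightarrow> ('o1 \<Rightarrow> 'm2) \<Rightarrow> bool"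
where
  "is_nat C D F G \<eta> \<longleftrightarrow>
     (\<forall>x \<in> Obj C. \<eta> x \<in> hom_set D (fob F x) (fob G x)) \<and>
     (\<forall>x \<in> Obj C. \<forall>y \<in> Obj C. \<forall>f \<in> hom_set C x y.
        Cmp D (\<eta> y) (far F f) = Cmp D (far G f) (\<eta> x))"

definition is_nat_iso ::
  "('o1, 'm1, 'z1) cat_scheme \<Rightarrow> ('o2, 'm2, 'z2) cat_scheme \<Rightarrow>
   ('o1, 'm1, 'o2, 'm2) funct \<Rightarrow> ('o1, 'm1, 'o2, 'm2) funct \<Rightarrow> ('o1 \<Rightarrow> 'm2) \<Rightarrow> bool"
where
  "is_nat_iso C D F G \<eta> \<longleftrightarrow> is_nat C D F G \<eta> \<and>
     (\<forall>x \<in> Obj C. is_iso D (fob F x) (fob G x) (\<eta> x))"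

definition isomorphic_functors ::
  "('o1, 'm1, 'z1) cat_scheme \<Rightarrow> ('o2, 'm2, 'z2) cat_scheme \<Rightarrow>
   ('o1, 'm1, 'o2, 'm2) funct \<Rightarrow> ('o1, 'm1, 'o2, 'm2) funct \<Rightarrow> bool"
where
  "isomorphic_functors C D F G \<longleftrightarrow>
     is_functor C D F \<and> is_functor C D G \<and> (\<exists>\<eta>. is_nat_iso C D F G \<eta>)"

text \<open>\<open>L : C \<rightarrow> D\<close> is left adjoint to \<open>R : D \<rightarrow> C\<close>, with unit \<open>\<eta>\<close> and counit \<open>\<epsilon>\<close>.\<close>

definition is_adjunction ::
  "('o1, 'm1, 'z1) cat_scheme \<Rightarrow> ('o2, 'm2, 'z2) cat_scheme \<Rightarrow>
   ('o1, 'm1, 'o2, 'm2) funct \<Rightarrow> ('o2, 'm2, 'o1, 'm1) funct \<Rightarrow>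
   ('o1 \<Rightarrow> 'm1) \<Rightarrow> ('o2 \<Rightarrow> 'm2) \<Rightarrow> bool"
where
  "is_adjunction C D L R \<eta> \<epsilon> \<longleftrightarrow>
     is_functor C D L \<and> is_functor D C R \<and>
     is_nat C C id_funct (R \<cdot>\<^sub>F L) \<eta> \<and> is_nat D D (L \<cdot>\<^sub>F R) id_funct \<epsilon> \<and>
     (\<forall>x \<in> Obj C. Cmp D (\<epsilon> (fob L x)) (far L (\<eta> x)) = Idn D (fob L x)) \<and>
     (\<forall>y \<in> Obj D. Cmp C (far R (\<epsilon> y)) (\<eta> (fob R y)) = Idn C (fob R y))"


section \<open>Exact functors and twists\<close>

text \<open>\<open>tcat\<close> holds the data of a triangulated category. A triangle \<open>x \<rightarrow> y \<rightarrow> z \<rightarrow> x[1]\<close> with maps \<open>u, v, w\<close> is the tuple \<open>(x, y, z, u, v, w)\<close>.\<close>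

record ('o, 'm) tcat = "('o, 'm) cat" +
  shf :: "('o, 'm, 'o, 'm) funct"
  dtri :: "('o \<times> 'o \<times> 'o \<times> 'm \<times> 'm \<times> 'm) set"

text \<open>Additivity is not listed: a functor that commutes with the shift and preserves
  distinguished triangles preserves biproducts.\<close>

definition is_exact_functor ::
  "('o1, 'm1, 'z1) tcat_scheme \<Rightarrow> ('o2, 'm2, 'z2) tcat_scheme \<Rightarrow> ('o1, 'm1, 'o2, 'm2) funct \<Rightarrow> bool"
where
  "is_exact_functor C D S \<longleftrightarrow> is_functor C D S \<and>
     (\<exists>\<theta>. is_nat_iso C D (S \<cdot>\<^sub>F shf C) (shf D \<cdot>\<^sub>F S) \<theta> \<and>
        (\<forall>x y z u v w. (x, y, z, u, v, w) \<in> dtri C \<longrightarrow>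
           (fob S x, fob S y, fob S z, far S u, far S v, Cmp D (\<theta> x) (far S w)) \<in> dtri D))"

text \<open>\<open>T\<close> is the twist around \<open>S : C \<rightarrow> D\<close>. The right adjoint \<open>R\<close> is determined up to
  isomorphism by \<open>S\<close>.\<close>

definition is_twist ::
  "('o1, 'm1, 'z1) tcat_scheme \<Rightarrow> ('o2, 'm2, 'z2) tcat_scheme \<Rightarrow>
   ('o1, 'm1, 'o2, 'm2) funct \<Rightarrow> ('o2, 'm2, 'o2, 'm2) funct \<Rightarrow> bool"
where
  "is_twist C D S T \<longleftrightarrow>
     is_exact_functor C D S \<and>
     (\<exists>L \<eta>' \<epsilon>'. is_adjunction D C L S \<eta>' \<epsilon>') \<and>
     is_functor D D T \<and>
     (\<exists>R \<eta> \<epsilon> \<phi> \<psi>. is_adjunction C D S R \<eta> \<epsilon> \<and>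
        is_nat D D id_funct T \<phi> \<and>
        is_nat D D T (shf D \<cdot>\<^sub>F S \<cdot>\<^sub>F R) \<psi> \<and>
        (\<forall>b \<in> Obj D. (fob S (fob R b), b, fob T b, \<epsilon> b, \<phi> b, \<psi> b) \<in> dtri D))"


section \<open>Right modules and bimodules\<close>

text \<open>The additive group of a module is an \<^locale>\<open>abelian_group\<close>; as for the library's modules,
  the fields \<open>mult\<close> and \<open>one\<close> of the underlying ring record carry no meaning.
  \<open>ract M x a\<close> is \<open>x \<cdot> a\<close> and \<open>lact M c x\<close> is \<open>c \<cdot> x\<close>.\<close>

record ('a, 'u) rmodule = "'u ring" +
  ract :: "'u \<Rightarrow> 'a \<Rightarrow> 'u"

record ('c, 'a, 'u) bimodule = "('a, 'u) rmodule" +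
  lact :: "'c \<Rightarrow> 'u \<Rightarrow> 'u"

definition mk_rmodule :: "'u set \<Rightarrow> ('u \<Rightarrow> 'u \<Rightarrow> 'u) \<Rightarrow> 'u \<Rightarrow> ('u \<Rightarrow> 'a \<Rightarrow> 'u) \<Rightarrow> ('a, 'u) rmodule" where
  "mk_rmodule U pl z act =
     \<lparr>carrier = U, monoid.mult = undefined, one = undefined, zero = z, add = pl, ract = act\<rparr>"

definition add_lact :: "('a, 'u) rmodule \<Rightarrow> ('c \<Rightarrow> 'u \<Rightarrow> 'u) \<Rightarrow> ('c, 'a, 'u) bimodule" where
  "add_lact M l = rmodule.extend M (bimodule.fields l)"

locale right_module = A?: ring A + M?: abelian_group M
  for A :: "('a, 'x) ring_scheme" and M :: "('a, 'u, 'z) rmodule_scheme" +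
  assumes ract_closed: "\<lbrakk>x \<in> carrier M; a \<in> carrier A\<rbrakk> \<Longrightarrow> ract M x a \<in> carrier M"
    and ract_add_left: "\<lbrakk>x \<in> carrier M; y \<in> carrier M; a \<in> carrier A\<rbrakk> \<Longrightarrow>
      ract M (x \<oplus>\<^bsub>M\<^esub> y) a = ract M x a \<oplus>\<^bsub>M\<^esub> ract M y a"
    and ract_add_right: "\<lbrakk>x \<in> carrier M; a \<in> carrier A; b \<in> carrier A\<rbrakk> \<Longrightarrow>
      ract M x (a \<oplus>\<^bsub>A\<^esub> b) = ract M x a \<oplus>\<^bsub>M\<^esub> ract M x b"
    and ract_mult: "\<lbrakk>x \<in> carrier M; a \<in> carrier A; b \<in> carrier A\<rbrakk> \<Longrightarrow>
      ract M x (a \<otimes>\<^bsub>A\<^esub> b) = ract M (ract M x a) b"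
    and ract_one: "x \<in> carrier M \<Longrightarrow> ract M x \<one>\<^bsub>A\<^esub> = x"

definition rlinear ::
  "('a, 'x) ring_scheme \<Rightarrow> ('a, 'u, 'z) rmodule_scheme \<Rightarrow> ('a, 'v, 'w) rmodule_scheme \<Rightarrow> ('u \<Rightarrow> 'v) \<Rightarrow> bool"
where
  "rlinear A M N f \<longleftrightarrow> f \<in> carrier M \<rightarrow> carrier N \<and>
     (\<forall>x \<in> carrier M. \<forall>y \<in> carrier M. f (x \<oplus>\<^bsub>M\<^esub> y) = f x \<oplus>\<^bsub>N\<^esub> f y) \<and>
     (\<forall>x \<in> carrier M. \<forall>a \<in> carrier A. f (ract M x a) = ract N (f x) a)"

text \<open>The ring \<open>R\<close> as a bimodule through ring homomorphisms \<open>l\<close> (acting on the left) and \<open>r\<close>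
  (acting on the right) into \<open>R\<close>.\<close>

definition ring_bimodule :: "('r, 'x) ring_scheme \<Rightarrow> ('c \<Rightarrow> 'r) \<Rightarrow> ('a \<Rightarrow> 'r) \<Rightarrow> ('c, 'a, 'r) bimodule" where
  "ring_bimodule R l r =
     add_lact (mk_rmodule (carrier R) (add R) \<zero>\<^bsub>R\<^esub> (\<lambda>x a. x \<otimes>\<^bsub>R\<^esub> r a)) (\<lambda>c x. l c \<otimes>\<^bsub>R\<^esub> x)"

definition free_rmodule :: "('a, 'x) ring_scheme \<Rightarrow> nat \<Rightarrow> ('a, nat \<Rightarrow> 'a) rmodule" where
  "free_rmodule A n = mk_rmodule ({..<n} \<rightarrow>\<^sub>E carrier A)
     (\<lambda>x y. \<lambda>i\<in>{..<n}. x i \<oplus>\<^bsub>A\<^esub> y i) (\<lambda>i\<in>{..<n}. \<zero>\<^bsub>A\<^esub>) (\<lambda>x a. \<lambda>i\<in>{..<n}. x i \<otimes>\<^bsub>A\<^esub> a)"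

definition fg_projective :: "('a, 'x) ring_scheme \<Rightarrow> ('a, 'u, 'z) rmodule_scheme \<Rightarrow> bool" where
  "fg_projective A P \<longleftrightarrow> right_module A P \<and>
     (\<exists>n i r. rlinear A P (free_rmodule A n) i \<and> rlinear A (free_rmodule A n) P r \<and>
        (\<forall>x \<in> carrier P. r (i x) = x))"

definition dsum_rmodule ::
  "('a, 'u, 'z) rmodule_scheme \<Rightarrow> ('a, 'v, 'w) rmodule_scheme \<Rightarrow> ('a, 'u \<times> 'v) rmodule"
where
  "dsum_rmodule M N = mk_rmodule (carrier M \<times> carrier N)
     (\<lambda>(x, y) (x', y'). (x \<oplus>\<^bsub>M\<^esub> x', y \<oplus>\<^bsub>N\<^esub> y')) (\<zero>\<^bsub>M\<^esub>, \<zero>\<^bsub>N\<^esub>)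
     (\<lambda>(x, y) a. (ract M x a, ract N y a))"

definition dsum_bimodule ::
  "('c, 'a, 'u) bimodule \<Rightarrow> ('c, 'a, 'v) bimodule \<Rightarrow> ('c, 'a, 'u \<times> 'v) bimodule"
where
  "dsum_bimodule M N = add_lact (dsum_rmodule M N) (\<lambda>c (x, y). (lact M c x, lact N c y))"


section \<open>Complexes\<close>

text \<open>Cohomological grading: \<open>cdf X n\<close> maps \<open>cob X n\<close> to \<open>cob X (n + 1)\<close>.\<close>

record ('M, 'u) cpx =
  cob :: "int \<Rightarrow> 'M"
  cdf :: "int \<Rightarrow> 'u \<Rightarrow> 'u"

type_synonym ('a, 'u) rcpx = "(('a, 'u) rmodule, 'u) cpx"
type_synonym ('c, 'a, 'u) bicpx = "(('c, 'a, 'u) bimodule, 'u) cpx"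

definition is_cpx :: "('a, 'x) ring_scheme \<Rightarrow> (('a, 'u, 'z) rmodule_scheme, 'u) cpx \<Rightarrow> bool" where
  "is_cpx A X \<longleftrightarrow> (\<forall>n. right_module A (cob X n) \<and> rlinear A (cob X n) (cob X (n + 1)) (cdf X n) \<and>
     (\<forall>x \<in> carrier (cob X n). cdf X (n + 1) (cdf X n x) = \<zero>\<^bsub>cob X (n + 2)\<^esub>))"

definition chain_map ::
  "('a, 'x) ring_scheme \<Rightarrow> (('a, 'u, 'z) rmodule_scheme, 'u) cpx \<Rightarrow>
   (('a, 'v, 'w) rmodule_scheme, 'v) cpx \<Rightarrow> (int \<Rightarrow> 'u \<Rightarrow> 'v) \<Rightarrow> bool"
where
  "chain_map A X Y f \<longleftrightarrow> (\<forall>n. rlinear A (cob X n) (cob Y n) (f n) \<and>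
     (\<forall>x \<in> carrier (cob X n). f (n + 1) (cdf X n x) = cdf Y n (f n x)))"

definition homotopic ::
  "('a, 'x) ring_scheme \<Rightarrow> (('a, 'u, 'z) rmodule_scheme, 'u) cpx \<Rightarrow>
   (('a, 'v, 'w) rmodule_scheme, 'v) cpx \<Rightarrow> (int \<Rightarrow> 'u \<Rightarrow> 'v) \<Rightarrow> (int \<Rightarrow> 'u \<Rightarrow> 'v) \<Rightarrow> bool"
where
  "homotopic A X Y f g \<longleftrightarrow> (\<exists>h. (\<forall>n. rlinear A (cob X n) (cob Y (n - 1)) (h n)) \<and>
     (\<forall>n. \<forall>x \<in> carrier (cob X n).
        f n x \<ominus>\<^bsub>cob Y n\<^esub> g n x = cdf Y (n - 1) (h n x) \<oplus>\<^bsub>cob Y n\<^esub> h (n + 1) (cdf X n x)))"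

abbreviation comp_maps :: "(int \<Rightarrow> 'v \<Rightarrow> 'w) \<Rightarrow> (int \<Rightarrow> 'u \<Rightarrow> 'v) \<Rightarrow> int \<Rightarrow> 'u \<Rightarrow> 'w" (infixl "\<circ>\<^sub>c" 55) where
  "g \<circ>\<^sub>c f \<equiv> \<lambda>n. g n \<circ> f n"

definition cocycles :: "(('u, 'z) ring_scheme, 'u) cpx \<Rightarrow> int \<Rightarrow> 'u set" where
  "cocycles X n = {x \<in> carrier (cob X n). cdf X n x = \<zero>\<^bsub>cob X (n + 1)\<^esub>}"

definition coboundaries :: "(('u, 'z) ring_scheme, 'u) cpx \<Rightarrow> int \<Rightarrow> 'u set" where
  "coboundaries X n = cdf X (n - 1) ` carrier (cob X (n - 1))"

definition cohomology :: "(('u, 'z) ring_scheme, 'u) cpx \<Rightarrow> int \<Rightarrow> 'u set set" where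
  "cohomology X n = (\<lambda>z. coboundaries X n +>\<^bsub>cob X n\<^esub> z) ` cocycles X n"

definition cohomology_map ::
  "(('v, 'w) ring_scheme, 'v) cpx \<Rightarrow> (int \<Rightarrow> 'u \<Rightarrow> 'v) \<Rightarrow> int \<Rightarrow> 'u set \<Rightarrow> 'v set"
where
  "cohomology_map Y f n c = (\<Union>z\<in>c. coboundaries Y n +>\<^bsub>cob Y n\<^esub> f n z)"

definition quasi_iso ::
  "('a, 'x) ring_scheme \<Rightarrow> (('a, 'u, 'z) rmodule_scheme, 'u) cpx \<Rightarrow>
   (('a, 'v, 'w) rmodule_scheme, 'v) cpx \<Rightarrow> (int \<Rightarrow> 'u \<Rightarrow> 'v) \<Rightarrow> bool"
where
  "quasi_iso A X Y f \<longleftrightarrow> chain_map A X Y f \<and>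
     (\<forall>n. bij_betw (cohomology_map Y f n) (cohomology X n) (cohomology Y n))"

definition acyclic_cpx :: "(('u, 'z) ring_scheme, 'u) cpx \<Rightarrow> bool" where
  "acyclic_cpx X \<longleftrightarrow> (\<forall>n. cocycles X n = coboundaries X n)"

definition conc :: "('u, 'z) ring_scheme \<Rightarrow> (('u, 'z) ring_scheme, 'u) cpx" where
  "conc M = \<lparr>cob = (\<lambda>n. if n = 0 then M else M\<lparr>carrier := {\<zero>\<^bsub>M\<^esub>}\<rparr>), cdf = (\<lambda>n x. \<zero>\<^bsub>M\<^esub>)\<rparr>"

definition shift :: "int \<Rightarrow> (('u, 'z) ring_scheme, 'u) cpx \<Rightarrow> (('u, 'z) ring_scheme, 'u) cpx" where
  "shift k X = \<lparr>cob = (\<lambda>n. cob X (n + k)),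
     cdf = (\<lambda>n x. if even k then cdf X (n + k) x else \<ominus>\<^bsub>cob X (n + k + 1)\<^esub> cdf X (n + k) x)\<rparr>"

definition shift_map :: "(int \<Rightarrow> 'u \<Rightarrow> 'v) \<Rightarrow> int \<Rightarrow> 'u \<Rightarrow> 'v" where
  "shift_map f n = f (n + 1)"

text \<open>In degree \<open>n\<close> the cone of \<open>f : X \<rightarrow> Y\<close> is \<open>Y\<^sup>n \<oplus> X\<^sup>n\<^sup>+\<^sup>1\<close>, with
  differential \<open>(y, x) \<mapsto> (d y + f x, - d x)\<close>.\<close>

definition cone_diff ::
  "(('u, 'z) ring_scheme, 'u) cpx \<Rightarrow> (('v, 'w) ring_scheme, 'v) cpx \<Rightarrow> (int \<Rightarrow> 'u \<Rightarrow> 'v) \<Rightarrow>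
   int \<Rightarrow> 'v \<times> 'u \<Rightarrow> 'v \<times> 'u"
where
  "cone_diff X Y f n = (\<lambda>(y, x).
     (cdf Y n y \<oplus>\<^bsub>cob Y (n + 1)\<^esub> f (n + 1) x, \<ominus>\<^bsub>cob X (n + 2)\<^esub> cdf X (n + 1) x))"

definition cone :: "('a, 'u) rcpx \<Rightarrow> ('a, 'v) rcpx \<Rightarrow> (int \<Rightarrow> 'u \<Rightarrow> 'v) \<Rightarrow> ('a, 'v \<times> 'u) rcpx" where
  "cone X Y f = \<lparr>cob = (\<lambda>n. dsum_rmodule (cob Y n) (cob X (n + 1))), cdf = cone_diff X Y f\<rparr>"

definition bicone ::
  "('c, 'a, 'u) bicpx \<Rightarrow> ('c, 'a, 'v) bicpx \<Rightarrow> (int \<Rightarrow> 'u \<Rightarrow> 'v) \<Rightarrow> ('c, 'a, 'v \<times> 'u) bicpx"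
where
  "bicone X Y f = \<lparr>cob = (\<lambda>n. dsum_bimodule (cob Y n) (cob X (n + 1))), cdf = cone_diff X Y f\<rparr>"

text \<open>A right module is perfect if it is quasi-isomorphic to a bounded complex of finitely
  generated projectives. Each such projective is isomorphic to a submodule of some \<open>A\<^sup>n\<close>, so
  the carrier type \<^typ>\<open>nat \<Rightarrow> 'a\<close> loses nothing; and since these complexes are K-projective,
  a zigzag of quasi-isomorphisms can be replaced by a single one.\<close>

definition perfect :: "('a, 'x) ring_scheme \<Rightarrow> ('a, 'u, 'z) rmodule_scheme \<Rightarrow> bool" where
  "perfect A M \<longleftrightarrow> (\<exists>(P :: ('a, nat \<Rightarrow> 'a) rcpx) f.
     is_cpx A P \<and> (\<forall>n. fg_projective A (cob P n)) \<and>
     (\<exists>m. \<forall>n. \<bar>n\<bar> > m \<longrightarrow> carrier (cob P n) = {\<zero>\<^bsub>cob P n\<^esub>}) \<and>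
     quasi_iso A P (conc M) f)"


section \<open>The universe\<close>

text \<open>Modules are taken with carrier inside a fixed type \<^typ>\<open>'u\<close>, which plays the role of the
  universe and must be big enough to contain Hom-complexes and resolutions: it has to be closed under
  powers indexed by countably many copies of the index type \<^typ>\<open>'i\<close> (in the application, of the
  rings involved). The two lemmas below show that every type embeds into such a universe.\<close>

definition large_universe :: "'i itself \<Rightarrow> 'u itself \<Rightarrow> bool" where
  "large_universe _ _ \<longleftrightarrow> (\<exists>e :: (nat \<times> 'i \<Rightarrow> 'u) \<Rightarrow> 'u. inj e) \<and> (\<exists>x y :: 'u. x \<noteq> y)"

lemma large_universe_exists: "large_universe TYPE('i) TYPE(nat \<times> 'i \<Rightarrow> 'c option)"
proof -
  let ?I = "UNIV :: (nat \<times> 'i) set"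
  have "infinite ?I"
    by (simp add: finite_prod)
  then obtain b :: "(nat \<times> 'i) \<times> (nat \<times> 'i) \<Rightarrow> nat \<times> 'i" where b: "bij b"
    using card_of_Times_same_infinite[of ?I] card_of_ordIso[of "?I \<times> ?I" ?I] by auto
  define e where "e g i = case_prod g (inv_into UNIV b i)" for g :: "nat \<times> 'i \<Rightarrow> nat \<times> 'i \<Rightarrow> 'c option" and i
  have "g x y = e g (b (x, y))" for g x y
    using b by (simp add: e_def bij_is_inj)
  then have "inj e"
    by (metis (no_types) ext injI)
  moreover have "(\<lambda>_. None) \<noteq> (\<lambda>_ :: nat \<times> 'i. Some (undefined :: 'c))"
    by (simp add: fun_eq_iff)
  ultimately show ?thesis
    unfolding large_universe_def by blast
qed

lemma large_universe_embeds: "\<exists>e :: 'c \<Rightarrow> (nat \<times> 'i \<Rightarrow> 'c option). inj e"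
  by (rule exI[of _ "\<lambda>c _. Some c"]) (simp add: inj_def fun_eq_iff)

text \<open>Constructions that leave the carrier type \<^typ>\<open>'u\<close> are brought back by renaming elements along
  an arbitrary injection.\<close>

definition enc :: "'v \<Rightarrow> 'u" where
  "enc = (SOME e. inj e)"

abbreviation dec :: "'u \<Rightarrow> 'v" where
  "dec \<equiv> inv_into UNIV enc"

definition enc_rmodule :: "('a, 'v) rmodule \<Rightarrow> ('a, 'u) rmodule" where
  "enc_rmodule M = mk_rmodule (enc ` carrier M) (\<lambda>x y. enc (dec x \<oplus>\<^bsub>M\<^esub> dec y)) (enc \<zero>\<^bsub>M\<^esub>)
     (\<lambda>x a. enc (ract M (dec x) a))"

definition enc_cpx :: "('a, 'v) rcpx \<Rightarrow> ('a, 'u) rcpx" where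
  "enc_cpx X = \<lparr>cob = (\<lambda>n. enc_rmodule (cob X n)), cdf = (\<lambda>n x. enc (cdf X n (dec x)))\<rparr>"


section \<open>The derived category\<close>

text \<open>The derived category of \<open>Mod A\<close> is the localization of the homotopy category at the
  quasi-isomorphisms, described by roofs: \<open>(X, s, W, f, Y)\<close> stands for
  \<open>X \<leftarrow> W \<rightarrow> Y\<close> with quasi-isomorphism \<open>s : W \<rightarrow> X\<close> and \<open>f : W \<rightarrow> Y\<close>.
  An arrow is an equivalence class of roofs.\<close>

type_synonym ('a, 'u) roof =
  "('a, 'u) rcpx \<times> (int \<Rightarrow> 'u \<Rightarrow> 'u) \<times> ('a, 'u) rcpx \<times> (int \<Rightarrow> 'u \<Rightarrow> 'u) \<times> ('a, 'u) rcpx"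

type_synonym ('a, 'u) dcat = "(('a, 'u) rcpx, ('a, 'u) roof set) tcat"

definition roofs :: "('a, 'x) ring_scheme \<Rightarrow> ('a, 'u) roof set" where
  "roofs A = {(X, s, W, f, Y). is_cpx A X \<and> is_cpx A W \<and> is_cpx A Y \<and>
     quasi_iso A W X s \<and> chain_map A W Y f}"

fun roof_equiv :: "('a, 'x) ring_scheme \<Rightarrow> ('a, 'u) roof \<Rightarrow> ('a, 'u) roof \<Rightarrow> bool" where
  "roof_equiv A (X, s, W, f, Y) (X', s', W', f', Y') \<longleftrightarrow> X = X' \<and> Y = Y' \<and>
     (\<exists>(V :: ('a, 'u) rcpx) u u'. is_cpx A V \<and> chain_map A V W u \<and> chain_map A V W' u' \<and>
        quasi_iso A V X (s \<circ>\<^sub>c u) \<and>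
        homotopic A V X (s \<circ>\<^sub>c u) (s' \<circ>\<^sub>c u') \<and> homotopic A V Y (f \<circ>\<^sub>c u) (f' \<circ>\<^sub>c u'))"

definition roof_class :: "('a, 'x) ring_scheme \<Rightarrow> ('a, 'u) roof \<Rightarrow> ('a, 'u) roof set" where
  "roof_class A \<rho> = {\<sigma> \<in> roofs A. roof_equiv A \<rho> \<sigma>}"

definition loc ::
  "('a, 'x) ring_scheme \<Rightarrow> ('a, 'u) rcpx \<Rightarrow> ('a, 'u) rcpx \<Rightarrow> (int \<Rightarrow> 'u \<Rightarrow> 'u) \<Rightarrow> ('a, 'u) roof set"
where
  "loc A X Y f = roof_class A (X, \<lambda>n x. x, X, f, Y)"

text \<open>To compose \<open>X \<leftarrow> W \<rightarrow> Y\<close> with \<open>Y \<leftarrow> V \<rightarrow> Z\<close>, complete \<open>W \<rightarrow> Y \<leftarrow> V\<close> to a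
  homotopy commutative square \<open>W \<leftarrow> U \<rightarrow> V\<close> whose left leg is a quasi-isomorphism.\<close>

definition roof_comp ::
  "('a, 'x) ring_scheme \<Rightarrow> ('a, 'u) roof set \<Rightarrow> ('a, 'u) roof set \<Rightarrow> ('a, 'u) roof set"
where
  "roof_comp A \<beta> \<alpha> = {\<tau>. \<exists>X s W f Y t V g Z U t' f'.
     (X, s, W, f, Y) \<in> \<alpha> \<and> (Y, t, V, g, Z) \<in> \<beta> \<and>
     is_cpx A U \<and> quasi_iso A U W t' \<and> chain_map A U V f' \<and>
     homotopic A U Y (f \<circ>\<^sub>c t') (t \<circ>\<^sub>c f') \<and>
     \<tau> \<in> roof_class A (X, s \<circ>\<^sub>c t', U, g \<circ>\<^sub>c f', Z)}"

definition roof_dom :: "('a, 'u) roof set \<Rightarrow> ('a, 'u) rcpx" where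
  "roof_dom \<alpha> = (THE X. \<exists>s W f Y. (X, s, W, f, Y) \<in> \<alpha>)"

definition roof_cod :: "('a, 'u) roof set \<Rightarrow> ('a, 'u) rcpx" where
  "roof_cod \<alpha> = (THE Y. \<exists>X s W f. (X, s, W, f, Y) \<in> \<alpha>)"

text \<open>The functor to the derived category of \<open>A\<close> induced by a functor on complexes
  that preserves quasi-isomorphisms.\<close>

definition induced_funct ::
  "('a, 'x) ring_scheme \<Rightarrow> (('b, 'u) rcpx \<Rightarrow> ('a, 'u) rcpx) \<Rightarrow>
   ((int \<Rightarrow> 'u \<Rightarrow> 'u) \<Rightarrow> (int \<Rightarrow> 'u \<Rightarrow> 'u)) \<Rightarrow>
   (('b, 'u) rcpx, ('b, 'u) roof set, ('a, 'u) rcpx, ('a, 'u) roof set) funct"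
where
  "induced_funct A Fo Fm = \<lparr>fob = Fo, far = (\<lambda>\<alpha>. {\<tau>. \<exists>X s W f Y. (X, s, W, f, Y) \<in> \<alpha> \<and>
     \<tau> \<in> roof_class A (Fo X, Fm s, Fo W, Fm f, Fo Y)})\<rparr>"

definition dercat_cat ::
  "('a, 'x) ring_scheme \<Rightarrow> (('a, 'u) rcpx, ('a, 'u) roof set) cat"
where
  "dercat_cat A = \<lparr>Obj = {X. is_cpx A X}, Arr = roof_class A ` roofs A,
     Dom = roof_dom, Cod = roof_cod, Cmp = roof_comp A, Idn = (\<lambda>X. loc A X X (\<lambda>n x. x))\<rparr>"

definition der_shift ::
  "('a, 'x) ring_scheme \<Rightarrow> (('a, 'u) rcpx, ('a, 'u) roof set, ('a, 'u) rcpx, ('a, 'u) roof set) funct"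
where
  "der_shift A = induced_funct A (shift 1) shift_map"

text \<open>The distinguished triangles are those isomorphic to some
  \<open>X \<rightarrow> Y \<rightarrow> cone f \<rightarrow> X[1]\<close> for a chain map \<open>f : X \<rightarrow> Y\<close>, with the maps
  \<open>y \<mapsto> (y, 0)\<close> and \<open>(y, x) \<mapsto> x\<close>.\<close>

definition standard_triangle ::
  "('a, 'x) ring_scheme \<Rightarrow> ('a, 'u) rcpx \<Rightarrow> ('a, 'u) rcpx \<Rightarrow> (int \<Rightarrow> 'u \<Rightarrow> 'u) \<Rightarrow>
   ('a, 'u) rcpx \<times> ('a, 'u) rcpx \<times> ('a, 'u) rcpx \<times>
   ('a, 'u) roof set \<times> ('a, 'u) roof set \<times> ('a, 'u) roof set"
where
  "standard_triangle A X Y f = (let C = enc_cpx (cone X Y f) in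
     (X, Y, C, loc A X Y f, loc A Y C (\<lambda>n y. enc (y, \<zero>\<^bsub>cob X (n + 1)\<^esub>)),
      loc A C (shift 1 X) (\<lambda>n z. snd (dec z :: 'u \<times> 'u))))"

definition der_triangles ::
  "('a, 'x) ring_scheme \<Rightarrow>
   (('a, 'u) rcpx \<times> ('a, 'u) rcpx \<times> ('a, 'u) rcpx \<times>
    ('a, 'u) roof set \<times> ('a, 'u) roof set \<times> ('a, 'u) roof set) set"
where
  "der_triangles A = {(x, y, z, u, v, w).
     u \<in> hom_set (dercat_cat A) x y \<and> v \<in> hom_set (dercat_cat A) y z \<and>
     w \<in> hom_set (dercat_cat A) z (shift 1 x) \<and>
     (\<exists>X Y f x' y' z' u' v' w' a b c.
        is_cpx A X \<and> is_cpx A Y \<and> chain_map A X Y f \<and>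
        standard_triangle A X Y f = (x', y', z', u', v', w') \<and>
        is_iso (dercat_cat A) x x' a \<and> is_iso (dercat_cat A) y y' b \<and> is_iso (dercat_cat A) z z' c \<and>
        roof_comp A u' a = roof_comp A b u \<and> roof_comp A v' b = roof_comp A c v \<and>
        roof_comp A w' c = roof_comp A (far (der_shift A) a) w)}"

definition dercat :: "('a, 'x) ring_scheme \<Rightarrow> ('a, 'u) dcat" where
  "dercat A = cat.extend (dercat_cat A) (tcat.fields (der_shift A) (der_triangles A))"


section \<open>Restriction of scalars and derived Hom\<close>

text \<open>Since \<open>X \<otimes>\<^sub>B B\<close> is \<open>X\<close> with \<open>A\<close> acting through \<open>p\<close>, and this functor is exact on modules,
  the derived functor of \<open>- \<otimes>\<^sub>B B\<^sub>A\<close> is the induced functor of restriction.\<close>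

definition restr_cpx :: "('a \<Rightarrow> 'b) \<Rightarrow> ('b, 'u) rcpx \<Rightarrow> ('a, 'u) rcpx" where
  "restr_cpx p X = \<lparr>cob = (\<lambda>n. mk_rmodule (carrier (cob X n)) (add (cob X n)) \<zero>\<^bsub>cob X n\<^esub>
     (\<lambda>x a. ract (cob X n) x (p a))), cdf = cdf X\<rparr>"

definition der_restr ::
  "('a, 'x) ring_scheme \<Rightarrow> ('a \<Rightarrow> 'b) \<Rightarrow>
   (('b, 'u) rcpx, ('b, 'u) roof set, ('a, 'u) rcpx, ('a, 'u) roof set) funct"
where
  "der_restr A p = induced_funct A (restr_cpx p) (\<lambda>f. f)"

text \<open>For a complex \<open>M\<close> of \<open>C\<close>-\<open>A\<close>-bimodules and a complex \<open>X\<close> of right \<open>A\<close>-modules, the complex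
  \<open>Hom\<^sub>A(M, X)\<close> of right \<open>C\<close>-modules. An element of degree \<open>n\<close> is a family of
  maps \<open>f i : M\<^sup>i \<rightarrow> X\<^sup>i\<^sup>+\<^sup>n\<close>; the differential is \<open>d f = d\<^sub>X f - (-1)\<^sup>n f d\<^sub>M\<close>,
  and \<open>(f \<cdot> c) m = f (c \<cdot> m)\<close>.\<close>

definition hom_cpx ::
  "('a, 'x) ring_scheme \<Rightarrow> ('c, 'a, 'v) bicpx \<Rightarrow> ('a, 'u) rcpx \<Rightarrow> ('c, int \<Rightarrow> 'v \<Rightarrow> 'u) rcpx"
where
  "hom_cpx A M X = \<lparr>
     cob = (\<lambda>n. mk_rmodule
       {f. \<forall>i. rlinear A (cob M i) (cob X (i + n)) (f i) \<and> f i \<in> extensional (carrier (cob M i))}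
       (\<lambda>f g i. \<lambda>m\<in>carrier (cob M i). f i m \<oplus>\<^bsub>cob X (i + n)\<^esub> g i m)
       (\<lambda>i. \<lambda>m\<in>carrier (cob M i). \<zero>\<^bsub>cob X (i + n)\<^esub>)
       (\<lambda>f c i. \<lambda>m\<in>carrier (cob M i). f i (lact (cob M i) c m))),
     cdf = (\<lambda>n f i. \<lambda>m\<in>carrier (cob M i).
       if even n then cdf X (i + n) (f i m) \<ominus>\<^bsub>cob X (i + n + 1)\<^esub> f (i + 1) (cdf M i m)
       else cdf X (i + n) (f i m) \<oplus>\<^bsub>cob X (i + n + 1)\<^esub> f (i + 1) (cdf M i m))\<rparr>"

definition hom_cpx_map ::
  "('c, 'a, 'v) bicpx \<Rightarrow> (int \<Rightarrow> 'u \<Rightarrow> 'u) \<Rightarrow> int \<Rightarrow> (int \<Rightarrow> 'v \<Rightarrow> 'u) \<Rightarrow> (int \<Rightarrow> 'v \<Rightarrow> 'u)"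
where
  "hom_cpx_map M \<phi> n f = (\<lambda>i. \<lambda>m\<in>carrier (cob M i). \<phi> (i + n) (f i m))"

definition K_injective :: "('a, 'x) ring_scheme \<Rightarrow> ('a, 'u) rcpx \<Rightarrow> bool" where
  "K_injective A I \<longleftrightarrow> is_cpx A I \<and> (\<forall>(N :: ('a, 'u) rcpx) f.
     is_cpx A N \<and> acyclic_cpx N \<and> chain_map A N I f \<longrightarrow>
     homotopic A N I f (\<lambda>n x. \<zero>\<^bsub>cob I n\<^esub>))"

definition K_injective_resolution ::
  "('a, 'x) ring_scheme \<Rightarrow> ('a, 'u) rcpx \<Rightarrow> ('a, 'u) rcpx \<times> (int \<Rightarrow> 'u \<Rightarrow> 'u)"
where
  "K_injective_resolution A X = (SOME (I, i). K_injective A I \<and> quasi_iso A X I i)"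

abbreviation K_inj :: "('a, 'x) ring_scheme \<Rightarrow> ('a, 'u) rcpx \<Rightarrow> ('a, 'u) rcpx" where
  "K_inj A X \<equiv> fst (K_injective_resolution A X)"

text \<open>A lift of an arrow \<open>\<alpha> : X \<rightarrow> Y\<close> to a chain map (unique up to homotopy) between the
  chosen resolutions.\<close>

definition K_inj_lift :: "('a, 'x) ring_scheme \<Rightarrow> ('a, 'u) roof set \<Rightarrow> int \<Rightarrow> 'u \<Rightarrow> 'u" where
  "K_inj_lift A \<alpha> = (let X = roof_dom \<alpha>; Y = roof_cod \<alpha> in
     (SOME \<phi>. chain_map A (K_inj A X) (K_inj A Y) \<phi> \<and>
        roof_comp A (loc A (K_inj A X) (K_inj A Y) \<phi>)
          (loc A X (K_inj A X) (snd (K_injective_resolution A X))) =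
        roof_comp A (loc A Y (K_inj A Y) (snd (K_injective_resolution A Y))) \<alpha>))"

text \<open>\<open>RHom\<^sub>A(M, -)\<close> is computed by resolving the second argument, which keeps the left \<open>C\<close>-action
  on \<open>M\<close> available; resolving \<open>M\<close> as a bimodule would be wrong without flatness assumptions.\<close>

definition RHom ::
  "('a, 'x) ring_scheme \<Rightarrow> ('c, 'y) ring_scheme \<Rightarrow> ('c, 'a, 'v) bicpx \<Rightarrow>
   (('a, 'u) rcpx, ('a, 'u) roof set, ('c, 'u) rcpx, ('c, 'u) roof set) funct"
where
  "RHom A C M = \<lparr>
     fob = (\<lambda>X. enc_cpx (hom_cpx A M (K_inj A X))),
     far = (\<lambda>\<alpha>. loc C (enc_cpx (hom_cpx A M (K_inj A (roof_dom \<alpha>))))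
       (enc_cpx (hom_cpx A M (K_inj A (roof_cod \<alpha>))))
       (\<lambda>n x. enc (hom_cpx_map M (K_inj_lift A \<alpha>) n (dec x))))\<rparr>"


section \<open>The bimodules attached to a ring homomorphism\<close>

definition ring_bicone ::
  "('a, 'x) ring_scheme \<Rightarrow> ('b, 'y) ring_scheme \<Rightarrow> ('a \<Rightarrow> 'b) \<Rightarrow> ('a, 'a, 'b \<times> 'a) bicpx"
where
  "ring_bicone A B p =
     bicone (conc (ring_bimodule A id id)) (conc (ring_bimodule B p p))
       (\<lambda>n x. if n = 0 then p x else \<zero>\<^bsub>B\<^esub>)"

definition kernel_bimodule ::
  "('a, 'x) ring_scheme \<Rightarrow> ('b, 'y) ring_scheme \<Rightarrow> ('a \<Rightarrow> 'b) \<Rightarrow> ('a, 'a, 'a) bimodule"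
where
  "kernel_bimodule A B p = (ring_bimodule A id id)\<lparr>carrier := a_kernel A B p\<rparr>"

end

theory Submission
  imports Defs "HOL-Library.Countable"
begin

text \<open>The functor \<open>F\<close> preserves quasi-isomorphisms, so morphisms can be computed strictly by K-injective
  resolutions \<open>X \<rightarrow> I\<close>. Maps \<open>F Y \<rightarrow> I\<close> are maps \<open>Y \<rightarrow> Hom\<^sub>A(B, I)\<close>, and \<open>Hom\<^sub>A(B, I)\<close> is again K-injective,
  so it computes the right adjoint, with counit the evaluation \<open>f \<mapsto> f(1)\<close>. A cochain on
  \<open>cone(p)[-1]\<close> with values in \<open>I\<close> is an element of \<open>I\<close> together with a map \<open>B \<rightarrow> I[1]\<close>; up to signs this
  identifies \<open>Hom\<^sub>A(cone(p)[-1], I)\<close> with the cone of the evaluation \<open>Hom\<^sub>A(B, I) \<rightarrow> I\<close>, and the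
  standard triangle of that cone is the twist triangle. The left adjoint extends scalars along a
  K-projective resolution. If \<open>p\<close> is surjective, \<open>ker p \<rightarrow> cone(p)[-1]\<close> is a quasi-isomorphism of
  bimodules, which \<open>Hom\<^sub>A(-, I)\<close> preserves.\<close>

text \<open>Everything has to stay inside the one type \<open>'u\<close>. Free modules are therefore
  terms, quotients are chosen representatives, limits are sequences, and each result is renamed into
  \<open>'u\<close> along an injection. Complexes are unbounded, so injective modules taken degree
  by degree do not give K-injective resolutions. Instead, X is covered by a tower of surjections
  that vanish on cohomology and whose kernels are injective in each degree with zero differential;
  the limit L is acyclic and the cone of L -> X is K-injective. Both kinds of resolution occur:
  K-projective ones turn a roof into a homotopy class of chain maps and build the left adjoint,
  K-injective ones compute \<open>RHom\<close>. Naturality of the triangle is obtained on cochains,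
  since the comparison with the cone of the evaluation is strictly compatible with chain maps
  between the chosen resolutions. The signs originate in \<open>cone(p)[-1]\<close>, which has A in
  degree 0, B in degree 1 and differential -p; a cochain of degree n needs the sign (-1)^n on its
  B-component.\<close>

type_synonym ('u, 'v) gmap = "int \<Rightarrow> 'u \<Rightarrow> 'v"

abbreviation (input) at_add ("(_ \<oplus>'[_'] _)" [65, 0, 66] 65) where "x \<oplus>[M] y \<equiv> x \<oplus>\<^bsub>M\<^esub> y"
abbreviation (input) at_minus ("(_ \<ominus>'[_'] _)" [65, 0, 66] 65) where "x \<ominus>[M] y \<equiv> x \<ominus>\<^bsub>M\<^esub> y"
abbreviation (input) at_neg ("(\<ominus>'[_'] _)" [0, 81] 80) where "\<ominus>[M] x \<equiv> \<ominus>\<^bsub>M\<^esub> x"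
abbreviation (input) at_zero ("\<zero>'[_']") where "\<zero>[M] \<equiv> \<zero>\<^bsub>M\<^esub>"
abbreviation (input) at_mult ("(_ \<otimes>'[_'] _)" [70, 0, 71] 70) where "x \<otimes>[M] y \<equiv> x \<otimes>\<^bsub>M\<^esub> y"
abbreviation (input) at_one ("\<one>'[_']") where "\<one>[M] \<equiv> \<one>\<^bsub>M\<^esub>"
abbreviation (input) cob_add ("(_ \<oplus>'[_,_'] _)" [65, 0, 0, 66] 65) where "x \<oplus>[X,n] y \<equiv> x \<oplus>[cob X n] y"
abbreviation (input) cob_minus ("(_ \<ominus>'[_,_'] _)" [65, 0, 0, 66] 65) where "x \<ominus>[X,n] y \<equiv> x \<ominus>[cob X n] y"
abbreviation (input) cob_neg ("(\<ominus>'[_,_'] _)" [0, 0, 81] 80) where "\<ominus>[X,n] x \<equiv> \<ominus>[cob X n] x"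
abbreviation (input) cob_zero ("\<zero>'[_,_']") where "\<zero>[X,n] \<equiv> \<zero>[cob X n]"

section \<open>Modules and linear maps\<close>

lemma (in abelian_group) a_inv_zero: "\<ominus> \<zero> = \<zero>" by (metis l_neg r_zero zero_closed a_inv_closed)

text \<open>Normalisation rules handed to the \<open>algebra\<close> method for a group written
  additively without any multiplication; the sign bookkeeping with cones and homotopies is
  discharged by it.\<close>

lemmas (in abelian_group) abelian_group_simprules
  [algebra abelian_group "zero G" "add G" "a_inv G" "a_minus G"] =
  a_closed zero_closed a_inv_closed minus_closed a_assoc l_zero l_neg a_comm minus_eq r_zero
  r_neg r_neg2 r_neg1 minus_add minus_minus a_inv_zero a_lcomm

lemma (in abelian_group) minus_eq_zero_iff: "\<lbrakk>x \<in> carrier G; y \<in> carrier G\<rbrakk> \<Longrightarrow> x \<ominus> y = \<zero> \<longleftrightarrow> x = y"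
  by (metis a_inv_closed a_minus_def add.inv_equality minus_minus r_neg)

lemma (in abelian_group) minus_eq_iff:
  "\<lbrakk>x \<in> carrier G; y \<in> carrier G; z \<in> carrier G\<rbrakk> \<Longrightarrow> x \<ominus> y = z \<longleftrightarrow> x = y \<oplus> z"
proof
  assume a: "x \<in> carrier G" "y \<in> carrier G" "z \<in> carrier G"
  show "x = y \<oplus> z" if "x \<ominus> y = z" unfolding that[symmetric] using a by algebra
  show "x \<ominus> y = z" if "x = y \<oplus> z" unfolding that using a by algebra
qed

lemma (in abelian_group) add_self_imp_zero: "x \<in> carrier G \<Longrightarrow> x \<oplus> x = x \<Longrightarrow> x = \<zero>" by (metis add.l_cancel_one')

lemma right_moduleI':
  assumes "ring A" "abelian_group M"
    "\<And>x a. \<lbrakk>x \<in> carrier M; a \<in> carrier A\<rbrakk> \<Longrightarrow> ract M x a \<in> carrier M"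
    "\<And>x y a. \<lbrakk>x \<in> carrier M; y \<in> carrier M; a \<in> carrier A\<rbrakk> \<Longrightarrow>
      ract M (x \<oplus>[M] y) a = ract M x a \<oplus>[M] ract M y a"
    "\<And>x a b. \<lbrakk>x \<in> carrier M; a \<in> carrier A; b \<in> carrier A\<rbrakk> \<Longrightarrow>
      ract M x (a \<oplus>[A] b) = ract M x a \<oplus>[M] ract M x b"
    "\<And>x a b. \<lbrakk>x \<in> carrier M; a \<in> carrier A; b \<in> carrier A\<rbrakk> \<Longrightarrow>
      ract M x (a \<otimes>[A] b) = ract M (ract M x a) b"
    "\<And>x. x \<in> carrier M \<Longrightarrow> ract M x \<one>[A] = x"
  shows "right_module A M" using assms by (simp add: right_module_def right_module_axioms_def)

lemma mk_rmodule_simps [simp]: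
  "carrier (mk_rmodule U pl z act) = U" "add (mk_rmodule U pl z act) = pl"
  "zero (mk_rmodule U pl z act) = z" "ract (mk_rmodule U pl z act) = act" by (simp_all add: mk_rmodule_def)

lemma right_module_group: "right_module A M \<Longrightarrow> abelian_group M" by (simp add: right_module_def)

lemma right_module_ring: "right_module A M \<Longrightarrow> ring A" by (simp add: right_module_def)

lemma rlinearI:
  assumes "\<And>x. x \<in> carrier M \<Longrightarrow> f x \<in> carrier N"
    "\<And>x y. \<lbrakk>x \<in> carrier M; y \<in> carrier M\<rbrakk> \<Longrightarrow> f (x \<oplus>[M] y) = f x \<oplus>[N] f y"
    "\<And>x a. \<lbrakk>x \<in> carrier M; a \<in> carrier A\<rbrakk> \<Longrightarrow> f (ract M x a) = ract N (f x) a"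
  shows "rlinear A M N f" using assms by (simp add: rlinear_def)

lemma rl_closed: "rlinear A M N f \<Longrightarrow> x \<in> carrier M \<Longrightarrow> f x \<in> carrier N" by (auto simp: rlinear_def)

lemma rl_add:
  "\<lbrakk>rlinear A M N f; x \<in> carrier M; y \<in> carrier M\<rbrakk> \<Longrightarrow> f (x \<oplus>[M] y) = f x \<oplus>[N] f y" by (auto simp: rlinear_def)

lemma rl_ract:
  "\<lbrakk>rlinear A M N f; x \<in> carrier M; a \<in> carrier A\<rbrakk> \<Longrightarrow> f (ract M x a) = ract N (f x) a" by (auto simp: rlinear_def)

lemma rl_zero:
  assumes "rlinear A M N f" "abelian_group M" "abelian_group N"
  shows "f \<zero>[M] = \<zero>[N]"
proof -
  interpret M: abelian_group M by fact
  interpret N: abelian_group N by fact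
  show ?thesis using rl_add[OF assms(1), of "\<zero>[M]" "\<zero>[M]"] rl_closed[OF assms(1), of "\<zero>[M]"]
    by (metis M.l_zero M.zero_closed N.add_self_imp_zero)
qed

lemma rl_neg:
  assumes "rlinear A M N f" "abelian_group M" "abelian_group N" "x \<in> carrier M"
  shows "f (\<ominus>[M] x) = \<ominus>[N] f x"
proof -
  interpret M: abelian_group M by fact
  interpret N: abelian_group N by fact
  show ?thesis using rl_add[OF assms(1), of "\<ominus>[M] x" x] rl_closed[OF assms(1)] rl_zero[OF assms(1-3)]
      N.minus_equality[of "f (\<ominus>[M] x)" "f x"] assms(4) by (simp add: M.l_neg)
qed

lemma rl_minus:
  assumes "rlinear A M N f" "abelian_group M" "abelian_group N" "x \<in> carrier M" "y \<in> carrier M"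
  shows "f (x \<ominus>[M] y) = f x \<ominus>[N] f y" using assms by (simp add: a_minus_def rl_add rl_neg abelian_group.a_inv_closed)

context right_module
begin

lemma ract_zero_left: "a \<in> carrier A \<Longrightarrow> ract M \<zero>[M] a = \<zero>[M]"
  by (metis M.add_self_imp_zero M.l_zero M.zero_closed ract_add_left ract_closed)

lemma ract_neg_left: "x \<in> carrier M \<Longrightarrow> a \<in> carrier A \<Longrightarrow> ract M (\<ominus>[M] x) a = \<ominus>[M] ract M x a"
  by (metis M.a_inv_closed M.l_neg M.minus_equality ract_add_left ract_closed ract_zero_left)

end

lemma rl_comp:
  "rlinear A M N f \<Longrightarrow> rlinear A N K g \<Longrightarrow> rlinear A M K (\<lambda>x. g (f x))" by (rule rlinearI) (simp_all add: rl_closed rl_add rl_ract)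

lemma rl_id: "rlinear A M M (\<lambda>x. x)" by (auto simp: rlinear_def)

lemma rl_const_zero:
  assumes "right_module A N" shows "rlinear A M N (\<lambda>x. \<zero>[N])"
proof -
  interpret right_module A N by fact
  show ?thesis by (simp add: rlinear_def ract_zero_left)
qed

lemma rl_plus:
  assumes "right_module A N" "rlinear A M N f" "rlinear A M N g"
  shows "rlinear A M N (\<lambda>x. f x \<oplus>[N] g x)"
proof -
  interpret N: right_module A N by fact
  show ?thesis by (rule rlinearI) (simp_all add: rl_closed[OF assms(2)] rl_closed[OF assms(3)] rl_add[OF assms(2)]
        rl_add[OF assms(3)] rl_ract[OF assms(2)] rl_ract[OF assms(3)]
        N.ract_add_left N.M.a_ac)
qed

lemma rl_uminus:
  assumes "right_module A N" "rlinear A M N f"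
  shows "rlinear A M N (\<lambda>x. \<ominus>[N] f x)"
proof -
  interpret N: right_module A N by fact
  show ?thesis by (rule rlinearI) (simp_all add: rl_closed[OF assms(2)] rl_add[OF assms(2)]
        rl_ract[OF assms(2)] N.ract_neg_left N.M.minus_add)
qed

lemma rl_diff:
  assumes "right_module A N" "rlinear A M N f" "rlinear A M N g"
  shows "rlinear A M N (\<lambda>x. f x \<ominus>[N] g x)" unfolding a_minus_def by (intro rl_plus rl_uminus assms)

lemma rl_cong:
  assumes "rlinear A M N f" "\<And>x. x \<in> carrier M \<Longrightarrow> f x = g x" "right_module A M"
  shows "rlinear A M N g"
proof -
  interpret M: right_module A M by fact
  show ?thesis by (rule rlinearI) (simp_all add: assms(2)[symmetric] rl_closed[OF assms(1)] rl_add[OF assms(1)] rl_ract[OF assms(1)]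
        M.ract_closed)
qed

section \<open>Complexes\<close>

abbreviation "el X n \<equiv> carrier (cob X n)"

locale cpx_loc =
  fixes A :: "('a, 'x) ring_scheme" and X :: "(('a, 'u, 'z) rmodule_scheme, 'u) cpx"
  assumes cpx: "is_cpx A X"

sublocale cpx_loc \<subseteq> ring A by (rule right_module_ring[of A "cob X 0"]) (use cpx in \<open>simp add: is_cpx_def\<close>)

sublocale cpx_loc \<subseteq> M: right_module A "cob X n" for n using cpx by (simp add: is_cpx_def)

context cpx_loc
begin

lemma d_lin: "rlinear A (cob X n) (cob X (n + 1)) (cdf X n)" using cpx by (simp add: is_cpx_def)

lemma d_closed: "x \<in> el X n \<Longrightarrow> cdf X n x \<in> el X (n + 1)" by (rule rl_closed[OF d_lin])

lemma dd: "x \<in> el X n \<Longrightarrow> cdf X (n + 1) (cdf X n x) = \<zero>[X,n + 2]" using cpx by (simp add: is_cpx_def)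

text \<open>The primed facts are the same statements one degree lower. They are stated separately
  because \<open>n - 1 + 1\<close> occurs inside \<open>cob X _\<close>, where matching against
  \<open>n + 1\<close> does not produce the degree \<open>n\<close>.\<close>

lemma d_lin': "rlinear A (cob X (n - 1)) (cob X n) (cdf X (n - 1))" using d_lin[of "n - 1"] by simp

lemma d_closed': "x \<in> el X (n - 1) \<Longrightarrow> cdf X (n - 1) x \<in> el X n" using d_closed[of x "n - 1"] by simp

lemma dd': "x \<in> el X (n - 1) \<Longrightarrow> cdf X n (cdf X (n - 1) x) = \<zero>[X,n + 1]" using dd[of x "n - 1"] by (simp add: add.commute)

lemma grp: "abelian_group (cob X n)" ..

lemma d_add: "\<lbrakk>x \<in> el X n; y \<in> el X n\<rbrakk> \<Longrightarrow>
    cdf X n (x \<oplus>[X,n] y) = cdf X n x \<oplus>[X,n + 1] cdf X n y" by (rule rl_add[OF d_lin])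

lemma d_zero: "cdf X n \<zero>[X,n] = \<zero>[X,n + 1]" by (rule rl_zero[OF d_lin]) (rule grp)+

lemma d_neg: "x \<in> el X n \<Longrightarrow> cdf X n (\<ominus>[X,n] x) = \<ominus>[X,n + 1] cdf X n x" by (rule rl_neg[OF d_lin]) (rule grp | assumption)+

lemma d_minus: "\<lbrakk>x \<in> el X n; y \<in> el X n\<rbrakk> \<Longrightarrow>
    cdf X n (x \<ominus>[X,n] y) = cdf X n x \<ominus>[X,n + 1] cdf X n y" by (rule rl_minus[OF d_lin]) (rule grp | assumption)+

lemma d_add': "\<lbrakk>x \<in> el X (n - 1); y \<in> el X (n - 1)\<rbrakk> \<Longrightarrow>
    cdf X (n - 1) (x \<oplus>[X,n - 1] y) = cdf X (n - 1) x \<oplus>[X,n] cdf X (n - 1) y" using d_add[of x "n - 1" y] by simp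

lemma d_zero': "cdf X (n - 1) \<zero>[X,n - 1] = \<zero>[X,n]" using d_zero[of "n - 1"] by simp

lemma d_neg': "x \<in> el X (n - 1) \<Longrightarrow>
    cdf X (n - 1) (\<ominus>[X,n - 1] x) = \<ominus>[X,n] cdf X (n - 1) x" using d_neg[of x "n - 1"] by simp

lemma d_minus': "\<lbrakk>x \<in> el X (n - 1); y \<in> el X (n - 1)\<rbrakk> \<Longrightarrow>
    cdf X (n - 1) (x \<ominus>[X,n - 1] y) = cdf X (n - 1) x \<ominus>[X,n] cdf X (n - 1) y" using d_minus[of x "n - 1" y] by simp

lemmas d_simps = d_closed d_closed' dd dd' d_add d_zero d_neg d_minus d_add' d_zero' d_neg' d_minus'

lemma coboundariesI: "x \<in> el X (n - 1) \<Longrightarrow> cdf X (n - 1) x \<in> coboundaries X n" by (simp add: coboundaries_def)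

lemma cobs_subset: "coboundaries X n \<subseteq> cocycles X n" by (auto simp: coboundaries_def cocycles_def d_simps)

lemma cobs_carrier: "x \<in> coboundaries X n \<Longrightarrow> x \<in> el X n" by (auto simp: coboundaries_def d_simps)

lemma cocs_carrier: "x \<in> cocycles X n \<Longrightarrow> x \<in> el X n" by (auto simp: cocycles_def)

lemma cobs_zero: "\<zero>[X,n] \<in> coboundaries X n" using d_zero'[of n] by (force simp: coboundaries_def)

lemma cobs_add: "\<lbrakk>x \<in> coboundaries X n; y \<in> coboundaries X n\<rbrakk> \<Longrightarrow> x \<oplus>[X,n] y \<in> coboundaries X n"
  unfolding coboundaries_def using d_add'[of _ n] by (auto simp: image_iff) (metis M.M.a_closed)

lemma cobs_neg: "x \<in> coboundaries X n \<Longrightarrow> \<ominus>[X,n] x \<in> coboundaries X n"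
  unfolding coboundaries_def using d_neg'[of _ n] by (auto simp: image_iff) (metis M.M.a_inv_closed)

lemma cobs_minus: "\<lbrakk>x \<in> coboundaries X n; y \<in> coboundaries X n\<rbrakk> \<Longrightarrow> x \<ominus>[X,n] y \<in> coboundaries X n"
  by (simp add: a_minus_def cobs_add cobs_neg)

lemma cobs_ract: "x \<in> coboundaries X n \<Longrightarrow> a \<in> carrier A \<Longrightarrow> ract (cob X n) x a \<in> coboundaries X n"
  unfolding coboundaries_def using rl_ract[OF d_lin'[of n]] by (auto simp: image_iff) (metis M.ract_closed)

lemma cocs_add: "\<lbrakk>x \<in> cocycles X n; y \<in> cocycles X n\<rbrakk> \<Longrightarrow> x \<oplus>[X,n] y \<in> cocycles X n" by (auto simp: cocycles_def d_simps)

lemma cocs_neg: "x \<in> cocycles X n \<Longrightarrow> \<ominus>[X,n] x \<in> cocycles X n" by (auto simp: cocycles_def d_simps M.M.a_inv_zero)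

lemma cocs_minus: "\<lbrakk>x \<in> cocycles X n; y \<in> cocycles X n\<rbrakk> \<Longrightarrow> x \<ominus>[X,n] y \<in> cocycles X n" by (simp add: a_minus_def cocs_add cocs_neg)

end

lemma is_cpxI:
  assumes "\<And>n. right_module A (cob X n)" "\<And>n. rlinear A (cob X n) (cob X (n + 1)) (cdf X n)"
    "\<And>n x. x \<in> el X n \<Longrightarrow> cdf X (n + 1) (cdf X n x) = \<zero>[X,n + 2]"
  shows "is_cpx A X" using assms by (simp add: is_cpx_def)

lemma chain_mapI:
  assumes "\<And>n. rlinear A (cob X n) (cob Y n) (f n)"
    "\<And>n x. x \<in> el X n \<Longrightarrow> f (n + 1) (cdf X n x) = cdf Y n (f n x)"
  shows "chain_map A X Y f" using assms by (simp add: chain_map_def)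

lemma cm_lin: "chain_map A X Y f \<Longrightarrow> rlinear A (cob X n) (cob Y n) (f n)" by (simp add: chain_map_def)

lemma cm_closed: "chain_map A X Y f \<Longrightarrow> x \<in> el X n \<Longrightarrow> f n x \<in> el Y n" by (rule rl_closed[OF cm_lin])

lemma cm_d: "chain_map A X Y f \<Longrightarrow> x \<in> el X n \<Longrightarrow> f (n + 1) (cdf X n x) = cdf Y n (f n x)" by (simp add: chain_map_def)

lemma cm_d': "chain_map A X Y f \<Longrightarrow> x \<in> el X (n - 1) \<Longrightarrow>
    f n (cdf X (n - 1) x) = cdf Y (n - 1) (f (n - 1) x)" using cm_d[of A X Y f x "n - 1"] by simp

lemma cm_comp: "chain_map A X Y f \<Longrightarrow> chain_map A Y Z g \<Longrightarrow> chain_map A X Z (\<lambda>n x. g n (f n x))"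
  by (rule chain_mapI) (auto intro: rl_comp cm_lin simp: cm_closed cm_d)

lemma cm_id: "chain_map A X X (\<lambda>n x. x)" by (simp add: chain_map_def rl_id)

lemma cm_zero_map:
  assumes "is_cpx A Y" shows "chain_map A X Y (\<lambda>n x. \<zero>[Y,n])"
proof -
  interpret Y: cpx_loc A Y by standard fact
  show ?thesis by (rule chain_mapI) (simp_all add: rl_const_zero Y.M.right_module_axioms Y.d_zero)
qed

lemma cm_diff:
  assumes Y: "is_cpx A Y" and "chain_map A X Y f" "chain_map A X Y g"
  shows "chain_map A X Y (\<lambda>n x. f n x \<ominus>[Y,n] g n x)"
proof -
  interpret Y: cpx_loc A Y by standard fact
  show ?thesis by (rule chain_mapI) (simp_all add: rl_diff Y.M.right_module_axioms cm_lin[OF assms(2)] cm_lin[OF assms(3)]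
      Y.d_minus cm_closed[OF assms(2)] cm_closed[OF assms(3)] cm_d[OF assms(2)] cm_d[OF assms(3)])
qed

lemma cm_neg:
  assumes Y: "is_cpx A Y" and "chain_map A X Y f"
  shows "chain_map A X Y (\<lambda>n x. \<ominus>[Y,n] f n x)"
proof -
  interpret Y: cpx_loc A Y by standard fact
  show ?thesis by (rule chain_mapI) (simp_all add: rl_uminus Y.M.right_module_axioms cm_lin[OF assms(2)]
      Y.d_neg cm_closed[OF assms(2)] cm_d[OF assms(2)])
qed

section \<open>Homotopies between chain maps\<close>

lemma homotopicI:
  assumes Y: "is_cpx A Y" and f: "chain_map A X Y f" and g: "chain_map A X Y g" and X: "is_cpx A X"
    and h: "\<And>n. rlinear A (cob X n) (cob Y (n - 1)) (h n)" and e: "\<And>n x. x \<in> el X n \<Longrightarrow>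
      f n x = g n x \<oplus>[Y,n] (cdf Y (n - 1) (h n x) \<oplus>[Y,n] h (n + 1) (cdf X n x))"
  shows "homotopic A X Y f g"
proof -
  interpret Y: cpx_loc A Y by standard fact
  interpret X: cpx_loc A X by standard fact
  have c: "h (n + 1) (cdf X n x) \<in> el Y n" if "x \<in> el X n" for n x using rl_closed[OF h[of "n + 1"]] X.d_closed[OF that] by simp
  have "f n x \<ominus>[Y,n] g n x = cdf Y (n - 1) (h n x) \<oplus>[Y,n] h (n + 1) (cdf X n x)"
    if "x \<in> el X n" for n x by (subst Y.M.M.minus_eq_iff) (simp_all add: that e[symmetric] c Y.d_closed' rl_closed[OF h]
        cm_closed[OF f] cm_closed[OF g])
  with h show ?thesis unfolding homotopic_def by blast
qed

text \<open>Exposes the homotopy \<open>h\<close> and writes its equation without subtraction, the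
  form that is easiest to rewrite with. That \<open>h (n + 1) (cdf X n x)\<close> lies in degree
  \<open>n\<close> is included because \<open>h (n + 1)\<close> formally lands in degree
  \<open>n + 1 - 1\<close>.\<close>

definition is_htpy ::
  "('a, 'x) ring_scheme \<Rightarrow> (('a, 'u, 'z) rmodule_scheme, 'u) cpx \<Rightarrow>
   (('a, 'v, 'w) rmodule_scheme, 'v) cpx \<Rightarrow> ('u, 'v) gmap \<Rightarrow> ('u, 'v) gmap \<Rightarrow> ('u, 'v) gmap \<Rightarrow> bool"
where
  "is_htpy A X Y h f g \<longleftrightarrow> (\<forall>n. rlinear A (cob X n) (cob Y (n - 1)) (h n)) \<and>
    (\<forall>n. \<forall>x \<in> el X n. h (n + 1) (cdf X n x) \<in> el Y n \<and>
      f n x = g n x \<oplus>[Y,n] (cdf Y (n - 1) (h n x) \<oplus>[Y,n] h (n + 1) (cdf X n x)))"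

lemma htpyD:
  assumes "is_htpy A X Y h f g"
  shows "rlinear A (cob X n) (cob Y (n - 1)) (h n)"
    "x \<in> el X n \<Longrightarrow> h (n + 1) (cdf X n x) \<in> el Y n"
    "x \<in> el X n \<Longrightarrow>
      f n x = g n x \<oplus>[Y,n] (cdf Y (n - 1) (h n x) \<oplus>[Y,n] h (n + 1) (cdf X n x))" using assms by (auto simp: is_htpy_def)

lemma homotopicE:
  assumes "homotopic A X Y f g" and Y: "is_cpx A Y" and f: "chain_map A X Y f" and g: "chain_map A X Y g" and X: "is_cpx A X"
  obtains h where "is_htpy A X Y h f g"
proof -
  interpret Y: cpx_loc A Y by standard fact
  interpret X: cpx_loc A X by standard fact
  from assms(1) obtain h where h: "\<And>n. rlinear A (cob X n) (cob Y (n - 1)) (h n)" and e: "\<And>n x. x \<in> el X n \<Longrightarrow>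
        f n x \<ominus>[Y,n] g n x = cdf Y (n - 1) (h n x) \<oplus>[Y,n] h (n + 1) (cdf X n x)" unfolding homotopic_def by blast
  have c: "h (n + 1) (cdf X n x) \<in> el Y n" if "x \<in> el X n" for n x using rl_closed[OF h[of "n + 1"]] X.d_closed[OF that] by simp
  have "f n x = g n x \<oplus>[Y,n] (cdf Y (n - 1) (h n x) \<oplus>[Y,n] h (n + 1) (cdf X n x))"
    if "x \<in> el X n" for n x using e[OF that] by (subst (asm) Y.M.M.minus_eq_iff) (simp_all add: that c Y.d_closed' rl_closed[OF h]
        cm_closed[OF f] cm_closed[OF g])
  with h c show ?thesis by (intro that[of h]) (simp add: is_htpy_def)
qed

text \<open>The zero homotopy. Maps are total functions on the carrier type, so chain maps that
  agree on the modules may still differ as functions; up to homotopy this difference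
  disappears.\<close>

lemma hmt_eqI:
  assumes Y: "is_cpx A Y" and f: "chain_map A X Y f" and g: "chain_map A X Y g" and X: "is_cpx A X" and "\<And>n x. x \<in> el X n \<Longrightarrow> f n x = g n x"
  shows "homotopic A X Y f g"
proof -
  interpret Y: cpx_loc A Y by standard fact
  show ?thesis by (rule homotopicI[OF Y f g X, where h="\<lambda>n x. \<zero>[Y,n - 1]"])
      (simp_all add: rl_const_zero Y.M.right_module_axioms assms(5) Y.d_zero' cm_closed[OF g])
qed

lemma hmt_refl: "\<lbrakk>is_cpx A X; is_cpx A Y; chain_map A X Y f\<rbrakk> \<Longrightarrow> homotopic A X Y f f" by (rule hmt_eqI) simp_all

lemma hmt_sym:
  assumes "homotopic A X Y f g" and Y: "is_cpx A Y" and f: "chain_map A X Y f" and g: "chain_map A X Y g" and X: "is_cpx A X"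
  shows "homotopic A X Y g f"
proof -
  interpret Y: cpx_loc A Y by standard fact
  interpret X: cpx_loc A X by standard fact
  obtain h where hh: "is_htpy A X Y h f g" by (rule homotopicE[OF assms(1) Y f g X])
  note h = htpyD(1)[OF hh] and c = htpyD(2)[OF hh] and e = htpyD(3)[OF hh]
  show ?thesis
  proof (rule homotopicI[OF Y g f X, where h="\<lambda>n x. \<ominus>[Y,n - 1] h n x"])
    fix n x assume x: "x \<in> el X n"
    have "h n x \<in> el Y (n - 1)" using rl_closed[OF h x] .
    then have d: "cdf Y (n - 1) (\<ominus>[Y,n - 1] h n x) = \<ominus>[Y,n] cdf Y (n - 1) (h n x)"
      and 1: "cdf Y (n - 1) (h n x) \<in> el Y n" by (simp_all add: Y.d_simps)
    have 2: "f n x \<in> el Y n" "g n x \<in> el Y n" using cm_closed[OF f x] cm_closed[OF g x] .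
    show "g n x = f n x \<oplus>[Y,n] (cdf Y (n - 1) (\<ominus>[Y,n - 1] h n x) \<oplus>[Y,n]
        \<ominus>[Y,n + 1 - 1] h (n + 1) (cdf X n x))" unfolding d e[OF x] add_diff_cancel_right' using 1 2 c[OF x] by algebra
  qed (rule rl_uminus[OF Y.M.right_module_axioms h])
qed

lemma hmt_trans:
  assumes "homotopic A X Y f g" "homotopic A X Y g k" and Y: "is_cpx A Y"
    and f: "chain_map A X Y f" and g: "chain_map A X Y g" and k: "chain_map A X Y k" and X: "is_cpx A X"
  shows "homotopic A X Y f k"
proof -
  interpret Y: cpx_loc A Y by standard fact
  interpret X: cpx_loc A X by standard fact
  obtain h where hh: "is_htpy A X Y h f g" by (rule homotopicE[OF assms(1) Y f g X])
  note h = htpyD(1)[OF hh] and c = htpyD(2)[OF hh] and e = htpyD(3)[OF hh]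
  obtain h' where hh': "is_htpy A X Y h' g k" by (rule homotopicE[OF assms(2) Y g k X])
  note h' = htpyD(1)[OF hh'] and c' = htpyD(2)[OF hh'] and e' = htpyD(3)[OF hh']
  show ?thesis
  proof (rule homotopicI[OF Y f k X, where h="\<lambda>n x. h n x \<oplus>[Y,n - 1] h' n x"])
    fix n x assume x: "x \<in> el X n"
    have 0: "h n x \<in> el Y (n - 1)" "h' n x \<in> el Y (n - 1)" using rl_closed[OF h x] rl_closed[OF h' x] .
    then have d: "cdf Y (n - 1) (h n x \<oplus>[Y,n - 1] h' n x) = cdf Y (n - 1) (h n x) \<oplus>[Y,n] cdf Y (n - 1) (h' n x)"
      and 1: "cdf Y (n - 1) (h n x) \<in> el Y n" "cdf Y (n - 1) (h' n x) \<in> el Y n" by (simp_all add: Y.d_simps)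
    have 2: "k n x \<in> el Y n" using cm_closed[OF k x] .
    show "f n x = k n x \<oplus>[Y,n] (cdf Y (n - 1) (h n x \<oplus>[Y,n - 1] h' n x) \<oplus>[Y,n]
        (h (n + 1) (cdf X n x) \<oplus>[Y,n + 1 - 1] h' (n + 1) (cdf X n x)))"
      unfolding d e[OF x] e'[OF x] add_diff_cancel_right' using 1 2 c[OF x] c'[OF x] by algebra
  qed (rule rl_plus[OF Y.M.right_module_axioms h h'])
qed

lemma hmt_comp_left:
  assumes "homotopic A X Y f g" and X: "is_cpx A X" and Y: "is_cpx A Y" and Z: "is_cpx A Z"
    and f: "chain_map A X Y f" and g: "chain_map A X Y g" and k: "chain_map A Y Z k"
  shows "homotopic A X Z (\<lambda>n x. k n (f n x)) (\<lambda>n x. k n (g n x))"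
proof -
  interpret Y: cpx_loc A Y by standard fact
  interpret X: cpx_loc A X by standard fact
  interpret Z: cpx_loc A Z by standard fact
  obtain h where hh: "is_htpy A X Y h f g" by (rule homotopicE[OF assms(1) Y f g X])
  note h = htpyD(1)[OF hh] and c = htpyD(2)[OF hh] and e = htpyD(3)[OF hh]
  show ?thesis
  proof (rule homotopicI[OF Z _ _ X, where h="\<lambda>n x. k (n - 1) (h n x)"])
    fix n x assume x: "x \<in> el X n"
    have 0: "h n x \<in> el Y (n - 1)" using rl_closed[OF h x] .
    then have d: "k n (cdf Y (n - 1) (h n x)) = cdf Z (n - 1) (k (n - 1) (h n x))" using cm_d'[OF k] by simp
    show "k n (f n x) = k n (g n x) \<oplus>[Z,n] (cdf Z (n - 1) (k (n - 1) (h n x)) \<oplus>[Z,n]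
       k (n + 1 - 1) (h (n + 1) (cdf X n x)))" unfolding d[symmetric] e[OF x] add_diff_cancel_right'
      using c[OF x] cm_closed[OF g x] Y.d_closed'[OF 0] Y.M.M.a_closed by (simp add: rl_add[OF cm_lin[OF k]])
  qed (use h k f g in \<open>auto intro: cm_comp rl_comp cm_lin\<close>)
qed

lemma hmt_comp_right:
  assumes "homotopic A X Y f g" and X: "is_cpx A X" and Y: "is_cpx A Y" and W: "is_cpx A W"
    and f: "chain_map A X Y f" and g: "chain_map A X Y g" and k: "chain_map A W X k"
  shows "homotopic A W Y (\<lambda>n x. f n (k n x)) (\<lambda>n x. g n (k n x))"
proof -
  obtain h where hh: "is_htpy A X Y h f g" by (rule homotopicE[OF assms(1) Y f g X])
  note h = htpyD(1)[OF hh] and c = htpyD(2)[OF hh] and e = htpyD(3)[OF hh]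
  show ?thesis by (rule homotopicI[OF Y _ _ W, where h="\<lambda>n x. h n (k n x)"]) (use h k f g in \<open>auto intro: cm_comp rl_comp cm_lin
         simp: cm_d cm_closed[OF k] e\<close>)
qed

text \<open>Turns uniqueness of lifts into a null-homotopy, the kind of conclusion that
  K-projectivity and K-injectivity provide.\<close>

lemma hmt_diff_iff:
  assumes X: "is_cpx A X" and Y: "is_cpx A Y" and f: "chain_map A X Y f" and g: "chain_map A X Y g"
  shows "homotopic A X Y f g \<longleftrightarrow> homotopic A X Y (\<lambda>n x. f n x \<ominus>[Y,n] g n x) (\<lambda>n x. \<zero>[Y,n])"
proof -
  interpret Y: cpx_loc A Y by standard fact
  have "f n x \<ominus>[Y,n] g n x \<ominus>[Y,n] \<zero>[Y,n] = f n x \<ominus>[Y,n] g n x"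
    if "x \<in> el X n" for n x using cm_closed[OF f that] cm_closed[OF g that] by algebra
  then show ?thesis unfolding homotopic_def by simp
qed

section \<open>Quasi-isomorphisms\<close>

lemma a_coset_eq_iff:
  assumes "abelian_group G" and H: "H \<subseteq> carrier G" "\<zero>[G] \<in> H"
    "\<And>x y. \<lbrakk>x \<in> H; y \<in> H\<rbrakk> \<Longrightarrow> x \<oplus>[G] y \<in> H" "\<And>x. x \<in> H \<Longrightarrow> \<ominus>[G] x \<in> H" and "a \<in> carrier G" "b \<in> carrier G"
  shows "H +>\<^bsub>G\<^esub> a = H +>\<^bsub>G\<^esub> b \<longleftrightarrow> a \<ominus>[G] b \<in> H"
proof -
  interpret abelian_group G by fact
  have mem: "z \<in> H +>\<^bsub>G\<^esub> a \<longleftrightarrow> z \<in> carrier G \<and> z \<ominus>[G] a \<in> H" if a: "a \<in> carrier G" for a z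
  proof
    assume "z \<in> H +>\<^bsub>G\<^esub> a"
    then obtain h where h: "h \<in> H" and z: "z = h \<oplus>[G] a" by (auto simp: a_r_coset_def')
    have hG: "h \<in> carrier G" using h H(1) by auto
    have "z \<ominus>[G] a = h" unfolding z using hG a by algebra
    then show "z \<in> carrier G \<and> z \<ominus>[G] a \<in> H" using h hG a z by simp
  next
    assume z: "z \<in> carrier G \<and> z \<ominus>[G] a \<in> H"
    have "z = (z \<ominus>[G] a) \<oplus>[G] a" using conjunct1[OF z] a by algebra
    with z show "z \<in> H +>\<^bsub>G\<^esub> a" unfolding a_r_coset_def' by blast
  qed
  show ?thesis
  proof
    assume "H +>\<^bsub>G\<^esub> a = H +>\<^bsub>G\<^esub> b"
    moreover have "a \<in> H +>\<^bsub>G\<^esub> a" using assms(6) H(2) by (simp add: mem r_neg a_minus_def)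
    ultimately show "a \<ominus>[G] b \<in> H" using mem[OF assms(7)] by auto
  next
    assume ab: "a \<ominus>[G] b \<in> H"
    have "z \<ominus>[G] a \<in> H \<longleftrightarrow> z \<ominus>[G] b \<in> H" if z: "z \<in> carrier G" for z
    proof -
      have 1: "z \<ominus>[G] b = (z \<ominus>[G] a) \<oplus>[G] (a \<ominus>[G] b)" and 2: "z \<ominus>[G] a = (z \<ominus>[G] b) \<oplus>[G] \<ominus>[G] (a \<ominus>[G] b)" using z assms(6,7) by algebra+
      show ?thesis using H(3)[OF _ ab, of "z \<ominus>[G] a"] H(3)[OF _ H(4)[OF ab], of "z \<ominus>[G] b"] unfolding 1[symmetric] 2[symmetric] by blast
    qed
    then show "H +>\<^bsub>G\<^esub> a = H +>\<^bsub>G\<^esub> b" using mem[OF assms(6)] mem[OF assms(7)] by blast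
  qed
qed

abbreviation "cls X n x \<equiv> coboundaries X n +>\<^bsub>cob X n\<^esub> x"

context cpx_loc
begin

lemma cohomology_class_eq_iff:
  "\<lbrakk>x \<in> el X n; y \<in> el X n\<rbrakk> \<Longrightarrow>
    cls X n x = cls X n y \<longleftrightarrow> x \<ominus>[X,n] y \<in> coboundaries X n"
  by (rule a_coset_eq_iff) (auto intro: cobs_carrier cobs_zero cobs_add cobs_neg grp)

lemma cohomology_class_mem:
  "\<lbrakk>x \<in> el X n; z \<in> cls X n x\<rbrakk> \<Longrightarrow> z \<in> el X n \<and> z \<ominus>[X,n] x \<in> coboundaries X n"
proof -
  assume x: "x \<in> el X n" and "z \<in> cls X n x"
  then obtain h where h: "h \<in> coboundaries X n" and z: "z = h \<oplus>[X,n] x" by (auto simp: a_r_coset_def')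
  have hG: "h \<in> el X n" using h cobs_carrier by auto
  have "z \<ominus>[X,n] x = h" unfolding z using hG x by algebra
  then show ?thesis using h hG x z by simp
qed

lemma cohomology_class_self: "x \<in> el X n \<Longrightarrow> x \<in> cls X n x" using cobs_zero[of n] by (force simp: a_r_coset_def')

end

lemma cm_cocs:
  assumes "is_cpx A X" "is_cpx A Y" "chain_map A X Y f" "z \<in> cocycles X n"
  shows "f n z \<in> cocycles Y n"
proof -
  interpret X: cpx_loc A X by standard fact
  interpret Y: cpx_loc A Y by standard fact
  have "f (n + 1) \<zero>[X,n + 1] = \<zero>[Y,n + 1]" by (rule rl_zero[OF cm_lin[OF assms(3)] X.grp Y.grp])
  then show ?thesis using assms(4) cm_d[OF assms(3), of z n] cm_closed[OF assms(3), of z n] by (simp add: cocycles_def)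
qed

lemma cm_cobs:
  assumes "chain_map A X Y f" "z \<in> coboundaries X n"
  shows "f n z \<in> coboundaries Y n"
  using assms(2) cm_d'[OF assms(1), of _ n] cm_closed[OF assms(1), of _ "n - 1"] by (auto simp: coboundaries_def)

text \<open>\<open>cohomology_map\<close> is a union over all members of a class; since chain maps
  send coboundaries to coboundaries, every member contributes the same coset.\<close>

lemma cohomology_map_class:
  assumes "is_cpx A X" "is_cpx A Y" "chain_map A X Y f" "z \<in> el X n"
  shows "cohomology_map Y f n (cls X n z) = cls Y n (f n z)"
proof -
  interpret X: cpx_loc A X by standard fact
  interpret Y: cpx_loc A Y by standard fact
  have "cls Y n (f n z') = cls Y n (f n z)"
    if "z' \<in> cls X n z" for z'
  proof (subst Y.cohomology_class_eq_iff)
    have z': "z' \<in> el X n" "z' \<ominus>[X,n] z \<in> coboundaries X n" using X.cohomology_class_mem[OF assms(4) that] by auto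
    show "f n z' \<in> el Y n" "f n z \<in> el Y n" using cm_closed[OF assms(3)] z' assms(4) by auto
    show "f n z' \<ominus>[Y,n] f n z \<in> coboundaries Y n" using cm_cobs[OF assms(3) z'(2)]
      by (simp add: rl_minus[OF cm_lin[OF assms(3)] X.grp Y.grp z'(1) assms(4)])
  qed
  then show ?thesis unfolding cohomology_map_def using X.cohomology_class_self[OF assms(4)] by blast
qed

text \<open>Injectivity becomes a condition on the kernel and surjectivity a statement about
  representatives, so that later arguments chase cocycles instead of handling cosets.\<close>

lemma qi_iff:
  assumes "is_cpx A X" "is_cpx A Y"
  shows "quasi_iso A X Y f \<longleftrightarrow> chain_map A X Y f \<and>
    (\<forall>n. \<forall>z \<in> cocycles X n. f n z \<in> coboundaries Y n \<longrightarrow> z \<in> coboundaries X n) \<and>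
    (\<forall>n. \<forall>y \<in> cocycles Y n. \<exists>z \<in> cocycles X n. f n z \<ominus>[Y,n] y \<in> coboundaries Y n)"
proof -
  interpret X: cpx_loc A X by standard fact
  interpret Y: cpx_loc A Y by standard fact
  have "bij_betw (cohomology_map Y f n) (cohomology X n) (cohomology Y n) \<longleftrightarrow>
    (\<forall>z \<in> cocycles X n. f n z \<in> coboundaries Y n \<longrightarrow> z \<in> coboundaries X n) \<and>
    (\<forall>y \<in> cocycles Y n. \<exists>z \<in> cocycles X n. f n z \<ominus>[Y,n] y \<in> coboundaries Y n)"
    if f: "chain_map A X Y f" for n
  proof -
    let ?cX = "cls X n" and ?cY = "cls Y n"
    note XC = X.cocs_carrier[of _ n] and YC = Y.cocs_carrier[of _ n]
    have fc: "f n z \<in> el Y n" if "z \<in> cocycles X n" for z using cm_closed[OF f XC[OF that]] .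
    have fm: "f n (z \<ominus>[X,n] w) = f n z \<ominus>[Y,n] f n w" if "z \<in> cocycles X n" "w \<in> cocycles X n" for z w
      by (rule rl_minus[OF cm_lin[OF f] X.grp Y.grp XC[OF that(1)] XC[OF that(2)]])
    have "bij_betw (cohomology_map Y f n) (cohomology X n) (cohomology Y n) \<longleftrightarrow>
      inj_on (cohomology_map Y f n) (cohomology X n) \<and> (\<lambda>z. ?cY (f n z)) ` cocycles X n = ?cY ` cocycles Y n"
      unfolding bij_betw_def cohomology_def image_image using cohomology_map_class[OF assms f XC] by simp
    also have "inj_on (cohomology_map Y f n) (cohomology X n) \<longleftrightarrow>
        (\<forall>z \<in> cocycles X n. \<forall>w \<in> cocycles X n. f n z \<ominus>[Y,n] f n w \<in> coboundaries Y n \<longrightarrow> z \<ominus>[X,n] w \<in> coboundaries X n)"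
      unfolding inj_on_def cohomology_def ball_simps using cohomology_map_class[OF assms f XC]
      by (simp add: X.cohomology_class_eq_iff[OF XC XC] Y.cohomology_class_eq_iff[OF fc fc])
    also have "\<dots> \<longleftrightarrow> (\<forall>z \<in> cocycles X n. f n z \<in> coboundaries Y n \<longrightarrow> z \<in> coboundaries X n)" (is "?l = ?r")
    proof
      assume ?l
      have z: "\<zero>[X,n] \<in> cocycles X n" using X.cobs_zero[of n] X.cobs_subset[of n] by blast
      have fz: "f n \<zero>[X,n] = \<zero>[Y,n]" by (rule rl_zero[OF cm_lin[OF f] X.grp Y.grp])
      have "z \<in> coboundaries X n" if c: "z \<in> cocycles X n" and b: "f n z \<in> coboundaries Y n" for z
      proof -
        have "f n z \<ominus>[Y,n] f n \<zero>[X,n] = f n z" unfolding fz using fc[OF c] by algebra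
        moreover have "z \<ominus>[X,n] \<zero>[X,n] = z" using XC[OF c] by algebra
        ultimately show ?thesis using \<open>?l\<close> c z b by fastforce
      qed
      then show ?r by blast
    next
      assume ?r then show ?l by (simp add: fm[symmetric] X.cocs_minus)
    qed
    also have "(\<lambda>z. ?cY (f n z)) ` cocycles X n = ?cY ` cocycles Y n \<longleftrightarrow>
        ?cY ` cocycles Y n \<subseteq> (\<lambda>z. ?cY (f n z)) ` cocycles X n" using cm_cocs[OF assms f] by blast
    also have "\<dots> \<longleftrightarrow> (\<forall>y \<in> cocycles Y n. \<exists>z \<in> cocycles X n. ?cY (f n z) = ?cY y)"
      unfolding image_subset_iff image_iff by (intro ball_cong bex_cong refl eq_commute)
    also have "\<dots> \<longleftrightarrow> (\<forall>y \<in> cocycles Y n. \<exists>z \<in> cocycles X n. f n z \<ominus>[Y,n] y \<in> coboundaries Y n)"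
      by (rule ball_cong[OF refl], rule bex_cong[OF refl]) (simp add: Y.cohomology_class_eq_iff[OF fc YC])
    finally show ?thesis .
  qed
  then show ?thesis unfolding quasi_iso_def by auto
qed

lemma qi_cm: "quasi_iso A X Y f \<Longrightarrow> chain_map A X Y f" by (simp add: quasi_iso_def)

lemma quasi_isoI:
  assumes "is_cpx A X" "is_cpx A Y" "chain_map A X Y f"
    "\<And>n z. \<lbrakk>z \<in> cocycles X n; f n z \<in> coboundaries Y n\<rbrakk> \<Longrightarrow> z \<in> coboundaries X n"
    "\<And>n y. y \<in> cocycles Y n \<Longrightarrow> \<exists>z \<in> cocycles X n. f n z \<ominus>[Y,n] y \<in> coboundaries Y n"
  shows "quasi_iso A X Y f" using assms by (simp add: qi_iff)

lemma qi_inj: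
  "\<lbrakk>quasi_iso A X Y f; is_cpx A X; is_cpx A Y; z \<in> cocycles X n; f n z \<in> coboundaries Y n\<rbrakk> \<Longrightarrow> z \<in> coboundaries X n" by (simp add: qi_iff)

lemma qi_surj:
  assumes "quasi_iso A X Y f" "is_cpx A X" "is_cpx A Y" "y \<in> cocycles Y n"
  obtains z where "z \<in> cocycles X n" "f n z \<ominus>[Y,n] y \<in> coboundaries Y n" using assms unfolding qi_iff[OF assms(2,3)] by blast

lemma qi_id:
  assumes "is_cpx A X" shows "quasi_iso A X X (\<lambda>n x. x)"
proof -
  interpret X: cpx_loc A X by standard fact
  have "\<exists>z\<in>cocycles X n. z \<ominus>[X,n] y \<in> coboundaries X n" if "y \<in> cocycles X n" for n y
    using that X.cobs_zero[of n] X.M.M.r_neg[OF X.cocs_carrier[OF that]] by (intro bexI[of _ y]) (simp_all add: a_minus_def)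
  then show ?thesis by (intro quasi_isoI assms cm_id) simp_all
qed

text \<open>On a cocycle the term \<open>h (d z)\<close> of the homotopy vanishes, leaving the
  coboundary \<open>d (h z)\<close>.\<close>

lemma hmt_cohomologous:
  assumes "homotopic A X Y f g" "is_cpx A X" "is_cpx A Y" "chain_map A X Y f" "chain_map A X Y g" "z \<in> cocycles X n"
  shows "f n z \<ominus>[Y,n] g n z \<in> coboundaries Y n"
proof -
  interpret X: cpx_loc A X by standard fact
  interpret Y: cpx_loc A Y by standard fact
  obtain h where h: "\<And>n. rlinear A (cob X n) (cob Y (n - 1)) (h n)" and e: "\<And>n x. x \<in> el X n \<Longrightarrow>
        f n x \<ominus>[Y,n] g n x = cdf Y (n - 1) (h n x) \<oplus>[Y,n] h (n + 1) (cdf X n x)" using assms(1) unfolding homotopic_def by auto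
  have z: "z \<in> el X n" "cdf X n z = \<zero>[X,n + 1]" using assms(6) by (auto simp: cocycles_def)
  have "h (n + 1) (cdf X n z) = \<zero>[Y,n]" using rl_zero[OF h[of "n + 1"] X.grp Y.grp] z by simp
  then have "f n z \<ominus>[Y,n] g n z = cdf Y (n - 1) (h n z)" using e[OF z(1)] Y.d_closed'[OF rl_closed[OF h z(1)]] by simp
  then show ?thesis using Y.coboundariesI[OF rl_closed[OF h z(1)]] by simp
qed

lemma qi_hmt:
  assumes "homotopic A X Y f g" "is_cpx A X" "is_cpx A Y" "quasi_iso A X Y f" "chain_map A X Y g"
  shows "quasi_iso A X Y g"
proof -
  interpret X: cpx_loc A X by standard fact
  interpret Y: cpx_loc A Y by standard fact
  note f = qi_cm[OF assms(4)]
  show ?thesis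
  proof (rule quasi_isoI[OF assms(2,3,5)])
    fix n z assume z: "z \<in> cocycles X n" and g: "g n z \<in> coboundaries Y n"
    note h = hmt_cohomologous[OF assms(1-3) f assms(5) z]
    have fz: "f n z \<in> el Y n" "g n z \<in> el Y n" using cm_closed[OF f X.cocs_carrier[OF z]] Y.cobs_carrier[OF g] .
    have "(f n z \<ominus>[Y,n] g n z) \<oplus>[Y,n] g n z = f n z" using fz by algebra
    with Y.cobs_add[OF h g] have "f n z \<in> coboundaries Y n" by simp
    then show "z \<in> coboundaries X n" using qi_inj[OF assms(4,2,3) z] by simp
  next
    fix n y assume y: "y \<in> cocycles Y n"
    obtain z where z: "z \<in> cocycles X n" "f n z \<ominus>[Y,n] y \<in> coboundaries Y n" by (rule qi_surj[OF assms(4,2,3) y])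
    note h = hmt_cohomologous[OF assms(1-3) f assms(5) z(1)]
    have fz: "f n z \<in> el Y n" "g n z \<in> el Y n" "y \<in> el Y n"
      using cm_closed[OF f X.cocs_carrier[OF z(1)]] cm_closed[OF assms(5) X.cocs_carrier[OF z(1)]]
        Y.cocs_carrier[OF y] by auto
    have "(f n z \<ominus>[Y,n] y) \<ominus>[Y,n] (f n z \<ominus>[Y,n] g n z) = g n z \<ominus>[Y,n] y" using fz by algebra
    with Y.cobs_minus[OF z(2) h] show "\<exists>z\<in>cocycles X n. g n z \<ominus>[Y,n] y \<in> coboundaries Y n" using z(1) by auto
  qed
qed

lemma qi_comp:
  assumes "is_cpx A X" "is_cpx A Y" "is_cpx A Z" "quasi_iso A X Y f" "quasi_iso A Y Z g"
  shows "quasi_iso A X Z (\<lambda>n x. g n (f n x))"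
proof -
  interpret X: cpx_loc A X by standard fact
  interpret Y: cpx_loc A Y by standard fact
  interpret Z: cpx_loc A Z by standard fact
  note f = qi_cm[OF assms(4)] and g = qi_cm[OF assms(5)]
  show ?thesis
  proof (rule quasi_isoI[OF assms(1,3) cm_comp[OF f g]])
    fix n z assume z: "z \<in> cocycles X n" "g n (f n z) \<in> coboundaries Z n"
    show "z \<in> coboundaries X n" by (rule qi_inj[OF assms(4,1,2) z(1)], rule qi_inj[OF assms(5,2,3) _ z(2)])
        (rule cm_cocs[OF assms(1,2) f z(1)])
  next
    fix n y assume y: "y \<in> cocycles Z n"
    obtain w where w: "w \<in> cocycles Y n" "g n w \<ominus>[Z,n] y \<in> coboundaries Z n" by (rule qi_surj[OF assms(5,2,3) y])
    obtain z where z: "z \<in> cocycles X n" "f n z \<ominus>[Y,n] w \<in> coboundaries Y n" by (rule qi_surj[OF assms(4,1,2) w(1)])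
    have c: "z \<in> el X n" "w \<in> el Y n" "y \<in> el Z n" "f n z \<in> el Y n"
      "g n (f n z) \<in> el Z n" "g n w \<in> el Z n" using X.cocs_carrier[OF z(1)] Y.cocs_carrier[OF w(1)] Z.cocs_carrier[OF y]
      by (auto intro: cm_closed[OF f] cm_closed[OF g])
    have "g n (f n z) \<ominus>[Z,n] g n w \<in> coboundaries Z n" using cm_cobs[OF g z(2)] c rl_minus[OF cm_lin[OF g] Y.grp Z.grp] by simp
    from Z.cobs_add[OF this w(2)]
    have "(g n (f n z) \<ominus>[Z,n] g n w) \<oplus>[Z,n] (g n w \<ominus>[Z,n] y) \<in> coboundaries Z n" .
    also have "(g n (f n z) \<ominus>[Z,n] g n w) \<oplus>[Z,n] (g n w \<ominus>[Z,n] y) = g n (f n z) \<ominus>[Z,n] y" using c by algebra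
    finally show "\<exists>z\<in>cocycles X n. g n (f n z) \<ominus>[Z,n] y \<in> coboundaries Z n" using z(1) by auto
  qed
qed

lemma qi_of_bij:
  assumes "is_cpx A X" "is_cpx A Y" "chain_map A X Y f" "\<And>n. bij_betw (f n) (el X n) (el Y n)"
  shows "quasi_iso A X Y f"
proof -
  interpret X: cpx_loc A X by standard fact
  interpret Y: cpx_loc A Y by standard fact
  have inj: "f n x = f n y \<Longrightarrow> x = y" if "x \<in> el X n" "y \<in> el X n" for n x y
    by (rule inj_onD[OF bij_betw_imp_inj_on[OF assms(4)[of n]] _ that])
  have surj: "\<exists>x \<in> el X n. f n x = y" if "y \<in> el Y n" for n y
    using that unfolding bij_betw_imp_surj_on[OF assms(4)[of n], symmetric] by auto
  show ?thesis
  proof (rule quasi_isoI[OF assms(1-3)])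
    fix n z assume z: "z \<in> cocycles X n" "f n z \<in> coboundaries Y n"
    then obtain y where y: "y \<in> el Y (n - 1)" "f n z = cdf Y (n - 1) y" by (auto simp: coboundaries_def)
    obtain x where x: "x \<in> el X (n - 1)" "f (n - 1) x = y" using surj[OF y(1)] by auto
    have "f n z = f n (cdf X (n - 1) x)" using cm_d'[OF assms(3) x(1)] x y by simp
    then have "z = cdf X (n - 1) x" using inj[OF X.cocs_carrier[OF z(1)] X.d_closed'[OF x(1)]] by simp
    then show "z \<in> coboundaries X n" using X.coboundariesI[OF x(1)] by simp
  next
    fix n y assume y: "y \<in> cocycles Y n"
    obtain x where x: "x \<in> el X n" "f n x = y" using surj[OF Y.cocs_carrier[OF y]] by auto
    have "f (n + 1) (cdf X n x) = f (n + 1) \<zero>[X,n + 1]"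
      using cm_d[OF assms(3) x(1)] x(2) y rl_zero[OF cm_lin[OF assms(3)] X.grp Y.grp] by (simp add: cocycles_def)
    then have "cdf X n x = \<zero>[X,n + 1]" using inj[OF X.d_closed[OF x(1)]] by simp
    then have "x \<in> cocycles X n" using x(1) by (simp add: cocycles_def)
    moreover have "f n x \<ominus>[Y,n] y = \<zero>[Y,n]" unfolding x(2) using Y.cocs_carrier[OF y] by algebra
    ultimately show "\<exists>z\<in>cocycles X n. f n z \<ominus>[Y,n] y \<in> coboundaries Y n" using Y.cobs_zero by (intro bexI[of _ x]) simp_all
  qed
qed

section \<open>Cones, shifts and encodings\<close>

lemma dsum_simps [simp]:
  "carrier (dsum_rmodule M N) = carrier M \<times> carrier N"
  "\<zero>[dsum_rmodule M N] = (\<zero>[M], \<zero>[N])"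
  "(x, y) \<oplus>[dsum_rmodule M N] (x', y') = (x \<oplus>[M] x', y \<oplus>[N] y')"
  "ract (dsum_rmodule M N) (x, y) a = (ract M x a, ract N y a)" by (simp_all add: dsum_rmodule_def)

lemma dsum_module:
  assumes "right_module A M" "right_module A N"
  shows "right_module A (dsum_rmodule M N)"
proof -
  interpret M: right_module A M by fact
  interpret N: right_module A N by fact
  have "abelian_group (dsum_rmodule M N)"
  proof (rule abelian_groupI)
    fix z assume "z \<in> carrier (dsum_rmodule M N)"
    then show "\<exists>w \<in> carrier (dsum_rmodule M N). w \<oplus>[dsum_rmodule M N] z = \<zero>[dsum_rmodule M N]"
      by (intro bexI[of _ "(\<ominus>[M] fst z, \<ominus>[N] snd z)"]) (auto simp: M.M.l_neg N.M.l_neg)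
  qed (auto simp: M.M.a_ac N.M.a_ac)
  then show ?thesis by (intro right_moduleI') (auto simp: M.A.ring_axioms M.ract_closed N.ract_closed M.ract_add_left N.ract_add_left
        M.ract_add_right N.ract_add_right M.ract_mult N.ract_mult M.ract_one N.ract_one)
qed

lemma dsum_a_inv:
  assumes "right_module A M" "right_module A N" "x \<in> carrier M" "y \<in> carrier N"
  shows "\<ominus>[dsum_rmodule M N] (x, y) = (\<ominus>[M] x, \<ominus>[N] y)"
proof -
  interpret M: right_module A M by fact
  interpret N: right_module A N by fact
  interpret S: right_module A "dsum_rmodule M N" by (rule dsum_module) fact+
  show ?thesis by (rule S.M.minus_equality) (simp_all add: assms M.M.l_neg N.M.l_neg)
qed

lemma cone_simps [simp]:
  "cob (cone X Y f) n = dsum_rmodule (cob Y n) (cob X (n + 1))"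
  "cdf (cone X Y f) n (y, x) = (cdf Y n y \<oplus>[Y,n + 1] f (n + 1) x, \<ominus>[X,n + 2] cdf X (n + 1) x)" by (simp_all add: cone_def cone_diff_def)

lemma cone_cpx:
  assumes X: "is_cpx A X" and Y: "is_cpx A Y" and f: "chain_map A X Y f"
  shows "is_cpx A (cone X Y f)"
proof -
  interpret X: cpx_loc A X by standard fact
  interpret Y: cpx_loc A Y by standard fact
  have dX: "cdf X (n + 1) x \<in> el X (n + 2)" if "x \<in> el X (n + 1)" for n x using X.d_closed[OF that] by (simp add: add.assoc)
  have fX: "f (n + 1) x \<in> el Y (n + 1)" if "x \<in> el X (n + 1)" for n x by (rule cm_closed[OF f that])
  have dl: "rlinear A (cob X (n + 1)) (cob X (n + 2)) (cdf X (n + 1))" for n using X.d_lin[of "n + 1"] by (simp add: add.assoc)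
  note fl = cm_lin[OF f] and al = X.M.right_module_axioms
  have sl: "rlinear A (cob X (n + 1)) (cob X (n + 2)) (\<lambda>x. \<ominus>[X,n + 2] cdf X (n + 1) x)" for n by (rule rl_uminus[OF al dl])
  show ?thesis
  proof (rule is_cpxI)
    show "right_module A (cob (cone X Y f) n)" for n by (simp add: dsum_module X.M.right_module_axioms Y.M.right_module_axioms)
    show "rlinear A (cob (cone X Y f) n) (cob (cone X Y f) (n + 1)) (cdf (cone X Y f) n)" for n
    proof (rule rlinearI, goal_cases)
      case (1 z)
      then show ?case using fX dX by (auto simp: Y.d_closed add.assoc)
    next
      case (2 z w)
      obtain y x y' x' where zw: "z = (y, x)" "w = (y', x')" by (cases z, cases w)
      have c: "y \<in> el Y n" "y' \<in> el Y n" "x \<in> el X (n + 1)" "x' \<in> el X (n + 1)" using 2 by (auto simp: zw)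
      show ?case unfolding zw using c fX dX by (simp add: Y.d_simps rl_add[OF fl] rl_add[OF sl] Y.M.M.a_ac add.assoc)
    next
      case (3 z a)
      obtain y x where zw: "z = (y, x)" by (cases z)
      have c: "y \<in> el Y n" "x \<in> el X (n + 1)" using 3 by (auto simp: zw)
      show ?case unfolding zw using c 3(2) fX dX
        by (simp add: Y.d_simps rl_ract[OF fl] rl_ract[OF sl] rl_ract[OF Y.d_lin] Y.M.ract_add_left add.assoc)
    qed
    show "cdf (cone X Y f) (n + 1) (cdf (cone X Y f) n z) = \<zero>[cone X Y f,n + 2]"
      if "z \<in> el (cone X Y f) n" for n z
    proof -
      obtain y x where z: "z = (y, x)" by (cases z)
      have c: "y \<in> el Y n" "x \<in> el X (n + 1)" using that by (auto simp: z)
      have 1: "cdf Y (n + 1) (cdf Y n y \<oplus>[Y,n + 1] f (n + 1) x) = cdf Y (n + 1) (f (n + 1) x)"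
        using c Y.d_closed[OF Y.d_closed[OF fX]] Y.d_closed[OF fX[OF c(2)]] by (simp add: Y.d_add Y.d_closed fX Y.dd add.assoc)
      have 2: "f (n + 1 + 1) (\<ominus>[X,n + 2] cdf X (n + 1) x) = \<ominus>[Y,n + 2] cdf Y (n + 1) (f (n + 1) x)"
        using rl_neg[OF fl X.grp Y.grp dX[OF c(2)]] cm_d[OF f c(2)] by (simp add: add.assoc)
      have 3: "cdf X (n + 1 + 1) (\<ominus>[X,n + 2] cdf X (n + 1) x) = \<zero>[X,n + 3]"
        using X.d_neg[OF dX[OF c(2)]] X.dd[OF c(2)] X.M.M.a_inv_zero by (simp add: add.assoc)
      have 4: "cdf Y (n + 1) (f (n + 1) x) \<in> el Y (n + 2)" using Y.d_closed[OF fX[OF c(2)]] by (simp add: add.assoc)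
      show ?thesis using 4 by (simp only: z cone_simps 1 2 3 dsum_simps) (simp add: add.assoc Y.M.M.r_neg X.M.M.a_inv_zero)
    qed
  qed
qed

text \<open>Diagram chase on a cocycle \<open>(y, x)\<close>: as \<open>f x = - d y\<close>,
  injectivity on cohomology gives \<open>x = d x'\<close>; then \<open>y + f x'\<close> is a cocycle
  and surjectivity writes it as \<open>f v - d w\<close>.\<close>

lemma cone_acyclic:
  assumes X: "is_cpx A X" and Y: "is_cpx A Y" and f: "quasi_iso A X Y f"
  shows "acyclic_cpx (cone X Y f)" unfolding acyclic_cpx_def
proof (intro allI equalityI subsetI)
  interpret X: cpx_loc A X by standard fact
  interpret Y: cpx_loc A Y by standard fact
  note fc = qi_cm[OF f]
  interpret C: cpx_loc A "cone X Y f" by (rule cpx_loc.intro, rule cone_cpx) fact+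
  show "z \<in> coboundaries (cone X Y f) n \<Longrightarrow> z \<in> cocycles (cone X Y f) n" for n z using C.cobs_subset by blast
  fix n z assume z: "z \<in> cocycles (cone X Y f) n"
  obtain y x where zz: "z = (y, x)" by (cases z)
  have c: "y \<in> el Y n" "x \<in> el X (n + 1)" and e1: "cdf Y n y \<oplus>[Y,n + 1] f (n + 1) x = \<zero>[Y,n + 1]"
    and e2: "\<ominus>[X,n + 2] cdf X (n + 1) x = \<zero>[X,n + 2]" using z by (auto simp: zz cocycles_def add.assoc)
  have dx: "cdf X (n + 1) x \<in> el X (n + 2)" "f (n + 1) x \<in> el Y (n + 1)"
    using X.d_closed[OF c(2)] cm_closed[OF fc c(2)] by (simp_all add: add.assoc)
  have "x \<in> cocycles X (n + 1)" using c(2) e2 X.M.M.minus_minus[OF dx(1)] X.M.M.a_inv_zero by (simp add: cocycles_def add.assoc)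
  moreover have "f (n + 1) x \<in> coboundaries Y (n + 1)"
  proof -
    have "f (n + 1) x = cdf Y n (\<ominus>[Y,n] y)"
      using Y.M.M.minus_equality[OF _ Y.d_closed[OF c(1)] dx(2)] e1 Y.M.M.a_comm[OF dx(2) Y.d_closed[OF c(1)]] Y.d_neg[OF c(1)] by simp
    then show ?thesis using Y.coboundariesI[of "\<ominus>[Y,n] y" "n + 1"] c(1) by simp
  qed
  ultimately have "x \<in> coboundaries X (n + 1)" by (rule qi_inj[OF f X Y])
  then obtain x' where x': "x' \<in> el X n" "x = cdf X n x'" by (auto simp: coboundaries_def)
  have fx': "f n x' \<in> el Y n" using cm_closed[OF fc x'(1)] .
  have "y \<oplus>[Y,n] f n x' \<in> cocycles Y n" using e1 c(1) fx' cm_d[OF fc x'(1)] by (simp add: cocycles_def Y.d_add x'(2))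
  then obtain v where v: "v \<in> cocycles X n" "f n v \<ominus>[Y,n] (y \<oplus>[Y,n] f n x') \<in> coboundaries Y n" by (rule qi_surj[OF f X Y])
  then obtain w where w: "w \<in> el Y (n - 1)" "f n v \<ominus>[Y,n] (y \<oplus>[Y,n] f n x') = cdf Y (n - 1) w" by (auto simp: coboundaries_def)
  have v': "v \<in> el X n" "cdf X n v = \<zero>[X,n + 1]" "f n v \<in> el Y n"
    using v(1) cm_closed[OF fc X.cocs_carrier[OF v(1)]] by (auto simp: cocycles_def)
  have xx: "v \<ominus>[X,n] x' \<in> el X n" using v'(1) x'(1) by simp
  \<comment> \<open>The sign in the cone differential turns \<open>v - x'\<close> into
    \<open>x\<close>, and the first component becomes \<open>f v - f x' - d w = y\<close>.\<close>
  have "cdf (cone X Y f) (n - 1) (\<ominus>[Y,n - 1] w, v \<ominus>[X,n] x') =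
      (\<ominus>[Y,n] cdf Y (n - 1) w \<oplus>[Y,n] (f n v \<ominus>[Y,n] f n x'), \<ominus>[X,n + 1] (\<zero>[X,n + 1] \<ominus>[X,n + 1] x))"
    using rl_minus[OF cm_lin[OF fc] X.grp Y.grp v'(1) x'(1)] by (simp add: Y.d_neg' w(1) X.d_minus v' x' add.commute)
  also have "\<ominus>[X,n + 1] (\<zero>[X,n + 1] \<ominus>[X,n + 1] x) = x" using c(2) by algebra
  also have "\<ominus>[Y,n] cdf Y (n - 1) w \<oplus>[Y,n] (f n v \<ominus>[Y,n] f n x') = y" unfolding w(2)[symmetric] using fx' c(1) v'(3) by algebra
  finally have "z = cdf (cone X Y f) (n - 1) (\<ominus>[Y,n - 1] w, v \<ominus>[X,n] x')" using zz by simp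
  then show "z \<in> coboundaries (cone X Y f) n" using C.coboundariesI[of "(\<ominus>[Y,n - 1] w, v \<ominus>[X,n] x')" n] w(1) xx by simp
qed

section \<open>Shifts of complexes\<close>

lemma shift_simps [simp]:
  "cob (shift k X) n = cob X (n + k)"
  "cdf (shift k X) n x = (if even k then cdf X (n + k) x else \<ominus>[X,n + k + 1] cdf X (n + k) x)" by (simp_all add: shift_def)

lemma shift_cpx:
  assumes X: "is_cpx A X" shows "is_cpx A (shift k X)"
proof -
  interpret X: cpx_loc A X by standard fact
  have eq: "n + 1 + k = n + k + 1" "n + 2 + k = n + k + 2" for n by simp_all
  have "rlinear A (cob X (n + k)) (cob X (n + k + 1)) (\<lambda>x. \<ominus>[X,n + k + 1] cdf X (n + k) x)" for n
    by (rule rl_uminus[OF X.M.right_module_axioms X.d_lin])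
  moreover have "\<ominus>[X,n + k + 2] cdf X (n + k + 1) (\<ominus>[X,n + k + 1] cdf X (n + k) x) = \<zero>[X,n + k + 2]"
    if "x \<in> el X (n + k)" for n x using X.d_neg[OF X.d_closed[OF that]] X.dd[OF that] X.M.M.a_inv_zero by (simp add: add.assoc)
  ultimately show ?thesis by (intro is_cpxI; cases "even k")
     (simp_all add: eq X.M.right_module_axioms X.d_lin X.dd shift_def add.assoc[of _ 1 1] del: shift_simps)
qed

text \<open>A sign on the differential changes neither its kernel nor its image, so cocycles, and
  likewise coboundaries, are merely reindexed.\<close>

lemma shift_cocs:
  assumes X: "is_cpx A X" shows "cocycles (shift k X) n = cocycles X (n + k)"
proof -
  interpret X: cpx_loc A X by standard fact
  have eq: "n + 1 + k = n + k + 1" by simp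
  have "\<ominus>[X,n + k + 1] cdf X (n + k) x = \<zero>[X,n + k + 1] \<longleftrightarrow> cdf X (n + k) x = \<zero>[X,n + k + 1]"
    if "x \<in> el X (n + k)" for x using X.M.M.minus_minus[OF X.d_closed[OF that]] X.M.M.a_inv_zero by metis
  then show ?thesis by (auto simp: cocycles_def eq)
qed

lemma shift_cobs:
  assumes X: "is_cpx A X" shows "coboundaries (shift k X) n = coboundaries X (n + k)"
proof -
  interpret X: cpx_loc A X by standard fact
  have eq: "n - 1 + k = n + k - 1" by simp
  have "(\<lambda>x. \<ominus>[X,n + k] cdf X (n + k - 1) x) ` el X (n + k - 1) = coboundaries X (n + k)" (is "?l = ?r")
  proof
    show "?l \<subseteq> ?r" by (auto intro: X.cobs_neg X.coboundariesI)
    show "?r \<subseteq> ?l"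
    proof
      fix y assume y: "y \<in> ?r"
      then have "\<ominus>[X,n + k] y \<in> ?r" by (rule X.cobs_neg)
      then obtain x where "x \<in> el X (n + k - 1)" "\<ominus>[X,n + k] y = cdf X (n + k - 1) x" by (auto simp: coboundaries_def)
      then show "y \<in> ?l" using X.M.M.minus_minus[OF X.cobs_carrier[OF y]] by force
    qed
  qed
  then show ?thesis by (simp add: coboundaries_def eq)
qed

lemma shift_acyclic: "is_cpx A X \<Longrightarrow> acyclic_cpx X \<Longrightarrow> acyclic_cpx (shift k X)"
  by (simp add: acyclic_cpx_def shift_cocs[of A] shift_cobs[of A])

lemma shift_cm:
  assumes X: "is_cpx A X" and Y: "is_cpx A Y" and f: "chain_map A X Y f"
  shows "chain_map A (shift k X) (shift k Y) (\<lambda>n. f (n + k))"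
proof -
  interpret X: cpx_loc A X by standard fact
  interpret Y: cpx_loc A Y by standard fact
  have eq: "n + 1 + k = n + k + 1" for n by simp
  show ?thesis by (rule chain_mapI) (simp_all add: eq cm_lin[OF f] cm_d[OF f] rl_neg[OF cm_lin[OF f] X.grp Y.grp] X.d_closed)
qed

lemma shift_map_cm:
  "\<lbrakk>is_cpx A X; is_cpx A Y; chain_map A X Y f\<rbrakk> \<Longrightarrow> chain_map A (shift 1 X) (shift 1 Y) (shift_map f)"
  using shift_cm[of A X Y f 1] by (simp add: shift_map_def[abs_def])

lemma shift_map_qi:
  assumes X: "is_cpx A X" and Y: "is_cpx A Y" and f: "quasi_iso A X Y f"
  shows "quasi_iso A (shift 1 X) (shift 1 Y) (shift_map f)" using shift_map_cm[OF X Y qi_cm[OF f]] f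
  unfolding qi_iff[OF X Y] qi_iff[OF shift_cpx[OF X] shift_cpx[OF Y]]
    shift_cocs[OF X] shift_cocs[OF Y] shift_cobs[OF X] shift_cobs[OF Y] by (simp add: shift_map_def)

lemma shift_map_hmt:
  assumes X: "is_cpx A X" and Y: "is_cpx A Y" and f: "chain_map A X Y f" and g: "chain_map A X Y g" and hom: "homotopic A X Y f g"
  shows "homotopic A (shift 1 X) (shift 1 Y) (shift_map f) (shift_map g)"
proof -
  interpret X: cpx_loc A X by standard fact
  interpret Y: cpx_loc A Y by standard fact
  obtain h where hh: "is_htpy A X Y h f g" by (rule homotopicE[OF hom Y f g X])
  note h = htpyD(1)[OF hh] and c = htpyD(2)[OF hh] and e = htpyD(3)[OF hh]
  have h': "rlinear A (cob X (n + 1)) (cob Y n) (h (n + 1))" for n using h[of "n + 1"] by simp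
  show ?thesis
  \<comment> \<open>\<open>shift 1\<close> negates the differentials of both complexes, so the
    homotopy has to be negated as well.\<close>
  proof (rule homotopicI[where h="\<lambda>n x. \<ominus>[Y,n] h (n + 1) x"])
    fix n x assume "x \<in> el (shift 1 X) n"
    then have x: "x \<in> el X (n + 1)" by simp
    have 1: "h (n + 1) x \<in> el Y n" by (rule rl_closed[OF h' x])
    have 2: "cdf Y n (h (n + 1) x) \<in> el Y (n + 1)" by (rule Y.d_closed[OF 1])
    have 3: "h (n + 1 + 1) (cdf X (n + 1) x) \<in> el Y (n + 1)" by (rule c[OF x])
    have "cdf (shift 1 Y) (n - 1) (\<ominus>[Y,n] h (n + 1) x) = cdf Y n (h (n + 1) x)" using Y.d_neg[OF 1] Y.M.M.minus_minus[OF 2] by simp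
    moreover have "\<ominus>[Y,n + 1] h (n + 1 + 1) (cdf (shift 1 X) n x) = h (n + 1 + 1) (cdf X (n + 1) x)"
      using rl_neg[OF h'[of "n + 1"] X.grp Y.grp X.d_closed[OF x]] Y.M.M.minus_minus[OF 3] by simp
    ultimately show "shift_map f n x = shift_map g n x \<oplus>[shift 1 Y,n]
       (cdf (shift 1 Y) (n - 1) (\<ominus>[Y,n] h (n + 1) x) \<oplus>[shift 1 Y,n]
       \<ominus>[Y,n + 1] h (n + 1 + 1) (cdf (shift 1 X) n x))" using e[OF x] by (simp add: shift_map_def)
  next
    show "rlinear A (cob (shift 1 X) n) (cob (shift 1 Y) (n - 1)) (\<lambda>x. \<ominus>[Y,n] h (n + 1) x)" for n
      using rl_uminus[OF Y.M.right_module_axioms h'] by simp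
  qed (rule shift_cpx shift_map_cm X Y f g)+
qed

section \<open>Renaming elements along an injection into the universe\<close>

lemma inj_enc: "\<exists>e :: 'v \<Rightarrow> 'u. inj e \<Longrightarrow> inj (enc :: 'v \<Rightarrow> 'u)" unfolding enc_def by (rule someI_ex[where P=inj])

lemma dec_enc: "inj (enc :: 'v \<Rightarrow> 'u) \<Longrightarrow> dec (enc x :: 'u) = (x :: 'v)" by (rule inv_into_f_f) simp_all

lemma enc_rmodule_simps [simp]:
  "carrier (enc_rmodule M) = enc ` carrier M"
  "\<zero>[enc_rmodule M] = enc \<zero>[M]" by (simp_all add: enc_rmodule_def)

lemma enc_cpx_simps [simp]:
  "cob (enc_cpx X) n = enc_rmodule (cob X n)"
  "cdf (enc_cpx X) n x = enc (cdf X n (dec x))" by (simp_all add: enc_cpx_def)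

text \<open>The type arguments select an instance of the polymorphic choice \<open>enc\<close>; its
  injectivity makes \<open>enc\<close> and \<open>dec\<close> mutually inverse isomorphisms between
  a complex \<open>X\<close> and \<open>enc_cpx X\<close>.\<close>

locale enc_loc =
  fixes T :: "'v itself" and U :: "'u itself"
  assumes inj: "inj (enc :: 'v \<Rightarrow> 'u)"
begin

lemma de [simp]: "dec (enc x :: 'u) = (x :: 'v)" by (rule dec_enc[OF inj])

lemma enc_add: "(enc x :: 'u) \<oplus>[enc_rmodule M] enc y = enc ((x :: 'v) \<oplus>[M] y)" by (simp add: enc_rmodule_def)

lemma enc_ract: "ract (enc_rmodule M) (enc x :: 'u) a = enc (ract M (x :: 'v) a)" by (simp add: enc_rmodule_def)

lemma enc_eq_iff: "(enc x :: 'u) = enc y \<longleftrightarrow> (x :: 'v) = y" using inj by (simp add: inj_eq)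

lemma enc_module:
  fixes M :: "('a, 'v) rmodule"
  assumes "right_module A M" shows "right_module A (enc_rmodule M :: ('a, 'u) rmodule)"
proof -
  interpret M: right_module A M by fact
  have "abelian_group (enc_rmodule M :: ('a, 'u) rmodule)"
  proof (rule abelian_groupI)
    fix z assume "z \<in> carrier (enc_rmodule M :: ('a, 'u) rmodule)"
    then obtain x where x: "x \<in> carrier M" "z = enc x" by auto
    then show "\<exists>w \<in> carrier (enc_rmodule M). w \<oplus>[enc_rmodule M] z = \<zero>[enc_rmodule M]"
      by (intro bexI[of _ "enc (\<ominus>[M] x)"]) (auto simp: enc_add M.M.l_neg)
  qed (auto simp: enc_add M.M.a_ac)
  then show ?thesis by (intro right_moduleI') (auto simp: enc_add enc_ract M.A.ring_axioms M.ract_closed M.ract_add_left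
        M.ract_add_right M.ract_mult M.ract_one)
qed

lemma enc_a_inv:
  fixes M :: "('a, 'v) rmodule"
  assumes "right_module A M" "x \<in> carrier M"
  shows "\<ominus>[enc_rmodule M] (enc x :: 'u) = enc (\<ominus>[M] x)"
proof -
  interpret M: right_module A M by fact
  interpret E: right_module A "enc_rmodule M :: ('a, 'u) rmodule" by (rule enc_module) fact
  show ?thesis by (rule E.M.minus_equality) (simp_all add: assms enc_add M.M.l_neg)
qed

lemma enc_rl:
  fixes M :: "('a, 'v) rmodule"
  shows "rlinear A M (enc_rmodule M :: ('a, 'u) rmodule) enc" by (rule rlinearI) (simp_all add: enc_add enc_ract)

lemma dec_rl:
  fixes M :: "('a, 'v) rmodule"
  shows "rlinear A (enc_rmodule M :: ('a, 'u) rmodule) M dec" by (rule rlinearI) (auto simp: enc_add enc_ract)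

lemma enc_cpx_cpx:
  fixes X :: "('a, 'v) rcpx"
  assumes "is_cpx A X" shows "is_cpx A (enc_cpx X :: ('a, 'u) rcpx)"
proof -
  interpret X: cpx_loc A X by standard fact
  have "rlinear A (enc_rmodule (cob X n) :: ('a, 'u) rmodule) (enc_rmodule (cob X (n + 1)) :: ('a, 'u) rmodule) (\<lambda>x. enc (cdf X n (dec x)))" for n
    by (rule rl_comp[OF rl_comp[OF dec_rl X.d_lin] enc_rl])
  then show ?thesis by (intro is_cpxI) (auto simp: enc_module X.M.right_module_axioms X.dd enc_cpx_def)
qed

lemma enc_cm:
  fixes X :: "('a, 'v) rcpx"
  shows "chain_map A X (enc_cpx X :: ('a, 'u) rcpx) (\<lambda>n. enc)" by (rule chain_mapI) (simp_all add: enc_rl)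

lemma dec_cm:
  fixes X :: "('a, 'v) rcpx"
  shows "chain_map A (enc_cpx X :: ('a, 'u) rcpx) X (\<lambda>n. dec)" by (rule chain_mapI) (auto simp: dec_rl)

lemma enc_qi:
  fixes X :: "('a, 'v) rcpx"
  assumes "is_cpx A X" shows "quasi_iso A X (enc_cpx X :: ('a, 'u) rcpx) (\<lambda>n. enc)"
  by (rule qi_of_bij[OF assms enc_cpx_cpx[OF assms] enc_cm]) (simp add: bij_betw_def inj_on_subset[OF inj])

lemma dec_qi:
  fixes X :: "('a, 'v) rcpx"
  assumes "is_cpx A X" shows "quasi_iso A (enc_cpx X :: ('a, 'u) rcpx) X (\<lambda>n. dec)"
  by (rule qi_of_bij[OF enc_cpx_cpx[OF assms] assms dec_cm]) (auto simp: bij_betw_def inj_on_def image_image)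

lemma enc_acyclic:
  fixes X :: "('a, 'v) rcpx"
  assumes "acyclic_cpx X" shows "acyclic_cpx (enc_cpx X :: ('a, 'u) rcpx)"
proof -
  have "cocycles (enc_cpx X :: ('a, 'u) rcpx) n = enc ` cocycles X n" for n by (auto simp: cocycles_def enc_eq_iff)
  moreover have "coboundaries (enc_cpx X :: ('a, 'u) rcpx) n = enc ` coboundaries X n" for n by (auto simp: coboundaries_def image_image)
  ultimately show ?thesis using assms by (simp add: acyclic_cpx_def)
qed

end

section \<open>Lifting against K-projective and K-injective complexes\<close>

lemma fst_rl: "rlinear A (dsum_rmodule M N) M fst" by (rule rlinearI) auto

lemma snd_rl: "rlinear A (dsum_rmodule M N) N snd" by (rule rlinearI) auto

lemma pair_rl: "rlinear A K M f \<Longrightarrow> rlinear A K N g \<Longrightarrow> rlinear A K (dsum_rmodule M N) (\<lambda>x. (f x, g x))"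
  by (rule rlinearI) (auto simp: rl_closed rl_add rl_ract)

text \<open>The homotopy fibre \<open>cone(s)[-1]\<close>: in degree \<open>n\<close> it is X in
  degree \<open>n - 1\<close> plus W in degree \<open>n\<close>. Up to sign, a chain map into it is
  a chain map to W together with a null-homotopy of its image in X.\<close>

definition fib :: "('a, 'u) rcpx \<Rightarrow> ('a, 'v) rcpx \<Rightarrow> ('u, 'v) gmap \<Rightarrow> ('a, 'v \<times> 'u) rcpx" where
  "fib W X s = shift (- 1) (cone W X s)"

lemma fib_cob [simp]: "cob (fib W X s) n = dsum_rmodule (cob X (n - 1)) (cob W n)" by (simp add: fib_def)

text \<open>The odd shift negates the whole cone differential, which moves the sign from the
  W-component to the X-component.\<close>

lemma fib_cdf:
  assumes W: "is_cpx A W" and X: "is_cpx A X" and s: "chain_map A W X s" and "x \<in> el X (n - 1)" "w \<in> el W n"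
  shows "cdf (fib W X s) n (x, w) = (\<ominus>[X,n] (cdf X (n - 1) x \<oplus>[X,n] s n w), cdf W n w)"
proof -
  interpret W: cpx_loc A W by standard fact
  interpret X: cpx_loc A X by standard fact
  have "cdf X (n - 1) x \<oplus>[X,n] s n w \<in> el X n" using X.d_closed'[OF assms(4)] cm_closed[OF s assms(5)] by simp
  moreover have "\<ominus>[W,n + 1] cdf W n w \<in> el W (n + 1)" using W.d_closed[OF assms(5)] by simp
  ultimately show ?thesis using W.M.M.minus_minus[OF W.d_closed[OF assms(5)]]
      dsum_a_inv[OF X.M.right_module_axioms[of n] W.M.right_module_axioms[of "n + 1"]] by (simp add: fib_def add.commute)
qed

lemma fib_cpx: "is_cpx A W \<Longrightarrow> is_cpx A X \<Longrightarrow> chain_map A W X s \<Longrightarrow> is_cpx A (fib W X s)" unfolding fib_def by (intro shift_cpx cone_cpx)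

lemma fib_acyclic: "is_cpx A W \<Longrightarrow> is_cpx A X \<Longrightarrow> quasi_iso A W X s \<Longrightarrow> acyclic_cpx (fib W X s)"
  unfolding fib_def by (intro shift_acyclic cone_acyclic cone_cpx qi_cm)

section \<open>K-projective and K-injective complexes\<close>

definition K_projective :: "('a, 'x) ring_scheme \<Rightarrow> ('a, 'u) rcpx \<Rightarrow> bool" where
  "K_projective A P \<longleftrightarrow> is_cpx A P \<and> (\<forall>(N :: ('a, 'u) rcpx) f.
     is_cpx A N \<and> acyclic_cpx N \<and> chain_map A P N f \<longrightarrow>
     homotopic A P N f (\<lambda>n x. \<zero>[N,n]))"

lemma K_proj_cpx: "K_projective A P \<Longrightarrow> is_cpx A P" by (simp add: K_projective_def)

lemma K_projectiveD:
  fixes P N :: "('a, 'u) rcpx"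
  assumes "K_projective A P" "is_cpx A N" "acyclic_cpx N" "chain_map A P N f"
  shows "homotopic A P N f (\<lambda>n x. \<zero>[N,n])" using assms unfolding K_projective_def by blast

lemma K_injectiveD:
  fixes I N :: "('a, 'u) rcpx"
  assumes "K_injective A I" "is_cpx A N" "acyclic_cpx N" "chain_map A N I f"
  shows "homotopic A N I f (\<lambda>n x. \<zero>[I,n])" using assms unfolding K_injective_def by blast

lemma K_inj_cpx: "K_injective A P \<Longrightarrow> is_cpx A P" by (simp add: K_injective_def)

text \<open>The definition tests against complexes with carrier type \<open>'u\<close> only. A
  complex of another type is renamed into \<open>'u\<close>, and the null-homotopy found there is
  decoded.\<close>

lemma K_projective_null:
  fixes P :: "('a, 'u) rcpx" and N :: "('a, 'v) rcpx"
  assumes inj: "inj (enc :: 'v \<Rightarrow> 'u)" and P: "K_projective A P" and N: "is_cpx A N" "acyclic_cpx N" and f: "chain_map A P N f"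
  obtains h where "is_htpy A P N h f (\<lambda>n x. \<zero>[N,n])"
proof -
  interpret N: cpx_loc A N by standard fact
  interpret enc_loc "TYPE('v)" "TYPE('u)" by standard fact
  let ?E = "enc_cpx N :: ('a, 'u) rcpx"
  have Pc: "is_cpx A P" by (rule K_proj_cpx[OF P])
  have E: "is_cpx A ?E" by (rule enc_cpx_cpx[OF N(1)])
  have ef: "chain_map A P ?E (\<lambda>n x. enc (f n x))" by (rule cm_comp[OF f enc_cm])
  have "homotopic A P ?E (\<lambda>n x. enc (f n x)) (\<lambda>n x. \<zero>[?E,n])" by (rule K_projectiveD[OF P E enc_acyclic[OF N(2)] ef])
  from hmt_comp_left[OF this Pc E N(1) ef cm_zero_map[OF E] dec_cm]
  have "homotopic A P N f (\<lambda>n x. \<zero>[N,n])" by simp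
  then show ?thesis by (rule homotopicE[OF _ N(1) f cm_zero_map[OF N(1)] Pc]) (rule that)
qed

lemma K_injective_null:
  fixes I :: "('a, 'u) rcpx" and N :: "('a, 'v) rcpx"
  assumes inj: "inj (enc :: 'v \<Rightarrow> 'u)" and I: "K_injective A I" and N: "is_cpx A N" "acyclic_cpx N" and f: "chain_map A N I f"
  obtains h where "is_htpy A N I h f (\<lambda>n x. \<zero>[I,n])"
proof -
  interpret enc_loc "TYPE('v)" "TYPE('u)" by standard fact
  let ?E = "enc_cpx N :: ('a, 'u) rcpx"
  have Ic: "is_cpx A I" by (rule K_inj_cpx[OF I])
  have E: "is_cpx A ?E" by (rule enc_cpx_cpx[OF N(1)])
  have ef: "chain_map A ?E I (\<lambda>n x. f n (dec x))" by (rule cm_comp[OF dec_cm f])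
  have "homotopic A ?E I (\<lambda>n x. f n (dec x)) (\<lambda>n x. \<zero>[I,n])" by (rule K_injectiveD[OF I E enc_acyclic[OF N(2)] ef])
  from hmt_comp_right[OF this E Ic N(1) ef cm_zero_map[OF Ic] enc_cm]
  have "homotopic A N I f (\<lambda>n x. \<zero>[I,n])" by simp
  then show ?thesis by (rule homotopicE[OF _ Ic f cm_zero_map[OF Ic] N(1)]) (rule that)
qed

text \<open>Sending x to \<open>(f x, 0)\<close> maps P into the acyclic cone of s. A null-homotopy
  of this map has components \<open>(k, g)\<close>: the W-part of its equation says that g is a
  chain map, the X-part that k is a homotopy from f to \<open>s g\<close>.\<close>

lemma K_projective_lift:
  fixes P W X :: "('a, 'u) rcpx"
  assumes inj: "inj (enc :: 'u \<times> 'u \<Rightarrow> 'u)" and P: "K_projective A P"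
    and W: "is_cpx A W" and X: "is_cpx A X" and s: "quasi_iso A W X s" and f: "chain_map A P X f"
  obtains g where "chain_map A P W g" "homotopic A P X (\<lambda>n x. s n (g n x)) f"
proof -
  interpret W: cpx_loc A W by standard fact
  interpret X: cpx_loc A X by standard fact
  have Pc: "is_cpx A P" by (rule K_proj_cpx[OF P])
  interpret P: cpx_loc A P by standard fact
  note sc = qi_cm[OF s]
  have C: "is_cpx A (cone W X s)" by (rule cone_cpx[OF W X sc])
  have s0: "s n \<zero>[W,n] = \<zero>[X,n]" for n by (rule rl_zero[OF cm_lin[OF sc] W.grp X.grp])
  have phi: "chain_map A P (cone W X s) (\<lambda>n x. (f n x, \<zero>[W,n + 1]))"
  proof (rule chain_mapI)
    show "rlinear A (cob P n) (cob (cone W X s) n) (\<lambda>x. (f n x, \<zero>[W,n + 1]))" for n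
      by (simp add: pair_rl cm_lin[OF f] rl_const_zero[OF W.M.right_module_axioms])
    fix n x assume "x \<in> el P n"
    then show "(f (n + 1) (cdf P n x), \<zero>[W,n + 1 + 1]) = cdf (cone W X s) n (f n x, \<zero>[W,n + 1])"
      using cm_d[OF f, of x n] X.d_closed[OF cm_closed[OF f, of x n]] W.d_zero[of "n + 1"] by (simp add: s0 W.M.M.a_inv_zero add.assoc)
  qed
  obtain h where "is_htpy A P (cone W X s) h (\<lambda>n x. (f n x, \<zero>[W,n + 1])) (\<lambda>n x. \<zero>[cone W X s,n])"
    by (rule K_projective_null[OF inj P C cone_acyclic[OF W X s] phi])
  note h = htpyD[OF this]
  define k where "k n x = fst (h n x)" for n x
  define g where "g n x = snd (h n x)" for n x
  have hkg: "h n x = (k n x, g n x)" for n x by (simp add: k_def g_def)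
  have hl: "rlinear A (cob P n) (dsum_rmodule (cob X (n - 1)) (cob W n)) (h n)" for n using h(1)[of n] by simp
  have kl: "rlinear A (cob P n) (cob X (n - 1)) (k n)" for n unfolding k_def by (rule rl_comp[OF hl fst_rl])
  have gl: "rlinear A (cob P n) (cob W n) (g n)" for n unfolding g_def by (rule rl_comp[OF hl snd_rl])
  have eqs: "f n x = \<zero>[X,n] \<oplus>[X,n] (cdf X (n - 1) (k n x) \<oplus>[X,n] s n (g n x) \<oplus>[X,n] k (n + 1) (cdf P n x))"
    "\<zero>[W,n + 1] = \<zero>[W,n + 1] \<oplus>[W,n + 1] (\<ominus>[W,n + 1] cdf W n (g n x) \<oplus>[W,n + 1] g (n + 1) (cdf P n x))"
    if x: "x \<in> el P n" for n x using h(3)[OF x] by (simp_all add: hkg add.commute)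
  have gc: "chain_map A P W g"
  proof (rule chain_mapI[OF gl])
    fix n x assume x: "x \<in> el P n"
    have c: "cdf W n (g n x) \<in> el W (n + 1)" "g (n + 1) (cdf P n x) \<in> el W (n + 1)"
      using W.d_closed[OF rl_closed[OF gl x]] rl_closed[OF gl P.d_closed[OF x]] .
    have "g (n + 1) (cdf P n x) = cdf W n (g n x) \<oplus>[W,n + 1] (\<zero>[W,n + 1] \<oplus>[W,n + 1] (\<ominus>[W,n + 1] cdf W n (g n x) \<oplus>[W,n + 1] g (n + 1) (cdf P n x)))"
      using c by algebra
    also have "\<dots> = cdf W n (g n x)" unfolding eqs(2)[OF x, symmetric] using c(1) by algebra
    finally show "g (n + 1) (cdf P n x) = cdf W n (g n x)" .
  qed
  have sg: "chain_map A P X (\<lambda>n x. s n (g n x))" by (rule cm_comp[OF gc sc])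
  have "homotopic A P X f (\<lambda>n x. s n (g n x))"
  proof (rule homotopicI[OF X f sg Pc kl])
    fix n x assume x: "x \<in> el P n"
    have c: "cdf X (n - 1) (k n x) \<in> el X n" "s n (g n x) \<in> el X n" "k (n + 1) (cdf P n x) \<in> el X n"
      using X.d_closed'[OF rl_closed[OF kl x]] rl_closed[OF kl P.d_closed[OF x]] cm_closed[OF sg x] by simp_all
    show "f n x = s n (g n x) \<oplus>[X,n] (cdf X (n - 1) (k n x) \<oplus>[X,n] k (n + 1) (cdf P n x))" unfolding eqs(1)[OF x] using c by algebra
  qed
  from that[OF gc hmt_sym[OF this X f sg Pc]] show ?thesis .
qed

text \<open>For \<open>u = g - g'\<close> a null-homotopy \<open>h\<close> of \<open>s u\<close>
  makes \<open>(- h, u)\<close> a chain map into the acyclic fibre of \<open>s\<close>; the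
  W-component of a null-homotopy of that map contracts \<open>u\<close>.\<close>

lemma K_projective_lift_unique:
  fixes P W X :: "('a, 'u) rcpx"
  assumes inj: "inj (enc :: 'u \<times> 'u \<Rightarrow> 'u)" and P: "K_projective A P"
    and W: "is_cpx A W" and X: "is_cpx A X" and s: "quasi_iso A W X s" and g: "chain_map A P W g" and g': "chain_map A P W g'"
    and hom: "homotopic A P X (\<lambda>n x. s n (g n x)) (\<lambda>n x. s n (g' n x))"
  shows "homotopic A P W g g'"
proof -
  interpret W: cpx_loc A W by standard fact
  interpret X: cpx_loc A X by standard fact
  have Pc: "is_cpx A P" by (rule K_proj_cpx[OF P])
  interpret P: cpx_loc A P by standard fact
  note sc = qi_cm[OF s]
  define u where "u n x = g n x \<ominus>[W,n] g' n x" for n x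
  have u: "chain_map A P W u" unfolding u_def by (rule cm_diff[OF W g g'])
  have su: "s n (u n x) = s n (g n x) \<ominus>[X,n] s n (g' n x)" if "x \<in> el P n" for n x unfolding u_def
    by (rule rl_minus[OF cm_lin[OF sc] W.grp X.grp cm_closed[OF g that] cm_closed[OF g' that]])
  obtain h where "is_htpy A P X h (\<lambda>n x. s n (g n x)) (\<lambda>n x. s n (g' n x))"
    by (rule homotopicE[OF hom X cm_comp[OF g sc] cm_comp[OF g' sc] Pc])
  note h = htpyD[OF this]
  have suc: "s n (u n x) = cdf X (n - 1) (h n x) \<oplus>[X,n] h (n + 1) (cdf P n x)"
    if x: "x \<in> el P n" for n x
  proof -
    have c: "s n (g' n x) \<in> el X n" "cdf X (n - 1) (h n x) \<in> el X n" "h (n + 1) (cdf P n x) \<in> el X n"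
      using X.d_closed'[OF rl_closed[OF h(1) x]] h(2)[OF x] cm_closed[OF cm_comp[OF g' sc] x] by simp_all
    show ?thesis unfolding su[OF x] h(3)[OF x] using c by algebra
  qed
  have F: "is_cpx A (fib W X s)" by (rule fib_cpx[OF W X sc])
  let ?p = "\<lambda>n x. (\<ominus>[X,n - 1] h n x, u n x)"
  have phi: "chain_map A P (fib W X s) ?p"
  proof (rule chain_mapI)
    show "rlinear A (cob P n) (cob (fib W X s) n) (?p n)" for n
      by (simp add: pair_rl cm_lin[OF u] rl_uminus[OF X.M.right_module_axioms h(1)])
    fix n x assume x: "x \<in> el P n"
    note hx = rl_closed[OF h(1) x]
    have c: "cdf X (n - 1) (h n x) \<in> el X n" "h (n + 1) (cdf P n x) \<in> el X n" using X.d_closed'[OF hx] h(2)[OF x] by simp_all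
    have "cdf (fib W X s) n (?p n x) = (\<ominus>[X,n] (cdf X (n - 1) (\<ominus>[X,n - 1] h n x) \<oplus>[X,n] s n (u n x)), cdf W n (u n x))"
      by (rule fib_cdf[OF W X sc]) (simp_all add: hx cm_closed[OF u x])
    also have "cdf X (n - 1) (\<ominus>[X,n - 1] h n x) = \<ominus>[X,n] cdf X (n - 1) (h n x)" by (rule X.d_neg'[OF hx])
    also have "\<ominus>[X,n] (\<ominus>[X,n] cdf X (n - 1) (h n x) \<oplus>[X,n] s n (u n x)) = \<ominus>[X,n] h (n + 1) (cdf P n x)"
      unfolding suc[OF x] using c by algebra
    finally show "?p (n + 1) (cdf P n x) = cdf (fib W X s) n (?p n x)" by (simp add: cm_d[OF u x])
  qed
  obtain K where "is_htpy A P (fib W X s) K ?p (\<lambda>n x. \<zero>[fib W X s,n])" by (rule K_projective_null[OF inj P F fib_acyclic[OF W X s] phi])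
  note K = htpyD[OF this]
  have Kl: "rlinear A (cob P n) (dsum_rmodule (cob X (n - 1 - 1)) (cob W (n - 1))) (K n)" for n using K(1)[of n] by simp
  define k where "k n x = snd (K n x)" for n x
  have kl: "rlinear A (cob P n) (cob W (n - 1)) (k n)" for n unfolding k_def by (rule rl_comp[OF Kl snd_rl])
  have "homotopic A P W u (\<lambda>n x. \<zero>[W,n])"
  proof (rule homotopicI[OF W u cm_zero_map[OF W] Pc kl])
    fix n x assume x: "x \<in> el P n"
    obtain j where j: "K n x = (j, k n x)" by (cases "K n x") (simp add: k_def)
    have jc: "j \<in> el X (n - 1 - 1)" "k n x \<in> el W (n - 1)" using rl_closed[OF Kl x] j by simp_all
    have "cdf (fib W X s) (n - 1) (K n x) = (\<ominus>[X,n - 1] (cdf X (n - 1 - 1) j \<oplus>[X,n - 1] s (n - 1) (k n x)), cdf W (n - 1) (k n x))"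
      unfolding j by (rule fib_cdf[OF W X sc jc])
    with K(3)[OF x]
    show "u n x = \<zero>[W,n] \<oplus>[W,n] (cdf W (n - 1) (k n x) \<oplus>[W,n] k (n + 1) (cdf P n x))" by (cases "K (n + 1) (cdf P n x)") (simp add: k_def)
  qed
  then show ?thesis unfolding hmt_diff_iff[OF Pc W g g'] u_def .
qed

text \<open>Sending \<open>(x, w)\<close> to \<open>g w\<close> is a chain map on the acyclic fibre
  of s, and a null-homotopy \<open>K\<close> of it splits along the two summands. On X it restricts
  to a chain map \<open>k\<close>, and \<open>f = - k\<close> is the lift; on W it restricts to a
  homotopy from g to \<open>f s\<close>.\<close>

lemma K_injective_lift:
  fixes I W X :: "('a, 'u) rcpx"
  assumes inj: "inj (enc :: 'u \<times> 'u \<Rightarrow> 'u)" and I: "K_injective A I"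
    and W: "is_cpx A W" and X: "is_cpx A X" and s: "quasi_iso A W X s" and g: "chain_map A W I g"
  obtains f where "chain_map A X I f" "homotopic A W I (\<lambda>n x. f n (s n x)) g"
proof -
  interpret W: cpx_loc A W by standard fact
  interpret X: cpx_loc A X by standard fact
  have Ic: "is_cpx A I" by (rule K_inj_cpx[OF I])
  interpret I: cpx_loc A I by standard fact
  note sc = qi_cm[OF s]
  have F: "is_cpx A (fib W X s)" by (rule fib_cpx[OF W X sc])
  interpret F: cpx_loc A "fib W X s" by standard fact
  let ?p = "\<lambda>n z. g n (snd z)"
  have phi: "chain_map A (fib W X s) I ?p"
  proof (rule chain_mapI)
    show "rlinear A (cob (fib W X s) n) (cob I n) (?p n)" for n by (simp add: rl_comp[OF snd_rl cm_lin[OF g]])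
    fix n z assume z: "z \<in> el (fib W X s) n"
    then show "?p (n + 1) (cdf (fib W X s) n z) = cdf I n (?p n z)" by (cases z) (simp add: fib_cdf[OF W X sc] cm_d[OF g])
  qed
  obtain K where "is_htpy A (fib W X s) I K ?p (\<lambda>n x. \<zero>[I,n])" by (rule K_injective_null[OF inj I F fib_acyclic[OF W X s] phi])
  note K = htpyD[OF this]
  have Kl: "rlinear A (dsum_rmodule (cob X (n - 1)) (cob W n)) (cob I (n - 1)) (K n)" for n using K(1)[of n] by simp
  have Kl': "rlinear A (dsum_rmodule (cob X n) (cob W (n + 1))) (cob I n) (K (n + 1))" for n using K(1)[of "n + 1"] by simp
  define k where "k n x = K (n + 1) (x, \<zero>[W,n + 1])" for n x
  have kl: "rlinear A (cob X n) (cob I n) (k n)" for n unfolding k_def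
    by (rule rl_comp[OF pair_rl[OF rl_id rl_const_zero[OF W.M.right_module_axioms]] Kl'])
  have s0: "s n \<zero>[W,n] = \<zero>[X,n]" for n by (rule rl_zero[OF cm_lin[OF sc] W.grp X.grp])
  have g0: "g n \<zero>[W,n] = \<zero>[I,n]" for n by (rule rl_zero[OF cm_lin[OF g] W.grp I.grp])
  have kc: "chain_map A X I k"
  proof (rule chain_mapI[OF kl])
    fix n x assume x: "x \<in> el X n"
    have z: "(x, \<zero>[W,n + 1]) \<in> el (fib W X s) (n + 1)" using x by simp
    have dx: "cdf X n x \<in> el X (n + 1)" by (rule X.d_closed[OF x])
    have kx: "cdf I n (k n x) \<in> el I (n + 1)" "k (n + 1) (cdf X n x) \<in> el I (n + 1)"
      using I.d_closed[OF rl_closed[OF kl x]] rl_closed[OF kl dx] .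
    have "cdf (fib W X s) (n + 1) (x, \<zero>[W,n + 1]) = (\<ominus>[X,n + 1] cdf X n x, \<zero>[W,n + 1 + 1])"
      using dx x by (subst fib_cdf[OF W X sc]) (simp_all add: s0 W.d_zero)
    moreover have "K (n + 1 + 1) (\<ominus>[X,n + 1] cdf X n x, \<zero>[W,n + 1 + 1]) = \<ominus>[I,n + 1] k (n + 1) (cdf X n x)"
      using rl_neg[OF kl X.grp I.grp dx] by (simp add: k_def)
    ultimately have "\<zero>[I,n + 1] = cdf I n (k n x) \<oplus>[I,n + 1] \<ominus>[I,n + 1] k (n + 1) (cdf X n x)"
      using K(3)[OF z] kx by (simp add: g0 k_def[symmetric])
    then show "k (n + 1) (cdf X n x) = cdf I n (k n x)" using I.M.M.minus_eq_zero_iff[OF kx] by (simp add: a_minus_def)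
  qed
  \<comment> \<open>The fibre differential sends \<open>(0, w)\<close> to
    \<open>(- s w, d w)\<close>, so the homotopy equation produces \<open>- k (s w)\<close>.\<close>
  define f where "f n x = \<ominus>[I,n] k n x" for n x
  have f: "chain_map A X I f" unfolding f_def by (rule cm_neg[OF Ic kc])
  have fs: "chain_map A W I (\<lambda>n x. f n (s n x))" by (rule cm_comp[OF sc f])
  define l where "l n w = K n (\<zero>[X,n - 1], w)" for n w
  have ll: "rlinear A (cob W n) (cob I (n - 1)) (l n)" for n unfolding l_def
    by (rule rl_comp[OF pair_rl[OF rl_const_zero[OF X.M.right_module_axioms] rl_id] Kl])
  have "homotopic A W I g (\<lambda>n x. f n (s n x))"
  proof (rule homotopicI[OF Ic g fs W ll])
    fix n w assume w: "w \<in> el W n"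
    have z: "(\<zero>[X,n - 1], w) \<in> el (fib W X s) n" using w by simp
    have sw: "s n w \<in> el X n" by (rule cm_closed[OF sc w])
    have dw: "cdf W n w \<in> el W (n + 1)" by (rule W.d_closed[OF w])
    have 1: "cdf (fib W X s) n (\<zero>[X,n - 1], w) = (\<ominus>[X,n] s n w, cdf W n w)"
      using w sw by (subst fib_cdf[OF W X sc]) (simp_all add: X.d_zero')
    have "(\<ominus>[X,n] s n w, cdf W n w) = (\<ominus>[X,n] s n w, \<zero>[W,n + 1]) \<oplus>[dsum_rmodule (cob X n) (cob W (n + 1))] (\<zero>[X,n], cdf W n w)"
      using sw dw by simp
    then have 2: "K (n + 1) (\<ominus>[X,n] s n w, cdf W n w) = f n (s n w) \<oplus>[I,n] l (n + 1) (cdf W n w)"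
      using rl_add[OF Kl'[of n], of "(\<ominus>[X,n] s n w, \<zero>[W,n + 1])" "(\<zero>[X,n], cdf W n w)"] sw dw
        rl_neg[OF kl X.grp I.grp sw] by (simp add: f_def k_def l_def)
    have c: "cdf I (n - 1) (l n w) \<in> el I n" "f n (s n w) \<in> el I n" "l (n + 1) (cdf W n w) \<in> el I n"
      using I.d_closed'[OF rl_closed[OF ll w]] cm_closed[OF fs w] rl_closed[OF ll dw] by simp_all
    have "g n w = \<zero>[I,n] \<oplus>[I,n] (cdf I (n - 1) (l n w) \<oplus>[I,n] (f n (s n w) \<oplus>[I,n] l (n + 1) (cdf W n w)))"
      using K(3)[OF z] unfolding 1 2 by (simp add: l_def)
    also have "\<dots> = f n (s n w) \<oplus>[I,n] (cdf I (n - 1) (l n w) \<oplus>[I,n] l (n + 1) (cdf W n w))" using c by algebra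
    finally show "g n w = f n (s n w) \<oplus>[I,n] (cdf I (n - 1) (l n w) \<oplus>[I,n] l (n + 1) (cdf W n w))" .
  qed
  from that[OF f hmt_sym[OF this Ic g fs W]] show ?thesis .
qed

text \<open>With \<open>u = f - f'\<close> and a null-homotopy \<open>h\<close> of
  \<open>u s\<close>, sending \<open>(x, w)\<close> to \<open>u x + h w\<close> is a chain map on
  the acyclic cone of \<open>s\<close>; restricting a null-homotopy of it to X contracts
  \<open>u\<close>.\<close>

lemma K_injective_lift_unique:
  fixes I W X :: "('a, 'u) rcpx"
  assumes inj: "inj (enc :: 'u \<times> 'u \<Rightarrow> 'u)" and I: "K_injective A I"
    and W: "is_cpx A W" and X: "is_cpx A X" and s: "quasi_iso A W X s" and f: "chain_map A X I f" and f': "chain_map A X I f'"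
    and hom: "homotopic A W I (\<lambda>n x. f n (s n x)) (\<lambda>n x. f' n (s n x))"
  shows "homotopic A X I f f'"
proof -
  interpret W: cpx_loc A W by standard fact
  interpret X: cpx_loc A X by standard fact
  have Ic: "is_cpx A I" by (rule K_inj_cpx[OF I])
  interpret I: cpx_loc A I by standard fact
  note sc = qi_cm[OF s]
  define u where "u n x = f n x \<ominus>[I,n] f' n x" for n x
  have u: "chain_map A X I u" unfolding u_def by (rule cm_diff[OF Ic f f'])
  note ul = cm_lin[OF u]
  obtain h where "is_htpy A W I h (\<lambda>n x. f n (s n x)) (\<lambda>n x. f' n (s n x))"
    by (rule homotopicE[OF hom Ic cm_comp[OF sc f] cm_comp[OF sc f'] W])
  note h = htpyD[OF this]
  have hl: "rlinear A (cob W (n + 1)) (cob I n) (h (n + 1))" for n using h(1)[of "n + 1"] by simp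
  have us: "u n (s n x) = cdf I (n - 1) (h n x) \<oplus>[I,n] h (n + 1) (cdf W n x)"
    if x: "x \<in> el W n" for n x
  proof -
    have c: "f' n (s n x) \<in> el I n" "cdf I (n - 1) (h n x) \<in> el I n" "h (n + 1) (cdf W n x) \<in> el I n"
      using I.d_closed'[OF rl_closed[OF h(1) x]] h(2)[OF x] cm_closed[OF cm_comp[OF sc f'] x] by simp_all
    show ?thesis unfolding u_def h(3)[OF x] using c by algebra
  qed
  have C: "is_cpx A (cone W X s)" by (rule cone_cpx[OF W X sc])
  let ?p = "\<lambda>n z. u n (fst z) \<oplus>[I,n] h (n + 1) (snd z)"
  have phi: "chain_map A (cone W X s) I ?p"
  proof (rule chain_mapI)
    show "rlinear A (cob (cone W X s) n) (cob I n) (?p n)" for n unfolding cone_simps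
      by (rule rl_plus[OF I.M.right_module_axioms rl_comp[OF fst_rl ul] rl_comp[OF snd_rl hl]])
    fix n z assume z: "z \<in> el (cone W X s) n"
    obtain x w where zz: "z = (x, w)" by (cases z)
    have c: "x \<in> el X n" "w \<in> el W (n + 1)" using z by (simp_all add: zz)
    have sw: "s (n + 1) w \<in> el X (n + 1)" by (rule cm_closed[OF sc c(2)])
    have dw: "cdf W (n + 1) w \<in> el W (n + 1 + 1)" by (rule W.d_closed[OF c(2)])
    have uw: "u (n + 1) (s (n + 1) w) = cdf I n (h (n + 1) w) \<oplus>[I,n + 1] h (n + 1 + 1) (cdf W (n + 1) w)" using us[OF c(2)] by simp
    have hd: "h (n + 1 + 1) (\<ominus>[W,n + 1 + 1] cdf W (n + 1) w) = \<ominus>[I,n + 1] h (n + 1 + 1) (cdf W (n + 1) w)"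
      by (rule rl_neg[OF hl W.grp I.grp dw])
    have uc: "u n x \<in> el I n" "h (n + 1) w \<in> el I n" "h (n + 1 + 1) (cdf W (n + 1) w) \<in> el I (n + 1)"
      using cm_closed[OF u c(1)] rl_closed[OF hl c(2)] rl_closed[OF hl dw] .
    note dc = I.d_closed[OF uc(1)] I.d_closed[OF uc(2)]
    have "?p (n + 1) (cdf (cone W X s) n z) = u (n + 1) (cdf X n x \<oplus>[X,n + 1] s (n + 1) w) \<oplus>[I,n + 1] h (n + 1 + 1) (\<ominus>[W,n + 1 + 1] cdf W (n + 1) w)"
      by (simp add: zz add.assoc)
    also have "\<dots> = cdf I n (u n x) \<oplus>[I,n + 1] (cdf I n (h (n + 1) w) \<oplus>[I,n + 1] h (n + 1 + 1) (cdf W (n + 1) w)) \<oplus>[I,n + 1] \<ominus>[I,n + 1] h (n + 1 + 1) (cdf W (n + 1) w)"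
      unfolding hd rl_add[OF ul X.d_closed[OF c(1)] sw] cm_d[OF u c(1)] uw ..
    also have "\<dots> = cdf I n (u n x) \<oplus>[I,n + 1] cdf I n (h (n + 1) w)" using dc uc(3) by algebra
    also have "\<dots> = cdf I n (?p n z)" using I.d_add[OF uc(1,2)] by (simp add: zz)
    finally show "?p (n + 1) (cdf (cone W X s) n z) = cdf I n (?p n z)" .
  qed
  obtain K where "is_htpy A (cone W X s) I K ?p (\<lambda>n x. \<zero>[I,n])" by (rule K_injective_null[OF inj I C cone_acyclic[OF W X s] phi])
  note K = htpyD[OF this]
  have Kl: "rlinear A (dsum_rmodule (cob X n) (cob W (n + 1))) (cob I (n - 1)) (K n)" for n using K(1)[of n] by simp
  define k where "k n x = K n (x, \<zero>[W,n + 1])" for n x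
  have kl: "rlinear A (cob X n) (cob I (n - 1)) (k n)" for n unfolding k_def
    by (rule rl_comp[OF pair_rl[OF rl_id rl_const_zero[OF W.M.right_module_axioms]] Kl])
  have s0: "s n \<zero>[W,n] = \<zero>[X,n]" for n by (rule rl_zero[OF cm_lin[OF sc] W.grp X.grp])
  have h0: "h (n + 1) \<zero>[W,n + 1] = \<zero>[I,n]" for n by (rule rl_zero[OF hl W.grp I.grp])
  have "homotopic A X I u (\<lambda>n x. \<zero>[I,n])"
  proof (rule homotopicI[OF Ic u cm_zero_map[OF Ic] X kl])
    fix n x assume x: "x \<in> el X n"
    have z: "(x, \<zero>[W,n + 1]) \<in> el (cone W X s) n" using x by simp
    have "cdf (cone W X s) n (x, \<zero>[W,n + 1]) = (cdf X n x, \<zero>[W,n + 1 + 1])"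
      using X.d_closed[OF x] W.d_zero[of "n + 1"] by (simp add: s0 W.M.M.a_inv_zero add.assoc)
    then show "u n x = \<zero>[I,n] \<oplus>[I,n] (cdf I (n - 1) (k n x) \<oplus>[I,n] k (n + 1) (cdf X n x))"
      using K(3)[OF z] cm_closed[OF u x] by (simp add: h0 k_def)
  qed
  then show ?thesis unfolding hmt_diff_iff[OF X Ic f f'] u_def .
qed

section \<open>Embeddings into the universe\<close>

text \<open>Comparison of types by size, phrased with type arguments so that such facts compose
  without naming an injection.\<close>

definition embeds :: "'v itself \<Rightarrow> 'u itself \<Rightarrow> bool" where
  "embeds _ _ \<longleftrightarrow> (\<exists>e :: 'v \<Rightarrow> 'u. inj e)"

lemma embedsI: "inj (e :: 'v \<Rightarrow> 'u) \<Longrightarrow> embeds TYPE('v) TYPE('u)" by (auto simp: embeds_def)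

lemma embeds_enc: "embeds TYPE('v) TYPE('u) \<Longrightarrow> inj (enc :: 'v \<Rightarrow> 'u)" by (rule inj_enc) (simp add: embeds_def)

lemma embeds_trans: "embeds TYPE('v) TYPE('w) \<Longrightarrow> embeds TYPE('w) TYPE('u) \<Longrightarrow> embeds TYPE('v) TYPE('u)"
  unfolding embeds_def by (metis inj_compose)

lemma embeds_fun:
  assumes "embeds TYPE('v) TYPE('w)" shows "embeds TYPE('c \<Rightarrow> 'v) TYPE('c \<Rightarrow> 'w)"
proof -
  obtain e :: "'v \<Rightarrow> 'w" where e: "inj e" using assms by (auto simp: embeds_def)
  have "inj (\<lambda>(g :: 'c \<Rightarrow> 'v) x. e (g x))" by (auto simp: inj_def fun_eq_iff inj_eq[OF e])
  then show ?thesis by (rule embedsI)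
qed

text \<open>Precomposition with a left inverse of the injection, which is surjective, loses no
  function.\<close>

lemma embeds_fun_dom:
  assumes "embeds TYPE('c) TYPE('d)" shows "embeds TYPE('c \<Rightarrow> 'v) TYPE('d \<Rightarrow> 'v)"
proof -
  obtain e :: "'c \<Rightarrow> 'd" where e: "inj e" using assms by (auto simp: embeds_def)
  have "inj (\<lambda>(g :: 'c \<Rightarrow> 'v) x. g (inv_into UNIV e x))"
  proof (rule injI)
    fix g g' :: "'c \<Rightarrow> 'v" assume a: "(\<lambda>x. g (inv_into UNIV e x)) = (\<lambda>x. g' (inv_into UNIV e x))"
    have "g x = g' x" for x using fun_cong[OF a, of "e x"] inv_f_f[OF e] by simp
    then show "g = g'" ..
  qed
  then show ?thesis by (rule embedsI)
qed

lemma embeds_prod: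
  assumes "embeds TYPE('c) TYPE('v)" "embeds TYPE('d) TYPE('w)" shows "embeds TYPE('c \<times> 'd) TYPE('v \<times> 'w)"
proof -
  obtain e :: "'c \<Rightarrow> 'v" where e: "inj e" using assms by (auto simp: embeds_def)
  obtain e' :: "'d \<Rightarrow> 'w" where e': "inj e'" using assms by (auto simp: embeds_def)
  have "inj (\<lambda>(x, y). (e x, e' y))" by (auto simp: inj_def inj_eq[OF e] inj_eq[OF e'])
  then show ?thesis by (rule embedsI)
qed

lemma embeds_curry: "embeds TYPE('c \<Rightarrow> 'd \<Rightarrow> 'v) TYPE('c \<times> 'd \<Rightarrow> 'v)"
proof -
  have "inj (case_prod :: ('c \<Rightarrow> 'd \<Rightarrow> 'v) \<Rightarrow> _)" by (auto simp: inj_def fun_eq_iff)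
  then show ?thesis by (rule embedsI)
qed

lemma embeds_countable: "embeds TYPE('c :: countable) TYPE(nat)" by (rule embedsI[of to_nat]) simp

lemma large_universe_mono:
  assumes "large_universe TYPE('j) TYPE('u)" "embeds TYPE('i) TYPE('j)"
  shows "large_universe TYPE('i) TYPE('u)"
proof -
  have "embeds TYPE(nat \<times> 'i) TYPE(nat \<times> 'j)" by (rule embeds_prod[OF _ assms(2)]) (rule embedsI[of id], simp)
  from embeds_trans[OF embeds_fun_dom[OF this, where 'v='u]] show ?thesis using assms(1) by (auto simp: large_universe_def embeds_def)
qed

context
  fixes U :: "'u itself" and T :: "'a itself"
  assumes large: "large_universe TYPE('a) TYPE('u)"
begin

lemma universe_fun: "embeds TYPE(nat \<times> 'a \<Rightarrow> 'u) TYPE('u)" using large by (simp add: large_universe_def embeds_def)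

text \<open>The form in which closure is applied to Hom complexes, whose elements are families of
  maps indexed by the integers.\<close>

lemma universe_fun_countable: "embeds TYPE('c :: countable \<Rightarrow> 'a \<Rightarrow> 'u) TYPE('u)"
proof -
  have "embeds TYPE('c \<times> 'a) TYPE(nat \<times> 'a)" by (rule embeds_prod[OF embeds_countable]) (rule embedsI[of id], simp)
  then show ?thesis by (rule embeds_trans[OF embeds_curry embeds_trans[OF embeds_fun_dom universe_fun]])
qed

lemma universe_power: "embeds TYPE('a \<Rightarrow> 'u) TYPE('u)"
proof -
  have "inj (\<lambda>(g :: 'a \<Rightarrow> 'u) (n :: nat). g)" by (auto simp: inj_def fun_eq_iff)
  from embeds_trans[OF embedsI[OF this] universe_fun_countable] show ?thesis .
qed

lemma universe_seq: "embeds TYPE(nat \<Rightarrow> 'u) TYPE('u)"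
proof -
  have "inj (\<lambda>(g :: nat \<Rightarrow> 'u) n (x :: 'a). g n)" by (auto simp: inj_def fun_eq_iff)
  from embeds_trans[OF embedsI[OF this] universe_fun_countable] show ?thesis .
qed

lemma universe_pair: "embeds TYPE('u \<times> 'u) TYPE('u)"
proof -
  have "inj (\<lambda>(p :: 'u \<times> 'u) n. if n = (0 :: nat) then fst p else snd p)" by (auto simp: inj_def fun_eq_iff prod_eq_iff split: if_splits)
  from embeds_trans[OF embedsI[OF this] universe_seq] show ?thesis .
qed

text \<open>An element is coded by its characteristic function; the two distinct elements of a large
  universe serve as truth values.\<close>

lemma universe_index: "embeds TYPE('c) TYPE('u)" if "embeds TYPE('c \<Rightarrow> 'u) TYPE('u)"
proof -
  obtain x y :: 'u where xy: "x \<noteq> y" using large by (auto simp: large_universe_def)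
  have "inj (\<lambda>(c :: 'c) c'. if c' = c then x else y)" using xy by (auto simp: inj_def fun_eq_iff split: if_splits)
  from embeds_trans[OF embedsI[OF this] that] show ?thesis .
qed

lemma universe_nat: "embeds TYPE(nat) TYPE('u)" by (rule universe_index[OF universe_seq])

lemma universe_countable: "embeds TYPE('c :: countable) TYPE('u)" by (rule embeds_trans[OF embeds_countable universe_nat])

lemma universe_ring: "embeds TYPE('a) TYPE('u)" by (rule universe_index[OF universe_power])

lemma universe_prod:
  "embeds TYPE('c) TYPE('u) \<Longrightarrow> embeds TYPE('d) TYPE('u) \<Longrightarrow> embeds TYPE('c \<times> 'd) TYPE('u)"
  by (rule embeds_trans[OF embeds_prod universe_pair])

text \<open>A list becomes a sequence headed by its length, so the padding after the last entry
  causes no ambiguity.\<close>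

lemma universe_list: "embeds TYPE('c list) TYPE('u)" if c: "embeds TYPE('c) TYPE('u)"
proof -
  obtain e :: "'c \<Rightarrow> 'u" where e: "inj e" using c by (auto simp: embeds_def)
  obtain k :: "nat \<Rightarrow> 'u" where k: "inj k" using universe_nat by (auto simp: embeds_def)
  have "inj (\<lambda>(xs :: 'c list) n. case n of 0 \<Rightarrow> k (length xs) | Suc i \<Rightarrow> if i < length xs then e (xs ! i) else undefined)"
  proof (rule injI)
    fix xs ys :: "'c list"
    assume eq: "(\<lambda>n. case n of 0 \<Rightarrow> k (length xs) | Suc i \<Rightarrow> if i < length xs then e (xs ! i) else undefined) =
      (\<lambda>n. case n of 0 \<Rightarrow> k (length ys) | Suc i \<Rightarrow> if i < length ys then e (ys ! i) else undefined)"
    have l: "length xs = length ys" using fun_cong[OF eq, of 0] by (simp add: inj_eq[OF k])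
    have "xs ! i = ys ! i" if "i < length xs" for i using fun_cong[OF eq, of "Suc i"] that l by (simp add: inj_eq[OF e])
    with l show "xs = ys" by (rule nth_equalityI)
  qed
  from embeds_trans[OF embedsI[OF this] universe_seq] show ?thesis .
qed

end

section \<open>Modules presented by representatives\<close>

text \<open>Quotients are formed by choosing a representative in each class, which keeps the carrier
  inside the original type and hence inside the universe.\<close>

locale setoid_group =
  fixes V :: "'v set" and pl :: "'v \<Rightarrow> 'v \<Rightarrow> 'v" and z :: 'v and ng :: "'v \<Rightarrow> 'v" and E :: "'v \<Rightarrow> 'v \<Rightarrow> bool"
  assumes refl: "x \<in> V \<Longrightarrow> E x x" and sym: "\<lbrakk>x \<in> V; y \<in> V; E x y\<rbrakk> \<Longrightarrow> E y x" and trans: "\<lbrakk>x \<in> V; y \<in> V; w \<in> V; E x y; E y w\<rbrakk> \<Longrightarrow> E x w"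
    and pl_closed: "\<lbrakk>x \<in> V; y \<in> V\<rbrakk> \<Longrightarrow> pl x y \<in> V" and z_closed: "z \<in> V" and ng_closed: "x \<in> V \<Longrightarrow> ng x \<in> V"
    and pl_cong: "\<lbrakk>x \<in> V; y \<in> V; x' \<in> V; y' \<in> V; E x x'; E y y'\<rbrakk> \<Longrightarrow> E (pl x y) (pl x' y')"
    and assoc: "\<lbrakk>x \<in> V; y \<in> V; w \<in> V\<rbrakk> \<Longrightarrow> E (pl (pl x y) w) (pl x (pl y w))" and comm: "\<lbrakk>x \<in> V; y \<in> V\<rbrakk> \<Longrightarrow> E (pl x y) (pl y x)"
    and lz: "x \<in> V \<Longrightarrow> E (pl z x) x" and lng: "x \<in> V \<Longrightarrow> E (pl (ng x) x) z"
begin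

definition rep :: "'v \<Rightarrow> 'v" where "rep x = (SOME y. y \<in> V \<and> E x y)"

lemma rep: assumes "x \<in> V" shows "rep x \<in> V" "E x (rep x)" using someI[of "\<lambda>y. y \<in> V \<and> E x y" x] assms refl unfolding rep_def by auto

text \<open>The choice depends only on the predicate it is applied to, and equivalent elements have
  the same predicate by symmetry and transitivity.\<close>

lemma rep_eqI: assumes "x \<in> V" "y \<in> V" "E x y" shows "rep x = rep y"
proof -
  have "(\<lambda>w. w \<in> V \<and> E x w) = (\<lambda>w. w \<in> V \<and> E y w)" using assms sym trans by blast
  then show ?thesis unfolding rep_def by simp
qed

lemma rep_eq_iff: "\<lbrakk>x \<in> V; y \<in> V\<rbrakk> \<Longrightarrow> rep x = rep y \<longleftrightarrow> E x y" by (metis rep rep_eqI sym trans)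

lemma rep_rep: "x \<in> V \<Longrightarrow> rep (rep x) = rep x" by (metis rep rep_eqI)

lemma rep_pl: "\<lbrakk>x \<in> V; y \<in> V\<rbrakk> \<Longrightarrow> rep (pl (rep x) (rep y)) = rep (pl x y)" by (rule rep_eqI) (simp_all add: rep pl_closed pl_cong sym refl)

definition QM :: "('v \<Rightarrow> 'a \<Rightarrow> 'v) \<Rightarrow> ('a, 'v) rmodule" where
  "QM act = mk_rmodule (rep ` V) (\<lambda>x y. rep (pl x y)) (rep z) (\<lambda>x a. rep (act x a))"

lemma QM_group: "abelian_group (QM act)"
proof (rule abelian_groupI)
  fix x assume "x \<in> carrier (QM act)"
  then obtain u where u: "u \<in> V" "x = rep u" by (auto simp: QM_def)
  have "rep (pl (rep (ng u)) (rep u)) = rep z"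
    using u by (simp add: rep_pl ng_closed) (simp add: rep_eqI lng pl_closed z_closed ng_closed)
  then show "\<exists>y\<in>carrier (QM act). y \<oplus>[QM act] x = \<zero>[QM act]" using u by (auto simp: QM_def ng_closed intro!: bexI[of _ "ng u"])
qed (auto simp: QM_def rep_pl pl_closed z_closed rep rep_rep intro: rep_eqI,
   (metis rep_pl rep_rep assoc comm lz rep_eqI pl_closed z_closed)+)

end

locale setoid_module = setoid_group V pl z ng E + A?: ring A
  for V :: "'v set" and pl :: "'v \<Rightarrow> 'v \<Rightarrow> 'v" and z :: 'v and ng :: "'v \<Rightarrow> 'v" and E :: "'v \<Rightarrow> 'v \<Rightarrow> bool" and A :: "('a, 'x) ring_scheme" +
  fixes act :: "'v \<Rightarrow> 'a \<Rightarrow> 'v"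
  assumes act_closed: "\<lbrakk>x \<in> V; a \<in> carrier A\<rbrakk> \<Longrightarrow> act x a \<in> V" and act_cong: "\<lbrakk>x \<in> V; y \<in> V; a \<in> carrier A; E x y\<rbrakk> \<Longrightarrow> E (act x a) (act y a)"
    and act_pl: "\<lbrakk>x \<in> V; y \<in> V; a \<in> carrier A\<rbrakk> \<Longrightarrow> E (act (pl x y) a) (pl (act x a) (act y a))"
    and act_add: "\<lbrakk>x \<in> V; a \<in> carrier A; b \<in> carrier A\<rbrakk> \<Longrightarrow> E (act x (a \<oplus>[A] b)) (pl (act x a) (act x b))"
    and act_mult: "\<lbrakk>x \<in> V; a \<in> carrier A; b \<in> carrier A\<rbrakk> \<Longrightarrow> E (act x (a \<otimes>[A] b)) (act (act x a) b)" and act_one: "x \<in> V \<Longrightarrow> E (act x \<one>[A]) x"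
begin

lemma rep_act: "\<lbrakk>x \<in> V; a \<in> carrier A\<rbrakk> \<Longrightarrow> rep (act (rep x) a) = rep (act x a)"
  by (rule rep_eqI) (simp_all add: rep act_closed act_cong sym)

lemma QM_module: "right_module A (QM act)"
proof (rule right_moduleI'[OF A.ring_axioms QM_group])
  fix x y a assume "x \<in> carrier (QM act)" "y \<in> carrier (QM act)" and a: "a \<in> carrier A"
  then obtain u v where u: "u \<in> V" "x = rep u" and v: "v \<in> V" "y = rep v" by (auto simp: QM_def)
  have "rep (act (pl u v) a) = rep (pl (act u a) (act v a))" using u v a by (intro rep_eqI) (simp_all add: act_pl pl_closed act_closed)
  then show "ract (QM act) (x \<oplus>[QM act] y) a = ract (QM act) x a \<oplus>[QM act] ract (QM act) y a"
    using u v a by (simp add: QM_def rep_pl rep_act pl_closed act_closed)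
next
  fix x a b assume "x \<in> carrier (QM act)" and a: "a \<in> carrier A" "b \<in> carrier A"
  then obtain u where u: "u \<in> V" "x = rep u" by (auto simp: QM_def)
  have "rep (act u (a \<oplus>[A] b)) = rep (pl (act u a) (act u b))" "rep (act u (a \<otimes>[A] b)) = rep (act (act u a) b)"
    using u a by (auto intro!: rep_eqI simp: act_add act_mult pl_closed act_closed)
  then show "ract (QM act) x (a \<oplus>[A] b) = ract (QM act) x a \<oplus>[QM act] ract (QM act) x b"
    "ract (QM act) x (a \<otimes>[A] b) = ract (QM act) (ract (QM act) x a) b" using u a by (simp_all add: QM_def rep_pl rep_act act_closed)
next
  fix x assume "x \<in> carrier (QM act)"
  then obtain u where u: "u \<in> V" "x = rep u" by (auto simp: QM_def)
  then show "ract (QM act) x \<one>[A] = x" by (simp add: QM_def rep_act) (simp add: rep_eqI act_closed act_one)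
qed (auto simp: QM_def act_closed rep)

end

section \<open>K-projective resolutions\<close>

text \<open>Formal linear combinations of generators. \<open>Gen n c x\<close> stores its own
  boundary \<open>c\<close>, again a term, and its image \<open>x\<close>, so that the differential
  \<open>dt\<close> and the augmentation \<open>pit\<close> are recursions. Extension of scalars
  reuses the type with generators \<open>Gen 0 Zero x\<close>.\<close>

datatype ('a, 'u) tm = Gen int "('a, 'u) tm" 'u | Zero | Add "('a, 'u) tm" "('a, 'u) tm" | Neg "('a, 'u) tm"
  | Act "('a, 'u) tm" 'a

lemma embeds_tm:
  assumes "embeds TYPE('u \<times> 'u) TYPE('u)" "embeds TYPE('a) TYPE('u)" "embeds TYPE(nat) TYPE('u)"
  shows "embeds TYPE(('a, 'u) tm) TYPE('u)"
proof -
  obtain p0 :: "'u \<times> 'u \<Rightarrow> 'u" where p0: "inj p0" using assms by (auto simp: embeds_def)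
  obtain a :: "'a \<Rightarrow> 'u" where a: "inj a" using assms by (auto simp: embeds_def)
  obtain k :: "nat \<Rightarrow> 'u" where k: "inj k" using assms by (auto simp: embeds_def)
  define p where "p x y = p0 (x, y)" for x y
  have p: "p x y = p x' y' \<longleftrightarrow> x = x' \<and> y = y'" for x y x' y' by (simp add: p_def inj_eq[OF p0])
  \<comment> \<open>Each constructor gets its own tag, \<open>k 0\<close> to \<open>k 4\<close>, in
    front of its arguments; as pairing is injective, a term can be read off its code.\<close>
  define e where "e = rec_tm (\<lambda>n c x ec. p (k 0) (p (k (to_nat n)) (p ec x))) (p (k 1) (k 0))
    (\<lambda>s t es et. p (k 2) (p es et)) (\<lambda>t et. p (k 3) et) (\<lambda>t b et. p (k 4) (p et (a b)))"
  have "e s = e t \<Longrightarrow> s = t" for s t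
  proof (induction s arbitrary: t)
    case (Gen n c x)
    then show ?case by (cases t) (auto simp: e_def p inj_eq[OF k] inj_eq[OF a])
  next
    case Zero
    then show ?case by (cases t) (auto simp: e_def p inj_eq[OF k] inj_eq[OF a])
  next
    case (Add s1 s2)
    then show ?case by (cases t) (auto simp: e_def p inj_eq[OF k] inj_eq[OF a])
  next
    case (Neg s)
    then show ?case by (cases t) (auto simp: e_def p inj_eq[OF k] inj_eq[OF a])
  next
    case (Act s b)
    then show ?case by (cases t) (auto simp: e_def p inj_eq[OF k] inj_eq[OF a])
  qed
  then have "inj e" by (auto simp: inj_def)
  then show ?thesis by (rule embedsI)
qed

primrec dt :: "('a, 'u) tm \<Rightarrow> ('a, 'u) tm" where
  "dt (Gen n c x) = c" | "dt Zero = Zero" | "dt (Add s t) = Add (dt s) (dt t)"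
| "dt (Neg t) = Neg (dt t)" | "dt (Act t a) = Act (dt t) a"

primrec pit :: "('a, 'u) rmodule \<Rightarrow> ('a, 'u) tm \<Rightarrow> 'u" where
  "pit M (Gen n c x) = x" | "pit M Zero = \<zero>[M]" | "pit M (Add s t) = pit M s \<oplus>[M] pit M t"
| "pit M (Neg t) = \<ominus>[M] pit M t" | "pit M (Act t a) = ract M (pit M t) a"

text \<open>\<open>tm_val A X n t\<close>: the term \<open>t\<close> denotes an element of degree \<open>n\<close> of the semi-free resolution; \<open>tm_eq A X n s t\<close>: the
  terms denote the same element. A generator \<open>Gen n c x\<close> has differential \<open>c\<close> and image \<open>x\<close>; adding one
  for each cocycle \<open>c\<close> and each \<open>x\<close> compatible with it kills the cone of the map to \<open>X\<close>.\<close>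

inductive tm_val :: "('a, 'x) ring_scheme \<Rightarrow> ('a, 'u) rcpx \<Rightarrow> int \<Rightarrow> ('a, 'u) tm \<Rightarrow> bool"
  and tm_eq :: "('a, 'x) ring_scheme \<Rightarrow> ('a, 'u) rcpx \<Rightarrow> int \<Rightarrow> ('a, 'u) tm \<Rightarrow> ('a, 'u) tm \<Rightarrow> bool"
  for A X where
  V_Gen: "\<lbrakk>tm_val A X (n + 1) c; tm_eq A X (n + 2) (dt c) Zero; x \<in> el X n; pit (cob X (n + 1)) c = cdf X n x\<rbrakk> \<Longrightarrow> tm_val A X n (Gen n c x)"
| V_Zero: "tm_val A X n Zero"
| V_Add: "tm_val A X n s \<Longrightarrow> tm_val A X n t \<Longrightarrow> tm_val A X n (Add s t)"
| V_Neg: "tm_val A X n t \<Longrightarrow> tm_val A X n (Neg t)"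
| V_Act: "tm_val A X n t \<Longrightarrow> a \<in> carrier A \<Longrightarrow> tm_val A X n (Act t a)"
| Q_refl: "tm_val A X n t \<Longrightarrow> tm_eq A X n t t"
| Q_sym: "tm_eq A X n s t \<Longrightarrow> tm_eq A X n t s"
| Q_trans: "tm_eq A X n s t \<Longrightarrow> tm_eq A X n t r \<Longrightarrow> tm_eq A X n s r"
| Q_Add: "tm_eq A X n s t \<Longrightarrow> tm_eq A X n s' t' \<Longrightarrow> tm_eq A X n (Add s s') (Add t t')"
| Q_Neg: "tm_eq A X n s t \<Longrightarrow> tm_eq A X n (Neg s) (Neg t)"
| Q_Act: "tm_eq A X n s t \<Longrightarrow> a \<in> carrier A \<Longrightarrow> tm_eq A X n (Act s a) (Act t a)"
| Q_assoc: "\<lbrakk>tm_val A X n r; tm_val A X n s; tm_val A X n t\<rbrakk> \<Longrightarrow> tm_eq A X n (Add (Add r s) t) (Add r (Add s t))"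
| Q_comm: "\<lbrakk>tm_val A X n s; tm_val A X n t\<rbrakk> \<Longrightarrow> tm_eq A X n (Add s t) (Add t s)"
| Q_zero: "tm_val A X n t \<Longrightarrow> tm_eq A X n (Add Zero t) t"
| Q_neg: "tm_val A X n t \<Longrightarrow> tm_eq A X n (Add (Neg t) t) Zero"
| Q_act_add: "\<lbrakk>tm_val A X n s; tm_val A X n t; a \<in> carrier A\<rbrakk> \<Longrightarrow> tm_eq A X n (Act (Add s t) a) (Add (Act s a) (Act t a))"
| Q_add_act: "\<lbrakk>tm_val A X n t; a \<in> carrier A; b \<in> carrier A\<rbrakk> \<Longrightarrow> tm_eq A X n (Act t (a \<oplus>[A] b)) (Add (Act t a) (Act t b))"
| Q_act_mult: "\<lbrakk>tm_val A X n t; a \<in> carrier A; b \<in> carrier A\<rbrakk> \<Longrightarrow> tm_eq A X n (Act t (a \<otimes>[A] b)) (Act (Act t a) b)"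
| Q_act_one: "tm_val A X n t \<Longrightarrow> tm_eq A X n (Act t \<one>[A]) t"

lemmas V_intros = V_Zero V_Add V_Neg V_Act
lemmas Q_intros = Q_refl Q_Add Q_Neg Q_Act Q_assoc Q_comm Q_zero Q_neg Q_act_add Q_add_act Q_act_mult Q_act_one

locale resol = cpx_loc A X
  for A :: "('a, 'x) ring_scheme" and X :: "('a, 'u) rcpx"
begin

text \<open>The mutual induction asks for a claim about both predicates; the first one is filled
  with a trivial claim.\<close>

lemma V_Q_valid:
  "tm_val A X n t \<Longrightarrow> True"
  "tm_eq A X n s t \<Longrightarrow> tm_val A X n s \<and> tm_val A X n t" by (induction rule: tm_val_tm_eq.inducts) (auto intro: V_intros V_Gen)

lemma QV: "tm_eq A X n s t \<Longrightarrow> tm_val A X n s" "tm_eq A X n s t \<Longrightarrow> tm_val A X n t" using V_Q_valid(2) by simp_all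

text \<open>That zero times a ring element is zero is not among the rules; it follows from
  \<open>0 a = 0 a + 0 a\<close> by cancellation. These equations are what makes the square of the
  differential vanish on sums, negatives and multiples.\<close>

lemma Q_Zeros:
  "tm_eq A X n (Add Zero Zero) Zero" "tm_eq A X n (Neg Zero) Zero" "a \<in> carrier A \<Longrightarrow> tm_eq A X n (Act Zero a) Zero"
proof -
  show "tm_eq A X n (Add Zero Zero) Zero" by (intro Q_zero Q_comm Q_neg V_intros)
  have "tm_eq A X n (Neg Zero) (Add Zero (Neg Zero))" by (intro Q_sym[OF Q_zero] V_Neg V_Zero)
  moreover have "tm_eq A X n (Add Zero (Neg Zero)) (Add (Neg Zero) Zero)" by (intro Q_zero Q_comm Q_neg V_intros)
  moreover have "tm_eq A X n (Add (Neg Zero) Zero) Zero" by (intro Q_zero Q_comm Q_neg V_intros)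
  ultimately show "tm_eq A X n (Neg Zero) Zero" by (metis Q_trans)
  assume a: "a \<in> carrier A"
  let ?t = "Act Zero a"
  have t: "tm_val A X n ?t" by (intro V_intros a)
  have 1: "tm_eq A X n ?t (Add ?t ?t)" by (rule Q_trans[OF Q_sym[OF Q_Act[OF Q_zero[OF V_Zero] a]] Q_act_add[OF V_Zero V_Zero a]])
  have 2: "tm_eq A X n (Add (Neg ?t) ?t) (Add (Neg ?t) (Add ?t ?t))" by (intro Q_Add 1 Q_refl V_Neg t)
  have 3: "tm_eq A X n (Add (Neg ?t) (Add ?t ?t)) (Add (Add (Neg ?t) ?t) ?t)" by (intro Q_sym[OF Q_assoc] V_Neg t)
  have 4: "tm_eq A X n (Add (Add (Neg ?t) ?t) ?t) (Add Zero ?t)" by (intro Q_Add Q_neg Q_refl t)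
  have "tm_eq A X n (Add (Neg ?t) ?t) ?t" by (rule Q_trans[OF 2 Q_trans[OF 3 Q_trans[OF 4 Q_zero[OF t]]]])
  then show "tm_eq A X n ?t Zero" by (rule Q_trans[OF Q_sym Q_neg[OF t]])
qed

text \<open>The claims have to be proved together, since well-formedness and equality of terms are
  defined by mutual recursion. For generators they are the side conditions of \<open>V_Gen\<close>;
  all other constructors are handled by linearity.\<close>

lemma V_Q_d_pi:
  "tm_val A X n t \<Longrightarrow> tm_val A X (n + 1) (dt t) \<and> pit (cob X n) t \<in> el X n \<and> tm_eq A X (n + 2) (dt (dt t)) Zero \<and>
     pit (cob X (n + 1)) (dt t) = cdf X n (pit (cob X n) t)"
  "tm_eq A X n s t \<Longrightarrow> tm_eq A X (n + 1) (dt s) (dt t) \<and> pit (cob X n) s = pit (cob X n) t"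
proof (induction rule: tm_val_tm_eq.inducts)
  case (V_Add n s t)
  have "tm_eq A X (n + 2) (Add (dt (dt s)) (dt (dt t))) Zero" using V_Add.IH by (intro Q_trans[OF Q_Add Q_Zeros(1)]) auto
  with V_Add.IH show ?case by (auto intro: V_intros Q_intros simp: d_add)
next
  case (V_Neg n t)
  have "tm_eq A X (n + 2) (Neg (dt (dt t))) Zero" using V_Neg.IH by (intro Q_trans[OF Q_Neg Q_Zeros(2)]) auto
  with V_Neg.IH show ?case by (auto intro: V_intros Q_intros simp: d_neg)
next
  case (V_Act n t a)
  have "tm_eq A X (n + 2) (Act (dt (dt t)) a) Zero" using V_Act by (intro Q_trans[OF Q_Act Q_Zeros(3)]) auto
  with V_Act show ?case by (auto intro: V_intros Q_intros simp: rl_ract[OF d_lin] M.ract_closed)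
next
  case (Q_assoc n r s t)
  then show ?case by (auto intro: V_intros Q_intros simp: M.M.a_assoc)
next
  case (Q_comm n s t)
  then show ?case by (auto intro: V_intros Q_intros simp: M.M.a_comm)
next
  case (Q_trans n s t r)
  then show ?case by (auto intro: tm_val_tm_eq.Q_trans[of A X _ _ "dt t"])
next
  case (Q_sym n s t)
  then show ?case by (auto intro: tm_val_tm_eq.Q_sym)
qed (auto intro: V_intros Q_intros simp: d_zero M.M.l_neg M.ract_add_left M.ract_add_right M.ract_mult M.ract_one)

lemmas V_dt = conjunct1[OF V_Q_d_pi(1)]
lemmas V_pit = conjunct1[OF conjunct2[OF V_Q_d_pi(1)]]
lemmas V_dtdt = conjunct1[OF conjunct2[OF conjunct2[OF V_Q_d_pi(1)]]]
lemmas V_pit_dt = conjunct2[OF conjunct2[OF conjunct2[OF V_Q_d_pi(1)]]]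
lemmas Q_dt = conjunct1[OF V_Q_d_pi(2)]
lemmas Q_pit = conjunct2[OF V_Q_d_pi(2)]

end

sublocale resol \<subseteq> S: setoid_module "{t. tm_val A X n t}" Add Zero Neg "tm_eq A X n" A Act for n
  by unfold_locales (simp_all add: V_intros Q_intros, erule Q_sym, erule (1) Q_trans)

context resol
begin

definition P :: "('a, ('a, 'u) tm) rcpx" where
  "P = \<lparr>cob = (\<lambda>n. S.QM n Act), cdf = (\<lambda>n t. S.rep (n + 1) (dt t))\<rparr>"

lemma cob_P [simp]: "cob P n = S.QM n Act" and cdf_P [simp]: "cdf P n t = S.rep (n + 1) (dt t)" by (simp_all add: P_def)

lemma QM_simps:
  "carrier (S.QM n Act) = S.rep n ` {t. tm_val A X n t}"
  "\<zero>[S.QM n Act] = S.rep n Zero"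
  "s \<oplus>[S.QM n Act] t = S.rep n (Add s t)"
  "ract (S.QM n Act) t a = S.rep n (Act t a)" by (simp_all add: S.QM_def)

lemma rep_V: "tm_val A X n t \<Longrightarrow> tm_val A X n (S.rep n t)" and rep_Q: "tm_val A X n t \<Longrightarrow> tm_eq A X n t (S.rep n t)"
  using S.rep[of t n] by auto

lemma rep_iff: "tm_val A X n s \<Longrightarrow> tm_val A X n t \<Longrightarrow> S.rep n s = S.rep n t \<longleftrightarrow> tm_eq A X n s t" using S.rep_eq_iff[of s n t] by auto

lemma repI: "tm_eq A X n s t \<Longrightarrow> S.rep n s = S.rep n t" using rep_iff QV by auto

lemma P_elim: assumes "x \<in> el P n" shows "tm_val A X n x" "S.rep n x = x" using assms by (auto simp: QM_simps rep_V S.rep_rep)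

lemma P_I: "tm_val A X n t \<Longrightarrow> S.rep n t \<in> el P n" by (auto simp: QM_simps)

text \<open>\<open>dt\<close> acts on terms, whereas the elements of P are chosen representatives.
  Every operation is therefore followed by \<open>rep\<close>, and equations in P are reduced to
  \<open>tm_eq\<close> through \<open>repI\<close>.\<close>

lemma P_cpx: "is_cpx A P"
proof (rule is_cpxI)
  show "right_module A (cob P n)" for n using S.QM_module by simp
  show "rlinear A (cob P n) (cob P (n + 1)) (cdf P n)" for n
  proof (rule rlinearI)
    fix x y a assume x: "x \<in> el P n"
    note V = P_elim[OF x]
    show "cdf P n x \<in> el P (n + 1)" using P_I[OF V_dt[OF V(1)]] by simp
    have d: "tm_eq A X (n + 1) (dt x) (S.rep (n + 1) (dt x))" by (rule rep_Q[OF V_dt[OF V(1)]])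
    show "cdf P n (x \<oplus>[P,n] y) = cdf P n x \<oplus>[P,n + 1] cdf P n y" if y: "y \<in> el P n"
    proof -
      note W = P_elim[OF y]
      have "tm_eq A X (n + 1) (dt (Add x y)) (dt (S.rep n (Add x y)))" by (rule Q_dt[OF rep_Q]) (intro V_Add V W)
      moreover have "tm_eq A X (n + 1) (Add (dt x) (dt y)) (Add (S.rep (n + 1) (dt x)) (S.rep (n + 1) (dt y)))"
        by (intro Q_Add d rep_Q[OF V_dt[OF W(1)]])
      ultimately show ?thesis by (simp add: QM_simps) (rule repI, rule Q_trans[OF Q_sym])
    qed
    show "cdf P n (ract (cob P n) x a) = ract (cob P (n + 1)) (cdf P n x) a" if a: "a \<in> carrier A"
    proof -
      have "tm_eq A X (n + 1) (dt (Act x a)) (dt (S.rep n (Act x a)))" by (rule Q_dt[OF rep_Q]) (intro V_Act V a)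
      moreover have "tm_eq A X (n + 1) (Act (dt x) a) (Act (S.rep (n + 1) (dt x)) a)" by (intro Q_Act d a)
      ultimately show ?thesis by (simp add: QM_simps) (rule repI, rule Q_trans[OF Q_sym])
    qed
  qed
  fix n x assume "x \<in> el P n"
  note V = P_elim[OF this]
  have "tm_eq A X (n + 1 + 1) (dt (dt x)) (dt (S.rep (n + 1) (dt x)))" by (rule Q_dt[OF rep_Q[OF V_dt[OF V(1)]]])
  with V_dtdt[OF V(1)] have "tm_eq A X (n + 2) (dt (S.rep (n + 1) (dt x))) Zero" by (simp add: add.assoc) (rule Q_trans[OF Q_sym])
  from repI[OF this] show "cdf P (n + 1) (cdf P n x) = \<zero>[P,n + 2]" by (simp add: QM_simps add.assoc)
qed

definition pi :: "int \<Rightarrow> ('a, 'u) tm \<Rightarrow> 'u" where "pi n = pit (cob X n)"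

lemma pi_rep: "tm_val A X n t \<Longrightarrow> pi n (S.rep n t) = pi n t" using Q_pit[OF rep_Q] by (simp add: pi_def)

lemma pi_chain: "chain_map A P X pi"
proof (rule chain_mapI)
  show "rlinear A (cob P n) (cob X n) (pi n)" for n
  proof (rule rlinearI)
    fix x y a assume x: "x \<in> el P n"
    note V = P_elim[OF x]
    show "pi n x \<in> el X n" using V_pit[OF V(1)] by (simp add: pi_def)
    show "pi n (x \<oplus>[P,n] y) = pi n x \<oplus>[X,n] pi n y" if y: "y \<in> el P n"
      using pi_rep[OF V_Add[OF V(1) P_elim(1)[OF y]]] by (simp add: QM_simps) (simp add: pi_def)
    show "pi n (ract (cob P n) x a) = ract (cob X n) (pi n x) a" if a: "a \<in> carrier A"
      using pi_rep[OF V_Act[OF V(1) a]] by (simp add: QM_simps) (simp add: pi_def)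
  qed
  fix n x assume "x \<in> el P n"
  note V = P_elim[OF this]
  show "pi (n + 1) (cdf P n x) = cdf X n (pi n x)" using V_pit_dt[OF V(1)] pi_rep[OF V_dt[OF V(1)]] by (simp add: pi_def)
qed

text \<open>A cocycle y of X is hit by the generator with boundary \<open>Zero\<close> and image y.
  A cocycle z of P whose image is \<open>d x\<close> is bounded by the generator with boundary z and
  image x. Since generators may have terms containing further generators as boundary, the inductive
  definition replaces the usual countable sequence of attachments.\<close>

lemma pi_qi: "quasi_iso A P X pi"
proof (rule quasi_isoI[OF P_cpx cpx pi_chain])
  interpret P: cpx_loc A P by standard (rule P_cpx)
  fix n y assume y: "y \<in> cocycles X n"
  let ?g = "Gen n Zero y"
  have V: "tm_val A X n ?g" using y by (intro V_Gen V_Zero) (auto simp: cocycles_def intro: Q_refl V_Zero)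
  have "tm_eq A X (n + 1) (dt ?g) (dt (S.rep n ?g))" by (rule Q_dt[OF rep_Q[OF V]])
  from repI[OF this] have "S.rep n ?g \<in> cocycles P n" using P_I[OF V] by (simp add: cocycles_def QM_simps)
  moreover have "pi n (S.rep n ?g) \<ominus>[X,n] y = \<zero>[X,n]"
    using cocs_carrier[OF y] by (simp add: pi_rep[OF V]) (simp add: pi_def M.M.minus_eq_zero_iff)
  ultimately show "\<exists>z\<in>cocycles P n. pi n z \<ominus>[X,n] y \<in> coboundaries X n" using cobs_zero by (intro bexI[of _ "S.rep n ?g"]) simp_all
next
  fix n z assume z: "z \<in> cocycles P n" and b: "pi n z \<in> coboundaries X n"
  then have zc: "z \<in> el P n" and zd: "S.rep (n + 1) (dt z) = S.rep (n + 1) Zero" by (simp_all add: cocycles_def QM_simps)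
  note V = P_elim[OF zc]
  obtain x where x: "x \<in> el X (n - 1)" "pi n z = cdf X (n - 1) x" using b by (auto simp: coboundaries_def)
  let ?g = "Gen (n - 1) z x"
  have g: "tm_val A X (n - 1) ?g" using x V(1) zd rep_iff[OF V_dt[OF V(1)] V_Zero] by (intro V_Gen) (simp_all add: pi_def add.commute)
  have "tm_eq A X (n - 1 + 1) (dt (S.rep (n - 1) ?g)) (dt ?g)" by (rule Q_sym[OF Q_dt[OF rep_Q[OF g]]])
  from repI[OF this] have "z = cdf P (n - 1) (S.rep (n - 1) ?g)" using V(2) by simp
  then show "z \<in> coboundaries P n" unfolding coboundaries_def using P_I[OF g] by auto
qed

text \<open>The null-homotopy of a map \<open>f\<close> from the resolution to an acyclic complex \<open>N\<close>, by recursion on terms.\<close>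

primrec ht :: "('a, 'w) rcpx \<Rightarrow> (int \<Rightarrow> ('a, 'u) tm \<Rightarrow> 'w) \<Rightarrow> int \<Rightarrow> ('a, 'u) tm \<Rightarrow> 'w" where
  "ht N f n (Gen m c x) = (SOME y. y \<in> el N (n - 1) \<and>
     cdf N (n - 1) y = f n (S.rep n (Gen m c x)) \<ominus>[N,n] ht N f (n + 1) c)"
| "ht N f n Zero = \<zero>[N,n - 1]"
| "ht N f n (Add s t) = ht N f n s \<oplus>[N,n - 1] ht N f n t"
| "ht N f n (Neg t) = \<ominus>[N,n - 1] ht N f n t"
| "ht N f n (Act t a) = ract (cob N (n - 1)) (ht N f n t) a"

text \<open>The value of the homotopy on the boundary \<open>c\<close> of a generator
  \<open>g\<close> is available before that on \<open>g\<close>: \<open>f g - h c\<close> is then a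
  cocycle of N, and acyclicity supplies a value for \<open>h g\<close>. The remaining constructors
  are forced by linearity, and the simultaneous claim for \<open>tm_eq\<close> makes h well defined
  on representatives.\<close>

lemma P_null:
  fixes N :: "('a, 'w) rcpx"
  assumes N: "is_cpx A N" "acyclic_cpx N" and f: "chain_map A P N f"
  shows "homotopic A P N f (\<lambda>n x. \<zero>[N,n])"
proof -
  interpret P: cpx_loc A P by standard (rule P_cpx)
  interpret N: cpx_loc A N by standard fact
  let ?h = "ht N f"
  have frep: "f n (S.rep n (Add s t)) = f n (S.rep n s) \<oplus>[N,n] f n (S.rep n t)" if "tm_val A X n s" "tm_val A X n t" for n s t
    using rl_add[OF cm_lin[OF f] P_I[OF that(1)] P_I[OF that(2)]] S.rep_pl[of s n t] that by (simp add: QM_simps)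
  have frep_act: "f n (S.rep n (Act s a)) = ract (cob N n) (f n (S.rep n s)) a" if "tm_val A X n s" "a \<in> carrier A" for n s a
    using rl_ract[OF cm_lin[OF f] P_I[OF that(1)] that(2)] S.rep_act[of s n a] that by (simp add: QM_simps)
  have frep0: "f n (S.rep n Zero) = \<zero>[N,n]" for n using rl_zero[OF cm_lin[OF f, of n] P.grp N.grp] by (simp add: QM_simps)
  have fc: "f n (S.rep n s) \<in> el N n" if "tm_val A X n s" for n s by (rule cm_closed[OF f P_I[OF that]])
  have frep_neg: "f n (S.rep n (Neg s)) = \<ominus>[N,n] f n (S.rep n s)" if "tm_val A X n s" for n s
  proof -
    have "f n (S.rep n (Neg s)) \<oplus>[N,n] f n (S.rep n s) = \<zero>[N,n]" using frep[OF V_Neg[OF that] that] repI[OF Q_neg[OF that]] frep0 by simp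
    from N.M.M.minus_equality[OF this fc[OF that] fc[OF V_Neg[OF that]]] show ?thesis by simp
  qed
  have fd: "f (n + 1) (S.rep (n + 1) (dt s)) = cdf N n (f n (S.rep n s))" if "tm_val A X n s" for n s
    using cm_d[OF f P_I[OF that]] repI[OF Q_dt[OF rep_Q[OF that]]] by simp
  have main: "tm_val A X n t \<Longrightarrow> ?h n t \<in> el N (n - 1) \<and> ?h (n + 1) (dt t) \<in> el N n \<and>
      f n (S.rep n t) = cdf N (n - 1) (?h n t) \<oplus>[N,n] ?h (n + 1) (dt t)"
    "tm_eq A X n s t \<Longrightarrow> ?h n s = ?h n t \<and> ?h n t \<in> el N (n - 1)" for n s t
  proof (induction rule: tm_val_tm_eq.inducts)
    case (V_Gen n c x)
    let ?g = "Gen n c x"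
    have g: "tm_val A X n ?g" by (rule tm_val_tm_eq.V_Gen; fact)
    have hc: "?h (n + 1) c \<in> el N n" using V_Gen.IH by simp
    have eq: "n + 1 + 1 = n + 2" "n + 2 - 1 = n + 1" by simp_all
    \<comment> \<open>The condition of \<open>V_Gen\<close> that \<open>dt c\<close> equals
      \<open>Zero\<close> enters here: it reduces the homotopy equation at \<open>c\<close> to
      \<open>f c = d (h c)\<close>, which makes \<open>f g - h c\<close> a cocycle.\<close>
    have "?h (n + 2) (dt c) = ?h (n + 2) Zero" using V_Gen.IH by simp
    then have z: "?h (n + 1 + 1) (dt c) = \<zero>[N,n + 1]" by (simp only: eq ht.simps)
    have "cdf N n (?h (n + 1) c) = f (n + 1) (S.rep (n + 1) c)"
    proof -
      have "f (n + 1) (S.rep (n + 1) c) = cdf N n (?h (n + 1) c) \<oplus>[N,n + 1] ?h (n + 1 + 1) (dt c)" using V_Gen(2) by simp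
      then show ?thesis unfolding z using N.d_closed[OF hc] by simp
    qed
    then have "cdf N n (f n (S.rep n ?g) \<ominus>[N,n] ?h (n + 1) c) = \<zero>[N,n + 1]"
      using fd[OF g] N.d_closed[OF hc] by (simp add: N.d_minus fc[OF g] hc N.M.M.minus_eq_zero_iff)
    then have "f n (S.rep n ?g) \<ominus>[N,n] ?h (n + 1) c \<in> cocycles N n" using fc[OF g] hc by (simp add: cocycles_def)
    then have "f n (S.rep n ?g) \<ominus>[N,n] ?h (n + 1) c \<in> coboundaries N n" using N(2) by (simp add: acyclic_cpx_def)
    then have "\<exists>y. y \<in> el N (n - 1) \<and> cdf N (n - 1) y = f n (S.rep n ?g) \<ominus>[N,n] ?h (n + 1) c" by (auto simp: coboundaries_def)
    from someI_ex[OF this] have h: "?h n ?g \<in> el N (n - 1)"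
      "cdf N (n - 1) (?h n ?g) = f n (S.rep n ?g) \<ominus>[N,n] ?h (n + 1) c" by simp_all
    have "f n (S.rep n ?g) = (f n (S.rep n ?g) \<ominus>[N,n] ?h (n + 1) c) \<oplus>[N,n] ?h (n + 1) c" using fc[OF g] hc by algebra
    with h hc show ?case by simp
  next
    case (V_Zero n)
    show ?case by (simp add: frep0 N.d_zero')
  next
    case (V_Add n s t)
    then have c: "?h n s \<in> el N (n - 1)" "?h n t \<in> el N (n - 1)"
      "?h (n + 1) (dt s) \<in> el N n" "?h (n + 1) (dt t) \<in> el N n" by auto
    note d = N.d_closed'[OF c(1)] N.d_closed'[OF c(2)]
    have "f n (S.rep n (Add s t)) = (cdf N (n - 1) (?h n s) \<oplus>[N,n] ?h (n + 1) (dt s)) \<oplus>[N,n] (cdf N (n - 1) (?h n t) \<oplus>[N,n] ?h (n + 1) (dt t))"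
      using V_Add frep[OF V_Add(1,3)] by simp
    also have "\<dots> = (cdf N (n - 1) (?h n s) \<oplus>[N,n] cdf N (n - 1) (?h n t)) \<oplus>[N,n] (?h (n + 1) (dt s) \<oplus>[N,n] ?h (n + 1) (dt t))"
      using c d by algebra
    finally show ?case using c by (simp add: N.d_add')
  next
    case (V_Neg n t)
    then have c: "?h n t \<in> el N (n - 1)" "?h (n + 1) (dt t) \<in> el N n" by auto
    note d = N.d_closed'[OF c(1)]
    have "f n (S.rep n (Neg t)) = \<ominus>[N,n] (cdf N (n - 1) (?h n t) \<oplus>[N,n] ?h (n + 1) (dt t))" using V_Neg frep_neg[OF V_Neg(1)] by simp
    also have "\<dots> = \<ominus>[N,n] cdf N (n - 1) (?h n t) \<oplus>[N,n] \<ominus>[N,n] ?h (n + 1) (dt t)" using c d by algebra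
    finally show ?case using c by (simp add: N.d_neg')
  next
    case (V_Act n t a)
    then have c: "?h n t \<in> el N (n - 1)" "?h (n + 1) (dt t) \<in> el N n" by auto
    note d = N.d_closed'[OF c(1)]
    have "f n (S.rep n (Act t a)) = ract (cob N n) (cdf N (n - 1) (?h n t) \<oplus>[N,n] ?h (n + 1) (dt t)) a"
      using V_Act frep_act[OF V_Act(1,3)] by simp
    then show ?case using c d V_Act(3) by (simp add: N.M.ract_add_left N.M.ract_closed rl_ract[OF N.d_lin'])
  qed (auto simp: N.M.M.a_ac N.M.M.l_neg N.M.M.r_neg N.M.ract_add_left N.M.ract_add_right N.M.ract_mult N.M.ract_one N.M.ract_closed)
  note hV = conjunct1[OF main(1)] and hd = conjunct1[OF conjunct2[OF main(1)]] and he = conjunct2[OF conjunct2[OF main(1)]]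
  have hQ: "?h n s = ?h n t" if "tm_eq A X n s t" for n s t using main(2)[OF that] by simp
  have hrep: "?h n (S.rep n t) = ?h n t" if "tm_val A X n t" for n t by (rule hQ[OF Q_sym[OF rep_Q[OF that]]])
  show ?thesis
  proof (rule homotopicI[OF N(1) f cm_zero_map[OF N(1)] P_cpx])
    show "rlinear A (cob P n) (cob N (n - 1)) (?h n)" for n by (rule rlinearI) (auto simp: QM_simps hrep V_Add V_Act hV rep_V)
    fix n x assume "x \<in> el P n"
    note V = P_elim[OF this]
    show "f n x = \<zero>[N,n] \<oplus>[N,n] (cdf N (n - 1) (?h n x) \<oplus>[N,n] ?h (n + 1) (cdf P n x))"
      using he[OF V(1)] V(2) hrep[OF V_dt[OF V(1)]] N.d_closed'[OF hV[OF V(1)]] hd[OF V(1)] by simp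
  qed
qed

end

lemma K_projective_resolution:
  fixes X :: "('a, 'u) rcpx"
  assumes large: "large_universe TYPE('a) TYPE('u)" and X: "is_cpx A X"
  obtains P and s where "K_projective A (P :: ('a, 'u) rcpx)" "quasi_iso A P X s"
proof -
  interpret resol A X by unfold_locales fact
  have "embeds TYPE(('a, 'u) tm) TYPE('u)" by (intro embeds_tm universe_pair[OF large] universe_ring[OF large] universe_nat[OF large])
  then interpret enc_loc "TYPE(('a, 'u) tm)" "TYPE('u)" by (intro enc_loc.intro embeds_enc)
  let ?P = "enc_cpx P :: ('a, 'u) rcpx"
  have PP: "is_cpx A ?P" by (rule enc_cpx_cpx[OF P_cpx])
  have "homotopic A ?P N f (\<lambda>n x. \<zero>[N,n])"
    if N: "is_cpx A N" "acyclic_cpx N" and f: "chain_map A ?P N f" for N :: "('a, 'u) rcpx" and f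
  proof -
    have fe: "chain_map A P N (\<lambda>n x. f n (enc x))" by (rule cm_comp[OF enc_cm f])
    have z: "chain_map A P N (\<lambda>n x. \<zero>[N,n])" by (rule cm_zero_map[OF N(1)])
    have "homotopic A ?P N (\<lambda>n x. f n (enc (dec x :: ('a, 'u) tm))) (\<lambda>n x. \<zero>[N,n])"
      by (rule hmt_comp_right[OF P_null[OF N fe] P_cpx N(1) PP fe z dec_cm])
    moreover have "homotopic A ?P N f (\<lambda>n x. f n (enc (dec x :: ('a, 'u) tm)))" by (rule hmt_eqI[OF N(1) f cm_comp[OF dec_cm fe] PP]) auto
    ultimately show ?thesis by (rule hmt_trans[OF _ _ N(1) f cm_comp[OF dec_cm fe] cm_zero_map[OF N(1)] PP, rotated])
  qed
  then have "K_projective A ?P" using PP unfolding K_projective_def by blast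
  moreover have "quasi_iso A ?P X (\<lambda>n x. pi n (dec x))" by (rule qi_comp[OF PP P_cpx X dec_qi[OF P_cpx] pi_qi])
  ultimately show ?thesis by (rule that)
qed

section \<open>Restriction and extension of scalars\<close>

definition restr_mod :: "('a \<Rightarrow> 'b) \<Rightarrow> ('b, 'u) rmodule \<Rightarrow> ('a, 'u) rmodule" where
  "restr_mod p M = mk_rmodule (carrier M) (add M) \<zero>[M] (\<lambda>x a. ract M x (p a))"

lemma restr_mod_simps [simp]:
  "carrier (restr_mod p M) = carrier M" "add (restr_mod p M) = add M" "zero (restr_mod p M) = zero M"
  "ract (restr_mod p M) x a = ract M x (p a)" by (simp_all add: restr_mod_def)

lemma restr_mod_a_inv [simp]: "a_inv (restr_mod p M) = a_inv M" by (rule ext) (simp add: a_inv_def m_inv_def)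

lemma restr_mod_minus [simp]: "a_minus (restr_mod p M) = a_minus M" by (simp add: a_minus_def fun_eq_iff)

lemma restr_mod_module:
  assumes A: "ring A" and p: "p \<in> ring_hom A B" and M: "right_module B M"
  shows "right_module A (restr_mod p M)"
proof -
  interpret M: right_module B M by fact
  interpret A: ring A by fact
  have "abelian_group (restr_mod p M)" by (rule abelian_groupI) (auto simp: M.M.a_ac intro!: bexI[of _ "\<ominus>[M] _"] M.M.l_neg)
  then show ?thesis by (intro right_moduleI' A)
      (simp_all add: ring_hom_closed[OF p] ring_hom_add[OF p] ring_hom_mult[OF p] ring_hom_one[OF p] M.ract_closed
        M.ract_add_left M.ract_add_right M.ract_mult M.ract_one)
qed

lemma restr_rl:
  "p \<in> ring_hom A B \<Longrightarrow> rlinear B M N f \<Longrightarrow> rlinear A (restr_mod p M) (restr_mod p N) f" by (auto simp: rlinear_def ring_hom_closed)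

lemma restr_cpx_cob [simp]: "cob (restr_cpx p X) n = restr_mod p (cob X n)"
  and restr_cpx_cdf [simp]: "cdf (restr_cpx p X) = cdf X" by (simp_all add: restr_cpx_def restr_mod_def)

text \<open>Presentation of the tensor product of M with B over A. It is a partial equivalence
  relation: a term is well formed exactly when it is related to itself, so one predicate does the
  work of two. The last two rules make the map from x to \<open>Gen 0 Zero x\<close> linear over A,
  acting through p.\<close>

inductive TQ :: "('a, 'x) ring_scheme \<Rightarrow> ('b, 'y) ring_scheme \<Rightarrow> ('a \<Rightarrow> 'b) \<Rightarrow> ('a, 'u) rmodule \<Rightarrow> ('b, 'u) tm \<Rightarrow> ('b, 'u) tm \<Rightarrow> bool"
  for A B p M where
  T_Gen: "x \<in> carrier M \<Longrightarrow> TQ A B p M (Gen 0 Zero x) (Gen 0 Zero x)"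
| T_Zero: "TQ A B p M Zero Zero"
| T_sym: "TQ A B p M s t \<Longrightarrow> TQ A B p M t s"
| T_trans: "TQ A B p M s t \<Longrightarrow> TQ A B p M t r \<Longrightarrow> TQ A B p M s r"
| T_Add: "TQ A B p M s t \<Longrightarrow> TQ A B p M s' t' \<Longrightarrow> TQ A B p M (Add s s') (Add t t')"
| T_Neg: "TQ A B p M s t \<Longrightarrow> TQ A B p M (Neg s) (Neg t)"
| T_Act: "TQ A B p M s t \<Longrightarrow> b \<in> carrier B \<Longrightarrow> TQ A B p M (Act s b) (Act t b)"
| T_assoc: "\<lbrakk>TQ A B p M r r; TQ A B p M s s; TQ A B p M t t\<rbrakk> \<Longrightarrow> TQ A B p M (Add (Add r s) t) (Add r (Add s t))"
| T_comm: "\<lbrakk>TQ A B p M s s; TQ A B p M t t\<rbrakk> \<Longrightarrow> TQ A B p M (Add s t) (Add t s)"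
| T_zero: "TQ A B p M t t \<Longrightarrow> TQ A B p M (Add Zero t) t"
| T_neg: "TQ A B p M t t \<Longrightarrow> TQ A B p M (Add (Neg t) t) Zero"
| T_act_add: "\<lbrakk>TQ A B p M s s; TQ A B p M t t; b \<in> carrier B\<rbrakk> \<Longrightarrow> TQ A B p M (Act (Add s t) b) (Add (Act s b) (Act t b))"
| T_add_act: "\<lbrakk>TQ A B p M t t; b \<in> carrier B; c \<in> carrier B\<rbrakk> \<Longrightarrow> TQ A B p M (Act t (b \<oplus>[B] c)) (Add (Act t b) (Act t c))"
| T_act_mult: "\<lbrakk>TQ A B p M t t; b \<in> carrier B; c \<in> carrier B\<rbrakk> \<Longrightarrow> TQ A B p M (Act t (b \<otimes>[B] c)) (Act (Act t b) c)"
| T_act_one: "TQ A B p M t t \<Longrightarrow> TQ A B p M (Act t \<one>[B]) t"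
| T_gen_add: "\<lbrakk>x \<in> carrier M; y \<in> carrier M\<rbrakk> \<Longrightarrow> TQ A B p M (Gen 0 Zero (x \<oplus>[M] y)) (Add (Gen 0 Zero x) (Gen 0 Zero y))"
| T_gen_act: "\<lbrakk>x \<in> carrier M; a \<in> carrier A\<rbrakk> \<Longrightarrow> TQ A B p M (Gen 0 Zero (ract M x a)) (Act (Gen 0 Zero x) (p a))"

lemmas T_intros = T_Gen T_Zero T_Add T_Neg T_Act T_assoc T_comm T_zero T_neg T_act_add T_add_act T_act_mult T_act_one
  T_gen_add T_gen_act

primrec ev :: "('b, 'w) rmodule \<Rightarrow> ('u \<Rightarrow> 'w) \<Rightarrow> ('b, 'u) tm \<Rightarrow> 'w" where
  "ev N g (Gen n c x) = g x" | "ev N g Zero = \<zero>[N]" | "ev N g (Add s t) = ev N g s \<oplus>[N] ev N g t"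
| "ev N g (Neg t) = \<ominus>[N] ev N g t" | "ev N g (Act t b) = ract N (ev N g t) b"

text \<open>The universal property of extension of scalars, for targets with carrier in
  \<open>'u\<close>. Uniqueness is phrased at each point of the carrier because maps are total
  functions whose values elsewhere are arbitrary.\<close>

definition is_tensor :: "('a, 'x) ring_scheme \<Rightarrow> ('b, 'y) ring_scheme \<Rightarrow> ('a \<Rightarrow> 'b) \<Rightarrow> ('a, 'u) rmodule \<Rightarrow>
    ('b, 'u) rmodule \<Rightarrow> ('u \<Rightarrow> 'u) \<Rightarrow> bool" where
  "is_tensor A B p M T un \<longleftrightarrow> right_module B T \<and> rlinear A M (restr_mod p T) un \<and>
    (\<forall>(N :: ('b, 'u) rmodule) g. right_module B N \<longrightarrow> rlinear A M (restr_mod p N) g \<longrightarrow>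
      (\<exists>k. rlinear B T N k \<and> (\<forall>x \<in> carrier M. k (un x) = g x))) \<and>
    (\<forall>(N :: ('b, 'u) rmodule) k k' y. right_module B N \<longrightarrow> rlinear B T N k \<longrightarrow> rlinear B T N k' \<longrightarrow>
      (\<forall>x \<in> carrier M. k (un x) = k' (un x)) \<longrightarrow> y \<in> carrier T \<longrightarrow> k y = k' y)"

text \<open>Existence of the extension evaluates terms in the target, which respects all relations;
  uniqueness is an induction over them. The module of representatives consists of terms and is
  finally renamed into \<open>'u\<close>.\<close>

lemma tensor_module:
  fixes A :: "('a, 'x) ring_scheme" and B :: "('b, 'y) ring_scheme" and M :: "('a, 'u) rmodule"
  assumes large: "large_universe TYPE('b) TYPE('u)" and B: "ring B" and p: "p \<in> ring_hom A B" and M: "right_module A M"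
  shows "\<exists>T un. is_tensor A B p M T un"
proof -
  interpret M: right_module A M by fact
  interpret B: ring B by fact
  let ?Q = "TQ A B p M"
  have Qv: "?Q s t \<Longrightarrow> ?Q s s \<and> ?Q t t" for s t by (induction rule: TQ.induct)
      (auto intro: T_Gen T_Zero T_Add T_Neg T_Act simp: M.ract_closed ring_hom_closed[OF p])
  interpret S: setoid_module "{t. ?Q t t}" Add Zero Neg ?Q B Act
    by unfold_locales (simp_all add: T_intros, erule T_sym, erule (1) T_trans)
  have repI: "?Q s t \<Longrightarrow> S.rep s = S.rep t" for s t using S.rep_eqI[of s t] Qv[of s t] by simp
  have rep: "?Q t t \<Longrightarrow> ?Q t (S.rep t)" for t using S.rep[of t] by simp
  have "embeds TYPE(('b, 'u) tm) TYPE('u)" by (intro embeds_tm universe_pair[OF large] universe_ring[OF large] universe_nat[OF large])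
  then interpret enc_loc "TYPE(('b, 'u) tm)" "TYPE('u)" by (intro enc_loc.intro embeds_enc)
  let ?TT = "S.QM Act" and ?uu = "\<lambda>x. S.rep (Gen 0 Zero x)"
  have QM_simps:
    "carrier ?TT = S.rep ` {t. ?Q t t}" "\<zero>[?TT] = S.rep Zero"
    "s \<oplus>[?TT] t = S.rep (Add s t)" "ract ?TT t b = S.rep (Act t b)" for s t b by (simp_all add: S.QM_def)
  interpret T: right_module B ?TT by (rule S.QM_module)
  have elim: "?Q x x \<and> S.rep x = x" if "x \<in> carrier ?TT" for x
  proof -
    obtain t where t: "t \<in> {t. ?Q t t}" "x = S.rep t" using \<open>x \<in> carrier ?TT\<close> unfolding QM_simps by blast
    show ?thesis unfolding t(2) using S.rep(1)[OF t(1)] S.rep_rep[OF t(1)] by simp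
  qed
  have u0: "rlinear A M (restr_mod p ?TT) ?uu"
  proof (rule rlinearI)
    fix x y assume x: "x \<in> carrier M" and y: "y \<in> carrier M"
    have "?Q (Gen 0 Zero (x \<oplus>[M] y)) (Add (S.rep (Gen 0 Zero x)) (S.rep (Gen 0 Zero y)))"
      by (rule T_trans[OF T_gen_add[OF x y]]) (intro T_Add rep T_Gen x y)
    then show "?uu (x \<oplus>[M] y) = ?uu x \<oplus>[restr_mod p ?TT] ?uu y" using repI by (simp add: QM_simps)
  next
    fix x a assume x: "x \<in> carrier M" and a: "a \<in> carrier A"
    have "?Q (Gen 0 Zero (ract M x a)) (Act (S.rep (Gen 0 Zero x)) (p a))"
      by (rule T_trans[OF T_gen_act[OF x a]]) (intro T_Act rep T_Gen x ring_hom_closed[OF p a])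
    then show "?uu (ract M x a) = ract (restr_mod p ?TT) (?uu x) a" using repI by (simp add: QM_simps)
  qed (auto simp: QM_simps intro: T_Gen)
  let ?T = "enc_rmodule ?TT :: ('b, 'u) rmodule" and ?u = "\<lambda>x. enc (?uu x) :: 'u"
  show ?thesis unfolding is_tensor_def
  proof (rule exI[of _ ?T], rule exI[of _ ?u], intro conjI allI impI)
    show "right_module B ?T" by (rule enc_module[OF S.QM_module])
    show "rlinear A M (restr_mod p ?T) ?u" by (rule rl_comp[OF u0 restr_rl[OF p enc_rl]])
  next
    fix N :: "('b, 'u) rmodule" and g assume N: "right_module B N" and g: "rlinear A M (restr_mod p N) g"
    interpret N: right_module B N by fact
    have evQ: "?Q s t \<Longrightarrow> ev N g s \<in> carrier N \<and> ev N g t \<in> carrier N \<and> ev N g s = ev N g t" for s t by (induction rule: TQ.induct)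
        (use rl_closed[OF g] rl_add[OF g] rl_ract[OF g] in \<open>auto simp: N.M.a_ac N.M.l_neg N.M.r_neg N.ract_add_left N.ract_add_right N.ract_mult
          N.ract_one N.ract_closed M.ract_closed ring_hom_closed[OF p]\<close>)
    have evr: "ev N g (S.rep t) = ev N g t" if "?Q t t" for t using evQ[OF rep[OF that]] by simp
    have k: "rlinear B ?TT N (ev N g)"
    proof (rule rlinearI)
      fix x y b assume x: "x \<in> carrier ?TT"
      show "ev N g x \<in> carrier N" using evQ[of x x] elim[OF x] by simp
      show "ev N g (x \<oplus>[?TT] y) = ev N g x \<oplus>[N] ev N g y" if y: "y \<in> carrier ?TT"
        using elim[OF x] elim[OF y] by (simp add: QM_simps evr T_Add)
      show "ev N g (ract ?TT x b) = ract N (ev N g x) b" if "b \<in> carrier B" using elim[OF x] that by (simp add: QM_simps evr T_Act)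
    qed
    show "\<exists>k. rlinear B ?T N k \<and> (\<forall>x \<in> carrier M. k (?u x) = g x)"
      by (intro exI[of _ "\<lambda>x. ev N g (dec x)"] conjI rl_comp[OF dec_rl k]) (simp add: evr T_Gen)
  next
    fix N :: "('b, 'u) rmodule" and k k' y
    assume N: "right_module B N" and k: "rlinear B ?T N k" and k': "rlinear B ?T N k'"
      and eq: "\<forall>x \<in> carrier M. k (?u x) = k' (?u x)" and y: "y \<in> carrier ?T"
    interpret N: right_module B N by fact
    note l = rl_comp[OF enc_rl k] and l' = rl_comp[OF enc_rl k']
    have c: "S.rep t \<in> carrier ?TT" if "?Q t t" for t using that by (simp add: QM_simps)
    have rA: "S.rep (Add s t) = S.rep s \<oplus>[?TT] S.rep t" if "?Q s s" "?Q t t" for s t using S.rep_pl[of s t] that by (simp add: QM_simps)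
    have rN: "S.rep (Neg t) = \<ominus>[?TT] S.rep t" if "?Q t t" for t
    proof -
      have "S.rep (Neg t) \<oplus>[?TT] S.rep t = \<zero>[?TT]" using rA[OF T_Neg[OF that] that] repI[OF T_neg[OF that]] by (simp add: QM_simps)
      from T.M.minus_equality[OF this c[OF that] c[OF T_Neg[OF that]]] show ?thesis by simp
    qed
    have rZ: "S.rep Zero = \<zero>[?TT]" by (simp add: QM_simps)
    have rC: "S.rep (Act t b) = ract ?TT (S.rep t) b" if "?Q t t" "b \<in> carrier B" for t b
      using S.rep_act[of t b] that by (simp add: QM_simps)
    \<comment> \<open>The maps agree on generators by assumption; induction over the relation
      reaches every well-formed term, since such a term is related to itself.\<close>
    have "?Q s t \<Longrightarrow> k (enc (S.rep s)) = k' (enc (S.rep s)) \<and> k (enc (S.rep t)) = k' (enc (S.rep t))" for s t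
    proof (induction rule: TQ.induct)
    qed (use Qv in \<open>auto simp: eq rA rN rZ rC T_Add T_Neg T_Act T_Zero T_Gen M.ract_closed T.ract_closed c
        ring_hom_closed[OF p] rl_zero[OF l T.M.abelian_group_axioms N.M.abelian_group_axioms]
        rl_zero[OF l' T.M.abelian_group_axioms N.M.abelian_group_axioms]
        rl_neg[OF l T.M.abelian_group_axioms N.M.abelian_group_axioms]
        rl_neg[OF l' T.M.abelian_group_axioms N.M.abelian_group_axioms]
        rl_add[OF l] rl_add[OF l'] rl_ract[OF l] rl_ract[OF l']\<close>)
    note main = this
    obtain x where x: "x \<in> carrier ?TT" "y = enc x" using y by auto
    show "k y = k' y" using main[of x x] elim[OF x(1)] by (simp add: x(2))
  qed
qed

lemma restr_cpx_cpx:
  assumes "ring A" "p \<in> ring_hom A B" "is_cpx B X" shows "is_cpx A (restr_cpx p X)"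
  using assms(3) by (auto simp: is_cpx_def restr_mod_module[OF assms(1,2)] restr_rl[OF assms(2)])

lemma restr_cm: "p \<in> ring_hom A B \<Longrightarrow> chain_map B X Y f \<Longrightarrow> chain_map A (restr_cpx p X) (restr_cpx p Y) f"
  by (auto simp: chain_map_def restr_rl)

lemma restr_hmt: "p \<in> ring_hom A B \<Longrightarrow> homotopic B X Y f g \<Longrightarrow> homotopic A (restr_cpx p X) (restr_cpx p Y) f g"
  unfolding homotopic_def by (elim exE, rule exI) (auto simp: restr_rl)

lemma restr_cocs [simp]: "cocycles (restr_cpx p X) n = cocycles X n"
  and restr_coboundaries [simp]: "coboundaries (restr_cpx p X) n = coboundaries X n"
  and restr_acyclic [simp]: "acyclic_cpx (restr_cpx p X) = acyclic_cpx X" by (simp_all add: acyclic_cpx_def cocycles_def coboundaries_def)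

lemma restr_qi:
  assumes "ring A" "p \<in> ring_hom A B" "is_cpx B X" "is_cpx B Y" "quasi_iso B X Y f"
  shows "quasi_iso A (restr_cpx p X) (restr_cpx p Y) f" using assms(5) restr_cm[OF assms(2) qi_cm[OF assms(5)]]
  by (simp add: qi_iff[OF assms(3,4)] qi_iff[OF restr_cpx_cpx[OF assms(1-3)] restr_cpx_cpx[OF assms(1,2,4)]])

text \<open>Extension of scalars degree by degree. The differential, the extended chain maps and the
  extended homotopies come from existence in the universal property, and their equations from
  uniqueness, without looking at elements of the tensor product. The last clause is what transports
  K-projectivity.\<close>

lemma tensor_cpx:
  fixes A :: "('a, 'x) ring_scheme" and B :: "('b, 'y) ring_scheme" and P :: "('a, 'u) rcpx"
  assumes large: "large_universe TYPE('b) TYPE('u)" and B: "ring B" and p: "p \<in> ring_hom A B" and P: "is_cpx A P"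
  obtains Z :: "('b, 'u) rcpx" and un :: "('u, 'u) gmap"
  where "is_cpx B Z" "chain_map A P (restr_cpx p Z) un"
    "\<And>(Y :: ('b, 'u) rcpx) g. \<lbrakk>is_cpx B Y; chain_map A P (restr_cpx p Y) g\<rbrakk> \<Longrightarrow>
      \<exists>k. chain_map B Z Y k \<and> (\<forall>n. \<forall>x \<in> el P n. k n (un n x) = g n x)"
    "\<And>(Y :: ('b, 'u) rcpx) k k'. \<lbrakk>is_cpx B Y; chain_map B Z Y k; chain_map B Z Y k';
      homotopic A P (restr_cpx p Y) (\<lambda>n x. k n (un n x)) (\<lambda>n x. k' n (un n x))\<rbrakk> \<Longrightarrow> homotopic B Z Y k k'"
proof -
  interpret P: cpx_loc A P by standard fact
  have "\<exists>T un. is_tensor A B p (cob P n) T un" for n by (rule tensor_module[OF large B p P.M.right_module_axioms[of n]])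
  then obtain T un where ok: "\<And>n. is_tensor A B p (cob P n) (T n) (un n)" by metis
  have T: "right_module B (T n)" and un: "rlinear A (cob P n) (restr_mod p (T n)) (un n)"
    and ex: "\<And>(N :: ('b, 'u) rmodule) g. right_module B N \<Longrightarrow> rlinear A (cob P n) (restr_mod p N) g \<Longrightarrow>
      \<exists>k. rlinear B (T n) N k \<and> (\<forall>x \<in> el P n. k (un n x) = g x)"
    and uq: "\<And>(N :: ('b, 'u) rmodule) k k' y. \<lbrakk>right_module B N; rlinear B (T n) N k; rlinear B (T n) N k';
      \<forall>x \<in> el P n. k (un n x) = k' (un n x); y \<in> carrier (T n)\<rbrakk> \<Longrightarrow> k y = k' y" for n using ok[of n] unfolding is_tensor_def by blast+
  have "\<exists>k. rlinear B (T n) (T (n + 1)) k \<and> (\<forall>x \<in> el P n. k (un n x) = un (n + 1) (cdf P n x))" for n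
    by (rule ex[OF T rl_comp[OF P.d_lin un]])
  then obtain d where d: "\<And>n. rlinear B (T n) (T (n + 1)) (d n)"
    and du: "\<And>n x. x \<in> el P n \<Longrightarrow> d n (un n x) = un (n + 1) (cdf P n x)" by metis
  have grpT: "abelian_group (T n)" for n by (rule right_module_group[OF T])
  have ruz: "un n \<zero>[P,n] = \<zero>[T n]" for n using rl_zero[OF un P.grp right_module_group[OF restr_mod_module[OF P.ring_axioms p T]]] by simp
  define Z where "Z = \<lparr>cob = T, cdf = d\<rparr>"
  have Z [simp]: "cob Z n = T n" "cdf Z n = d n" for n by (simp_all add: Z_def)
  show ?thesis
  proof (rule that)
    show "is_cpx B Z"
    proof (rule is_cpxI)
      fix n x assume x: "x \<in> el Z n"
      have 2: "n + 1 + 1 = n + 2" by simp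
      \<comment> \<open>The square of the differential and the zero map agree on the image of P,
        hence everywhere.\<close>
      show "cdf Z (n + 1) (cdf Z n x) = \<zero>[Z,n + 2]"
        using uq[OF T rl_comp[OF d d[of "n + 1"]] rl_const_zero[OF T], where y=x] x by (simp add: du P.d_closed P.dd 2 ruz)
    qed (simp_all add: T d)
    show "chain_map A P (restr_cpx p Z) un" by (rule chain_mapI) (simp_all add: un du)
  next
    fix Y :: "('b, 'u) rcpx" and g assume Y: "is_cpx B Y" and g: "chain_map A P (restr_cpx p Y) g"
    interpret Y: cpx_loc B Y by standard fact
    have "\<exists>k. rlinear B (T n) (cob Y n) k \<and> (\<forall>x \<in> el P n. k (un n x) = g n x)" for n
    proof -
      have "rlinear A (cob P n) (restr_mod p (cob Y n)) (g n)" using cm_lin[OF g, of n] by simp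
      from ex[OF Y.M.right_module_axioms this] show ?thesis .
    qed
    then obtain k where k: "\<And>n. rlinear B (T n) (cob Y n) (k n)" and ku: "\<And>n x. x \<in> el P n \<Longrightarrow> k n (un n x) = g n x" by metis
    have "chain_map B Z Y k"
    proof (rule chain_mapI)
      fix n x assume x: "x \<in> el Z n"
      show "k (n + 1) (cdf Z n x) = cdf Y n (k n x)"
        using uq[OF Y.M.right_module_axioms rl_comp[OF d k] rl_comp[OF k Y.d_lin, of n], where y=x] x cm_d[OF g]
        by (simp add: du ku P.d_closed)
    qed (simp add: k)
    then show "\<exists>k. chain_map B Z Y k \<and> (\<forall>n. \<forall>x \<in> el P n. k n (un n x) = g n x)" using ku by blast
  next
    fix Y :: "('b, 'u) rcpx" and k k'
    assume Y: "is_cpx B Y" and k: "chain_map B Z Y k" and k': "chain_map B Z Y k'"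
      and hom: "homotopic A P (restr_cpx p Y) (\<lambda>n x. k n (un n x)) (\<lambda>n x. k' n (un n x))"
    interpret Y: cpx_loc B Y by standard fact
    obtain h where h: "\<And>n. rlinear A (cob P n) (restr_mod p (cob Y (n - 1))) (h n)"
      and e: "\<And>n x. x \<in> el P n \<Longrightarrow> k n (un n x) \<ominus>[Y,n] k' n (un n x) =
        cdf Y (n - 1) (h n x) \<oplus>[Y,n] h (n + 1) (cdf P n x)" using hom unfolding homotopic_def by auto
    have "\<exists>l. rlinear B (T n) (cob Y (n - 1)) l \<and> (\<forall>x \<in> el P n. l (un n x) = h n x)" for n by (rule ex[OF Y.M.right_module_axioms h])
    then obtain l where l: "\<And>n. rlinear B (T n) (cob Y (n - 1)) (l n)" and lu: "\<And>n x. x \<in> el P n \<Longrightarrow> l n (un n x) = h n x" by metis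
    have l': "rlinear B (T (n + 1)) (cob Y n) (l (n + 1))" for n using l[of "n + 1"] by simp
    have kl: "rlinear B (T n) (cob Y n) (k n)" "rlinear B (T n) (cob Y n) (k' n)" for n using cm_lin[OF k] cm_lin[OF k'] by simp_all
    have "k n x \<ominus>[Y,n] k' n x = cdf Y (n - 1) (l n x) \<oplus>[Y,n] l (n + 1) (d n x)" if x: "x \<in> carrier (T n)" for n x
      by (rule uq[OF Y.M.right_module_axioms rl_diff[OF Y.M.right_module_axioms kl]
          rl_plus[OF Y.M.right_module_axioms rl_comp[OF l Y.d_lin'] rl_comp[OF d l']] _ x]) (simp add: e du lu P.d_closed)
    then show "homotopic B Z Y k k'" unfolding homotopic_def using l by (intro exI[of _ l]) simp
  qed
qed

section \<open>Enough injective modules\<close>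

context abelian_group
begin

lemma zmul_closed: "x \<in> carrier G \<Longrightarrow> [(k :: int)] \<cdot> x \<in> carrier G"
  using group.int_pow_closed[OF a_group, of x k] by (simp add: add_pow_def)

lemma zmul_add: "x \<in> carrier G \<Longrightarrow> [(i + j :: int)] \<cdot> x = [i] \<cdot> x \<oplus> [j] \<cdot> x"
  using group.int_pow_mult[OF a_group, of x i j] by (simp add: add_pow_def)

lemma zmul_0: "[(0 :: int)] \<cdot> x = \<zero>" by (simp add: add_pow_def)

lemma zmul_1: "x \<in> carrier G \<Longrightarrow> [(1 :: int)] \<cdot> x = x" using group.int_pow_1[OF a_group, of x] by (simp add: add_pow_def)

lemma zmul_neg: "x \<in> carrier G \<Longrightarrow> [(- k :: int)] \<cdot> x = \<ominus> ([k] \<cdot> x)"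
  using group.int_pow_neg[OF a_group, of x k] by (simp add: add_pow_def a_inv_def)

lemma zmul_mult: "x \<in> carrier G \<Longrightarrow> [(i * j :: int)] \<cdot> x = [j] \<cdot> ([i] \<cdot> x)"
  using group.int_pow_pow[OF a_group, of x i j] by (simp add: add_pow_def)

lemma nmul: "[(int n)] \<cdot> x = [n] \<cdot> x" by (simp add: add_pow_def int_pow_int)

lemma nmul_Suc: "x \<in> carrier G \<Longrightarrow> [Suc n] \<cdot> x = [n] \<cdot> x \<oplus> x" by (simp add: add_pow_def)

lemma nmul_0: "[(0 :: nat)] \<cdot> x = \<zero>" by (simp add: add_pow_def)

end

definition divisible :: "('d, 'z) ring_scheme \<Rightarrow> bool" where
  "divisible D \<longleftrightarrow> (\<forall>x \<in> carrier D. \<forall>n > 0. \<exists>y \<in> carrier D. [(n :: nat)] \<cdot>\<^bsub>D\<^esub> y = x)"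

text \<open>The order of \<open>x\<close> modulo the domain of the partial homomorphism \<open>R\<close> prescribes which multiple
  of the value \<open>y\<close> at \<open>x\<close> is already determined.\<close>

lemma divisible_value:
  fixes G :: "('g, 'y) ring_scheme" (structure) and D :: "('d, 'z) ring_scheme"
  assumes G: "abelian_group G" and D: "abelian_group D" and div: "divisible D" and R: "R \<subseteq> carrier G \<times> carrier D" "(\<zero>, \<zero>[D]) \<in> R"
      "\<And>a b a' b'. \<lbrakk>(a, b) \<in> R; (a', b') \<in> R\<rbrakk> \<Longrightarrow> (a \<oplus> a', b \<oplus>[D] b') \<in> R"
      "\<And>a b. (a, b) \<in> R \<Longrightarrow> (\<ominus> a, \<ominus>[D] b) \<in> R"
      "\<And>d. (\<zero>, d) \<in> R \<Longrightarrow> d = \<zero>[D]" and x: "x \<in> carrier G"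
  shows "\<exists>y \<in> carrier D. \<forall>(k :: int) d. ([k] \<cdot> x, d) \<in> R \<longrightarrow> d = [k] \<cdot>\<^bsub>D\<^esub> y"
proof -
  interpret G: abelian_group G by fact
  interpret D: abelian_group D by fact
  have fn: "d = d'" if "(a, d) \<in> R" "(a, d') \<in> R" for a d d'
  proof -
    have c: "a \<in> carrier G" "d \<in> carrier D" "d' \<in> carrier D" using that R(1) by auto
    have "(a \<oplus> \<ominus> a, d \<oplus>[D] \<ominus>[D] d') \<in> R" by (intro R(3,4) that)
    then have "d \<ominus>[D] d' = \<zero>[D]" using R(5) c by (simp add: G.r_neg a_minus_def)
    then show ?thesis using c by (simp add: D.minus_eq_zero_iff)
  qed
  have Rz: "([k] \<cdot> a, [k] \<cdot>\<^bsub>D\<^esub> b) \<in> R" if ab: "(a, b) \<in> R" for a b and k :: int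
  proof -
    have c: "a \<in> carrier G" "b \<in> carrier D" using ab R(1) by auto
    have n: "([n] \<cdot> a, [n] \<cdot>\<^bsub>D\<^esub> b) \<in> R" for n :: nat by (induction n) (simp_all add: G.nmul_0 D.nmul_0 G.nmul_Suc D.nmul_Suc c R(2,3) ab)
    show ?thesis
    proof (cases k)
      case (nonneg m) then show ?thesis using n[of m] by (simp add: G.nmul D.nmul)
    next
      case (neg m)
      then show ?thesis using R(4)[OF n[of "Suc m"]] c by (simp del: of_nat_Suc add: G.nmul D.nmul G.zmul_neg D.zmul_neg)
    qed
  qed
  define ok where "ok k \<longleftrightarrow> (\<exists>d. ([k] \<cdot> x, d) \<in> R)" for k :: int
  show ?thesis
  \<comment> \<open>\<open>ok k\<close> says that the multiple \<open>k x\<close> already has a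
    value. If only \<open>k = 0\<close> does, there is no constraint on y and zero is taken.\<close>
  proof (cases "\<exists>n > 0. ok (int n)")
    case False
    have "k = 0" if "ok k" for k
    proof (rule ccontr)
      assume k: "k \<noteq> 0"
      have "ok (- k)" using that R(4) x unfolding ok_def by (metis G.zmul_neg)
      with that k False show False by (metis linorder_neqE_linordered_idom neg_0_less_iff_less of_nat_0_less_iff zero_less_imp_eq_int)
    qed
    then have "\<forall>(k :: int) d. ([k] \<cdot> x, d) \<in> R \<longrightarrow> d = [k] \<cdot>\<^bsub>D\<^esub> \<zero>[D]" using R(5) unfolding ok_def by (metis G.zmul_0 D.zmul_0)
    then show ?thesis by (rule bexI[OF _ D.zero_closed])
  next
    case True
    define n where "n = (LEAST n. n > 0 \<and> ok (int n))"
    have n: "n > 0" "ok (int n)" using LeastI_ex[OF True] unfolding n_def by auto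
    have least: "n \<le> m" if "m > 0" "ok (int m)" for m unfolding n_def by (rule Least_le) (use that in simp)
    obtain t where t: "([int n] \<cdot> x, t) \<in> R" using n by (auto simp: ok_def)
    then have tc: "t \<in> carrier D" using R(1) by auto
    \<comment> \<open>Divisibility enters here: \<open>n y\<close> has to be the value
      \<open>t\<close> already assigned to \<open>n x\<close>.\<close>
    obtain y where y: "y \<in> carrier D" "[n] \<cdot>\<^bsub>D\<^esub> y = t" using div n tc unfolding divisible_def by blast
    have "d = [k] \<cdot>\<^bsub>D\<^esub> y" if k: "([k] \<cdot> x, d) \<in> R" for k :: int and d
    proof -
      define q r where "q = k div int n" and "r = k mod int n"
      have kq: "k = int n * q + r" by (simp add: q_def r_def)
      have 1: "([(int n * q)] \<cdot> x, [q] \<cdot>\<^bsub>D\<^esub> t) \<in> R" using Rz[OF t, of q] by (simp add: G.zmul_mult x)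
      have "[k] \<cdot> x \<oplus> \<ominus> ([(int n * q)] \<cdot> x) = [r] \<cdot> x" using G.zmul_add[OF x, of k "- (int n * q)"] x kq by (simp add: G.zmul_neg)
      with R(3)[OF k R(4)[OF 1]] have "ok r" by (auto simp: ok_def)
      moreover have "r \<ge> 0" "r < int n" using n by (simp_all add: r_def)
      ultimately have "r = 0" using least[of "nat r"] by (cases "r = 0") auto
      then have k': "k = int n * q" using kq by simp
      have "d = [q] \<cdot>\<^bsub>D\<^esub> t" using fn[OF k] 1 by (simp add: k')
      then show ?thesis using y by (simp add: k' D.zmul_mult D.nmul)
    qed
    with y(1) show ?thesis by blast
  qed
qed

text \<open>Baer's argument by Zorn's lemma. Partial homomorphisms are represented by their graphs,
  which are subgroups of the product, so the union of a chain is again one; being single-valued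
  amounts to containing no \<open>(0, d)\<close> with \<open>d\<close> nonzero. A maximal one is
  total, because a pair \<open>(x, y)\<close> with y from \<open>divisible_value\<close> can always
  be adjoined.\<close>

lemma divisible_extension:
  fixes G :: "('g, 'y) ring_scheme" (structure) and D :: "('d, 'z) ring_scheme"
  assumes G: "abelian_group G" and D: "abelian_group D" and div: "divisible D"
    and H0: "H \<subseteq> carrier G" "\<zero> \<in> H" "\<forall>x \<in> H. \<forall>y \<in> H. x \<oplus> y \<in> H" "\<forall>x \<in> H. \<ominus> x \<in> H"
    and f0: "f \<in> H \<rightarrow> carrier D" "\<forall>x \<in> H. \<forall>y \<in> H. f (x \<oplus> y) = f x \<oplus>[D] f y"
  shows "\<exists>g. g \<in> carrier G \<rightarrow> carrier D \<and> (\<forall>x \<in> carrier G. \<forall>y \<in> carrier G. g (x \<oplus> y) = g x \<oplus>[D] g y) \<and>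
    (\<forall>x \<in> H. g x = f x)"
proof -
  have H: "H \<subseteq> carrier G" "\<zero> \<in> H" "\<And>x y. x \<in> H \<Longrightarrow> y \<in> H \<Longrightarrow> x \<oplus> y \<in> H" "\<And>x. x \<in> H \<Longrightarrow> \<ominus> x \<in> H"
    and f: "f \<in> H \<rightarrow> carrier D" "\<And>x y. x \<in> H \<Longrightarrow> y \<in> H \<Longrightarrow> f (x \<oplus> y) = f x \<oplus>[D] f y" using H0 f0 by auto
  interpret G: abelian_group G by fact
  interpret D: abelian_group D by fact
  define ok where "ok R \<longleftrightarrow> R \<subseteq> carrier G \<times> carrier D \<and> (\<zero>, \<zero>[D]) \<in> R \<and>
      (\<forall>a b a' b'. (a, b) \<in> R \<longrightarrow> (a', b') \<in> R \<longrightarrow> (a \<oplus> a', b \<oplus>[D] b') \<in> R) \<and>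
      (\<forall>a b. (a, b) \<in> R \<longrightarrow> (\<ominus> a, \<ominus>[D] b) \<in> R) \<and>
      (\<forall>d. (\<zero>, d) \<in> R \<longrightarrow> d = \<zero>[D]) \<and> (\<forall>x \<in> H. (x, f x) \<in> R)" for R
  have f0: "f \<zero> = \<zero>[D]" using f(2)[OF H(2) H(2)] f(1) H(2) D.add_self_imp_zero[of "f \<zero>"] by auto
  have fneg: "f (\<ominus> x) = \<ominus>[D] f x" if "x \<in> H" for x
  proof -
    have "f (\<ominus> x) \<oplus>[D] f x = \<zero>[D]" using f(2)[OF H(4)[OF that] that] f0 H(1) that by (simp add: G.l_neg subsetD)
    then show ?thesis using D.minus_equality[of "f (\<ominus> x)" "f x"] funcset_mem[OF f(1)] that H(4)[OF that] by simp
  qed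
  let ?S = "{R. ok R}"
  have "ok ((\<lambda>x. (x, f x)) ` H)" using H f f0 fneg unfolding ok_def by (auto simp: image_iff)
  then have ne: "?S \<noteq> {}" by blast
  have "\<Union>C \<in> ?S" if C: "C \<noteq> {}" "subset.chain ?S C" for C
  proof -
    have okC: "ok R" if "R \<in> C" for R using C(2) that by (auto simp: subset.chain_def)
    have two: "\<exists>R \<in> C. u \<in> R \<and> v \<in> R" if "u \<in> \<Union>C" "v \<in> \<Union>C" for u v using C(2) that unfolding subset.chain_def by blast
    obtain R0 where R0: "R0 \<in> C" using C(1) by blast
    have o: "R \<subseteq> carrier G \<times> carrier D" "(\<zero>, \<zero>[D]) \<in> R"
      "(a, b) \<in> R \<Longrightarrow> (a', b') \<in> R \<Longrightarrow> (a \<oplus> a', b \<oplus>[D] b') \<in> R"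
      "(a, b) \<in> R \<Longrightarrow> (\<ominus> a, \<ominus>[D] b) \<in> R" "(\<zero>, d) \<in> R \<Longrightarrow> d = \<zero>[D]" "x \<in> H \<Longrightarrow> (x, f x) \<in> R"
      if "R \<in> C" for R a b a' b' d x using okC[OF that] unfolding ok_def by blast+
    have "ok (\<Union>C)" unfolding ok_def
    proof (intro conjI allI impI ballI)
      show "\<Union>C \<subseteq> carrier G \<times> carrier D" using o(1) by (rule Union_least)
      show "(\<zero>, \<zero>[D]) \<in> \<Union>C" by (rule UnionI[OF R0 o(2)[OF R0]])
      show "(x, f x) \<in> \<Union>C" if "x \<in> H" for x by (rule UnionI[OF R0 o(6)[OF R0 that]])
    next
      fix a b a' b' assume "(a, b) \<in> \<Union>C" "(a', b') \<in> \<Union>C"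
      from two[OF this] obtain R where R: "R \<in> C" "(a, b) \<in> R" "(a', b') \<in> R" by blast
      show "(a \<oplus> a', b \<oplus>[D] b') \<in> \<Union>C" by (rule UnionI[OF R(1) o(3)[OF R]])
    next
      fix a b assume "(a, b) \<in> \<Union>C"
      then obtain R where R: "R \<in> C" "(a, b) \<in> R" by blast
      show "(\<ominus> a, \<ominus>[D] b) \<in> \<Union>C" by (rule UnionI[OF R(1) o(4)[OF R]])
    next
      fix d assume "(\<zero>, d) \<in> \<Union>C"
      then obtain R where R: "R \<in> C" "(\<zero>, d) \<in> R" by blast
      show "d = \<zero>[D]" by (rule o(5)[OF R])
    qed
    then show ?thesis by simp
  qed
  from subset_Zorn_nonempty[OF ne this] obtain R where okR: "ok R" and max: "\<And>R'. ok R' \<Longrightarrow> R \<subseteq> R' \<Longrightarrow> R' = R" by blast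
  have R: "R \<subseteq> carrier G \<times> carrier D" "(\<zero>, \<zero>[D]) \<in> R"
      "\<And>a b a' b'. (a, b) \<in> R \<Longrightarrow> (a', b') \<in> R \<Longrightarrow> (a \<oplus> a', b \<oplus>[D] b') \<in> R"
      "\<And>a b. (a, b) \<in> R \<Longrightarrow> (\<ominus> a, \<ominus>[D] b) \<in> R" "\<And>d. (\<zero>, d) \<in> R \<Longrightarrow> d = \<zero>[D]" "\<And>x. x \<in> H \<Longrightarrow> (x, f x) \<in> R" using okR unfolding ok_def by blast+
  have c: "a \<in> carrier G" "b \<in> carrier D" if "(a, b) \<in> R" for a b using that R(1) by auto
  have total: "\<exists>y. (x, y) \<in> R" if x: "x \<in> carrier G" for x
  proof -
    obtain y where y: "y \<in> carrier D" and yk: "\<And>(k :: int) d. ([k] \<cdot> x, d) \<in> R \<Longrightarrow> d = [k] \<cdot>\<^bsub>D\<^esub> y"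
      using divisible_value[OF G D div R(1-5) x] by blast
    \<comment> \<open>The subgroup generated by \<open>R\<close> and the pair
      \<open>(x, y)\<close>.\<close>
    define R' where "R' = {(a \<oplus> [k] \<cdot> x, b \<oplus>[D] [k] \<cdot>\<^bsub>D\<^esub> y) | a b (k :: int). (a, b) \<in> R}"
    have R'I: "(a \<oplus> [k] \<cdot> x, b \<oplus>[D] [k] \<cdot>\<^bsub>D\<^esub> y) \<in> R'" if "(a, b) \<in> R" for a b and k :: int using that unfolding R'_def by blast
    have R'E: "\<exists>a b (k :: int). (a, b) \<in> R \<and> u = a \<oplus> [k] \<cdot> x \<and> v = b \<oplus>[D] [k] \<cdot>\<^bsub>D\<^esub> y" if "(u, v) \<in> R'" for u v
      using that unfolding R'_def by blast
    have sub: "R \<subseteq> R'"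
    proof
      fix z assume z: "z \<in> R"
      show "z \<in> R'" using R'I[of "fst z" "snd z" 0] z c[of "fst z" "snd z"] by (simp add: G.zmul_0 D.zmul_0)
    qed
    have "ok R'" unfolding ok_def
    proof (intro conjI allI impI ballI)
      show "R' \<subseteq> carrier G \<times> carrier D" unfolding R'_def using c x y by (auto simp: G.zmul_closed D.zmul_closed)
      show "(\<zero>, \<zero>[D]) \<in> R'" using sub R(2) by auto
      show "(z, f z) \<in> R'" if "z \<in> H" for z using sub R(6)[OF that] by auto
    next
      fix u v u' v' assume "(u, v) \<in> R'" "(u', v') \<in> R'"
      then obtain a b a' b' and k k' :: int where ab: "(a, b) \<in> R" "(a', b') \<in> R"
        and e: "u = a \<oplus> [k] \<cdot> x" "v = b \<oplus>[D] [k] \<cdot>\<^bsub>D\<^esub> y" "u' = a' \<oplus> [k'] \<cdot> x" "v' = b' \<oplus>[D] [k'] \<cdot>\<^bsub>D\<^esub> y"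
        using R'E[of u v] R'E[of u' v'] by blast
      note cc = c[OF ab(1)] c[OF ab(2)] G.zmul_closed[OF x] D.zmul_closed[OF y]
      have "u \<oplus> u' = (a \<oplus> a') \<oplus> [(k + k')] \<cdot> x" "v \<oplus>[D] v' = (b \<oplus>[D] b') \<oplus>[D] [(k + k')] \<cdot>\<^bsub>D\<^esub> y"
        unfolding e G.zmul_add[OF x] D.zmul_add[OF y] using cc by (simp_all add: G.a_ac D.a_ac)
      then show "(u \<oplus> u', v \<oplus>[D] v') \<in> R'" using R'I[OF R(3)[OF ab], of "k + k'"] by simp
    next
      fix u v assume "(u, v) \<in> R'"
      then obtain a b and k :: int where ab: "(a, b) \<in> R" and e: "u = a \<oplus> [k] \<cdot> x" "v = b \<oplus>[D] [k] \<cdot>\<^bsub>D\<^esub> y" using R'E[of u v] by blast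
      have "\<ominus> u = \<ominus> a \<oplus> [(- k)] \<cdot> x" "\<ominus>[D] v = \<ominus>[D] b \<oplus>[D] [(- k)] \<cdot>\<^bsub>D\<^esub> y"
        unfolding e G.zmul_neg[OF x] D.zmul_neg[OF y] using c[OF ab] G.zmul_closed[OF x] D.zmul_closed[OF y]
        by (simp_all add: G.minus_add D.minus_add)
      then show "(\<ominus> u, \<ominus>[D] v) \<in> R'" using R'I[OF R(4)[OF ab], of "- k"] by simp
    next
      fix d assume "(\<zero>, d) \<in> R'"
      then obtain a b and k :: int where ab: "(a, b) \<in> R" and e: "\<zero> = a \<oplus> [k] \<cdot> x" "d = b \<oplus>[D] [k] \<cdot>\<^bsub>D\<^esub> y" using R'E[of "\<zero>" d] by blast
      \<comment> \<open>If \<open>a + k x = 0\<close>, then R assigns \<open>- b\<close> to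
        \<open>k x\<close>; the choice of y forces \<open>- b = k y\<close>, so the new value at
        zero is \<open>b + k y = 0\<close>.\<close>
      have "\<ominus> a = [k] \<cdot> x" using G.minus_equality[of "[k] \<cdot> x" a] e(1) c[OF ab] G.zmul_closed[OF x] by (simp add: G.a_comm)
      then have "([k] \<cdot> x, \<ominus>[D] b) \<in> R" using R(4)[OF ab] by simp
      from yk[OF this] show "d = \<zero>[D]" unfolding e(2) using c[OF ab] by (metis D.r_neg)
    qed
    then have "R' = R" using max sub by blast
    moreover have "(\<zero> \<oplus> [(1 :: int)] \<cdot> x, \<zero>[D] \<oplus>[D] [(1 :: int)] \<cdot>\<^bsub>D\<^esub> y) \<in> R'" by (rule R'I[OF R(2)])
    ultimately show ?thesis using x y by (auto simp: G.zmul_1 D.zmul_1)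
  qed
  have fn: "d = d'" if "(a, d) \<in> R" "(a, d') \<in> R" for a d d'
  proof -
    have "(a \<oplus> \<ominus> a, d \<oplus>[D] \<ominus>[D] d') \<in> R" by (intro R(3,4) that)
    then have "d \<ominus>[D] d' = \<zero>[D]" using R(5) c that by (simp add: G.r_neg a_minus_def)
    then show ?thesis using c that by (simp add: D.minus_eq_zero_iff)
  qed
  define g where "g x = (THE y. (x, y) \<in> R)" for x
  have g: "(x, g x) \<in> R" if x: "x \<in> carrier G" for x
  proof -
    obtain y where y: "(x, y) \<in> R" using total[OF x] by blast
    show ?thesis unfolding g_def by (rule theI[of _ y]) (use y fn in auto)
  qed
  show ?thesis
  proof (intro exI[of _ g] conjI ballI)
    show "g \<in> carrier G \<rightarrow> carrier D" using c(2)[OF g] by auto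
    show "g (x \<oplus> y) = g x \<oplus>[D] g y" if "x \<in> carrier G" "y \<in> carrier G" for x y
      using fn[OF g R(3)[OF g[OF that(1)] g[OF that(2)]]] that by simp
    show "g x = f x" if "x \<in> H" for x using fn[OF g R(6)[OF that]] that H(1) by auto
  qed
qed

text \<open>Formal sums \<open>\<Sum> q\<^sub>i m\<^sub>i\<close> with rational coefficients are lists of pairs \<open>(q\<^sub>i, m\<^sub>i)\<close>; modulo the integral
  ones whose value lies in \<open>S\<close> they form a divisible group containing \<open>M / S\<close>.\<close>

definition cf :: "(rat \<times> 'u) list \<Rightarrow> 'u \<Rightarrow> rat" where
  "cf L m = sum_list (map (\<lambda>(q, x). if x = m then q else 0) L)"

lemma cf_simps [simp]: "cf [] m = 0" "cf ((q, x) # L) m = (if x = m then q else 0) + cf L m" "cf (L @ L') m = cf L m + cf L' m"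
  by (simp_all add: cf_def)

lemma cf_scale [simp]: "cf (map (\<lambda>(q, x). (r * q, x)) L) m = r * cf L m" by (induction L) (auto simp: algebra_simps)

lemma cf_neg [simp]: "cf (map (\<lambda>(q, x). (- q, x)) L) m = - cf L m" by (induction L) auto

context abelian_group
begin

text \<open>Evaluation of an integral combination as a relation: the coefficients \<open>f\<close>
  are integers and the combination has value \<open>v\<close>. The support is only bounded by some
  finite F, so two coefficient functions can be compared over a common F.\<close>

definition kr :: "('a \<Rightarrow> rat) \<Rightarrow> 'a \<Rightarrow> bool" where
  "kr f v \<longleftrightarrow> (\<forall>m. f m \<in> \<int>) \<and> (\<exists>F. finite F \<and> F \<subseteq> carrier G \<and> (\<forall>m. m \<notin> F \<longrightarrow> f m = 0) \<and> v = (\<Oplus>m\<in>F. [\<lfloor>f m\<rfloor>] \<cdot> m))"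

lemma kr_finsum:
  assumes "finite F" "F \<subseteq> carrier G" "finite F'" "F' \<subseteq> carrier G" "F \<subseteq> F'" "\<And>m. m \<notin> F \<Longrightarrow> f m = (0 :: rat)"
  shows "(\<Oplus>m\<in>F. [\<lfloor>f m\<rfloor>] \<cdot> m) = (\<Oplus>m\<in>F'. [\<lfloor>f m\<rfloor>] \<cdot> m)"
  by (rule add.finprod_mono_neutral_cong_left) (use assms in \<open>auto simp: zmul_0 zmul_closed\<close>)

lemma kr_unique: "kr f v \<Longrightarrow> kr f w \<Longrightarrow> v = w"
proof -
  assume "kr f v" "kr f w"
  then obtain F F' where F: "finite F" "F \<subseteq> carrier G" "\<And>m. m \<notin> F \<Longrightarrow> f m = 0" "v = (\<Oplus>m\<in>F. [\<lfloor>f m\<rfloor>] \<cdot> m)"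
    and F': "finite F'" "F' \<subseteq> carrier G" "\<And>m. m \<notin> F' \<Longrightarrow> f m = 0" "w = (\<Oplus>m\<in>F'. [\<lfloor>f m\<rfloor>] \<cdot> m)" unfolding kr_def by blast
  show "v = w" unfolding F(4) F'(4) using kr_finsum[of F "F \<union> F'" f] kr_finsum[of F' "F \<union> F'" f] F(1-3) F'(1-3) by simp
qed

lemma kr_add: "kr f v \<Longrightarrow> kr g w \<Longrightarrow> kr (\<lambda>m. f m + g m) (v \<oplus> w)"
proof -
  assume "kr f v" "kr g w"
  then obtain F F' where F: "finite F" "F \<subseteq> carrier G" "\<And>m. m \<notin> F \<Longrightarrow> f m = 0" "v = (\<Oplus>m\<in>F. [\<lfloor>f m\<rfloor>] \<cdot> m)"
    and F': "finite F'" "F' \<subseteq> carrier G" "\<And>m. m \<notin> F' \<Longrightarrow> g m = 0" "w = (\<Oplus>m\<in>F'. [\<lfloor>g m\<rfloor>] \<cdot> m)"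
    and i: "\<And>m. f m \<in> \<int>" "\<And>m. g m \<in> \<int>" unfolding kr_def by blast
  let ?F = "F \<union> F'"
  have fl: "\<lfloor>f m + g m\<rfloor> = \<lfloor>f m\<rfloor> + \<lfloor>g m\<rfloor>" for m using i(1)[of m] by (auto elim!: Ints_cases)
  have c: "m \<in> ?F \<Longrightarrow> m \<in> carrier G" for m using F F' by blast
  have "v \<oplus> w = (\<Oplus>m\<in>?F. [\<lfloor>f m\<rfloor>] \<cdot> m) \<oplus> (\<Oplus>m\<in>?F. [\<lfloor>g m\<rfloor>] \<cdot> m)"
    unfolding F(4) F'(4) using kr_finsum[of F ?F f] kr_finsum[of F' ?F g] F(1-3) F'(1-3) by simp
  also have "\<dots> = (\<Oplus>m\<in>?F. [\<lfloor>f m\<rfloor>] \<cdot> m \<oplus> [\<lfloor>g m\<rfloor>] \<cdot> m)" by (rule finsum_addf[symmetric]) (use c in \<open>auto simp: zmul_closed\<close>)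
  also have "\<dots> = (\<Oplus>m\<in>?F. [\<lfloor>f m + g m\<rfloor>] \<cdot> m)" by (rule finsum_cong') (use c in \<open>auto simp: zmul_closed fl zmul_add\<close>)
  finally show ?thesis unfolding kr_def using F(1-3) F'(1-3) i by (intro conjI allI exI[of _ ?F]) auto
qed

lemma kr_0: "(\<And>m. f m = 0) \<Longrightarrow> kr f \<zero>" unfolding kr_def by (intro conjI allI exI[of _ "{}"]) auto

lemma kr_single: "x \<in> carrier G \<Longrightarrow> kr (\<lambda>m. if x = m then of_int k else 0) ([k] \<cdot> x)"
  unfolding kr_def by (intro conjI allI exI[of _ "{x}"]) (auto simp: zmul_closed)

lemma kr_closed: "kr f v \<Longrightarrow> v \<in> carrier G" unfolding kr_def by (auto intro!: finsum_closed simp: zmul_closed subsetD)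

lemma kr_neg: assumes "kr f v" shows "kr (\<lambda>m. - f m) (\<ominus> v)"
proof -
  obtain F where F: "finite F" "F \<subseteq> carrier G" "\<And>m. m \<notin> F \<Longrightarrow> f m = 0" "v = (\<Oplus>m\<in>F. [\<lfloor>f m\<rfloor>] \<cdot> m)" and i: "\<And>m. f m \<in> \<int>"
    using assms unfolding kr_def by blast
  have "kr (\<lambda>m. - f m) (\<Oplus>m\<in>F. [\<lfloor>- f m\<rfloor>] \<cdot> m)" unfolding kr_def using F i by (intro conjI allI exI[of _ F]) auto
  from kr_add[OF this assms] have "(\<Oplus>m\<in>F. [\<lfloor>- f m\<rfloor>] \<cdot> m) \<oplus> v = \<zero>" using kr_unique[OF _ kr_0] by simp
  then have "\<ominus> v = (\<Oplus>m\<in>F. [\<lfloor>- f m\<rfloor>] \<cdot> m)" using kr_closed[OF assms] kr_closed[OF \<open>kr (\<lambda>m. - f m) _\<close>] by (rule minus_equality)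
  with \<open>kr (\<lambda>m. - f m) _\<close> show ?thesis by simp
qed

end

text \<open>The group is the rational vector space on the elements of M modulo the integral
  combinations with value in S. As a quotient of a rational vector space it is divisible. An element
  x of M dies exactly when it lies in S, because \<open>1 x\<close> is an integral combination and
  its value is unique. The action of \<open>unit\<close> is a dummy that allows \<open>QM\<close> to
  be reused.\<close>

lemma divisible_hull:
  fixes M :: "('u, 'z) ring_scheme"
  assumes M: "abelian_group M" and S0: "S \<subseteq> carrier M" "\<zero>[M] \<in> S" "\<forall>x \<in> S. \<forall>y \<in> S. x \<oplus>[M] y \<in> S"
    "\<forall>x \<in> S. \<ominus>[M] x \<in> S"
  obtains D :: "(unit, (rat \<times> 'u) list) rmodule" and i :: "'u \<Rightarrow> (rat \<times> 'u) list"
  where "abelian_group D" "divisible D" "\<And>x. x \<in> carrier M \<Longrightarrow> i x \<in> carrier D"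
    "\<And>x y. x \<in> carrier M \<Longrightarrow> y \<in> carrier M \<Longrightarrow> i (x \<oplus>[M] y) = i x \<oplus>[D] i y"
    "\<And>x. x \<in> carrier M \<Longrightarrow> i x = \<zero>[D] \<longleftrightarrow> x \<in> S"
proof -
  interpret M: abelian_group M by fact
  have S: "S \<subseteq> carrier M" "\<zero>[M] \<in> S" "\<And>x y. x \<in> S \<Longrightarrow> y \<in> S \<Longrightarrow> x \<oplus>[M] y \<in> S"
    "\<And>x. x \<in> S \<Longrightarrow> \<ominus>[M] x \<in> S" using S0 by auto
  define E where "E L L' \<longleftrightarrow> (\<exists>v \<in> S. M.kr (\<lambda>m. cf L m - cf L' m) v)" for L L'
  have EI: "E L L'" if "\<And>m. cf L m = cf L' m" for L L' unfolding E_def using M.kr_0[of "\<lambda>m. cf L m - cf L' m"] that S(2) by auto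
  let ?V = "{L. snd ` set L \<subseteq> carrier M}"
  interpret Q: setoid_group ?V "(@)" "[]" "map (\<lambda>(q, x). (- 1 * q, x))" E
  proof
    fix L L' L'' K K'
    show "E L L" by (rule EI) simp
    show "E L' L" if h: "E L L'"
    proof -
      obtain v where v: "v \<in> S" "M.kr (\<lambda>m. cf L m - cf L' m) v" using h unfolding E_def by blast
      from M.kr_neg[OF v(2)] S(4)[OF v(1)] show ?thesis unfolding E_def by auto
    qed
    show "E L L''" if h: "E L L'" "E L' L''"
    proof -
      obtain v w where v: "v \<in> S" "M.kr (\<lambda>m. cf L m - cf L' m) v" "w \<in> S" "M.kr (\<lambda>m. cf L' m - cf L'' m) w"
        using h unfolding E_def by blast
      from M.kr_add[OF v(2,4)] S(3)[OF v(1,3)] show ?thesis unfolding E_def by auto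
    qed
    show "E (L @ L') (K @ K')" if h: "E L K" "E L' K'"
    proof -
      obtain v w where v: "v \<in> S" "M.kr (\<lambda>m. cf L m - cf K m) v" "w \<in> S" "M.kr (\<lambda>m. cf L' m - cf K' m) w" using h unfolding E_def by blast
      from M.kr_add[OF v(2,4)] S(3)[OF v(1,3)] show ?thesis unfolding E_def by (auto simp: algebra_simps)
    qed
  qed (auto intro!: EI)
  let ?D = "Q.QM (\<lambda>L (_ :: unit). L)" and ?i = "\<lambda>x. Q.rep [(1, x)]"
  have D: "abelian_group ?D" by (rule Q.QM_group)
  interpret D: abelian_group ?D by (rule D)
  have simps: "carrier ?D = Q.rep ` ?V" "\<zero>[?D] = Q.rep []" "L \<oplus>[?D] L' = Q.rep (L @ L')" for L L' by (simp_all add: Q.QM_def)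
  show ?thesis
  proof (rule that[OF D])
    \<comment> \<open>Multiplying by n scales every coefficient by n; scaling by
      \<open>1 / n\<close> beforehand then solves the divisibility equation.\<close>
    have nm: "[n] \<cdot>\<^bsub>?D\<^esub> Q.rep L = Q.rep (map (\<lambda>(q, x). (of_nat n * q, x)) L)" if L: "L \<in> ?V" for n :: nat and L
    proof (induction n)
      let ?s = "\<lambda>r. map (\<lambda>(q, x). (r * q, x)) L"
      have s: "?s r \<in> ?V" for r :: rat using L by force
      case 0
      have "Q.rep [] = Q.rep (map (\<lambda>(q, x). (0 * q, x)) L)" by (rule Q.rep_eqI[OF Q.z_closed s EI]) (simp only: cf_scale, simp)
      then show ?case by (simp add: D.nmul_0 simps(2))
    next
      case (Suc n)
      let ?s = "\<lambda>r. map (\<lambda>(q, x). (r * q, x)) L"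
      have s: "?s r \<in> ?V" for r :: rat using L by force
      have "[Suc n] \<cdot>\<^bsub>?D\<^esub> Q.rep L = Q.rep (?s (of_nat n)) \<oplus>[?D] Q.rep L" using L by (simp add: D.nmul_Suc Suc simps(1))
      also have "\<dots> = Q.rep (?s (of_nat n) @ L)" using Q.rep_pl[OF s L] by (simp add: simps)
      also have "\<dots> = Q.rep (?s (of_nat (Suc n)))"
        by (rule Q.rep_eqI[OF Q.pl_closed[OF s L] s]) (rule EI, simp only: cf_simps cf_scale, simp add: algebra_simps)
      finally show ?case .
    qed
    show "divisible ?D" unfolding divisible_def
    proof (intro ballI allI impI)
      fix x and n :: nat assume "x \<in> carrier ?D" and n: "n > 0"
      then obtain L where L: "L \<in> ?V" "x = Q.rep L" by (auto simp: simps)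
      let ?L = "map (\<lambda>(q, x). (1 / of_nat n * q, x)) L"
      have l: "?L \<in> ?V" using L(1) by force
      have l': "map (\<lambda>(q, x). (of_nat n * q, x)) ?L \<in> ?V" using L(1) by force
      have "[n] \<cdot>\<^bsub>?D\<^esub> Q.rep ?L = x"
        unfolding nm[OF l] L(2) by (rule Q.rep_eqI[OF l' L(1)], rule EI) (use n in \<open>simp only: cf_scale, simp\<close>)
      then show "\<exists>y\<in>carrier ?D. [n] \<cdot>\<^bsub>?D\<^esub> y = x" using l unfolding simps by blast
    qed
  next
    fix x assume x: "x \<in> carrier M"
    then have v: "[(1, x)] \<in> ?V" by simp
    show "?i x \<in> carrier ?D" unfolding simps using v by (rule imageI)
    have k: "M.kr (\<lambda>m. cf [(1, x)] m - cf [] m) x" using M.kr_single[OF x, of 1] x by (simp add: M.zmul_1 cong: if_cong)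
    have "?i x = \<zero>[?D] \<longleftrightarrow> E [(1, x)] []" unfolding simps by (rule Q.rep_eq_iff[OF v]) simp
    also have "\<dots> \<longleftrightarrow> x \<in> S" unfolding E_def using k M.kr_unique[OF k] by blast
    finally show "?i x = \<zero>[?D] \<longleftrightarrow> x \<in> S" .
    fix y assume y: "y \<in> carrier M"
    then have w: "[(1, y)] \<in> ?V" by simp
    have xy: "[(1, x \<oplus>[M] y)] \<in> ?V" using x y by simp
    \<comment> \<open>The combination \<open>1 (x + y) - 1 x - 1 y\<close> has value zero. It is
      treated as a sum of three single-term functions because x, y and \<open>x + y\<close> may
      coincide.\<close>
    have "M.kr (\<lambda>m. cf [(1, x \<oplus>[M] y)] m - cf ([(1, x)] @ [(1, y)]) m) \<zero>[M]"
    proof -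
      have "M.kr (\<lambda>m. (if x \<oplus>[M] y = m then of_int 1 else 0) + ((if x = m then of_int (- 1) else 0) + (if y = m then of_int (- 1) else 0)))
        ([(1 :: int)] \<cdot>\<^bsub>M\<^esub> (x \<oplus>[M] y) \<oplus>[M] ([(- 1 :: int)] \<cdot>\<^bsub>M\<^esub> x \<oplus>[M] [(- 1 :: int)] \<cdot>\<^bsub>M\<^esub> y))"
        by (intro M.kr_add M.kr_single x y M.a_closed)
      moreover have "[(1 :: int)] \<cdot>\<^bsub>M\<^esub> (x \<oplus>[M] y) \<oplus>[M] ([(- 1 :: int)] \<cdot>\<^bsub>M\<^esub> x \<oplus>[M] [(- 1 :: int)] \<cdot>\<^bsub>M\<^esub> y) = \<zero>[M]"
        unfolding M.zmul_neg[OF x] M.zmul_neg[OF y] M.zmul_1[OF x] M.zmul_1[OF y] M.zmul_1[OF M.a_closed[OF x y]] using x y by algebra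
      moreover have "(\<lambda>m. (if x \<oplus>[M] y = m then of_int 1 else 0) + ((if x = m then of_int (- 1) else 0) + (if y = m then of_int (- 1) else 0)))
        = (\<lambda>m. cf [(1, x \<oplus>[M] y)] m - cf ([(1, x)] @ [(1, y)]) m)" by (rule ext) (simp cong: if_cong)
      ultimately show ?thesis by simp
    qed
    then have "E [(1, x \<oplus>[M] y)] ([(1, x)] @ [(1, y)])" unfolding E_def using S(2) by blast
    then have "?i (x \<oplus>[M] y) = Q.rep ([(1, x)] @ [(1, y)])" using Q.rep_eqI[OF xy Q.pl_closed[OF v w]] by blast
    also have "\<dots> = ?i x \<oplus>[?D] ?i y" using Q.rep_pl[OF v w] by (simp add: simps)
    finally show "?i (x \<oplus>[M] y) = ?i x \<oplus>[?D] ?i y" .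
  qed
qed

text \<open>The coinduced module of additive maps from A to D, on which A acts from the right
  through left multiplication in the argument.\<close>

definition coind :: "('a, 'x) ring_scheme \<Rightarrow> ('d, 'z) ring_scheme \<Rightarrow> ('a, 'a \<Rightarrow> 'd) rmodule" where
  "coind A D = mk_rmodule
    {f \<in> carrier A \<rightarrow>\<^sub>E carrier D. \<forall>x \<in> carrier A. \<forall>y \<in> carrier A. f (x \<oplus>[A] y) = f x \<oplus>[D] f y}
    (\<lambda>f g. \<lambda>x\<in>carrier A. f x \<oplus>[D] g x) (\<lambda>x\<in>carrier A. \<zero>[D]) (\<lambda>f a. \<lambda>x\<in>carrier A. f (a \<otimes>[A] x))"

lemma coind_module:
  assumes A: "ring A" and D: "abelian_group D" shows "right_module A (coind A D)"
proof -
  interpret A: ring A by fact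
  interpret D: abelian_group D by fact
  have "abelian_group (coind A D)"
  proof (rule abelian_groupI)
    fix f assume f: "f \<in> carrier (coind A D)"
    then have fc: "f x \<in> carrier D" if "x \<in> carrier A" for x using that by (auto simp: coind_def)
    show "\<exists>g\<in>carrier (coind A D). g \<oplus>[coind A D] f = \<zero>[coind A D]" by (rule bexI[of _ "\<lambda>x\<in>carrier A. \<ominus>[D] f x"])
        (use f fc in \<open>auto simp: coind_def fun_eq_iff D.l_neg D.minus_add restrict_def\<close>)
  qed (auto simp: coind_def fun_eq_iff D.a_ac restrict_def PiE_iff Pi_iff extensional_def)
  then show ?thesis by (rule right_moduleI'[OF A])
      (auto simp: coind_def fun_eq_iff restrict_def PiE_iff Pi_iff extensional_def A.r_distr A.l_distr A.m_assoc)
qed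

definition injective_module :: "('a, 'x) ring_scheme \<Rightarrow> ('a, 'u) rmodule \<Rightarrow> bool" where
  "injective_module A J \<longleftrightarrow> right_module A J \<and> (\<forall>(N :: ('a, 'u) rmodule) U f. right_module A N \<longrightarrow> U \<subseteq> carrier N \<longrightarrow> \<zero>[N] \<in> U \<longrightarrow>
    (\<forall>x \<in> U. \<forall>y \<in> U. x \<oplus>[N] y \<in> U) \<longrightarrow> (\<forall>x \<in> U. \<ominus>[N] x \<in> U) \<longrightarrow> (\<forall>x \<in> U. \<forall>a \<in> carrier A. ract N x a \<in> U) \<longrightarrow>
    rlinear A (N\<lparr>carrier := U\<rparr>) J f \<longrightarrow> (\<exists>g. rlinear A N J g \<and> (\<forall>x \<in> U. g x = f x)))"

text \<open>Linear maps into the coinduced module correspond to additive maps into D by evaluation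
  at \<open>1\<close>, so divisibility of D gives injectivity. The map sending x to the function
  \<open>i (x a)\<close> of a has kernel S because S is a submodule. Prescribing the kernel avoids
  forming the quotient of M by S as a module.\<close>

lemma enough_injectives:
  fixes A :: "('a, 'x) ring_scheme" and M :: "('a, 'u) rmodule"
  assumes large: "large_universe TYPE('a) TYPE('u)" and M: "right_module A M"
    and S: "S \<subseteq> carrier M" "\<zero>[M] \<in> S" "\<forall>x \<in> S. \<forall>y \<in> S. x \<oplus>[M] y \<in> S"
    "\<forall>x \<in> S. \<ominus>[M] x \<in> S" "\<forall>x \<in> S. \<forall>a \<in> carrier A. ract M x a \<in> S"
  obtains J :: "('a, 'u) rmodule" and f where "injective_module A J" "rlinear A M J f"
    "\<And>x. x \<in> carrier M \<Longrightarrow> f x = \<zero>[J] \<longleftrightarrow> x \<in> S"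
proof -
  interpret M: right_module A M by fact
  obtain D :: "(unit, (rat \<times> 'u) list) rmodule" and i where D: "abelian_group D" "divisible D"
    and i: "\<And>x. x \<in> carrier M \<Longrightarrow> i x \<in> carrier D"
      "\<And>x y. x \<in> carrier M \<Longrightarrow> y \<in> carrier M \<Longrightarrow> i (x \<oplus>[M] y) = i x \<oplus>[D] i y"
      "\<And>x. x \<in> carrier M \<Longrightarrow> i x = \<zero>[D] \<longleftrightarrow> x \<in> S"
    by (rule divisible_hull[OF M.M.abelian_group_axioms S(1-4)]) (rule that; (assumption | blast))
  interpret D: abelian_group D by fact
  have "embeds TYPE((rat \<times> 'u) list) TYPE('u)"
    by (intro universe_list[OF large] universe_prod[OF large] universe_countable[OF large] embedsI[of id]) simp
  then have "embeds TYPE('a \<Rightarrow> (rat \<times> 'u) list) TYPE('u)" by (rule embeds_trans[OF embeds_fun universe_power[OF large]])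
  then interpret enc_loc "TYPE('a \<Rightarrow> (rat \<times> 'u) list)" "TYPE('u)" by (intro enc_loc.intro embeds_enc)
  let ?C = "coind A D"
  let ?J = "enc_rmodule ?C :: ('a, 'u) rmodule"
  have C: "right_module A ?C" by (rule coind_module[OF M.A.ring_axioms D(1)])
  interpret C: right_module A ?C by (rule C)
  let ?f = "\<lambda>x. \<lambda>a\<in>carrier A. i (ract M x a)"
  have f: "rlinear A M ?C ?f"
    by (rule rlinearI) (auto simp: coind_def fun_eq_iff restrict_def extensional_def i M.ract_closed M.ract_add_left M.ract_add_right M.ract_mult)
  show ?thesis
  proof (rule that)
    show "rlinear A M ?J (\<lambda>x. enc (?f x))" by (rule rl_comp[OF f enc_rl])
    show "(enc (?f x) :: 'u) = \<zero>[?J] \<longleftrightarrow> x \<in> S" if x: "x \<in> carrier M" for x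
    proof -
      have "?f x = \<zero>[?C] \<longleftrightarrow> (\<forall>a \<in> carrier A. i (ract M x a) = \<zero>[D])" by (auto simp: coind_def fun_eq_iff restrict_def)
      also have "\<dots> \<longleftrightarrow> (\<forall>a \<in> carrier A. ract M x a \<in> S)" using i(3) M.ract_closed[OF x] by simp
      also have "\<dots> \<longleftrightarrow> x \<in> S" using S(5) M.ract_one[OF x] M.A.one_closed by metis
      finally show ?thesis by (simp add: enc_eq_iff)
    qed
    show "injective_module A ?J" unfolding injective_module_def
    proof (intro conjI allI impI enc_module[OF C])
      fix N :: "('a, 'u) rmodule" and U h
      assume N: "right_module A N" and U: "U \<subseteq> carrier N" "\<zero>[N] \<in> U" "\<forall>x\<in>U. \<forall>y\<in>U. x \<oplus>[N] y \<in> U"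
        "\<forall>x\<in>U. \<ominus>[N] x \<in> U" "\<forall>x\<in>U. \<forall>a\<in>carrier A. ract N x a \<in> U" and h: "rlinear A (N\<lparr>carrier := U\<rparr>) ?J h"
      interpret N: right_module A N by fact
      define k where "k x = (dec (h x) :: 'a \<Rightarrow> (rat \<times> 'u) list)" for x
      have "rlinear A (N\<lparr>carrier := U\<rparr>) ?C k" unfolding k_def by (rule rl_comp[OF h dec_rl])
      then have k: "k x \<in> carrier ?C" "x \<in> U \<Longrightarrow> y \<in> U \<Longrightarrow> k (x \<oplus>[N] y) = k x \<oplus>[?C] k y"
        "a \<in> carrier A \<Longrightarrow> k (ract N x a) = ract ?C (k x) a" if "x \<in> U" for x y a using that by (auto simp: rlinear_def)
      have hk: "h x = enc (k x)" if x: "x \<in> U" for x using rl_closed[OF h, of x] x by (auto simp: k_def)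
      have m1: "(\<lambda>x. k x \<one>[A]) \<in> U \<rightarrow> carrier D" using k(1) by (auto simp: coind_def)
      have m2: "\<forall>x \<in> U. \<forall>y \<in> U. k (x \<oplus>[N] y) \<one>[A] = k x \<one>[A] \<oplus>[D] k y \<one>[A]" using k(2) by (simp add: coind_def)
      obtain g where g: "g \<in> carrier N \<rightarrow> carrier D"
        "\<And>x y. x \<in> carrier N \<Longrightarrow> y \<in> carrier N \<Longrightarrow> g (x \<oplus>[N] y) = g x \<oplus>[D] g y" "\<And>x. x \<in> U \<Longrightarrow> g x = k x \<one>[A]"
        using divisible_extension[OF N.M.abelian_group_axioms D U(1-4) m1 m2] by blast
      let ?g = "\<lambda>x. \<lambda>a\<in>carrier A. g (ract N x a)"
      have gl: "rlinear A N ?C ?g"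
        by (rule rlinearI) (use funcset_mem[OF g(1)] in \<open>auto simp: coind_def fun_eq_iff restrict_def extensional_def g(2)
          N.ract_closed N.ract_add_left N.ract_add_right N.ract_mult\<close>)
      have "?g x = k x" if x: "x \<in> U" for x
      proof
        fix a
        show "?g x a = k x a"
        proof (cases "a \<in> carrier A")
          case True
          \<comment> \<open>A linear map into the coinduced module is recovered from its values at
            \<open>1\<close>: the value at \<open>a\<close> is the value at \<open>1\<close> after
            acting by \<open>a\<close>.\<close>
          then have "g (ract N x a) = ract ?C (k x) a \<one>[A]" using g(3)[of "ract N x a"] U(5) x k(3)[OF x True] by simp
          then show ?thesis using True by (simp add: coind_def)
        next
          case False
          then show ?thesis using k(1)[OF x] by (auto simp: coind_def PiE_iff extensional_def)
        qed
      qed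
      then show "\<exists>g. rlinear A N ?J g \<and> (\<forall>x\<in>U. g x = h x)"
        by (intro exI[of _ "\<lambda>x. enc (?g x)"] conjI rl_comp[OF gl enc_rl]) (simp add: hk)
    qed
  qed
qed

section \<open>K-injective resolutions\<close>

lemma is_homotopy_cong:
  assumes "is_htpy A X Y h f g" "\<And>n x. x \<in> el X n \<Longrightarrow> f n x = f' n x"
  shows "is_htpy A X Y h f' g" using assms by (simp add: is_htpy_def)

text \<open>One step of the resolution: \<open>q : Y \<rightarrow> X\<close> is surjective, vanishes on cohomology, and null-homotopies of
  maps from acyclic complexes lift strictly along it. The last property is stable under sequential limits.\<close>

definition coghost :: "('a, 'x) ring_scheme \<Rightarrow> ('a, 'u) rcpx \<Rightarrow> (('a, 'v) rmodule, 'v) cpx \<Rightarrow> ('v, 'u) gmap \<Rightarrow> bool" where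
  "coghost A X Y q \<longleftrightarrow> is_cpx A Y \<and> chain_map A Y X q \<and>
    (\<forall>n. \<forall>x \<in> el X n. \<exists>y \<in> el Y n. q n y = x) \<and>
    (\<forall>n. \<forall>y \<in> cocycles Y n. q n y \<in> coboundaries X n)"

definition lifts_null :: "('a, 'x) ring_scheme \<Rightarrow> ('a, 'u) rcpx \<Rightarrow> ('a, 'v) rcpx \<Rightarrow> ('v, 'u) gmap \<Rightarrow> bool" where
  "lifts_null A X Y q \<longleftrightarrow> (\<forall>(N :: ('a, 'u) rcpx) c h. is_cpx A N \<longrightarrow> acyclic_cpx N \<longrightarrow> chain_map A N Y c \<longrightarrow>
    is_htpy A N X h (\<lambda>n x. q n (c n x)) (\<lambda>n x. \<zero>[X,n]) \<longrightarrow>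
    (\<exists>k. is_htpy A N Y k c (\<lambda>n x. \<zero>[Y,n]) \<and> (\<forall>n. \<forall>x \<in> el N n. q (n - 1) (k n x) = h n x)))"

lemma injective_module_ext:
  fixes J N :: "('a, 'u) rmodule"
  assumes "injective_module A J" "right_module A N" "U \<subseteq> carrier N" "\<zero>[N] \<in> U"
    "\<forall>x \<in> U. \<forall>y \<in> U. x \<oplus>[N] y \<in> U" "\<forall>x \<in> U. \<ominus>[N] x \<in> U" "\<forall>x \<in> U. \<forall>a \<in> carrier A. ract N x a \<in> U"
    "rlinear A (N\<lparr>carrier := U\<rparr>) J f"
  shows "\<exists>g. rlinear A N J g \<and> (\<forall>x \<in> U. g x = f x)" using assms unfolding injective_module_def by blast

text \<open>A map killing the cocycles factors through the differential as a map on the coboundaries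
  of the next degree, and injectivity of J extends it from there to the whole module.\<close>

lemma cob_cocs_ext:
  fixes N :: "('a, 'u) rcpx" and J :: "('a, 'u) rmodule"
  assumes N: "is_cpx A N" "acyclic_cpx N" and J: "injective_module A J"
    and g: "rlinear A (cob N n) J g" and g0: "\<And>z. z \<in> cocycles N n \<Longrightarrow> g z = \<zero>[J]"
  shows "\<exists>k. rlinear A (cob N (n + 1)) J k \<and> (\<forall>x \<in> el N n. k (cdf N n x) = g x)"
proof -
  interpret N: cpx_loc A N by standard fact
  have "right_module A J" using J by (simp add: injective_module_def)
  then interpret J: right_module A J .
  let ?U = "coboundaries N (n + 1)"
  define f where "f u = g (SOME x. x \<in> el N n \<and> cdf N n x = u)" for u
  have fd: "f (cdf N n x) = g x" if x: "x \<in> el N n" for x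
  proof -
    let ?y = "SOME y. y \<in> el N n \<and> cdf N n y = cdf N n x"
    have y: "?y \<in> el N n \<and> cdf N n ?y = cdf N n x" by (rule someI[of _ x]) (use x in simp)
    then have "?y \<ominus>[N,n] x \<in> cocycles N n" using x N.d_closed[OF x] by (simp add: cocycles_def N.d_minus N.M.M.minus_eq_zero_iff)
    from g0[OF this] have "g ?y \<ominus>[J] g x = \<zero>[J]" using rl_minus[OF g N.grp J.M.abelian_group_axioms conjunct1[OF y] x] by simp
    then show ?thesis using J.M.minus_eq_zero_iff[OF rl_closed[OF g conjunct1[OF y]] rl_closed[OF g x]] by (simp add: f_def)
  qed
  have U: "?U = cdf N n ` el N n" by (simp add: coboundaries_def)
  have fl: "rlinear A ((cob N (n + 1))\<lparr>carrier := ?U\<rparr>) J f"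
    by (rule rlinearI) (auto simp: U fd rl_closed[OF g] N.d_add[symmetric] rl_add[OF g]
      rl_ract[OF N.d_lin, symmetric] rl_ract[OF g] N.M.ract_closed)
  have "\<exists>k. rlinear A (cob N (n + 1)) J k \<and> (\<forall>x \<in> ?U. k x = f x)"
    by (rule injective_module_ext[OF J N.M.right_module_axioms _ _ _ _ _ fl])
      (auto intro: N.cobs_add N.cobs_neg N.cobs_ract N.cobs_carrier N.cobs_zero)
  then obtain k where "rlinear A (cob N (n + 1)) J k" "\<forall>x \<in> ?U. k x = f x" by blast
  then show ?thesis by (intro exI[of _ k]) (simp add: U fd)
qed

text \<open>Map X in degree n into an injective \<open>J n\<close> with kernel the coboundaries.
  This is a chain map f to the complex J with zero differential, and Y is its homotopy fibre in the
  form \<open>d (x, j) = (d x, f x)\<close>. A cocycle of Y has \<open>f x = 0\<close>, so its image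
  in X is a coboundary.\<close>

lemma injective_step:
  fixes A :: "('a, 'x) ring_scheme" and X :: "('a, 'u) rcpx"
  assumes large: "large_universe TYPE('a) TYPE('u)" and X: "is_cpx A X"
  shows "\<exists>(Y :: ('a, 'u) rcpx) q. coghost A X Y q \<and> lifts_null A X Y q"
proof -
  interpret X: cpx_loc A X by standard fact
  have "\<exists>(J :: ('a, 'u) rmodule) f. injective_module A J \<and> rlinear A (cob X n) J f \<and>
      (\<forall>x \<in> el X n. f x = \<zero>[J] \<longleftrightarrow> x \<in> coboundaries X n)" for n
    by (rule enough_injectives[OF large X.M.right_module_axioms[of n], of "coboundaries X n"])
      (use X.cobs_carrier X.cobs_zero X.cobs_add X.cobs_neg X.cobs_ract in \<open>(blast; fail)+\<close>)
  then obtain J :: "int \<Rightarrow> ('a, 'u) rmodule" and f where J: "\<And>n. injective_module A (J n)" and f: "\<And>n. rlinear A (cob X n) (J n) (f n)"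
    and ker: "\<And>n x. x \<in> el X n \<Longrightarrow> f n x = \<zero>[J n] \<longleftrightarrow> x \<in> coboundaries X n" by metis
  have Jm: "right_module A (J n)" for n using J by (simp add: injective_module_def)
  note Jg = right_module_group[OF Jm]
  interpret enc_loc "TYPE('u \<times> 'u)" "TYPE('u)" by (intro enc_loc.intro embeds_enc universe_pair[OF large])
  define Y where "Y = \<lparr>cob = (\<lambda>n. dsum_rmodule (cob X n) (J (n - 1))), cdf = (\<lambda>n z. (cdf X n (fst z), f n (fst z)))\<rparr>"
  have Ys [simp]: "cob Y n = dsum_rmodule (cob X n) (J (n - 1))" "cdf Y n z = (cdf X n (fst z), f n (fst z))" for n z
    by (simp_all add: Y_def)
  have fd: "f (n + 1) (cdf X n x) = \<zero>[J (n + 1)]" if "x \<in> el X n" for n x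
    using ker[OF X.d_closed[OF that]] X.coboundariesI[of x "n + 1"] that by simp
  have Y: "is_cpx A Y"
  proof (rule is_cpxI)
    show "right_module A (cob Y n)" for n by (simp add: dsum_module X.M.right_module_axioms Jm)
    have "rlinear A (dsum_rmodule (cob X n) (J (n - 1))) (dsum_rmodule (cob X (n + 1)) (J n)) (\<lambda>z. (cdf X n (fst z), f n (fst z)))" for n
      by (rule pair_rl[OF rl_comp[OF fst_rl X.d_lin] rl_comp[OF fst_rl f]])
    then show "rlinear A (cob Y n) (cob Y (n + 1)) (cdf Y n)" for n by (simp add: Y_def)
    fix n z assume "z \<in> el Y n"
    then have x: "fst z \<in> el X n" by auto
    have eq: "n + 2 - 1 = n + 1" by simp
    show "cdf Y (n + 1) (cdf Y n z) = \<zero>[Y,n + 2]" by (simp only: Ys dsum_simps fst_conv X.dd[OF x] fd[OF x] eq)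
  qed
  let ?E = "enc_cpx Y :: ('a, 'u) rcpx"
  have E: "is_cpx A ?E" by (rule enc_cpx_cpx[OF Y])
  have fstc: "chain_map A Y X (\<lambda>n. fst)" by (rule chain_mapI) (simp_all add: fst_rl)
  let ?q = "\<lambda>n (x :: 'u). fst (dec x :: 'u \<times> 'u)"
  have q: "chain_map A ?E X ?q" by (rule cm_comp[OF dec_cm fstc])
  have "coghost A X ?E ?q" unfolding coghost_def
  proof (intro conjI allI ballI E q)
    fix n x assume x: "x \<in> el X n"
    show "\<exists>y\<in>el ?E n. ?q n y = x" using x abelian_groupE(2)[OF Jg] by (intro bexI[of _ "enc (x, \<zero>[J (n - 1)])"]) auto
  next
    fix n y assume "y \<in> cocycles ?E n"
    then show "?q n y \<in> coboundaries X n" using ker by (auto simp: cocycles_def enc_eq_iff)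
  qed
  moreover have "lifts_null A X ?E ?q" unfolding lifts_null_def
  proof (intro allI impI)
    fix N :: "('a, 'u) rcpx" and c h
    assume N: "is_cpx A N" "acyclic_cpx N" and c: "chain_map A N ?E c" and hh: "is_htpy A N X h (\<lambda>n x. ?q n (c n x)) (\<lambda>n x. \<zero>[X,n])"
    interpret N: cpx_loc A N by standard fact
    note h = htpyD[OF hh]
    have dc: "chain_map A N Y (\<lambda>n x. dec (c n x) :: 'u \<times> 'u)" by (rule cm_comp[OF c dec_cm])
    define a b where "a n x = fst (dec (c n x) :: 'u \<times> 'u)" and "b n x = snd (dec (c n x) :: 'u \<times> 'u)" for n x
    have dec: "dec (c n x) = (a n x, b n x)" for n x by (simp add: a_def b_def)
    have dl: "rlinear A (cob N n) (dsum_rmodule (cob X n) (J (n - 1))) (\<lambda>x. dec (c n x))" for n using cm_lin[OF dc, of n] by simp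
    have al: "rlinear A (cob N n) (cob X n) (a n)" for n unfolding a_def by (rule rl_comp[OF dl fst_rl])
    have bl: "rlinear A (cob N n) (J (n - 1)) (b n)" for n unfolding b_def by (rule rl_comp[OF dl snd_rl])
    have bl': "rlinear A (cob N (n + 1)) (J n) (b (n + 1))" for n using bl[of "n + 1"] by simp
    have ad: "a (n + 1) (cdf N n x) = cdf X n (a n x)" and bd: "b (n + 1) (cdf N n x) = f n (a n x)" if "x \<in> el N n" for n x
      using cm_d[OF dc that] unfolding dec by simp_all
    have cE: "c n x = enc (a n x, b n x)" if "x \<in> el N n" for n x using cm_closed[OF c that] by (auto simp: a_def b_def)
    have ah: "a n x = cdf X (n - 1) (h n x) \<oplus>[X,n] h (n + 1) (cdf N n x)" if x: "x \<in> el N n" for n x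
      using h(3)[OF x] h(2)[OF x] X.d_closed'[OF rl_closed[OF h(1) x]] by (simp add: a_def)
    have fl: "rlinear A (cob X (n - 1)) (J (n - 1)) (f (n - 1))" for n by (rule f)
    have gl: "rlinear A (cob N n) (J (n - 1)) (\<lambda>x. b n x \<ominus>[J (n - 1)] f (n - 1) (h n x))" for n
      by (rule rl_diff[OF Jm bl rl_comp[OF h(1) f]])
    \<comment> \<open>Writing the cocycle as \<open>z = d x\<close>, the chain map equation gives
      \<open>b z = f (a x)\<close> with \<open>a x = d (h x) + h z\<close>, and f kills the
      coboundary.\<close>
    have g0: "b n z \<ominus>[J (n - 1)] f (n - 1) (h n z) = \<zero>[J (n - 1)]" if zc: "z \<in> cocycles N n" for n z
    proof -
      obtain x where x: "x \<in> el N (n - 1)" "z = cdf N (n - 1) x" using zc N(2) by (auto simp: acyclic_cpx_def coboundaries_def)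
      interpret J: abelian_group "J (n - 1)" by (rule Jg)
      have hx: "h (n - 1) x \<in> el X (n - 1 - 1)" by (rule rl_closed[OF h(1) x(1)])
      note dhx = X.d_closed'[OF hx]
      have hz: "h n z \<in> el X (n - 1)" using h(2)[OF x(1)] x(2) by simp
      have "b n z = f (n - 1) (a (n - 1) x)" using bd[OF x(1)] x(2) by simp
      also have "a (n - 1) x = cdf X (n - 1 - 1) (h (n - 1) x) \<oplus>[X,n - 1] h n z" using ah[OF x(1)] x(2) by simp
      also have "f (n - 1) \<dots> = \<zero>[J (n - 1)] \<oplus>[J (n - 1)] f (n - 1) (h n z)" unfolding rl_add[OF f dhx hz] using fd[OF hx] by simp
      finally show ?thesis using rl_closed[OF f hz] by (simp add: J.r_neg a_minus_def)
    qed
    have "\<exists>k. rlinear A (cob N (n + 1)) (J (n - 1)) k \<and>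
        (\<forall>x \<in> el N n. k (cdf N n x) = b n x \<ominus>[J (n - 1)] f (n - 1) (h n x))" for n by (rule cob_cocs_ext[OF N J gl g0])
    then obtain k where k: "\<And>n. rlinear A (cob N (n + 1)) (J (n - 1)) (k n)"
      and kd: "\<And>n x. x \<in> el N n \<Longrightarrow> k n (cdf N n x) = b n x \<ominus>[J (n - 1)] f (n - 1) (h n x)" by metis
    have k': "rlinear A (cob N n) (J (n - 1 - 1)) (k (n - 1))" for n using k[of "n - 1"] by simp
    \<comment> \<open>The first component is \<open>h\<close> itself, which makes the lift strict;
      the second solves \<open>b = f h + k d\<close> and comes from extending over the injective
      module.\<close>
    let ?k = "\<lambda>n x. enc (h n x, k (n - 1) x) :: 'u"
    have kl: "rlinear A (cob N n) (cob ?E (n - 1)) (?k n)" for n using rl_comp[OF pair_rl[OF h(1) k'] enc_rl] by simp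
    have "is_htpy A N ?E ?k c (\<lambda>n x. \<zero>[?E,n])" unfolding is_htpy_def
    proof (intro conjI allI ballI kl)
      fix n x assume x: "x \<in> el N n"
      interpret J: abelian_group "J (n - 1)" by (rule Jg)
      have kc: "k n (cdf N n x) \<in> carrier (J (n - 1))" by (rule rl_closed[OF k N.d_closed[OF x]])
      have hc: "h n x \<in> el X (n - 1)" by (rule rl_closed[OF h(1) x])
      have bc: "b n x \<in> carrier (J (n - 1))" by (rule rl_closed[OF bl x])
      note fc = rl_closed[OF f hc]
      show "?k (n + 1) (cdf N n x) \<in> el ?E n" using h(2)[OF x] kc by simp
      have "b n x = f (n - 1) (h n x) \<oplus>[J (n - 1)] k n (cdf N n x)" unfolding kd[OF x] using bc fc by algebra
      then show "c n x = \<zero>[?E,n] \<oplus>[?E,n] (cdf ?E (n - 1) (?k n x) \<oplus>[?E,n] ?k (n + 1) (cdf N n x))"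
        using cE[OF x] ah[OF x] h(2)[OF x] X.d_closed'[OF hc] fc kc by (simp add: enc_add)
    qed
    then show "\<exists>k. is_htpy A N ?E k c (\<lambda>n x. \<zero>[?E,n]) \<and> (\<forall>n. \<forall>x\<in>el N n. ?q (n - 1) (k n x) = h n x)" by (intro exI[of _ ?k]) simp
  qed
  ultimately show ?thesis by blast
qed

section \<open>The limit of a tower of such steps\<close>

locale injective_tower =
  fixes A :: "('a, 'x) ring_scheme" and C :: "nat \<Rightarrow> ('a, 'u) rcpx" and q :: "nat \<Rightarrow> ('u, 'u) gmap"
  assumes C0: "is_cpx A (C 0)" and step: "coghost A (C k) (C (Suc k)) (q k)" and lifts: "lifts_null A (C k) (C (Suc k)) (q k)"
begin

lemma C_cpx: "is_cpx A (C k)" using C0 step by (cases k) (auto simp: coghost_def)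

end

sublocale injective_tower \<subseteq> C: cpx_loc A "C k" for k by standard (rule C_cpx)

context injective_tower
begin

lemma q_chain: "chain_map A (C (Suc k)) (C k) (q k)" and q_surj: "x \<in> el (C k) n \<Longrightarrow> \<exists>y \<in> el (C (Suc k)) n. q k n y = x"
  and q_ghost: "y \<in> cocycles (C (Suc k)) n \<Longrightarrow> q k n y \<in> coboundaries (C k) n" using step by (auto simp: coghost_def)

lemmas q_lin = cm_lin[OF q_chain] and q_closed = cm_closed[OF q_chain] and q_d = cm_d[OF q_chain] and q_d' = cm_d'[OF q_chain]

text \<open>The inverse limit, realised by compatible sequences; functions from \<open>nat\<close>
  to \<open>'u\<close> still embed into the universe.\<close>

definition L :: "('a, nat \<Rightarrow> 'u) rcpx" where
  "L = \<lparr>cob = (\<lambda>n. mk_rmodule {s. \<forall>k. s k \<in> el (C k) n \<and> q k n (s (Suc k)) = s k}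
     (\<lambda>s t k. s k \<oplus>[C k,n] t k) (\<lambda>k. \<zero>[C k,n]) (\<lambda>s a k. ract (cob (C k) n) (s k) a)),
     cdf = (\<lambda>n s k. cdf (C k) n (s k))\<rparr>"

lemma L_simps:
  "s \<in> el L n \<longleftrightarrow> (\<forall>k. s k \<in> el (C k) n \<and> q k n (s (Suc k)) = s k)"
  "s \<oplus>[L,n] t = (\<lambda>k. s k \<oplus>[C k,n] t k)" "\<zero>[L,n] = (\<lambda>k. \<zero>[C k,n])"
  "ract (cob L n) s a = (\<lambda>k. ract (cob (C k) n) (s k) a)" "cdf L n s = (\<lambda>k. cdf (C k) n (s k))" by (simp_all add: L_def)

lemma L_cpx: "is_cpx A L"
proof (rule is_cpxI)
  fix n
  have z: "q k n \<zero>[C (Suc k),n] = \<zero>[C k,n]" for k by (rule rl_zero[OF q_lin C.grp C.grp])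
  have "abelian_group (cob L n)"
  proof (rule abelian_groupI)
    fix s assume "s \<in> el L n"
    then show "\<exists>t\<in>el L n. t \<oplus>[L,n] s = \<zero>[L,n]"
      by (intro bexI[of _ "\<lambda>k. \<ominus>[C k,n] s k"]) (auto simp: L_simps C.M.M.l_neg rl_neg[OF q_lin C.grp C.grp])
  qed (auto simp: L_simps C.M.M.a_ac rl_add[OF q_lin] z)
  then show "right_module A (cob L n)" by (intro right_moduleI' C.ring_axioms)
      (auto simp: L_simps C.M.ract_closed C.M.ract_add_left C.M.ract_add_right C.M.ract_mult C.M.ract_one rl_ract[OF q_lin])
  show "rlinear A (cob L n) (cob L (n + 1)) (cdf L n)" by (rule rlinearI) (auto simp: L_simps C.d_closed q_d C.d_add rl_ract[OF C.d_lin])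
qed (auto simp: L_simps C.dd)

text \<open>A Mittag-Leffler argument. Each \<open>s k\<close> is the image of a cocycle one level
  up and hence a coboundary, but primitives at different levels need not be compatible. They are
  chosen successively, each one agreeing up to a coboundary with the image of a primitive from the
  level above; this slack makes the next choice possible.\<close>

lemma L_acyclic: "acyclic_cpx L"
proof -
  interpret L: cpx_loc A L by standard (rule L_cpx)
  have "s \<in> coboundaries L (m + 1)" if s: "s \<in> cocycles L (m + 1)" for s m
  proof -
    have sc: "s k \<in> cocycles (C k) (m + 1)" and sq: "q k (m + 1) (s (Suc k)) = s k" for k
      using s by (auto simp: cocycles_def L_simps fun_eq_iff)
    have sb: "\<exists>b \<in> el (C k) m. cdf (C k) m b = s k" for k using q_ghost[OF sc[of "Suc k"]] sq by (auto simp: coboundaries_def)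
    define P where "P k b \<longleftrightarrow> b \<in> el (C k) m \<and> (\<exists>\<beta> \<in> el (C (Suc k)) m.
      cdf (C (Suc k)) m \<beta> = s (Suc k) \<and> b \<ominus>[C k,m] q k m \<beta> \<in> coboundaries (C k) m)" for k b
    have "\<exists>t. \<forall>k. P k (t k) \<and> q k m (t (Suc k)) = t k"
    proof (rule dependent_nat_choice)
      obtain \<beta> where b: "\<beta> \<in> el (C (Suc 0)) m" "cdf (C (Suc 0)) m \<beta> = s (Suc 0)" using sb by blast
      have "q 0 m \<beta> \<ominus>[C 0,m] q 0 m \<beta> = \<zero>[C 0,m]" using q_closed[OF b(1)] by (simp add: C.M.M.r_neg a_minus_def)
      then have "P 0 (q 0 m \<beta>)" unfolding P_def using b q_closed[OF b(1)] C.cobs_zero[of 0 m] by (intro conjI bexI[of _ \<beta>]) simp_all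
      then show "\<exists>b. P 0 b" by blast
    next
      fix b k assume "P k b"
      then obtain \<beta> where bc: "b \<in> el (C k) m" and \<beta>: "\<beta> \<in> el (C (Suc k)) m" "cdf (C (Suc k)) m \<beta> = s (Suc k)"
        and bb: "b \<ominus>[C k,m] q k m \<beta> \<in> coboundaries (C k) m" unfolding P_def by blast
      \<comment> \<open>Two primitives of \<open>s (Suc k)\<close>, namely \<beta> and the image of
        \<gamma>, differ by a cocycle, which \<open>q k\<close> turns into a coboundary. The
        remaining discrepancy \<open>d g\<close> is removed by lifting \<open>g\<close> along the
        surjection \<open>q k\<close>.\<close>
      obtain \<gamma> where \<gamma>: "\<gamma> \<in> el (C (Suc (Suc k))) m" "cdf (C (Suc (Suc k))) m \<gamma> = s (Suc (Suc k))" using sb by blast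
      let ?\<gamma> = "q (Suc k) m \<gamma>"
      have \<gamma>c: "?\<gamma> \<in> el (C (Suc k)) m" by (rule q_closed[OF \<gamma>(1)])
      have "cdf (C (Suc k)) m ?\<gamma> = s (Suc k)" using q_d[OF \<gamma>(1)] \<gamma>(2) sq by simp
      then have "?\<gamma> \<ominus>[C (Suc k),m] \<beta> \<in> cocycles (C (Suc k)) m"
        using \<gamma>c \<beta> C.cocs_carrier[OF sc[of "Suc k"]] by (simp add: cocycles_def C.d_minus C.M.M.minus_eq_zero_iff)
      from q_ghost[OF this] have "q k m ?\<gamma> \<ominus>[C k,m] q k m \<beta> \<in> coboundaries (C k) m" by (simp add: rl_minus[OF q_lin C.grp C.grp \<gamma>c \<beta>(1)])
      from C.cobs_minus[OF bb this]
      obtain g where g: "g \<in> el (C k) (m - 1)"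
        "(b \<ominus>[C k,m] q k m \<beta>) \<ominus>[C k,m] (q k m ?\<gamma> \<ominus>[C k,m] q k m \<beta>) = cdf (C k) (m - 1) g" by (auto simp: coboundaries_def)
      obtain g' where g': "g' \<in> el (C (Suc k)) (m - 1)" "q k (m - 1) g' = g" using q_surj[OF g(1)] by blast
      let ?b = "?\<gamma> \<oplus>[C (Suc k),m] cdf (C (Suc k)) (m - 1) g'"
      note dg' = C.d_closed'[OF g'(1)]
      have c: "q k m \<beta> \<in> el (C k) m" "q k m ?\<gamma> \<in> el (C k) m" using q_closed \<beta>(1) \<gamma>c by auto
      have "q k m ?b = q k m ?\<gamma> \<oplus>[C k,m] cdf (C k) (m - 1) g" by (simp add: rl_add[OF q_lin \<gamma>c dg'] q_d'[OF g'(1)] g'(2))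
      also have "\<dots> = b" unfolding g(2)[symmetric] using c bc by algebra
      finally have qb: "q k m ?b = b" .
      have "?b \<ominus>[C (Suc k),m] ?\<gamma> = cdf (C (Suc k)) (m - 1) g'" using \<gamma>c dg' by algebra
      then have "P (Suc k) ?b" unfolding P_def using \<gamma> \<gamma>c dg' C.coboundariesI[OF g'(1)] by (intro conjI bexI[of _ \<gamma>]) simp_all
      with qb show "\<exists>b'. P (Suc k) b' \<and> q k m b' = b" by blast
    qed
    then obtain t where t: "\<And>k. P k (t k)" "\<And>k. q k m (t (Suc k)) = t k" by blast
    have "cdf (C k) m (t k) = s k" for k
    proof -
      obtain \<beta> where tc: "t k \<in> el (C k) m" and \<beta>: "\<beta> \<in> el (C (Suc k)) m" "cdf (C (Suc k)) m \<beta> = s (Suc k)"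
        and bb: "t k \<ominus>[C k,m] q k m \<beta> \<in> coboundaries (C k) m" using t(1)[of k] unfolding P_def by blast
      have "cdf (C k) m (t k \<ominus>[C k,m] q k m \<beta>) = \<zero>[C k,m + 1]" using bb C.cobs_subset by (auto simp: cocycles_def)
      then show ?thesis using q_closed[OF \<beta>(1)] tc q_d[OF \<beta>(1)] \<beta>(2) sq[of k] C.d_closed[OF tc] C.cocs_carrier[OF sc[of k]]
        by (simp add: C.d_minus C.M.M.minus_eq_zero_iff)
    qed
    then have "s = cdf L m t" by (simp add: L_simps fun_eq_iff)
    moreover have "t \<in> el L m" using t by (auto simp: L_simps P_def)
    ultimately show ?thesis using L.coboundariesI[of t "m + 1"] by simp
  qed
  from this[where m="n - 1" for n] show ?thesis
    using L.cobs_subset unfolding acyclic_cpx_def by (metis diff_add_cancel subset_antisym subsetI)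
qed

definition pr :: "int \<Rightarrow> (nat \<Rightarrow> 'u) \<Rightarrow> 'u" where "pr n s = s 0"

lemma pr_chain: "chain_map A L (C 0) pr" by (rule chain_mapI, rule rlinearI) (auto simp: L_simps pr_def)

lemma comp_chain: "chain_map A N L c \<Longrightarrow> chain_map A N (C k) (\<lambda>n x. c n x k)"
  by (rule cm_comp[where g="\<lambda>n s. s k"]) (assumption, rule chain_mapI, rule rlinearI, auto simp: L_simps)

text \<open>The homotopy is lifted level by level by dependent choice. Strictness of each lift makes
  the sequence of homotopies compatible, hence a homotopy into the limit; lifts up to homotopy would
  not pass to the limit.\<close>

lemma L_lifts_null: "lifts_null A (C 0) L pr" unfolding lifts_null_def
proof (intro allI impI)
  fix N :: "('a, 'u) rcpx" and c h
  assume N: "is_cpx A N" "acyclic_cpx N" and c: "chain_map A N L c" and hh: "is_htpy A N (C 0) h (\<lambda>n x. pr n (c n x)) (\<lambda>n x. \<zero>[C 0,n])"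
  interpret N: cpx_loc A N by standard fact
  have cq: "q k n (c n x (Suc k)) = c n x k" if "x \<in> el N n" for n x k using cm_closed[OF c that] by (simp add: L_simps)
  define P where "P k l \<longleftrightarrow> is_htpy A N (C k) l (\<lambda>n x. c n x k) (\<lambda>n x. \<zero>[C k,n]) \<and> (k = 0 \<longrightarrow> l = h)" for k l
  have "\<exists>l. \<forall>k. P k (l k) \<and> (\<forall>n. \<forall>x \<in> el N n. q k (n - 1) (l (Suc k) n x) = l k n x)"
  proof (rule dependent_nat_choice)
    show "\<exists>l. P 0 l" using hh by (auto simp: P_def pr_def)
  next
    fix l k assume "P k l"
    then have "is_htpy A N (C k) l (\<lambda>n x. c n x k) (\<lambda>n x. \<zero>[C k,n])" by (simp add: P_def)
    then have "is_htpy A N (C k) l (\<lambda>n x. q k n (c n x (Suc k))) (\<lambda>n x. \<zero>[C k,n])" by (rule is_homotopy_cong) (simp add: cq)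
    with lifts[of k] N comp_chain[OF c, of "Suc k"]
    have "\<exists>l'. is_htpy A N (C (Suc k)) l' (\<lambda>n x. c n x (Suc k)) (\<lambda>n x. \<zero>[C (Suc k),n]) \<and>
      (\<forall>n. \<forall>x \<in> el N n. q k (n - 1) (l' n x) = l n x)" unfolding lifts_null_def by blast
    then show "\<exists>l'. P (Suc k) l' \<and> (\<forall>n. \<forall>x \<in> el N n. q k (n - 1) (l' n x) = l n x)" by (simp add: P_def)
  qed
  then obtain l where P: "\<And>k. P k (l k)" and lq: "\<And>k n x. x \<in> el N n \<Longrightarrow> q k (n - 1) (l (Suc k) n x) = l k n x" by blast
  have lh: "is_htpy A N (C k) (l k) (\<lambda>n x. c n x k) (\<lambda>n x. \<zero>[C k,n])" for k using P[of k] by (simp add: P_def)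
  note l = htpyD[OF lh]
  have l0: "l 0 = h" using P[of 0] by (simp add: P_def)
  let ?l = "\<lambda>n x k. l k n x"
  have ll: "rlinear A (cob N n) (cob L (n - 1)) (?l n)" for n
    by (rule rlinearI) (auto simp: L_simps rl_closed[OF l(1)] lq rl_add[OF l(1)] rl_ract[OF l(1)])
  have "is_htpy A N L ?l c (\<lambda>n x. \<zero>[L,n])" unfolding is_htpy_def
  proof (intro conjI allI ballI ll)
    fix n x assume x: "x \<in> el N n"
    show "?l (n + 1) (cdf N n x) \<in> el L n" using rl_closed[OF ll N.d_closed[OF x]] by simp
    show "c n x = \<zero>[L,n] \<oplus>[L,n] (cdf L (n - 1) (?l n x) \<oplus>[L,n] ?l (n + 1) (cdf N n x))" using l(3)[OF x] by (simp add: L_simps fun_eq_iff)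
  qed
  then show "\<exists>k. is_htpy A N L k c (\<lambda>n x. \<zero>[L,n]) \<and> (\<forall>n. \<forall>x\<in>el N n. pr (n - 1) (k n x) = h n x)"
    by (intro exI[of _ ?l]) (simp add: pr_def l0)
qed

end

section \<open>The cone of the limit as a K-injective resolution\<close>

lemma cone_cdf':
  "cdf (cone X Y f) (n - 1) (y, x) = (cdf Y (n - 1) y \<oplus>[Y,n] f n x, \<ominus>[X,n + 1] cdf X n x)" by (simp add: add.commute)

text \<open>A chain map \<open>c = (x, l)\<close> from N into the cone is a chain map
  \<open>l\<close> from N[-1] to L together with the null-homotopy \<open>- x\<close> of
  \<open>r l\<close>. Lifting this homotopy strictly to a null-homotopy \<open>b\<close> of
  \<open>l\<close> yields the contraction \<open>(0, - b)\<close> of c.\<close>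

lemma cone_K_injective:
  fixes X :: "('a, 'u) rcpx" and L :: "('a, 'v) rcpx"
  assumes X: "is_cpx A X" and L: "is_cpx A L" and r: "chain_map A L X r" and lifts: "lifts_null A X L r"
    and N: "is_cpx A (N :: ('a, 'u) rcpx)" "acyclic_cpx N" and c: "chain_map A N (cone L X r) c"
  shows "homotopic A N (cone L X r) c (\<lambda>n x. \<zero>[cone L X r,n])"
proof -
  interpret X: cpx_loc A X by standard fact
  interpret L: cpx_loc A L by standard fact
  interpret N: cpx_loc A N by standard fact
  define x l where "x n m = fst (c n m)" and "l n m = snd (c n m)" for n m
  have cxl: "c n m = (x n m, l n m)" for n m by (simp add: x_def l_def)
  have cl: "rlinear A (cob N n) (dsum_rmodule (cob X n) (cob L (n + 1))) (c n)" for n using cm_lin[OF c, of n] by simp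
  have xl: "rlinear A (cob N n) (cob X n) (x n)" for n unfolding x_def by (rule rl_comp[OF cl fst_rl])
  have ll: "rlinear A (cob N n) (cob L (n + 1)) (l n)" for n unfolding l_def by (rule rl_comp[OF cl snd_rl])
  have ll': "rlinear A (cob N (n - 1)) (cob L n) (l (n - 1))" for n using ll[of "n - 1"] by simp
  have xd: "x (n + 1) (cdf N n m) = cdf X n (x n m) \<oplus>[X,n + 1] r (n + 1) (l n m)"
    and ld: "l (n + 1) (cdf N n m) = \<ominus>[L,n + 1 + 1] cdf L (n + 1) (l n m)" if "m \<in> el N n" for n m
    using cm_d[OF c that] unfolding cxl by (simp_all add: add.assoc)
  let ?N = "shift (- 1) N"
  have N': "is_cpx A ?N" "acyclic_cpx ?N" by (rule shift_cpx[OF N(1)], rule shift_acyclic[OF N])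
  let ?c = "\<lambda>n. l (n - 1)"
  have eq: "n + 1 + - 1 = n - 1 + 1" "n + - 1 = n - 1" for n :: int by simp_all
  have ci: "chain_map A ?N L ?c"
  proof (rule chain_mapI)
    show "rlinear A (cob ?N n) (cob L n) (?c n)" for n using ll' by simp
    fix n m assume "m \<in> el ?N n"
    then have m: "m \<in> el N (n - 1)" by simp
    have lm: "cdf L n (l (n - 1) m) \<in> el L (n + 1)" by (rule L.d_closed[OF rl_closed[OF ll' m]])
    have ldm: "l n (cdf N (n - 1) m) = \<ominus>[L,n + 1] cdf L n (l (n - 1) m)" using ld[OF m] by simp
    show "?c (n + 1) (cdf ?N n m) = cdf L n (?c n m)"
      using rl_neg[OF ll N.grp L.grp N.d_closed'[OF m]] ldm L.M.M.minus_minus[OF lm] by simp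
  qed
  let ?h = "\<lambda>n m. \<ominus>[X,n - 1] x (n - 1) m"
  have "is_htpy A ?N X ?h (\<lambda>n m. r n (?c n m)) (\<lambda>n m. \<zero>[X,n])" unfolding is_htpy_def
  proof (intro conjI allI ballI)
    show "rlinear A (cob ?N n) (cob X (n - 1)) (?h n)" for n using rl_uminus[OF X.M.right_module_axioms xl[of "n - 1"]] by simp
    fix n m assume "m \<in> el ?N n"
    then have m: "m \<in> el N (n - 1)" by simp
    have d: "cdf N (n - 1) m \<in> el N n" by (rule N.d_closed'[OF m])
    have xm: "x (n - 1) m \<in> el X (n - 1)" by (rule rl_closed[OF xl m])
    have rl: "r n (l (n - 1) m) \<in> el X n" by (rule cm_closed[OF r rl_closed[OF ll' m]])
    have 1: "?h (n + 1) (cdf ?N n m) = x n (cdf N (n - 1) m)"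
      using rl_neg[OF xl N.grp X.grp d] X.M.M.minus_minus[OF rl_closed[OF xl d]] by simp
    have 2: "x n (cdf N (n - 1) m) = cdf X (n - 1) (x (n - 1) m) \<oplus>[X,n] r n (l (n - 1) m)" using xd[OF m] by simp
    show "?h (n + 1) (cdf ?N n m) \<in> el X n" unfolding 1 by (rule rl_closed[OF xl d])
    show "r n (?c n m) = \<zero>[X,n] \<oplus>[X,n] (cdf X (n - 1) (?h n m) \<oplus>[X,n] ?h (n + 1) (cdf ?N n m))"
      unfolding 1 2 X.d_neg'[OF xm] using rl X.d_closed'[OF xm] by algebra
  qed
  with lifts N' ci obtain b where bh: "is_htpy A ?N L b ?c (\<lambda>n m. \<zero>[L,n])" and rb: "\<And>n m. m \<in> el N (n - 1) \<Longrightarrow> r (n - 1) (b n m) = ?h n m"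
    unfolding lifts_null_def by (auto dest!: spec[of _ ?N] spec[of _ ?c])
  note b = htpyD[OF bh]
  have bl: "rlinear A (cob N n) (cob L n) (b (n + 1))" for n using b(1)[of "n + 1"] by simp
  \<comment> \<open>Since \<open>r b = - x\<close> holds exactly and not just up to homotopy, the
    X-component of the contraction can be zero.\<close>
  define k where "k n m = (\<zero>[X,n - 1], \<ominus>[L,n] b (n + 1) m)" for n m
  have kl: "rlinear A (cob N n) (cob (cone L X r) (n - 1)) (k n)" for n unfolding k_def
    using pair_rl[OF rl_const_zero[OF X.M.right_module_axioms] rl_uminus[OF L.M.right_module_axioms bl]] by simp
  have C: "is_cpx A (cone L X r)" by (rule cone_cpx[OF L X r])
  show ?thesis
  proof (rule homotopicI[OF C c cm_zero_map[OF C] N(1) kl])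
    fix n m assume m: "m \<in> el N n"
    have m': "m \<in> el ?N (n + 1)" "m \<in> el N (n + 1 - 1)" using m by simp_all
    have bm: "b (n + 1) m \<in> el L n" by (rule rl_closed[OF bl m])
    have dm: "cdf N n m \<in> el N (n + 1)" by (rule N.d_closed[OF m])
    have bdm: "b (n + 1 + 1) (cdf N n m) \<in> el L (n + 1)" by (rule rl_closed[OF bl dm])
    have rbm: "r n (b (n + 1) m) = \<ominus>[X,n] x n m" using rb[OF m'(2)] by simp
    have xm: "x n m \<in> el X n" by (rule rl_closed[OF xl m])
    have r1: "r n (\<ominus>[L,n] b (n + 1) m) = x n m" unfolding rl_neg[OF cm_lin[OF r] L.grp X.grp bm] rbm using X.M.M.minus_minus[OF xm] .
    have d1: "cdf L n (\<ominus>[L,n] b (n + 1) m) = \<ominus>[L,n + 1] cdf L n (b (n + 1) m)" by (rule L.d_neg[OF bm])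
    have b1: "b (n + 1 + 1) (cdf ?N (n + 1) m) = \<ominus>[L,n + 1] b (n + 1 + 1) (cdf N n m)" using rl_neg[OF bl N.grp L.grp dm] by simp
    have db: "cdf L n (b (n + 1) m) \<in> el L (n + 1)" by (rule L.d_closed[OF bm])
    have "l n m = \<zero>[L,n + 1] \<oplus>[L,n + 1] (cdf L n (b (n + 1) m) \<oplus>[L,n + 1] b (n + 1 + 1) (cdf ?N (n + 1) m))" using b(3)[OF m'(1)] by simp
    then have l1: "l n m = cdf L n (b (n + 1) m) \<oplus>[L,n + 1] \<ominus>[L,n + 1] b (n + 1 + 1) (cdf N n m)" unfolding b1 using db bdm by simp
    have k1: "cdf (cone L X r) (n - 1) (k n m) = (x n m, cdf L n (b (n + 1) m))"
      unfolding k_def cone_cdf' X.d_zero' r1 d1 L.M.M.minus_minus[OF db] using xm by simp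
    have k2: "k (n + 1) (cdf N n m) = (\<zero>[X,n], \<ominus>[L,n + 1] b (n + 1 + 1) (cdf N n m))" by (simp add: k_def)
    show "c n m = \<zero>[cone L X r,n] \<oplus>[cone L X r,n]
        (cdf (cone L X r) (n - 1) (k n m) \<oplus>[cone L X r,n] k (n + 1) (cdf N n m))" unfolding k1 k2 cxl using xm db bdm by (simp add: l1)
  qed
qed

lemma cone_incl_qi:
  assumes X: "is_cpx A X" and L: "is_cpx A L" "acyclic_cpx L" and r: "chain_map A L X r"
  shows "quasi_iso A X (cone L X r) (\<lambda>n x. (x, \<zero>[L,n + 1]))"
proof -
  interpret X: cpx_loc A X by standard fact
  interpret L: cpx_loc A L by standard fact
  have C: "is_cpx A (cone L X r)" by (rule cone_cpx[OF L(1) X r])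
  interpret C: cpx_loc A "cone L X r" by standard fact
  have r0: "r n \<zero>[L,n] = \<zero>[X,n]" for n by (rule rl_zero[OF cm_lin[OF r] L.grp X.grp])
  have L0: "\<ominus>[L,n + 2] cdf L (n + 1) \<zero>[L,n + 1] = \<zero>[L,n + 2]" for n using L.d_zero[of "n + 1"] by (simp add: L.M.M.a_inv_zero add.assoc)
  have i: "chain_map A X (cone L X r) (\<lambda>n x. (x, \<zero>[L,n + 1]))"
    by (rule chain_mapI) (simp_all add: pair_rl rl_id rl_const_zero L.M.right_module_axioms r0 L0 X.d_closed add.assoc)
  show ?thesis
  proof (rule quasi_isoI[OF X C i])
    fix n z assume z: "z \<in> cocycles X n" and "(z, \<zero>[L,n + 1]) \<in> coboundaries (cone L X r) n"
    then obtain x l where x: "x \<in> el X (n - 1)" and l: "l \<in> el L n"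
      and e: "z = cdf X (n - 1) x \<oplus>[X,n] r n l" "\<ominus>[L,n + 1] cdf L n l = \<zero>[L,n + 1]" by (auto simp: coboundaries_def add.commute)
    have "cdf L n l = \<zero>[L,n + 1]" using e(2) L.M.M.minus_minus[OF L.d_closed[OF l]] L.M.M.a_inv_zero by simp
    then have "l \<in> coboundaries L n" using l L(2) by (auto simp: acyclic_cpx_def cocycles_def)
    from cm_cobs[OF r this] show "z \<in> coboundaries X n" unfolding e by (intro X.cobs_add X.coboundariesI x)
  next
    fix n y assume y: "y \<in> cocycles (cone L X r) n"
    obtain x l where yy: "y = (x, l)" by (cases y)
    have x: "x \<in> el X n" and l: "l \<in> el L (n + 1)"
      and e: "cdf X n x \<oplus>[X,n + 1] r (n + 1) l = \<zero>[X,n + 1]" "\<ominus>[L,n + 1 + 1] cdf L (n + 1) l = \<zero>[L,n + 1 + 1]"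
      using y by (auto simp: yy cocycles_def add.assoc)
    have "cdf L (n + 1) l = \<zero>[L,n + 1 + 1]" using e(2) L.M.M.minus_minus[OF L.d_closed[OF l]] L.M.M.a_inv_zero by simp
    then have "l \<in> cocycles L (n + 1)" unfolding cocycles_def using l by blast
    then have "l \<in> coboundaries L (n + 1)" using L(2) by (simp add: acyclic_cpx_def)
    then obtain l' where l': "l' \<in> el L n" "l = cdf L n l'" by (auto simp: coboundaries_def)
    have rl: "r n l' \<in> el X n" by (rule cm_closed[OF r l'(1)])
    have z: "x \<oplus>[X,n] r n l' \<in> cocycles X n" using x rl e(1) cm_d[OF r l'(1)] by (simp add: cocycles_def X.d_add l'(2))
    have "(x \<oplus>[X,n] r n l', \<zero>[L,n + 1]) \<ominus>[dsum_rmodule (cob X n) (cob L (n + 1))] (x, l)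
        = (r n l', \<ominus>[L,n + 1] cdf L n l')"
    proof -
      have "x \<oplus>[X,n] r n l' \<oplus>[X,n] \<ominus>[X,n] x = r n l'" using x rl by algebra
      then show ?thesis using dsum_a_inv[OF X.M.right_module_axioms L.M.right_module_axioms x l] l by (simp add: a_minus_def l'(2))
    qed
    also have "\<dots> = cdf (cone L X r) (n - 1) (\<zero>[X,n - 1], l')" unfolding cone_cdf' X.d_zero' using rl by simp
    finally have "(x \<oplus>[X,n] r n l', \<zero>[L,n + 1]) \<ominus>[cone L X r,n] y \<in> coboundaries (cone L X r) n"
      using C.coboundariesI[of "(\<zero>[X,n - 1], l')" n] l'(1) by (simp add: yy)
    with z show "\<exists>z\<in>cocycles X n. (z, \<zero>[L,n + 1]) \<ominus>[cone L X r,n] y \<in> coboundaries (cone L X r) n" by (rule bexI[rotated])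
  qed
qed

text \<open>Iterating a chosen step from X gives the tower. As its limit L is acyclic, X is
  quasi-isomorphic to the cone of the projection L -> X, and that cone is K-injective.\<close>

lemma K_injective_resolution_exists:
  fixes X :: "('a, 'u) rcpx"
  assumes large: "large_universe TYPE('a) TYPE('u)" and X: "is_cpx A X"
  shows "\<exists>(I :: ('a, 'u) rcpx) i. K_injective A I \<and> quasi_iso A X I i"
proof -
  have ex: "\<exists>z :: ('a, 'u) rcpx \<times> ('u, 'u) gmap. coghost A Z (fst z) (snd z) \<and> lifts_null A Z (fst z) (snd z)" if "is_cpx A Z" for Z :: "('a, 'u) rcpx"
    using injective_step[OF large that] by auto
  define T where "T Z = (SOME z :: ('a, 'u) rcpx \<times> ('u, 'u) gmap. coghost A Z (fst z) (snd z) \<and> lifts_null A Z (fst z) (snd z))" for Z :: "('a, 'u) rcpx"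
  have T: "coghost A Z (fst (T Z)) (snd (T Z)) \<and> lifts_null A Z (fst (T Z)) (snd (T Z))" if "is_cpx A Z" for Z
    unfolding T_def by (rule someI_ex[OF ex[OF that]])
  define C where "C k = ((\<lambda>Z. fst (T Z)) ^^ k) X" for k
  have CS: "C (Suc k) = fst (T (C k))" for k by (simp add: C_def)
  have cpx: "is_cpx A (C k)" for k
  proof (induction k)
    case 0 show ?case using X by (simp add: C_def)
  next
    case (Suc k) then show ?case using T[of "C k"] by (simp add: CS coghost_def)
  qed
  interpret injective_tower A C "\<lambda>k. snd (T (C k))" by unfold_locales (use cpx T in \<open>simp_all add: CS\<close>)
  have C0: "C 0 = X" by (simp add: C_def)
  note pr = pr_chain[unfolded C0] and ln = L_lifts_null[unfolded C0]
  let ?I = "cone L X pr"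
  have I: "is_cpx A ?I" by (rule cone_cpx[OF L_cpx X pr])
  have "embeds TYPE('u \<times> (nat \<Rightarrow> 'u)) TYPE('u)" by (intro universe_prod[OF large] universe_seq[OF large] embedsI[of id]) simp
  then interpret enc_loc "TYPE('u \<times> (nat \<Rightarrow> 'u))" "TYPE('u)" by (intro enc_loc.intro embeds_enc)
  let ?E = "enc_cpx ?I :: ('a, 'u) rcpx"
  have E: "is_cpx A ?E" by (rule enc_cpx_cpx[OF I])
  have "homotopic A N ?E c (\<lambda>n x. \<zero>[?E,n])" if N: "is_cpx A N" "acyclic_cpx N" and c: "chain_map A N ?E c" for N :: "('a, 'u) rcpx" and c
  proof -
    have dc: "chain_map A N ?I (\<lambda>n x. dec (c n x))" by (rule cm_comp[OF c dec_cm])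
    have z: "chain_map A N ?I (\<lambda>n x. \<zero>[?I,n])" by (rule cm_zero_map[OF I])
    have "homotopic A N ?E (\<lambda>n x. enc (dec (c n x) :: 'u \<times> (nat \<Rightarrow> 'u))) (\<lambda>n x. enc \<zero>[?I,n])"
      by (rule hmt_comp_left[OF cone_K_injective[OF X L_cpx pr ln N dc] N(1) I E dc z enc_cm])
    moreover have "homotopic A N ?E c (\<lambda>n x. enc (dec (c n x) :: 'u \<times> (nat \<Rightarrow> 'u)))"
      by (rule hmt_eqI[OF E c cm_comp[OF dc enc_cm] N(1)]) (use cm_closed[OF c] in force)
    ultimately show ?thesis using hmt_trans[OF _ _ E c cm_comp[OF dc enc_cm] cm_zero_map[OF E] N(1)] by simp
  qed
  then have "K_injective A ?E" using E unfolding K_injective_def by blast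
  moreover have "quasi_iso A X ?E (\<lambda>n x. enc (x, \<zero>[L,n + 1]))"
    by (rule qi_comp[OF X I E cone_incl_qi[OF X L_cpx L_acyclic pr] enc_qi[OF I]])
  ultimately show ?thesis by blast
qed

section \<open>The derived category\<close>

definition is_cat :: "('o, 'm, 'z) cat_scheme \<Rightarrow> bool" where
  "is_cat C \<longleftrightarrow> (\<forall>x \<in> Obj C. Idn C x \<in> hom_set C x x) \<and>
    (\<forall>x y f. f \<in> hom_set C x y \<longrightarrow> x \<in> Obj C \<and> y \<in> Obj C \<and> Cmp C f (Idn C x) = f \<and> Cmp C (Idn C y) f = f) \<and>
    (\<forall>x y z f g. f \<in> hom_set C x y \<longrightarrow> g \<in> hom_set C y z \<longrightarrow> Cmp C g f \<in> hom_set C x z) \<and>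
    (\<forall>x y z w f g h. f \<in> hom_set C x y \<longrightarrow> g \<in> hom_set C y z \<longrightarrow> h \<in> hom_set C z w \<longrightarrow>
      Cmp C h (Cmp C g f) = Cmp C (Cmp C h g) f)"

lemma is_cat_comp: "\<lbrakk>is_cat C; f \<in> hom_set C x y; g \<in> hom_set C y z\<rbrakk> \<Longrightarrow> Cmp C g f \<in> hom_set C x z" unfolding is_cat_def by blast

lemma is_cat_assoc:
  "\<lbrakk>is_cat C; f \<in> hom_set C x y; g \<in> hom_set C y z; h \<in> hom_set C z w\<rbrakk> \<Longrightarrow> Cmp C h (Cmp C g f) = Cmp C (Cmp C h g) f"
  unfolding is_cat_def by blast

lemma is_cat_id:
  assumes "is_cat C" "f \<in> hom_set C x y"
  shows "Cmp C f (Idn C x) = f" "Cmp C (Idn C y) f = f" "x \<in> Obj C" "y \<in> Obj C" using assms unfolding is_cat_def by blast+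

lemma is_cat_Idn: "\<lbrakk>is_cat C; x \<in> Obj C\<rbrakk> \<Longrightarrow> Idn C x \<in> hom_set C x x" unfolding is_cat_def by blast

section \<open>Arrows of the derived category as homotopy classes of chain maps\<close>

locale derived = A?: ring A for A :: "('a, 'x) ring_scheme" +
  fixes U :: "'u itself"
  assumes large: "large_universe TYPE('a) TYPE('u)"
begin

lemma inj_pair: "inj (enc :: 'u \<times> 'u \<Rightarrow> 'u)" by (rule embeds_enc[OF universe_pair[OF large]])

definition Kp :: "('a, 'u) rcpx \<Rightarrow> ('a, 'u) rcpx \<Rightarrow> ('u, 'u) gmap \<Rightarrow> bool" where
  "Kp X P s \<longleftrightarrow> is_cpx A X \<and> K_projective A P \<and> quasi_iso A P X s"

lemma KpD:
  assumes "Kp X P s"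
  shows "is_cpx A X" "K_projective A P" "quasi_iso A P X s" "is_cpx A P" "chain_map A P X s"
  using assms K_proj_cpx qi_cm unfolding Kp_def by blast+

lemma Kp_ex: assumes "is_cpx A X" obtains P and s where "Kp X P s"
  using K_projective_resolution[OF large assms] assms unfolding Kp_def by metis

lemma Kp_self: "K_projective A P \<Longrightarrow> Kp P P (\<lambda>n x. x)" by (simp add: Kp_def K_proj_cpx qi_id)

abbreviation RR :: "('a, 'u) roof set" where "RR \<equiv> roofs A"
abbreviation locU :: "('a, 'u) rcpx \<Rightarrow> ('a, 'u) rcpx \<Rightarrow> ('u, 'u) gmap \<Rightarrow> ('a, 'u) roof set" where "locU \<equiv> loc A"
abbreviation "hmt \<equiv> homotopic A"
abbreviation "RC X s P a Y \<equiv> roof_class A (X, s, P, a, Y :: ('a, 'u) rcpx)"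

lemma roofsI: "\<lbrakk>is_cpx A W; is_cpx A Y; Kp X P s; quasi_iso A W X t; chain_map A W Y f\<rbrakk> \<Longrightarrow> (X, t, W, f, Y) \<in> RR"
  by (simp add: roofs_def KpD)

lemma roof_equivI:
  fixes V W W' X Y :: "('a, 'u) rcpx"
  assumes "is_cpx A V" "chain_map A V W u" "chain_map A V W' u'" "quasi_iso A V X (\<lambda>n x. s n (u n x))"
    "hmt V X (\<lambda>n x. s n (u n x)) (\<lambda>n x. s' n (u' n x))" "hmt V Y (\<lambda>n x. f n (u n x)) (\<lambda>n x. f' n (u' n x))"
  shows "roof_equiv A (X, s, W, f, Y) (X, s', W', f', Y)" unfolding roof_equiv.simps comp_def using assms by blast

lemma Kp_lift:
  fixes W :: "('a, 'u) rcpx"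
  assumes "Kp X P s" "is_cpx A W" "quasi_iso A W X t"
  obtains u where "chain_map A P W u" "hmt P X (\<lambda>n x. t n (u n x)) s"
  using K_projective_lift[OF inj_pair KpD(2)[OF assms(1)] assms(2) KpD(1)[OF assms(1)] assms(3) KpD(5)[OF assms(1)]] .

lemma Kp_unique:
  fixes W :: "('a, 'u) rcpx"
  assumes K: "Kp X P s" and W: "is_cpx A W" and t: "quasi_iso A W X t" and u: "chain_map A P W u" and v: "chain_map A P W v"
    and hu: "hmt P X (\<lambda>n x. t n (u n x)) s" and hv: "hmt P X (\<lambda>n x. t n (v n x)) s"
  shows "hmt P W u v"
proof (rule K_projective_lift_unique[OF inj_pair KpD(2)[OF K] W KpD(1)[OF K] t u v])
  note X = KpD(1)[OF K] and P = KpD(4)[OF K] and s = KpD(5)[OF K] and tc = qi_cm[OF t]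
  show "hmt P X (\<lambda>n x. t n (u n x)) (\<lambda>n x. t n (v n x))"
    by (rule hmt_trans[OF hu hmt_sym[OF hv X cm_comp[OF v tc] s P] X cm_comp[OF u tc] s cm_comp[OF v tc] P])
qed

text \<open>\<open>roof_equiv\<close> allows an arbitrary common refinement V. As V -> X is a
  quasi-isomorphism, the K-projective P maps back into V compatibly, so P itself can serve as the
  refinement.\<close>

lemma mem_RC:
  assumes K: "Kp X P s" and Y: "is_cpx A Y" and a: "chain_map A P Y a" and r: "(X, t, W, f, Y) \<in> RR"
  shows "(X, t, W, f, Y) \<in> RC X s P a Y \<longleftrightarrow>
    (\<exists>u. chain_map A P W u \<and> hmt P X (\<lambda>n x. t n (u n x)) s \<and> hmt P Y (\<lambda>n x. f n (u n x)) a)"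
    (is "?l \<longleftrightarrow> ?r")
proof
  note X = KpD(1)[OF K] and P = KpD(4)[OF K] and s = KpD(5)[OF K] and sq = KpD(3)[OF K]
  have W: "is_cpx A W" and tq: "quasi_iso A W X t" and f: "chain_map A W Y f" using r by (auto simp: roofs_def)
  note tc = qi_cm[OF tq]
  { assume ?l
    then have "roof_equiv A (X, s, P, a, Y) (X, t, W, f, Y)" by (simp add: roof_class_def)
    then obtain V :: "('a, 'u) rcpx" and v v' where V: "is_cpx A V" and v: "chain_map A V P v" and v': "chain_map A V W v'"
      and svq: "quasi_iso A V X (s \<circ>\<^sub>c v)" and h: "hmt V X (s \<circ>\<^sub>c v) (t \<circ>\<^sub>c v')" and h': "hmt V Y (a \<circ>\<^sub>c v) (f \<circ>\<^sub>c v')" by auto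
    note svq = svq[unfolded comp_def] and h = h[unfolded comp_def] and h' = h'[unfolded comp_def]
    obtain w where w: "chain_map A P V w" "hmt P X (\<lambda>n x. s n (v n (w n x))) s" by (rule Kp_lift[OF K V svq])
    have vw: "chain_map A P P (\<lambda>n x. v n (w n x))" "chain_map A P W (\<lambda>n x. v' n (w n x))"
      by (rule cm_comp[OF w(1) v], rule cm_comp[OF w(1) v'])
    have svw: "chain_map A P X (\<lambda>n x. s n (v n (w n x)))" by (rule cm_comp[OF vw(1) s])
    \<comment> \<open>Both maps are lifts of \<open>s\<close> through \<open>s\<close>, hence
      homotopic.\<close>
    have "hmt P P (\<lambda>n x. v n (w n x)) (\<lambda>n x. x)" by (rule Kp_unique[OF K P sq vw(1) cm_id w(2) hmt_refl[OF P X s]])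
    then have 1: "hmt P Y (\<lambda>n x. a n (v n (w n x))) a" by (rule hmt_comp_left[OF _ P P Y vw(1) cm_id a])
    have 2: "hmt P Y (\<lambda>n x. a n (v n (w n x))) (\<lambda>n x. f n (v' n (w n x)))"
      by (rule hmt_comp_right[OF h' V Y P cm_comp[OF v a] cm_comp[OF v' f] w(1)])
    note c1 = cm_comp[OF vw(1) a] and c2 = cm_comp[OF vw(2) f]
    have 3: "hmt P Y (\<lambda>n x. f n (v' n (w n x))) a" by (rule hmt_trans[OF hmt_sym[OF 2 Y c1 c2 P] 1 Y c2 c1 a P])
    have 4: "hmt P X (\<lambda>n x. s n (v n (w n x))) (\<lambda>n x. t n (v' n (w n x)))"
      by (rule hmt_comp_right[OF h V X P cm_comp[OF v s] cm_comp[OF v' tc] w(1)])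
    note c3 = cm_comp[OF vw(2) tc]
    have "hmt P X (\<lambda>n x. t n (v' n (w n x))) s" by (rule hmt_trans[OF hmt_sym[OF 4 X svw c3 P] w(2) X c3 svw s P])
    with 3 vw(2) show ?r by blast
  next
    assume ?r
    then obtain u where u: "chain_map A P W u" "hmt P X (\<lambda>n x. t n (u n x)) s" "hmt P Y (\<lambda>n x. f n (u n x)) a" by blast
    have "roof_equiv A (X, s, P, a, Y) (X, t, W, f, Y)" by (rule roof_equivI[OF P cm_id u(1) sq hmt_sym[OF u(2) X cm_comp[OF u(1) tc] s P]
        hmt_sym[OF u(3) Y cm_comp[OF u(1) f] a P]])
    then show ?l using r by (simp add: roof_class_def) }
qed

lemma roof_class_self:
  assumes r: "(X, t, W, f, Y) \<in> RR" shows "(X, t, W, f, Y) \<in> roof_class A (X, t, W, f, Y)"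
proof -
  have X: "is_cpx A X" and W: "is_cpx A W" and Y: "is_cpx A Y" and t: "quasi_iso A W X t" and f: "chain_map A W Y f"
    using r by (auto simp: roofs_def)
  have "roof_equiv A (X, t, W, f, Y) (X, t, W, f, Y)"
    by (rule roof_equivI[OF W cm_id cm_id t hmt_refl[OF W X qi_cm[OF t]] hmt_refl[OF W Y f]])
  then show ?thesis using r by (simp add: roof_class_def)
qed

text \<open>With a fixed K-projective resolution \<open>s : P \<rightarrow> X\<close>, arrows \<open>X \<rightarrow> Y\<close> are homotopy classes of maps
  \<open>a : P \<rightarrow> Y\<close>.\<close>

lemma roof_class_eq_RC:
  assumes K: "Kp X P s" and r: "(X, t, W, f, Y) \<in> RR"
    and u: "chain_map A P W u" and hu: "hmt P X (\<lambda>n x. t n (u n x)) s" and a: "chain_map A P Y a" and ha: "hmt P Y (\<lambda>n x. f n (u n x)) a"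
  shows "roof_class A (X, t, W, f, Y) = RC X s P a Y"
proof -
  note X = KpD(1)[OF K] and P = KpD(4)[OF K] and s = KpD(5)[OF K] and sq = KpD(3)[OF K]
  have W: "is_cpx A W" and Y: "is_cpx A Y" and tq: "quasi_iso A W X t" and f: "chain_map A W Y f" using r by (auto simp: roofs_def)
  note tc = qi_cm[OF tq]
  have "roof_equiv A (X, t, W, f, Y) (X', t', W', f', Y') \<longleftrightarrow> roof_equiv A (X, s, P, a, Y) (X', t', W', f', Y')"
    if r': "(X', t', W', f', Y') \<in> RR" for X' t' W' f' Y'
  proof (cases "X' = X \<and> Y' = Y")
    case True
    then have [simp]: "X' = X" "Y' = Y" by auto
    note r' = r'[simplified]
    have W': "is_cpx A W'" and tq': "quasi_iso A W' X t'" and f': "chain_map A W' Y f'" using r' by (auto simp: roofs_def)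
    note tc' = qi_cm[OF tq']
    have "roof_equiv A (X, s, P, a, Y) (X, t', W', f', Y) \<longleftrightarrow>
      (\<exists>u'. chain_map A P W' u' \<and> hmt P X (\<lambda>n x. t' n (u' n x)) s \<and> hmt P Y (\<lambda>n x. f' n (u' n x)) a)"
      using mem_RC[OF K Y a r'] r' by (simp add: roof_class_def del: roof_equiv.simps)
    also have "\<dots> \<longleftrightarrow> roof_equiv A (X, t, W, f, Y) (X, t', W', f', Y)"
    proof
      assume "\<exists>u'. chain_map A P W' u' \<and> hmt P X (\<lambda>n x. t' n (u' n x)) s \<and> hmt P Y (\<lambda>n x. f' n (u' n x)) a"
      then obtain u' where u': "chain_map A P W' u'" "hmt P X (\<lambda>n x. t' n (u' n x)) s" "hmt P Y (\<lambda>n x. f' n (u' n x)) a" by blast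
      have "quasi_iso A P X (\<lambda>n x. t n (u n x))" by (rule qi_hmt[OF hmt_sym[OF hu X cm_comp[OF u tc] s P] P X sq cm_comp[OF u tc]])
      from roof_equivI[OF P u u'(1) this]
      have "hmt P X (\<lambda>n x. t n (u n x)) (\<lambda>n x. t' n (u' n x)) \<Longrightarrow> hmt P Y (\<lambda>n x. f n (u n x)) (\<lambda>n x. f' n (u' n x)) \<Longrightarrow>
        roof_equiv A (X, t, W, f, Y) (X, t', W', f', Y)" .
      moreover have "hmt P X (\<lambda>n x. t n (u n x)) (\<lambda>n x. t' n (u' n x))"
        by (rule hmt_trans[OF hu hmt_sym[OF u'(2) X cm_comp[OF u'(1) tc'] s P] X
          cm_comp[OF u tc] s cm_comp[OF u'(1) tc'] P])
      moreover have "hmt P Y (\<lambda>n x. f n (u n x)) (\<lambda>n x. f' n (u' n x))"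
        by (rule hmt_trans[OF ha hmt_sym[OF u'(3) Y cm_comp[OF u'(1) f'] a P] Y
          cm_comp[OF u f] a cm_comp[OF u'(1) f'] P])
      ultimately show "roof_equiv A (X, t, W, f, Y) (X, t', W', f', Y)" by blast
    next
      assume "roof_equiv A (X, t, W, f, Y) (X, t', W', f', Y)"
      then obtain V :: "('a, 'u) rcpx" and v v' where V: "is_cpx A V" and v: "chain_map A V W v" and v': "chain_map A V W' v'"
        and svq: "quasi_iso A V X (t \<circ>\<^sub>c v)" and h: "hmt V X (t \<circ>\<^sub>c v) (t' \<circ>\<^sub>c v')" and h': "hmt V Y (f \<circ>\<^sub>c v) (f' \<circ>\<^sub>c v')" by auto
      note svq = svq[unfolded comp_def] and h = h[unfolded comp_def] and h' = h'[unfolded comp_def]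
      obtain w where w: "chain_map A P V w" "hmt P X (\<lambda>n x. t n (v n (w n x))) s" by (rule Kp_lift[OF K V svq])
      note vw = cm_comp[OF w(1) v] and vw' = cm_comp[OF w(1) v']
      have "hmt P W (\<lambda>n x. v n (w n x)) u" by (rule Kp_unique[OF K W tq vw u w(2) hu])
      then have 1: "hmt P Y (\<lambda>n x. f n (v n (w n x))) (\<lambda>n x. f n (u n x))" by (rule hmt_comp_left[OF _ P W Y vw u f])
      have 2: "hmt P Y (\<lambda>n x. f n (v n (w n x))) (\<lambda>n x. f' n (v' n (w n x)))"
        by (rule hmt_comp_right[OF h' V Y P cm_comp[OF v f] cm_comp[OF v' f'] w(1)])
      note c1 = cm_comp[OF vw f] and c2 = cm_comp[OF vw' f'] and c3 = cm_comp[OF u f]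
      have 3: "hmt P Y (\<lambda>n x. f' n (v' n (w n x))) a"
        by (rule hmt_trans[OF hmt_sym[OF 2 Y c1 c2 P] hmt_trans[OF 1 ha Y c1 c3 a P] Y c2 c1 a P])
      have 4: "hmt P X (\<lambda>n x. t n (v n (w n x))) (\<lambda>n x. t' n (v' n (w n x)))"
        by (rule hmt_comp_right[OF h V X P cm_comp[OF v tc] cm_comp[OF v' tc'] w(1)])
      have 5: "hmt P X (\<lambda>n x. t' n (v' n (w n x))) s" by (rule hmt_trans[OF hmt_sym[OF 4 X cm_comp[OF vw tc] cm_comp[OF vw' tc'] P] w(2) X
          cm_comp[OF vw' tc'] cm_comp[OF vw tc] s P])
      show "\<exists>u'. chain_map A P W' u' \<and> hmt P X (\<lambda>n x. t' n (u' n x)) s \<and> hmt P Y (\<lambda>n x. f' n (u' n x)) a" using vw' 3 5 by blast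
    qed
    finally show ?thesis by simp
  qed auto
  then show ?thesis unfolding roof_class_def by (auto simp del: roof_equiv.simps)
qed

text \<open>Together with \<open>Hom_RC\<close> this identifies the arrows from X to Y with the
  homotopy classes of chain maps from P to Y, so equalities of arrows can be checked as
  homotopies.\<close>

lemma RC_eq_iff:
  assumes K: "Kp X P s" and Y: "is_cpx A Y" and a: "chain_map A P Y a" and b: "chain_map A P Y b"
  shows "RC X s P a Y = RC X s P b Y \<longleftrightarrow> hmt P Y a b"
proof
  note X = KpD(1)[OF K] and P = KpD(4)[OF K] and s = KpD(5)[OF K] and sq = KpD(3)[OF K]
  have r: "(X, s, P, a, Y) \<in> RR" by (rule roofsI[OF P Y K sq a])
  { assume "hmt P Y a b"
    then show "RC X s P a Y = RC X s P b Y" by (rule roof_class_eq_RC[OF K r cm_id hmt_refl[OF P X s] b])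
  next
    assume "RC X s P a Y = RC X s P b Y"
    then have "(X, s, P, a, Y) \<in> RC X s P b Y" using roof_class_self[OF r] by simp
    then obtain u where u: "chain_map A P P u" "hmt P X (\<lambda>n x. s n (u n x)) s" "hmt P Y (\<lambda>n x. a n (u n x)) b"
      unfolding mem_RC[OF K Y b r] by blast
    have "hmt P P u (\<lambda>n x. x)" by (rule Kp_unique[OF K P sq u(1) cm_id u(2) hmt_refl[OF P X s]])
    then have "hmt P Y (\<lambda>n x. a n (u n x)) a" by (rule hmt_comp_left[OF _ P P Y u(1) cm_id a])
    then show "hmt P Y a b" by (rule hmt_trans[OF hmt_sym[OF _ Y cm_comp[OF u(1) a] a P] u(3) Y a cm_comp[OF u(1) a] b P])
  }
qed

abbreviation "D \<equiv> dercat_cat A :: (('a, 'u) rcpx, ('a, 'u) roof set) cat"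
abbreviation "Hom \<equiv> hom_set D"

lemma roof_dom_cod:
  assumes "(X, t, W, f, Y) \<in> RR"
  shows "roof_dom (roof_class A (X, t, W, f, Y)) = X" "roof_cod (roof_class A (X, t, W, f, Y)) = Y"
proof -
  have 1: "(X', t', W', f', Y') \<in> roof_class A (X, t, W, f, Y) \<Longrightarrow> X' = X \<and> Y' = Y" for X' t' W' f' Y' by (auto simp: roof_class_def)
  note 2 = roof_class_self[OF assms]
  show "roof_dom (roof_class A (X, t, W, f, Y)) = X" unfolding roof_dom_def by (rule the_equality) (use 1 2 in blast)+
  show "roof_cod (roof_class A (X, t, W, f, Y)) = Y" unfolding roof_cod_def by (rule the_equality) (use 1 2 in blast)+
qed

lemma Hom_iff: "\<alpha> \<in> Hom X Y \<longleftrightarrow> (\<exists>t W f. (X, t, W, f, Y) \<in> RR \<and> \<alpha> = roof_class A (X, t, W, f, Y))"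
proof
  assume "\<alpha> \<in> Hom X Y"
  then obtain r where r: "r \<in> RR" "\<alpha> = roof_class A r" "roof_dom \<alpha> = X" "roof_cod \<alpha> = Y" by (auto simp: hom_set_def dercat_cat_def)
  obtain X' t W f Y' where rr: "r = (X', t, W, f, Y')" by (cases r)
  show "\<exists>t W f. (X, t, W, f, Y) \<in> RR \<and> \<alpha> = roof_class A (X, t, W, f, Y)" using r roof_dom_cod[of X' t W f Y'] unfolding rr by auto
next
  assume "\<exists>t W f. (X, t, W, f, Y) \<in> RR \<and> \<alpha> = roof_class A (X, t, W, f, Y)"
  then show "\<alpha> \<in> Hom X Y" using roof_dom_cod by (auto simp: hom_set_def dercat_cat_def)
qed

lemma Hom_obj: assumes "\<alpha> \<in> Hom X Y" shows "is_cpx A X" "is_cpx A Y" using assms by (auto simp: Hom_iff roofs_def)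

lemma Hom_dom_cod: assumes "\<alpha> \<in> Hom X Y" shows "roof_dom \<alpha> = X" "roof_cod \<alpha> = Y" using assms roof_dom_cod by (auto simp: Hom_iff)

lemma Hom_RC:
  assumes K: "Kp X P s" and "\<alpha> \<in> Hom X Y"
  obtains a where "chain_map A P Y a" "\<alpha> = RC X s P a Y"
proof -
  obtain t W f where r: "(X, t, W, f, Y) \<in> RR" and al: "\<alpha> = roof_class A (X, t, W, f, Y)" using assms(2) by (auto simp: Hom_iff)
  have W: "is_cpx A W" and Y: "is_cpx A Y" and tq: "quasi_iso A W X t" and f: "chain_map A W Y f" using r by (auto simp: roofs_def)
  obtain u where u: "chain_map A P W u" "hmt P X (\<lambda>n x. t n (u n x)) s" by (rule Kp_lift[OF K W tq])
  note a = cm_comp[OF u(1) f]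
  show ?thesis using roof_class_eq_RC[OF K r u a hmt_refl[OF KpD(4)[OF K] Y a]] by (intro that[OF a]) (simp add: al)
qed

lemma RC_Hom: "\<lbrakk>Kp X P s; is_cpx A Y; chain_map A P Y a\<rbrakk> \<Longrightarrow> RC X s P a Y \<in> Hom X Y"
  unfolding Hom_iff by (rule exI, rule exI, rule exI, rule conjI[OF roofsI[OF KpD(4) _ _ KpD(3)] refl])

text \<open>\<open>roof_comp\<close> collects the roofs of all completing squares over all
  representatives. Every such square gives the same class, because P lifts to its apex U and the two
  resulting maps from P to V are homotopic by uniqueness of lifts. The square with apex P and leg
  \<open>c\<close> shows that the collection is not empty.\<close>

lemma comp_RC:
  assumes K: "Kp X P s" and K': "Kp Y Q t" and Z: "is_cpx A Z" and a: "chain_map A P Y a" and b: "chain_map A Q Z b"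
    and c: "chain_map A P Q c" and hc: "hmt P Y (\<lambda>n x. t n (c n x)) a"
  shows "roof_comp A (RC Y t Q b Z) (RC X s P a Y) = RC X s P (\<lambda>n x. b n (c n x)) Z"
proof -
  note X = KpD(1)[OF K] and P = KpD(4)[OF K] and s = KpD(5)[OF K] and sq = KpD(3)[OF K]
  note Y = KpD(1)[OF K'] and Q = KpD(4)[OF K'] and t = KpD(5)[OF K'] and tq = KpD(3)[OF K']
  note bc = cm_comp[OF c b]
  let ?R = "RC X s P (\<lambda>n x. b n (c n x)) Z"
  have cand: "roof_class A (X, t1 \<circ>\<^sub>c t', U, g \<circ>\<^sub>c f', Z') = ?R \<and> Z' = Z \<and> X' = X"
    if al: "(X', t1, W, f, Y') \<in> RC X s P a Y" and be: "(Y', t2, V, g, Z') \<in> RC Y t Q b Z"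
      and U: "is_cpx A U" and t': "quasi_iso A U W t'" and f': "chain_map A U V f'" and h: "hmt U Y' (f \<circ>\<^sub>c t') (t2 \<circ>\<^sub>c f')"
    for X' t1 W f Y' t2 V g Z' U t' f'
  proof -
    have eq: "X' = X" "Y' = Y" "Z' = Z" and r1: "(X, t1, W, f, Y) \<in> RR" and r2: "(Y, t2, V, g, Z) \<in> RR"
      using al be by (auto simp: roof_class_def)
    have W: "is_cpx A W" and t1: "quasi_iso A W X t1" and f: "chain_map A W Y f" using r1 by (auto simp: roofs_def)
    have V: "is_cpx A V" and t2: "quasi_iso A V Y t2" and g: "chain_map A V Z g" using r2 by (auto simp: roofs_def)
    note t1c = qi_cm[OF t1] and t2c = qi_cm[OF t2] and t'c = qi_cm[OF t']
    note h = h[unfolded comp_def eq]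
    obtain u where u: "chain_map A P W u" "hmt P X (\<lambda>n x. t1 n (u n x)) s" "hmt P Y (\<lambda>n x. f n (u n x)) a"
      using al[unfolded eq] unfolding mem_RC[OF K Y a r1] by blast
    obtain v where v: "chain_map A Q V v" "hmt Q Y (\<lambda>n x. t2 n (v n x)) t" "hmt Q Z (\<lambda>n x. g n (v n x)) b"
      using be[unfolded eq] unfolding mem_RC[OF K' Z b r2] by blast
    have q: "quasi_iso A U X (\<lambda>n x. t1 n (t' n x))" by (rule qi_comp[OF U W X t' t1])
    obtain w where w: "chain_map A P U w" "hmt P X (\<lambda>n x. t1 n (t' n (w n x))) s" by (rule Kp_lift[OF K U q])
    note tw = cm_comp[OF w(1) t'c] and fw = cm_comp[OF w(1) f'] and vc = cm_comp[OF c v(1)]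
    have "hmt P W (\<lambda>n x. t' n (w n x)) u" by (rule Kp_unique[OF K W t1 tw u(1) w(2) u(2)])
    then have 1: "hmt P Y (\<lambda>n x. f n (t' n (w n x))) (\<lambda>n x. f n (u n x))" by (rule hmt_comp_left[OF _ P W Y tw u(1) f])
    have 2: "hmt P Y (\<lambda>n x. f n (t' n (w n x))) (\<lambda>n x. t2 n (f' n (w n x)))"
      by (rule hmt_comp_right[OF h U Y P cm_comp[OF t'c f] cm_comp[OF f' t2c] w(1)])
    have 3: "hmt P Y (\<lambda>n x. t2 n (v n (c n x))) (\<lambda>n x. t n (c n x))" by (rule hmt_comp_right[OF v(2) Q Y P cm_comp[OF v(1) t2c] t c])
    note c1 = cm_comp[OF tw f] and c2 = cm_comp[OF fw t2c] and c3 = cm_comp[OF vc t2c] and c4 = cm_comp[OF c t]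
      and c5 = cm_comp[OF u(1) f]
    have 4: "hmt P Y (\<lambda>n x. t2 n (f' n (w n x))) a"
      by (rule hmt_trans[OF hmt_sym[OF 2 Y c1 c2 P] hmt_trans[OF 1 u(3) Y c1 c5 a P] Y c2 c1 a P])
    have 5: "hmt P Y (\<lambda>n x. t2 n (v n (c n x))) a" by (rule hmt_trans[OF 3 hc Y c3 c4 a P])
    \<comment> \<open>After composition with the quasi-isomorphism \<open>t2\<close> both maps
      become homotopic to \<open>a\<close>; maps out of the K-projective P allow \<open>t2\<close>
      to be cancelled.\<close>
    have "hmt P V (\<lambda>n x. f' n (w n x)) (\<lambda>n x. v n (c n x))"
      by (rule K_projective_lift_unique[OF inj_pair KpD(2)[OF K] V Y t2 fw vc hmt_trans[OF 4 hmt_sym[OF 5 Y c3 a P] Y c2 a c3 P]])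
    then have 6: "hmt P Z (\<lambda>n x. g n (f' n (w n x))) (\<lambda>n x. g n (v n (c n x)))" by (rule hmt_comp_left[OF _ P V Z fw vc g])
    have 7: "hmt P Z (\<lambda>n x. g n (v n (c n x))) (\<lambda>n x. b n (c n x))" by (rule hmt_comp_right[OF v(3) Q Z P cm_comp[OF v(1) g] b c])
    have 8: "hmt P Z (\<lambda>n x. g n (f' n (w n x))) (\<lambda>n x. b n (c n x))" by (rule hmt_trans[OF 6 7 Z cm_comp[OF fw g] cm_comp[OF vc g] bc P])
    have "(X, \<lambda>n x. t1 n (t' n x), U, \<lambda>n x. g n (f' n x), Z) \<in> RR" by (rule roofsI[OF U Z K q cm_comp[OF f' g]])
    from roof_class_eq_RC[OF K this w bc 8] eq show ?thesis by (simp add: comp_def)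
  qed
  have r1: "(X, s, P, a, Y) \<in> RC X s P a Y" by (rule roof_class_self[OF roofsI[OF P Y K sq a]])
  have r2: "(Y, t, Q, b, Z) \<in> RC Y t Q b Z" by (rule roof_class_self[OF roofsI[OF Q Z K' tq b]])
  have i: "quasi_iso A P P (\<lambda>n x. x)" by (rule qi_id[OF P])
  have h: "hmt P Y (a \<circ>\<^sub>c (\<lambda>n x. x)) (t \<circ>\<^sub>c c)" using hmt_sym[OF hc Y cm_comp[OF c t] a P] by (simp add: comp_def)
  show ?thesis
  proof (intro Set.set_eqI iffI)
    fix \<tau> assume "\<tau> \<in> roof_comp A (RC Y t Q b Z) (RC X s P a Y)"
    then obtain X' s' W' f' Y' t2 V g Z' U t' f'' where c: "(X', s', W', f', Y') \<in> RC X s P a Y" "(Y', t2, V, g, Z') \<in> RC Y t Q b Z"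
       "is_cpx A U" "quasi_iso A U W' t'" "chain_map A U V f''" "hmt U Y' (f' \<circ>\<^sub>c t') (t2 \<circ>\<^sub>c f'')"
       and \<tau>: "\<tau> \<in> roof_class A (X', s' \<circ>\<^sub>c t', U, g \<circ>\<^sub>c f'', Z')" unfolding roof_comp_def by blast
    have "X' = X" using cand[OF c] by (elim conjE)
    moreover have "roof_class A (X, s' \<circ>\<^sub>c t', U, g \<circ>\<^sub>c f'', Z') = ?R" using cand[OF c] by (rule conjunct1)
    ultimately show "\<tau> \<in> ?R" using \<tau> by blast
  next
    fix \<tau> assume \<tau>: "\<tau> \<in> ?R"
    have "\<tau> \<in> roof_class A (X, s \<circ>\<^sub>c (\<lambda>n x. x), P, b \<circ>\<^sub>c c, Z)" using \<tau> by (simp add: comp_def)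
    then show "\<tau> \<in> roof_comp A (RC Y t Q b Z) (RC X s P a Y)" unfolding roof_comp_def using r1 r2 P i c h by blast
  qed
qed

lemma comp_RC_ex:
  assumes K: "Kp X P s" and K': "Kp Y Q t" and Z: "is_cpx A Z" and a: "chain_map A P Y a" and b: "chain_map A Q Z b"
  obtains c where "chain_map A P Q c" "hmt P Y (\<lambda>n x. t n (c n x)) a"
    "roof_comp A (RC Y t Q b Z) (RC X s P a Y) = RC X s P (\<lambda>n x. b n (c n x)) Z"
proof -
  obtain c where c: "chain_map A P Q c" "hmt P Y (\<lambda>n x. t n (c n x)) a"
    by (rule K_projective_lift[OF inj_pair KpD(2)[OF K] KpD(4)[OF K'] KpD(1)[OF K'] KpD(3)[OF K'] a])
  show ?thesis by (rule that[OF c comp_RC[OF assms c]])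
qed

lemma loc_RC:
  assumes K: "Kp X P s" and Y: "is_cpx A Y" and f: "chain_map A X Y f"
  shows "locU X Y f = RC X s P (\<lambda>n x. f n (s n x)) Y"
proof -
  note X = KpD(1)[OF K] and P = KpD(4)[OF K] and s = KpD(5)[OF K]
  have r: "(X, \<lambda>n x. x, X, f, Y) \<in> RR" by (rule roofsI[OF X Y K qi_id[OF X] f])
  show ?thesis unfolding loc_def by (rule roof_class_eq_RC[OF K r s hmt_refl[OF P X s] cm_comp[OF s f] hmt_refl[OF P Y cm_comp[OF s f]]])
qed

lemma loc_Hom: "\<lbrakk>is_cpx A X; is_cpx A Y; chain_map A X Y f\<rbrakk> \<Longrightarrow> locU X Y f \<in> Hom X Y"
proof -
  assume X: "is_cpx A X" and Y: "is_cpx A Y" and f: "chain_map A X Y f"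
  obtain P s where K: "Kp X P s" by (rule Kp_ex[OF X])
  show ?thesis unfolding loc_RC[OF K Y f] by (rule RC_Hom[OF K Y cm_comp[OF KpD(5)[OF K] f]])
qed

lemma loc_hmt:
  assumes X: "is_cpx A X" and Y: "is_cpx A Y" and f: "chain_map A X Y f" and g: "chain_map A X Y g" and h: "hmt X Y f g"
  shows "locU X Y f = locU X Y g"
proof -
  obtain P s where K: "Kp X P s" by (rule Kp_ex[OF X])
  note P = KpD(4)[OF K] and s = KpD(5)[OF K]
  show ?thesis unfolding loc_RC[OF K Y f] loc_RC[OF K Y g] RC_eq_iff[OF K Y cm_comp[OF s f] cm_comp[OF s g]]
    by (rule hmt_comp_right[OF h X Y P f g s])
qed

lemma loc_comp:
  assumes X: "is_cpx A X" and Y: "is_cpx A Y" and Z: "is_cpx A Z" and f: "chain_map A X Y f" and g: "chain_map A Y Z g"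
  shows "roof_comp A (locU Y Z g) (locU X Y f) = locU X Z (\<lambda>n x. g n (f n x))"
proof -
  obtain P s where K: "Kp X P s" by (rule Kp_ex[OF X])
  obtain Q t where K': "Kp Y Q t" by (rule Kp_ex[OF Y])
  note P = KpD(4)[OF K] and s = KpD(5)[OF K] and Q = KpD(4)[OF K'] and t = KpD(5)[OF K']
  note fs = cm_comp[OF s f] and gt = cm_comp[OF t g]
  obtain c where c: "chain_map A P Q c" "hmt P Y (\<lambda>n x. t n (c n x)) (\<lambda>n x. f n (s n x))"
    "roof_comp A (RC Y t Q (\<lambda>n x. g n (t n x)) Z) (RC X s P (\<lambda>n x. f n (s n x)) Y) = RC X s P (\<lambda>n x. g n (t n (c n x))) Z"
    by (rule comp_RC_ex[OF K K' Z fs gt])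
  have "hmt P Z (\<lambda>n x. g n (t n (c n x))) (\<lambda>n x. g n (f n (s n x)))" by (rule hmt_comp_left[OF c(2) P Y Z cm_comp[OF c(1) t] fs g])
  then show ?thesis unfolding loc_RC[OF K Y f] loc_RC[OF K' Z g] loc_RC[OF K Z cm_comp[OF f g]] c(3)
    by (subst RC_eq_iff[OF K Z cm_comp[OF cm_comp[OF c(1) t] g] cm_comp[OF fs g]])
qed

lemma is_cat_D: "is_cat D"
proof -
  have sel: "Obj D = {X. is_cpx A X}" "Cmp D = roof_comp A" "Idn D X = locU X X (\<lambda>n x. x)" for X by (simp_all add: dercat_cat_def)
  have idn: "roof_comp A \<alpha> (locU X X (\<lambda>n x. x)) = \<alpha> \<and> roof_comp A (locU Y Y (\<lambda>n x. x)) \<alpha> = \<alpha>" if al: "\<alpha> \<in> Hom X Y" for \<alpha> X Y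
  proof -
    note X = Hom_obj(1)[OF al] and Y = Hom_obj(2)[OF al]
    obtain P s where K: "Kp X P s" by (rule Kp_ex[OF X])
    obtain Q t where K': "Kp Y Q t" by (rule Kp_ex[OF Y])
    note P = KpD(4)[OF K] and s = KpD(5)[OF K] and Q = KpD(4)[OF K'] and t = KpD(5)[OF K']
    obtain a where a: "chain_map A P Y a" "\<alpha> = RC X s P a Y" by (rule Hom_RC[OF K al])
    obtain c where c: "chain_map A P Q c" "hmt P Y (\<lambda>n x. t n (c n x)) a"
      "roof_comp A (RC Y t Q t Y) (RC X s P a Y) = RC X s P (\<lambda>n x. t n (c n x)) Y" by (rule comp_RC_ex[OF K K' Y a(1) t])
    have "roof_comp A (RC X s P a Y) (RC X s P s X) = RC X s P a Y" by (rule comp_RC[OF K K Y s a(1) cm_id hmt_refl[OF P X s]])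
    moreover have "roof_comp A (RC Y t Q t Y) (RC X s P a Y) = RC X s P a Y"
      unfolding c(3) RC_eq_iff[OF K Y cm_comp[OF c(1) t] a(1)] by (rule c(2))
    ultimately show ?thesis by (simp add: loc_RC[OF K X cm_id] loc_RC[OF K' Y cm_id] a(2))
  qed
  have cl: "roof_comp A \<beta> \<alpha> \<in> Hom X Z" if al: "\<alpha> \<in> Hom X Y" and be: "\<beta> \<in> Hom Y Z" for \<alpha> \<beta> X Y Z
  proof -
    note X = Hom_obj(1)[OF al] and Y = Hom_obj(2)[OF al] and Z = Hom_obj(2)[OF be]
    obtain P s where K: "Kp X P s" by (rule Kp_ex[OF X])
    obtain Q t where K': "Kp Y Q t" by (rule Kp_ex[OF Y])
    obtain a where a: "chain_map A P Y a" "\<alpha> = RC X s P a Y" by (rule Hom_RC[OF K al])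
    obtain b where b: "chain_map A Q Z b" "\<beta> = RC Y t Q b Z" by (rule Hom_RC[OF K' be])
    obtain c where c: "chain_map A P Q c" "hmt P Y (\<lambda>n x. t n (c n x)) a"
      "roof_comp A (RC Y t Q b Z) (RC X s P a Y) = RC X s P (\<lambda>n x. b n (c n x)) Z" by (rule comp_RC_ex[OF K K' Z a(1) b(1)])
    show ?thesis unfolding a(2) b(2) c(3) by (rule RC_Hom[OF K Z cm_comp[OF c(1) b(1)]])
  qed
  have as: "roof_comp A \<gamma> (roof_comp A \<beta> \<alpha>) = roof_comp A (roof_comp A \<gamma> \<beta>) \<alpha>"
    if al: "\<alpha> \<in> Hom X Y" and be: "\<beta> \<in> Hom Y Z" and ga: "\<gamma> \<in> Hom Z T" for \<alpha> \<beta> \<gamma> X Y Z T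
  proof -
    note X = Hom_obj(1)[OF al] and Y = Hom_obj(2)[OF al] and Z = Hom_obj(2)[OF be] and T = Hom_obj(2)[OF ga]
    obtain P s where K: "Kp X P s" by (rule Kp_ex[OF X])
    obtain Q t where K': "Kp Y Q t" by (rule Kp_ex[OF Y])
    obtain R r where K'': "Kp Z R r" by (rule Kp_ex[OF Z])
    obtain a where a: "chain_map A P Y a" "\<alpha> = RC X s P a Y" by (rule Hom_RC[OF K al])
    obtain b where b: "chain_map A Q Z b" "\<beta> = RC Y t Q b Z" by (rule Hom_RC[OF K' be])
    obtain g where g: "chain_map A R T g" "\<gamma> = RC Z r R g T" by (rule Hom_RC[OF K'' ga])
    obtain c where c: "chain_map A P Q c" "hmt P Y (\<lambda>n x. t n (c n x)) a"
      "roof_comp A (RC Y t Q b Z) (RC X s P a Y) = RC X s P (\<lambda>n x. b n (c n x)) Z" by (rule comp_RC_ex[OF K K' Z a(1) b(1)])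
    obtain d where d: "chain_map A Q R d" "hmt Q Z (\<lambda>n x. r n (d n x)) b"
      "roof_comp A (RC Z r R g T) (RC Y t Q b Z) = RC Y t Q (\<lambda>n x. g n (d n x)) T" by (rule comp_RC_ex[OF K' K'' T b(1) g(1)])
    have h: "hmt P Z (\<lambda>n x. r n (d n (c n x))) (\<lambda>n x. b n (c n x))"
      by (rule hmt_comp_right[OF d(2) KpD(4)[OF K'] Z KpD(4)[OF K] cm_comp[OF d(1) KpD(5)[OF K'']] b(1) c(1)])
    show ?thesis unfolding a(2) b(2) g(2) c(3) d(3) comp_RC[OF K K'' T cm_comp[OF c(1) b(1)] g(1) cm_comp[OF c(1) d(1)] h]
        comp_RC[OF K K' T a(1) cm_comp[OF d(1) g(1)] c(1,2)] ..
  qed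
  have i: "locU X X (\<lambda>n x. x) \<in> Hom X X" if "is_cpx A X" for X by (rule loc_Hom[OF that that cm_id])
  show ?thesis unfolding is_cat_def sel
  proof (intro conjI allI ballI impI)
    fix X :: "('a, 'u) rcpx" assume "X \<in> {X. is_cpx A X}"
    then show "locU X X (\<lambda>n x. x) \<in> Hom X X" using i by simp
  next
    fix X Y :: "('a, 'u) rcpx" and f assume f: "f \<in> Hom X Y"
    show "X \<in> {X. is_cpx A X}" "Y \<in> {X. is_cpx A X}" using Hom_obj[OF f] by simp_all
    show "roof_comp A f (locU X X (\<lambda>n x. x)) = f" "roof_comp A (locU Y Y (\<lambda>n x. x)) f = f" using idn[OF f] by simp_all
  next
    fix X Y Z :: "('a, 'u) rcpx" and f g assume "f \<in> Hom X Y" "g \<in> Hom Y Z"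
    then show "roof_comp A g f \<in> Hom X Z" by (rule cl)
  next
    fix X Y Z W :: "('a, 'u) rcpx" and f g h assume "f \<in> Hom X Y" "g \<in> Hom Y Z" "h \<in> Hom Z W"
    then show "roof_comp A h (roof_comp A g f) = roof_comp A (roof_comp A h g) f" by (rule as)
  qed
qed

lemma D_sel: "Obj D = {X. is_cpx A X}" "Cmp D = roof_comp A" "Idn D X = locU X X (\<lambda>n x. x)" by (simp_all add: dercat_cat_def)

lemmas D_comp = is_cat_comp[OF is_cat_D, unfolded D_sel] and D_assoc = is_cat_assoc[OF is_cat_D, unfolded D_sel]
  and D_id = is_cat_id(1,2)[OF is_cat_D, unfolded D_sel]

text \<open>If \<open>r\<close> resolves W, then \<open>s r\<close> resolves X, and the roof with
  left leg \<open>s r\<close> and right leg \<open>r\<close> inverts the arrow of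
  \<open>s\<close>.\<close>

lemma loc_qi:
  assumes W: "is_cpx A W" and X: "is_cpx A X" and s: "quasi_iso A W X s"
  shows "is_iso D W X (locU W X s)"
proof -
  note sc = qi_cm[OF s]
  obtain P r where K: "Kp W P r" by (rule Kp_ex[OF W])
  note P = KpD(4)[OF K] and r = KpD(5)[OF K]
  let ?sr = "\<lambda>n x. s n (r n x)"
  have K': "Kp X P ?sr" unfolding Kp_def using X KpD(2)[OF K] qi_comp[OF P W X KpD(3)[OF K] s] by simp
  let ?g = "RC X ?sr P r W"
  have "roof_comp A ?g (locU W X s) = locU W W (\<lambda>n x. x)" unfolding loc_RC[OF K X sc] loc_RC[OF K W cm_id]
    by (rule comp_RC[OF K K' W KpD(5)[OF K'] r cm_id hmt_refl[OF P X KpD(5)[OF K']]])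
  moreover have "roof_comp A (locU W X s) ?g = locU X X (\<lambda>n x. x)" unfolding loc_RC[OF K X sc] loc_RC[OF K' X cm_id]
    by (rule comp_RC[OF K' K X r KpD(5)[OF K'] cm_id hmt_refl[OF P W r]])
  ultimately show ?thesis unfolding is_iso_def using loc_Hom[OF W X sc] RC_Hom[OF K' W r]
    by (auto simp: dercat_cat_def intro!: bexI[of _ ?g])
qed

lemma Kp_loc_surj:
  assumes P: "K_projective A P" and al: "\<alpha> \<in> Hom P Y"
  obtains a where "chain_map A P Y a" "\<alpha> = locU P Y a" by (rule Hom_RC[OF Kp_self[OF P] al]) (rule that[unfolded loc_def])

lemma iso_cancel_right:
  assumes i: "is_iso D W X \<sigma>" and al: "\<alpha> \<in> Hom X Y" "\<beta> \<in> Hom X Y" and eq: "roof_comp A \<alpha> \<sigma> = roof_comp A \<beta> \<sigma>"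
  shows "\<alpha> = \<beta>"
proof -
  have s: "\<sigma> \<in> Hom W X" and ex: "\<exists>g\<in>Hom X W. Cmp D g \<sigma> = Idn D W \<and> Cmp D \<sigma> g = Idn D X"
    using i[unfolded is_iso_def] by (rule conjunct1, rule conjunct2)
  from ex obtain g where g: "g \<in> Hom X W" and g': "Cmp D g \<sigma> = Idn D W \<and> Cmp D \<sigma> g = Idn D X" by (rule bexE)
  have g2: "roof_comp A \<sigma> g = locU X X (\<lambda>n x. x)" using conjunct2[OF g'] by (simp only: D_sel)
  have *: "\<gamma> = roof_comp A (roof_comp A \<gamma> \<sigma>) g" if "\<gamma> \<in> Hom X Y" for \<gamma> using D_assoc[OF g s that] unfolding g2 D_id(1)[OF that] .
  show ?thesis by (rule trans[OF *[OF al(1)] trans[OF _ *[OF al(2), symmetric]]]) (simp add: eq)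
qed

text \<open>The map from the apex P of a roof extends along the quasi-isomorphism P -> X up to
  homotopy, so a roof into a K-injective complex straightens to a chain map.\<close>

lemma Ki_loc_surj:
  assumes I: "K_injective A I" and al: "\<alpha> \<in> Hom X I"
  obtains f where "chain_map A X I f" "\<alpha> = locU X I f"
proof -
  note X = Hom_obj(1)[OF al] and Ic = K_inj_cpx[OF I]
  obtain P s where K: "Kp X P s" by (rule Kp_ex[OF X])
  note P = KpD(4)[OF K] and s = KpD(5)[OF K]
  obtain a where a: "chain_map A P I a" "\<alpha> = RC X s P a I" by (rule Hom_RC[OF K al])
  obtain f where f: "chain_map A X I f" "hmt P I (\<lambda>n x. f n (s n x)) a" by (rule K_injective_lift[OF inj_pair I P X KpD(3)[OF K] a(1)])
  show ?thesis by (rule that[OF f(1)]) (simp add: a(2) loc_RC[OF K Ic f(1)] RC_eq_iff[OF K Ic a(1) cm_comp[OF s f(1)]]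
      hmt_sym[OF f(2) Ic cm_comp[OF s f(1)] a(1) P])
qed

lemma Ki_loc_eq_iff:
  assumes I: "K_injective A I" and X: "is_cpx A X" and f: "chain_map A X I f" and g: "chain_map A X I g"
  shows "locU X I f = locU X I g \<longleftrightarrow> hmt X I f g"
proof
  note Ic = K_inj_cpx[OF I]
  obtain P s where K: "Kp X P s" by (rule Kp_ex[OF X])
  note P = KpD(4)[OF K] and s = KpD(5)[OF K]
  show "hmt X I f g \<Longrightarrow> locU X I f = locU X I g" by (rule loc_hmt[OF X Ic f g])
  assume "locU X I f = locU X I g"
  then have "hmt P I (\<lambda>n x. f n (s n x)) (\<lambda>n x. g n (s n x))"
    unfolding loc_RC[OF K Ic f] loc_RC[OF K Ic g] RC_eq_iff[OF K Ic cm_comp[OF s f] cm_comp[OF s g]] .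
  then show "hmt X I f g" by (rule K_injective_lift_unique[OF inj_pair I P X KpD(3)[OF K] f g])
qed

end

section \<open>Adjoints from universal arrows\<close>

lemma is_functorD:
  assumes "is_functor C D F"
  shows "x \<in> Obj C \<Longrightarrow> fob F x \<in> Obj D" "x \<in> Obj C \<Longrightarrow> far F (Idn C x) = Idn D (fob F x)" using assms unfolding is_functor_def by blast+

lemma is_functor_hom:
  assumes "is_functor C D F" "is_cat C" "f \<in> hom_set C x y"
  shows "far F f \<in> hom_set D (fob F x) (fob F y)" using assms(1) is_cat_id(3,4)[OF assms(2,3)] assms(3) unfolding is_functor_def by blast

lemma is_functor_comp:
  assumes "is_functor C D F" "is_cat C" "f \<in> hom_set C x y" "g \<in> hom_set C y z"
  shows "far F (Cmp C g f) = Cmp D (far F g) (far F f)"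
  using assms(1) is_cat_id(3,4)[OF assms(2,3)] is_cat_id(4)[OF assms(2,4)] assms(3,4) unfolding is_functor_def by blast

lemma is_natD:
  assumes "is_nat C D F G \<eta>"
  shows "x \<in> Obj C \<Longrightarrow> \<eta> x \<in> hom_set D (fob F x) (fob G x)" using assms unfolding is_nat_def by blast

lemma is_nat_sq:
  assumes "is_nat C D F G \<eta>" "is_cat C" "f \<in> hom_set C x y"
  shows "Cmp D (\<eta> y) (far F f) = Cmp D (far G f) (\<eta> x)"
  using assms(1) is_cat_id(3,4)[OF assms(2,3)] assms(3) unfolding is_nat_def by blast

lemma comp_funct_sel [simp]: "fob (G \<cdot>\<^sub>F F) x = fob G (fob F x)" "far (G \<cdot>\<^sub>F F) f = far G (far F f)" by (simp_all add: comp_funct_def)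

lemma id_funct_sel [simp]: "fob id_funct x = x" "far id_funct f = f" by (simp_all add: id_funct_def)

text \<open>The right adjoint is already given as a functor. The unit is the factorisation of an
  identity; its naturality and the second triangle identity are verified after composing with
  \<epsilon>, which uniqueness of factorisations cancels.\<close>

lemma right_adjointI:
  assumes C: "is_cat C" and D: "is_cat D" and S: "is_functor C D S" and R: "is_functor D C R"
    and e: "is_nat D D (S \<cdot>\<^sub>F R) id_funct \<epsilon>" and ex: "\<And>x y f. x \<in> Obj C \<Longrightarrow> f \<in> hom_set D (fob S x) y \<Longrightarrow>
      \<exists>g. g \<in> hom_set C x (fob R y) \<and> Cmp D (\<epsilon> y) (far S g) = f"
    and un: "\<And>x y g h. g \<in> hom_set C x (fob R y) \<Longrightarrow> h \<in> hom_set C x (fob R y) \<Longrightarrow> y \<in> Obj D \<Longrightarrow>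
      Cmp D (\<epsilon> y) (far S g) = Cmp D (\<epsilon> y) (far S h) \<Longrightarrow> g = h"
  shows "\<exists>\<eta>. is_adjunction C D S R \<eta> \<epsilon>"
proof -
  note So = is_functorD(1)[OF S] and Ro = is_functorD(1)[OF R] and Sm = is_functor_hom[OF S C] and Rm = is_functor_hom[OF R D]
  note Sc = is_functor_comp[OF S C] and Rc = is_functor_comp[OF R D] and cC = is_cat_comp[OF C] and cD = is_cat_comp[OF D]
  have em: "\<epsilon> y \<in> hom_set D (fob S (fob R y)) y" if "y \<in> Obj D" for y using is_natD[OF e that] by simp
  have en: "Cmp D (\<epsilon> y) (far S (far R f)) = Cmp D f (\<epsilon> x)" if "f \<in> hom_set D x y" for f x y using is_nat_sq[OF e D that] by simp
  have "\<exists>g. g \<in> hom_set C x (fob R (fob S x)) \<and> Cmp D (\<epsilon> (fob S x)) (far S g) = Idn D (fob S x)" if "x \<in> Obj C" for x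
    by (rule ex[OF that is_cat_Idn[OF D So[OF that]]])
  then have "\<exists>\<eta>. \<forall>x. x \<in> Obj C \<longrightarrow> \<eta> x \<in> hom_set C x (fob R (fob S x)) \<and> Cmp D (\<epsilon> (fob S x)) (far S (\<eta> x)) = Idn D (fob S x)"
    by (intro choice allI) blast
  then obtain \<eta> where hm: "\<And>x. x \<in> Obj C \<Longrightarrow> \<eta> x \<in> hom_set C x (fob R (fob S x))"
    and t1: "\<And>x. x \<in> Obj C \<Longrightarrow> Cmp D (\<epsilon> (fob S x)) (far S (\<eta> x)) = Idn D (fob S x)" by blast
  have "is_adjunction C D S R \<eta> \<epsilon>" unfolding is_adjunction_def
  proof (intro conjI ballI S R e t1)
    show "is_nat C C id_funct (R \<cdot>\<^sub>F S) \<eta>" unfolding is_nat_def comp_funct_sel id_funct_sel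
    proof (intro conjI ballI hm)
      fix x y f assume x: "x \<in> Obj C" and y: "y \<in> Obj C" and f: "f \<in> hom_set C x y"
      have "Cmp D (\<epsilon> (fob S y)) (far S (Cmp C (\<eta> y) f)) = Cmp D (\<epsilon> (fob S y)) (Cmp D (far S (\<eta> y)) (far S f))"
        by (simp only: Sc[OF f hm[OF y]])
      also have "\<dots> = Cmp D (Cmp D (\<epsilon> (fob S y)) (far S (\<eta> y))) (far S f)"
        by (rule is_cat_assoc[OF D Sm[OF f] Sm[OF hm[OF y]] em[OF So[OF y]]])
      also have "\<dots> = far S f" by (simp only: t1[OF y] is_cat_id(2)[OF D Sm[OF f]])
      also have "\<dots> = Cmp D (far S f) (Cmp D (\<epsilon> (fob S x)) (far S (\<eta> x)))" by (simp only: t1[OF x] is_cat_id(1)[OF D Sm[OF f]])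
      also have "\<dots> = Cmp D (Cmp D (far S f) (\<epsilon> (fob S x))) (far S (\<eta> x))"
        by (rule is_cat_assoc[OF D Sm[OF hm[OF x]] em[OF So[OF x]] Sm[OF f]])
      also have "\<dots> = Cmp D (Cmp D (\<epsilon> (fob S y)) (far S (far R (far S f)))) (far S (\<eta> x))" by (simp only: en[OF Sm[OF f]])
      also have "\<dots> = Cmp D (\<epsilon> (fob S y)) (Cmp D (far S (far R (far S f))) (far S (\<eta> x)))"
        by (rule is_cat_assoc[OF D Sm[OF hm[OF x]] Sm[OF Rm[OF Sm[OF f]]] em[OF So[OF y]], symmetric])
      also have "\<dots> = Cmp D (\<epsilon> (fob S y)) (far S (Cmp C (far R (far S f)) (\<eta> x)))" by (simp only: Sc[OF hm[OF x] Rm[OF Sm[OF f]]])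
      finally show "Cmp C (\<eta> y) f = Cmp C (far R (far S f)) (\<eta> x)"
        by (rule un[OF cC[OF f hm[OF y]] cC[OF hm[OF x] Rm[OF Sm[OF f]]] So[OF y]])
    qed
  next
    fix y assume y: "y \<in> Obj D"
    note h = hm[OF Ro[OF y]] and e = em[OF y]
    have "Cmp D (\<epsilon> y) (far S (Cmp C (far R (\<epsilon> y)) (\<eta> (fob R y)))) = Cmp D (\<epsilon> y) (Cmp D (far S (far R (\<epsilon> y))) (far S (\<eta> (fob R y))))"
      by (simp only: Sc[OF h Rm[OF e]])
    also have "\<dots> = Cmp D (Cmp D (\<epsilon> y) (far S (far R (\<epsilon> y)))) (far S (\<eta> (fob R y)))"
      by (rule is_cat_assoc[OF D Sm[OF h] Sm[OF Rm[OF e]] e])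
    also have "\<dots> = Cmp D (Cmp D (\<epsilon> y) (\<epsilon> (fob S (fob R y)))) (far S (\<eta> (fob R y)))" by (simp only: en[OF e])
    also have "\<dots> = Cmp D (\<epsilon> y) (Cmp D (\<epsilon> (fob S (fob R y))) (far S (\<eta> (fob R y))))"
      by (rule is_cat_assoc[OF D Sm[OF h] em[OF So[OF Ro[OF y]]] e, symmetric])
    also have "\<dots> = Cmp D (\<epsilon> y) (far S (Idn C (fob R y)))" by (simp only: t1[OF Ro[OF y]] is_functorD(2)[OF S Ro[OF y]])
    finally show "Cmp C (far R (\<epsilon> y)) (\<eta> (fob R y)) = Idn C (fob R y)" by (rule un[OF cC[OF h Rm[OF e]] is_cat_Idn[OF C Ro[OF y]] y])
  qed
  then show ?thesis by blast
qed

text \<open>A left adjoint of F is a right adjoint of F between the opposite categories, so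
  \<open>right_adjointI\<close> can be reused.\<close>

definition op_cat :: "('o, 'm, 'z) cat_scheme \<Rightarrow> ('o, 'm) cat" where
  "op_cat C = \<lparr>Obj = Obj C, Arr = Arr C, Dom = Cod C, Cod = Dom C, Cmp = (\<lambda>g f. Cmp C f g), Idn = Idn C\<rparr>"

lemma op_sel: "Obj (op_cat C) = Obj C" "Cmp (op_cat C) g f = Cmp C f g" "Idn (op_cat C) = Idn C" "hom_set (op_cat C) x y = hom_set C y x"
  by (auto simp: op_cat_def hom_set_def)

lemma op_is_cat: assumes C: "is_cat C" shows "is_cat (op_cat C)" unfolding is_cat_def op_sel
  by (intro conjI allI impI ballI) (auto simp: op_cat_def is_cat_id[OF C] is_cat_Idn[OF C] is_cat_comp[OF C] intro: is_cat_assoc[OF C, symmetric])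

lemma op_functor: assumes F: "is_functor C D F" shows "is_functor (op_cat C) (op_cat D) F"
  unfolding is_functor_def op_sel by (intro conjI ballI) (use F in \<open>unfold is_functor_def, blast+\<close>)

lemma op_nat: assumes "is_nat C D G F \<eta>" shows "is_nat (op_cat C) (op_cat D) F G \<eta>"
  unfolding is_nat_def op_sel by (intro conjI ballI) (use assms in \<open>simp_all add: is_nat_def\<close>)

lemma op_natD: assumes "is_nat (op_cat C) (op_cat D) F G \<eta>" shows "is_nat C D G F \<eta>"
  unfolding is_nat_def by (intro conjI ballI) (use assms in \<open>simp_all add: is_nat_def op_sel\<close>)

text \<open>Only objects and universal arrows are given, so L has to be built on arrows by the
  universal property before dualising. In the opposite categories \<eta> plays the role of the
  counit, and \<epsilon> comes out as the unit.\<close>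

lemma left_adjointI:
  assumes C: "is_cat C" and D: "is_cat D" and F: "is_functor C D F" and un: "\<And>y. y \<in> Obj D \<Longrightarrow> \<exists>x h. x \<in> Obj C \<and> h \<in> hom_set D y (fob F x) \<and>
      (\<forall>z f. z \<in> Obj C \<longrightarrow> f \<in> hom_set D y (fob F z) \<longrightarrow> (\<exists>!g. g \<in> hom_set C x z \<and> Cmp D (far F g) h = f))"
  shows "\<exists>L \<eta> \<epsilon>. is_adjunction D C L F \<eta> \<epsilon>"
proof -
  note Fo = is_functorD(1)[OF F] and Fm = is_functor_hom[OF F C] and Fc = is_functor_comp[OF F C]
    and cC = is_cat_comp[OF C] and cD = is_cat_comp[OF D]
  have "\<exists>q. \<forall>y. y \<in> Obj D \<longrightarrow> fst (q y) \<in> Obj C \<and> snd (q y) \<in> hom_set D y (fob F (fst (q y))) \<and>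
      (\<forall>z f. z \<in> Obj C \<longrightarrow> f \<in> hom_set D y (fob F z) \<longrightarrow> (\<exists>!g. g \<in> hom_set C (fst (q y)) z \<and> Cmp D (far F g) (snd (q y)) = f))"
    using un by (intro choice) auto
  then obtain q where q: "\<And>y. y \<in> Obj D \<Longrightarrow> fst (q y) \<in> Obj C \<and> snd (q y) \<in> hom_set D y (fob F (fst (q y))) \<and>
      (\<forall>z f. z \<in> Obj C \<longrightarrow> f \<in> hom_set D y (fob F z) \<longrightarrow> (\<exists>!g. g \<in> hom_set C (fst (q y)) z \<and> Cmp D (far F g) (snd (q y)) = f))" by blast
  define l \<eta> where "l y = fst (q y)" and "\<eta> y = snd (q y)" for y
  define tr where "tr y z f = (THE g. g \<in> hom_set C (l y) z \<and> Cmp D (far F g) (\<eta> y) = f)" for y z f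
  have lo: "l y \<in> Obj C" and hm: "\<eta> y \<in> hom_set D y (fob F (l y))" if "y \<in> Obj D" for y using q[OF that] by (simp_all add: l_def \<eta>_def)
  have u: "\<exists>!g. g \<in> hom_set C (l y) z \<and> Cmp D (far F g) (\<eta> y) = f" if "y \<in> Obj D" "z \<in> Obj C" "f \<in> hom_set D y (fob F z)" for y z f
    using q[OF that(1)] that(2,3) unfolding l_def \<eta>_def by blast
  have tr: "tr y z f \<in> hom_set C (l y) z" "Cmp D (far F (tr y z f)) (\<eta> y) = f"
    if "y \<in> Obj D" "z \<in> Obj C" "f \<in> hom_set D y (fob F z)" for y z f using theI'[OF u[OF that]] unfolding tr_def by simp_all
  have eqI: "g = h" if y: "y \<in> Obj D" and g: "g \<in> hom_set C (l y) z" and h: "h \<in> hom_set C (l y) z"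
      and eq: "Cmp D (far F g) (\<eta> y) = Cmp D (far F h) (\<eta> y)" for y z g h
    using u[OF y is_cat_id(4)[OF C g] cD[OF hm[OF y] Fm[OF h]]] g h eq by blast
  define L where "L = \<lparr>fob = l, far = (\<lambda>f. tr (Dom D f) (l (Cod D f)) (Cmp D (\<eta> (Cod D f)) f))\<rparr>"
  have Lo: "fob L y = l y" for y by (simp add: L_def)
  have La: "far L f = tr x (l y) (Cmp D (\<eta> y) f)" if "f \<in> hom_set D x y" for f x y using that by (simp add: L_def hom_set_def)
  have Lm: "far L f \<in> hom_set C (l x) (l y)" and Le: "Cmp D (far F (far L f)) (\<eta> x) = Cmp D (\<eta> y) f"
    if f: "f \<in> hom_set D x y" for f x y
  proof -
    note x = is_cat_id(3)[OF D f] and y = is_cat_id(4)[OF D f]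
    show "far L f \<in> hom_set C (l x) (l y)" "Cmp D (far F (far L f)) (\<eta> x) = Cmp D (\<eta> y) f"
      using tr[OF x lo[OF y] cD[OF f hm[OF y]]] unfolding La[OF f] by simp_all
  qed
  have LF: "is_functor D C L" unfolding is_functor_def Lo
  proof (intro conjI ballI lo)
    fix y assume y: "y \<in> Obj D"
    note i = is_cat_Idn[OF D y]
    have "Cmp D (far F (far L (Idn D y))) (\<eta> y) = Cmp D (far F (Idn C (l y))) (\<eta> y)"
      by (simp only: Le[OF i] is_cat_id(1)[OF D hm[OF y]] is_functorD(2)[OF F lo[OF y]] is_cat_id(2)[OF D hm[OF y]])
    then show "far L (Idn D y) = Idn C (l y)" by (rule eqI[OF y Lm[OF i] is_cat_Idn[OF C lo[OF y]]])
  next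
    fix x y f assume "f \<in> hom_set D x y" then show "far L f \<in> hom_set C (l x) (l y)" by (rule Lm)
  next
    fix x y z f g assume x: "x \<in> Obj D" and y: "y \<in> Obj D" and z: "z \<in> Obj D" and f: "f \<in> hom_set D x y" and g: "g \<in> hom_set D y z"
    have "Cmp D (far F (Cmp C (far L g) (far L f))) (\<eta> x) = Cmp D (Cmp D (far F (far L g)) (far F (far L f))) (\<eta> x)"
      by (simp only: Fc[OF Lm[OF f] Lm[OF g]])
    also have "\<dots> = Cmp D (far F (far L g)) (Cmp D (far F (far L f)) (\<eta> x))"
      by (rule is_cat_assoc[OF D hm[OF x] Fm[OF Lm[OF f]] Fm[OF Lm[OF g]], symmetric])
    also have "\<dots> = Cmp D (Cmp D (far F (far L g)) (\<eta> y)) f" unfolding Le[OF f] by (rule is_cat_assoc[OF D f hm[OF y] Fm[OF Lm[OF g]]])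
    also have "\<dots> = Cmp D (\<eta> z) (Cmp D g f)" unfolding Le[OF g] by (rule is_cat_assoc[OF D f g hm[OF z], symmetric])
    also have "\<dots> = Cmp D (far F (far L (Cmp D g f))) (\<eta> x)" by (rule Le[OF cD[OF f g], symmetric])
    finally show "far L (Cmp D g f) = Cmp C (far L g) (far L f)" by (intro eqI[OF x Lm[OF cD[OF f g]] cC[OF Lm[OF f] Lm[OF g]], OF sym])
  qed
  have eta: "is_nat D D id_funct (F \<cdot>\<^sub>F L) \<eta>" unfolding is_nat_def comp_funct_sel id_funct_sel Lo using hm Le by metis
  have "\<exists>\<epsilon>. is_adjunction (op_cat C) (op_cat D) F L \<epsilon> \<eta>"
  proof (rule right_adjointI[of "op_cat C" "op_cat D" F L \<eta>, unfolded op_sel Lo, OF op_is_cat[OF C] op_is_cat[OF D] op_functor[OF F] op_functor[OF LF] op_nat[OF eta]])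
    show "\<exists>g. g \<in> hom_set C (l y) x \<and> Cmp D (far F g) (\<eta> y) = f" if "x \<in> Obj C" "f \<in> hom_set D y (fob F x)" for x y f
      using tr[OF is_cat_id(3)[OF D that(2)] that] by blast
  qed (rule eqI)
  then obtain \<epsilon> where ad: "is_adjunction (op_cat C) (op_cat D) F L \<epsilon> \<eta>" by blast
  note a = ad[unfolded is_adjunction_def op_sel]
  have "is_adjunction D C L F \<eta> \<epsilon>" unfolding is_adjunction_def
    by (intro conjI LF F eta op_natD[OF a[THEN conjunct2, THEN conjunct2, THEN conjunct1]]) (use a in simp_all)
  then show ?thesis by blast
qed

text \<open>\<open>dercat\<close> extends \<open>dercat_cat\<close> by the shift and the triangles,
  so the purely categorical notions can be moved to the smaller record.\<close>

lemma dercat_sel: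
  "Obj (dercat A) = Obj (dercat_cat A)" "Cmp (dercat A) = Cmp (dercat_cat A)" "Idn (dercat A) = Idn (dercat_cat A)"
  "hom_set (dercat A) = hom_set (dercat_cat A)" "shf (dercat A) = der_shift A" "dtri (dercat A) = der_triangles A"
  by (auto simp: dercat_def cat.extend_def tcat.fields_def hom_set_def fun_eq_iff)

lemma dercat_iso: "is_iso (dercat A) = is_iso (dercat_cat A)" by (auto simp: is_iso_def dercat_sel fun_eq_iff)

lemma dercat_functor: "is_functor (dercat A) (dercat B) F = is_functor (dercat_cat A) (dercat_cat B) F"
  by (simp add: is_functor_def dercat_sel)

lemma dercat_nat: "is_nat (dercat A) (dercat B) F = is_nat (dercat_cat A) (dercat_cat B) F"
  by (simp add: is_nat_def dercat_sel fun_eq_iff)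

lemma dercat_nat_iso: "is_nat_iso (dercat A) (dercat B) F = is_nat_iso (dercat_cat A) (dercat_cat B) F"
  by (simp add: is_nat_iso_def dercat_nat dercat_sel dercat_iso fun_eq_iff)

lemma dercat_adjunction: "is_adjunction (dercat A) (dercat B) F = is_adjunction (dercat_cat A) (dercat_cat B) F"
  by (simp add: is_adjunction_def dercat_nat dercat_sel dercat_functor fun_eq_iff)

section \<open>Functors induced from complexes\<close>

context derived begin

text \<open>An arrow is the class of any of its members. This is transitivity of
  \<open>roof_equiv\<close> in disguise: both roofs are compared with a K-projective resolution of
  X.\<close>

lemma Hom_member:
  assumes "\<alpha> \<in> Hom X Y" "(X', s, W, f, Y') \<in> \<alpha>"
  shows "X' = X" "Y' = Y" "(X, s, W, f, Y) \<in> RR" "\<alpha> = roof_class A (X, s, W, f, Y)"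
proof -
  obtain t V g where r: "(X, t, V, g, Y) \<in> RR" and al: "\<alpha> = roof_class A (X, t, V, g, Y)" using assms(1) by (auto simp: Hom_iff)
  show e: "X' = X" "Y' = Y" using assms(2) by (auto simp: al roof_class_def)
  note m = assms(2)[unfolded e al]
  show r': "(X, s, W, f, Y) \<in> RR" using m by (simp add: roof_class_def)
  have X: "is_cpx A X" using r by (simp add: roofs_def)
  obtain P p where K: "Kp X P p" by (rule Kp_ex[OF X])
  obtain a where a: "chain_map A P Y a" "\<alpha> = RC X p P a Y" by (rule Hom_RC[OF K assms(1)])
  have Y: "is_cpx A Y" using r by (simp add: roofs_def)
  obtain u where u: "chain_map A P W u" "hmt P X (\<lambda>n x. s n (u n x)) p" "hmt P Y (\<lambda>n x. f n (u n x)) a"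
    using assms(2)[unfolded e a(2) mem_RC[OF K Y a(1) r']] by blast
  show "\<alpha> = roof_class A (X, s, W, f, Y)" unfolding a(2) by (rule roof_class_eq_RC[OF K r' u(1,2) a(1) u(3), symmetric])
qed

lemma roof_class_Hom: "(X, s, W, f, Y) \<in> RR \<Longrightarrow> roof_class A (X, s, W, f, Y) \<in> Hom X Y"
  unfolding Hom_iff by (rule exI, rule exI, rule exI, rule conjI[OF _ refl])

lemma roof_class_eqI:
  assumes r: "(X, s, W, f, Y) \<in> RR" and r': "(X, s', W', f', Y) \<in> RR" and e: "roof_equiv A (X, s, W, f, Y) (X, s', W', f', Y)"
  shows "roof_class A (X, s, W, f, Y) = roof_class A (X, s', W', f', Y)"
proof -
  have "(X, s', W', f', Y) \<in> roof_class A (X, s, W, f, Y)" using r' e by (simp add: roof_class_def del: roof_equiv.simps)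
  then show ?thesis by (rule Hom_member(4)[OF roof_class_Hom[OF r]])
qed

text \<open>By \<open>Hom_member\<close> a composite is known as soon as one roof in it is, so any
  single completing square computes it.\<close>

lemma roof_comp_eq:
  fixes N :: "('a, 'u) rcpx"
  assumes r: "(X, s, W, f, Y) \<in> RR" and r': "(Y, t, V, g, Z) \<in> RR"
    and U: "is_cpx A N" and t': "quasi_iso A N W t'" and f': "chain_map A N V f'"
    and h: "hmt N Y (\<lambda>n x. f n (t' n x)) (\<lambda>n x. t n (f' n x))"
  shows "roof_comp A (roof_class A (Y, t, V, g, Z)) (roof_class A (X, s, W, f, Y)) =
    roof_class A (X, \<lambda>n x. s n (t' n x), N, \<lambda>n x. g n (f' n x), Z)"
proof -
  have c: "is_cpx A X" "is_cpx A W" "quasi_iso A W X s" "is_cpx A Z" "chain_map A V Z g" using r r' by (simp_all add: roofs_def)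
  have r'': "(X, \<lambda>n x. s n (t' n x), N, \<lambda>n x. g n (f' n x), Z) \<in> RR"
    using U c(1,4) qi_comp[OF U c(2,1) t' c(3)] cm_comp[OF f' c(5)] by (simp add: roofs_def)
  have "(X, \<lambda>n x. s n (t' n x), N, \<lambda>n x. g n (f' n x), Z) \<in> roof_comp A (roof_class A (Y, t, V, g, Z)) (roof_class A (X, s, W, f, Y))"
    unfolding roof_comp_def mem_Collect_eq comp_def
    by (rule exI, rule exI, rule exI, rule exI, rule exI, rule exI, rule exI, rule exI, rule exI, rule exI, rule exI, rule exI,
      rule conjI[OF roof_class_self[OF r]], rule conjI[OF roof_class_self[OF r']], rule conjI[OF U], rule conjI[OF t'],
      rule conjI[OF f'], rule conjI[OF h], rule roof_class_self[OF r''])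
  then show ?thesis by (rule Hom_member(4)[OF D_comp[OF roof_class_Hom[OF r] roof_class_Hom[OF r']]])
qed

lemma Hom_frac:
  assumes al: "\<alpha> \<in> Hom X Y"
  obtains s W f where "is_cpx A W" "quasi_iso A W X s" "chain_map A W Y f" "\<alpha> = roof_class A (X, s, W, f, Y)" "(X, s, W, f, Y) \<in> RR"
    "roof_comp A \<alpha> (locU W X s) = locU W Y f"
proof -
  obtain s W f where r: "(X, s, W, f, Y) \<in> RR" and e: "\<alpha> = roof_class A (X, s, W, f, Y)" using al by (auto simp: Hom_iff)
  have c: "is_cpx A X" "is_cpx A W" "quasi_iso A W X s" "is_cpx A Y" "chain_map A W Y f" using r by (simp_all add: roofs_def)
  have r0: "(W, \<lambda>n x. x, W, s, X) \<in> RR" using c qi_id[OF c(2)] qi_cm[OF c(3)] by (simp add: roofs_def)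
  have "roof_comp A \<alpha> (locU W X s) = locU W Y f" unfolding e loc_def
    by (rule roof_comp_eq[OF r0 r c(2) qi_id[OF c(2)] cm_id hmt_refl[OF c(2,1) qi_cm[OF c(3)]]])
  with c r e show ?thesis by (intro that[of W s f])
qed

end

lemma functor_iso:
  assumes F: "is_functor C D F" and C: "is_cat C" and f: "is_iso C x y f"
  shows "is_iso D (fob F x) (fob F y) (far F f)"
proof -
  obtain g where fh: "f \<in> hom_set C x y" and g: "g \<in> hom_set C y x" "Cmp C g f = Idn C x" "Cmp C f g = Idn C y"
    using f unfolding is_iso_def by (elim conjE bexE)
  note o = is_cat_id(3,4)[OF C fh]
  show ?thesis unfolding is_iso_def
  proof (intro conjI bexI)
    show "far F f \<in> hom_set D (fob F x) (fob F y)" "far F g \<in> hom_set D (fob F y) (fob F x)"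
      by (rule is_functor_hom[OF F C fh], rule is_functor_hom[OF F C g(1)])
    show "Cmp D (far F g) (far F f) = Idn D (fob F x)" "Cmp D (far F f) (far F g) = Idn D (fob F y)"
      using is_functor_comp[OF F C fh g(1)] is_functor_comp[OF F C g(1) fh] is_functorD(2)[OF F] o g by simp_all
  qed
qed

text \<open>A functor on complexes that preserves quasi-isomorphisms can be applied to both legs of
  a roof. \<open>Fid\<close> and \<open>Fcomp\<close> are equations between total functions, as they
  hold for shift and restriction, whose effect on maps is reindexing or nothing at all.\<close>

locale induced = A: derived A U + B: derived B U
  for A :: "('a, 'x) ring_scheme" and B :: "('b, 'y) ring_scheme" and U :: "'u itself" +
  fixes Fo :: "('b, 'u) rcpx \<Rightarrow> ('a, 'u) rcpx" and Fm :: "('u, 'u) gmap \<Rightarrow> ('u, 'u) gmap"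
  assumes Fo: "is_cpx B X \<Longrightarrow> is_cpx A (Fo X)" and Fm: "\<lbrakk>is_cpx B X; is_cpx B Y; chain_map B X Y f\<rbrakk> \<Longrightarrow> chain_map A (Fo X) (Fo Y) (Fm f)"
    and Fq: "\<lbrakk>is_cpx B X; is_cpx B Y; quasi_iso B X Y f\<rbrakk> \<Longrightarrow> quasi_iso A (Fo X) (Fo Y) (Fm f)"
    and Fh: "\<lbrakk>is_cpx B X; is_cpx B Y; chain_map B X Y f; chain_map B X Y g; homotopic B X Y f g\<rbrakk> \<Longrightarrow>
      homotopic A (Fo X) (Fo Y) (Fm f) (Fm g)" and Fid: "Fm (\<lambda>n x. x) = (\<lambda>n x. x)"
    and Fcomp: "Fm (\<lambda>n x. g n (f n x)) = (\<lambda>n x. Fm g n (Fm f n x))"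
begin

abbreviation "F \<equiv> induced_funct A Fo Fm"

lemma F_roof: "(X, s, W, f, Y) \<in> B.RR \<Longrightarrow> (Fo X, Fm s, Fo W, Fm f, Fo Y) \<in> A.RR" by (simp add: roofs_def Fo Fm Fq)

text \<open>\<open>induced_funct\<close> unites the images of all representatives. The functor
  carries a common refinement and its homotopies along, so equivalent roofs have equivalent images
  and the union is a single class.\<close>

lemma F_class:
  assumes r: "(X, s, W, f, Y) \<in> B.RR"
  shows "far F (roof_class B (X, s, W, f, Y)) = roof_class A (Fo X, Fm s, Fo W, Fm f, Fo Y)"
proof -
  have *: "roof_class A (Fo X', Fm s', Fo W', Fm f', Fo Y') = roof_class A (Fo X, Fm s, Fo W, Fm f, Fo Y)"
    if m: "(X', s', W', f', Y') \<in> roof_class B (X, s, W, f, Y)" for X' s' W' f' Y'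
  proof -
    have e: "X' = X" "Y' = Y" and r': "(X, s', W', f', Y) \<in> B.RR" using m by (auto simp: roof_class_def)
    have q: "roof_equiv B (X, s, W, f, Y) (X, s', W', f', Y)" using m unfolding e by (simp add: roof_class_def del: roof_equiv.simps)
    obtain V :: "('b, 'u) rcpx" and v v' where V: "is_cpx B V" and v: "chain_map B V W v" and v': "chain_map B V W' v'"
      and svq: "quasi_iso B V X (s \<circ>\<^sub>c v)" and h: "homotopic B V X (s \<circ>\<^sub>c v) (s' \<circ>\<^sub>c v')" and h': "homotopic B V Y (f \<circ>\<^sub>c v) (f' \<circ>\<^sub>c v')"
      using q by auto
    have c: "is_cpx B X" "is_cpx B W" "is_cpx B Y" "chain_map B W X s" "chain_map B W Y f"
       "is_cpx B W'" "chain_map B W' X s'" "chain_map B W' Y f'" using r r' by (simp_all add: roofs_def qi_cm)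
    note svq = svq[unfolded comp_def] and h = h[unfolded comp_def] and h' = h'[unfolded comp_def]
    have "roof_equiv A (Fo X, Fm s, Fo W, Fm f, Fo Y) (Fo X, Fm s', Fo W', Fm f', Fo Y)"
      by (rule A.roof_equivI[OF Fo[OF V] Fm[OF V c(2) v] Fm[OF V c(6) v'] Fq[OF V c(1) svq, unfolded Fcomp]
        Fh[OF V c(1) cm_comp[OF v c(4)] cm_comp[OF v' c(7)] h, unfolded Fcomp]
        Fh[OF V c(3) cm_comp[OF v c(5)] cm_comp[OF v' c(8)] h', unfolded Fcomp]])
    then show ?thesis unfolding e by (rule A.roof_class_eqI[OF F_roof[OF r] F_roof[OF r'], symmetric])
  qed
  show ?thesis
  proof (intro Set.set_eqI iffI)
    fix \<tau> assume "\<tau> \<in> far F (roof_class B (X, s, W, f, Y))"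
    then obtain X' s' W' f' Y' where m: "(X', s', W', f', Y') \<in> roof_class B (X, s, W, f, Y)"
      and t: "\<tau> \<in> roof_class A (Fo X', Fm s', Fo W', Fm f', Fo Y')" unfolding induced_funct_def by auto
    show "\<tau> \<in> roof_class A (Fo X, Fm s, Fo W, Fm f, Fo Y)" using t unfolding *[OF m] .
  next
    fix \<tau> assume "\<tau> \<in> roof_class A (Fo X, Fm s, Fo W, Fm f, Fo Y)"
    with B.roof_class_self[OF r] show "\<tau> \<in> far F (roof_class B (X, s, W, f, Y))" unfolding induced_funct_def funct.simps mem_Collect_eq by blast
  qed
qed

lemma F_ob: "fob F X = Fo X" by (simp add: induced_funct_def)

lemma F_loc:
  assumes X: "is_cpx B X" and Y: "is_cpx B Y" and f: "chain_map B X Y f"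
  shows "far F (B.locU X Y f) = A.locU (Fo X) (Fo Y) (Fm f)"
proof -
  have r: "(X, \<lambda>n x. x, X, f, Y) \<in> B.RR" using X Y f qi_id[OF X] by (simp add: roofs_def)
  show ?thesis unfolding loc_def F_class[OF r] Fid ..
qed

lemma F_functor: "is_functor B.D A.D F" unfolding is_functor_def F_ob
proof (intro conjI ballI)
  fix X assume "X \<in> Obj B.D" then have X: "is_cpx B X" by (simp add: B.D_sel)
  show "Fo X \<in> Obj A.D" using Fo[OF X] by (simp add: A.D_sel)
  show "far F (Idn B.D X) = Idn A.D (Fo X)" unfolding B.D_sel A.D_sel F_loc[OF X X cm_id] Fid ..
next
  fix X Y \<alpha> assume al: "\<alpha> \<in> B.Hom X Y"
  obtain s W f where r: "(X, s, W, f, Y) \<in> B.RR" and e: "\<alpha> = roof_class B (X, s, W, f, Y)" by (rule B.Hom_frac[OF al])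
  show "far F \<alpha> \<in> A.Hom (Fo X) (Fo Y)" unfolding e F_class[OF r] by (rule A.roof_class_Hom[OF F_roof[OF r]])
next
  fix X Y Z \<alpha> \<beta> assume al: "\<alpha> \<in> B.Hom X Y" and be: "\<beta> \<in> B.Hom Y Z"
  note X = B.Hom_obj(1)[OF al] and Y = B.Hom_obj(2)[OF al] and Z = B.Hom_obj(2)[OF be]
  obtain P s where K: "B.Kp X P s" by (rule B.Kp_ex[OF X])
  obtain Q t where K': "B.Kp Y Q t" by (rule B.Kp_ex[OF Y])
  obtain a where a: "chain_map B P Y a" "\<alpha> = B.RC X s P a Y" by (rule B.Hom_RC[OF K al])
  obtain b where b: "chain_map B Q Z b" "\<beta> = B.RC Y t Q b Z" by (rule B.Hom_RC[OF K' be])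
  obtain c where c: "chain_map B P Q c" "homotopic B P Y (\<lambda>n x. t n (c n x)) a"
    "roof_comp B (B.RC Y t Q b Z) (B.RC X s P a Y) = B.RC X s P (\<lambda>n x. b n (c n x)) Z" by (rule B.comp_RC_ex[OF K K' Z a(1) b(1)])
  note P = B.KpD(4)[OF K] and Q = B.KpD(4)[OF K']
  have r1: "(X, s, P, a, Y) \<in> B.RR" by (rule B.roofsI[OF P Y K B.KpD(3)[OF K] a(1)])
  have r2: "(Y, t, Q, b, Z) \<in> B.RR" by (rule B.roofsI[OF Q Z K' B.KpD(3)[OF K'] b(1)])
  have r3: "(X, s, P, \<lambda>n x. b n (c n x), Z) \<in> B.RR" by (rule B.roofsI[OF P Z K B.KpD(3)[OF K] cm_comp[OF c(1) b(1)]])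
  note h = Fh[OF P Y a(1) cm_comp[OF c(1) B.KpD(5)[OF K']]
    hmt_sym[OF c(2) Y cm_comp[OF c(1) B.KpD(5)[OF K']] a(1) P], unfolded Fcomp]
  show "far F (Cmp B.D \<beta> \<alpha>) = Cmp A.D (far F \<beta>) (far F \<alpha>)"
    unfolding B.D_sel A.D_sel a(2) b(2) c(3) F_class[OF r1] F_class[OF r2] F_class[OF r3] Fcomp
    by (rule A.roof_comp_eq[OF F_roof[OF r1] F_roof[OF r2] Fo[OF P] qi_id[OF Fo[OF P]] Fm[OF P Q c(1)] h, symmetric])
qed

end

lemma (in derived) induced_shift: "induced A A (shift 1 :: ('a, 'u) rcpx \<Rightarrow> _) shift_map"
proof (intro induced.intro induced_axioms.intro derived_axioms)
  fix X Y :: "('a, 'u) rcpx" and f g :: "('u, 'u) gmap"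
  show "is_cpx A X \<Longrightarrow> is_cpx A Y \<Longrightarrow> chain_map A X Y f \<Longrightarrow> chain_map A X Y g \<Longrightarrow> hmt X Y f g \<Longrightarrow>
    hmt (shift 1 X) (shift 1 Y) (shift_map f) (shift_map g)" by (rule shift_map_hmt)
  show "is_cpx A X \<Longrightarrow> is_cpx A (shift 1 X)" by (rule shift_cpx)
  show "is_cpx A X \<Longrightarrow> is_cpx A Y \<Longrightarrow> chain_map A X Y f \<Longrightarrow> chain_map A (shift 1 X) (shift 1 Y) (shift_map f)" by (rule shift_map_cm)
  show "is_cpx A X \<Longrightarrow> is_cpx A Y \<Longrightarrow> quasi_iso A X Y f \<Longrightarrow> quasi_iso A (shift 1 X) (shift 1 Y) (shift_map f)" by (rule shift_map_qi)
qed (simp_all add: shift_map_def fun_eq_iff)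

lemma cone_incl_cm:
  assumes X: "is_cpx A X" and Y: "is_cpx A Y" and f: "chain_map A X Y f"
  shows "chain_map A Y (cone X Y f) (\<lambda>n y. (y, \<zero>[X,n + 1]))"
proof -
  interpret X: cpx_loc A X by standard fact
  interpret Y: cpx_loc A Y by standard fact
  have eq: "n + 1 + 1 = n + (2::int)" for n by simp
  have "f (n + 1) \<zero>[X,n + 1] = \<zero>[Y,n + 1]" for n by (rule rl_zero[OF cm_lin[OF f] X.grp Y.grp])
  moreover have "cdf X (n + 1) \<zero>[X,n + 1] = \<zero>[X,n + 2]" for n using X.d_zero[of "n + 1"] unfolding eq .
  moreover have "ract (cob X n) \<zero>[X,n] a = \<zero>[X,n]" if "a \<in> carrier A" for a n by (rule X.M.ract_zero_left[OF that])
  ultimately show ?thesis by (intro chain_mapI rlinearI) (simp_all add: X.M.M.a_inv_zero Y.d_closed add.assoc)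
qed

lemma cone_proj_cm:
  fixes X :: "('a, 'u) rcpx" and Y :: "('a, 'v) rcpx"
  assumes X: "is_cpx A X"
  shows "chain_map A (cone X Y f) (shift 1 X) (\<lambda>n. snd)" by (rule chain_mapI; (rule rlinearI)?) (auto simp: add.assoc)

section \<open>Exactness of restriction of scalars\<close>

locale ring_mor = A: derived A U + B: derived B U
  for A :: "('a, 'x) ring_scheme" and B :: "('b, 'y) ring_scheme" and U :: "'u itself" +
  fixes p :: "'a \<Rightarrow> 'b"
  assumes p: "p \<in> ring_hom A B"
begin

abbreviation "res \<equiv> restr_cpx p :: ('b, 'u) rcpx \<Rightarrow> ('a, 'u) rcpx"

lemma induced_restr: "induced A B res (\<lambda>f. f)"
proof (intro induced.intro induced_axioms.intro A.derived_axioms B.derived_axioms)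
  fix X Y :: "('b, 'u) rcpx" and f g :: "('u, 'u) gmap"
  show "is_cpx B X \<Longrightarrow> is_cpx A (res X)" by (rule restr_cpx_cpx[OF A.A.ring_axioms p])
  show "chain_map B X Y f \<Longrightarrow> chain_map A (res X) (res Y) f" by (rule restr_cm[OF p])
  show "is_cpx B X \<Longrightarrow> is_cpx B Y \<Longrightarrow> quasi_iso B X Y f \<Longrightarrow> quasi_iso A (res X) (res Y) f" by (rule restr_qi[OF A.A.ring_axioms p])
  show "homotopic B X Y f g \<Longrightarrow> homotopic A (res X) (res Y) f g" by (rule restr_hmt[OF p])
qed simp_all

sublocale SA: induced A A U "shift 1" shift_map by (rule A.induced_shift)
sublocale SB: induced B B U "shift 1" shift_map by (rule B.induced_shift)
sublocale R: induced A B U res "\<lambda>f. f" by (rule induced_restr)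

text \<open>This and \<open>res_enc_cone\<close> are equalities of complexes and not just
  isomorphisms: restriction alters only the action, which shift, cone and renaming carry along. The
  comparison of the two shifts can thus be an identity arrow.\<close>

lemma res_shift: "res (shift k X) = shift k (res X)"
  by (simp add: shift_def restr_cpx_def fun_eq_iff restr_mod_a_inv[unfolded restr_mod_def] cong: if_cong)

lemma res_enc_cone:
  fixes X Y :: "('b, 'u) rcpx"
  shows "res (enc_cpx (cone X Y f)) = enc_cpx (cone (res X) (res Y) f)"
  by (simp add: enc_cpx_def restr_cpx_def cone_def fun_eq_iff enc_rmodule_def dsum_rmodule_def mk_rmodule_def cone_diff_def
    restr_mod_a_inv[unfolded restr_mod_def mk_rmodule_def] split: prod.splits)

text \<open>Standard triangles restrict to standard triangles on the nose, so applying the functor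
  to an isomorphism with a standard triangle gives another one.\<close>

lemma der_restr_exact: "is_exact_functor (dercat B :: ('b, 'u) dcat) (dercat A :: ('a, 'u) dcat) (der_restr A p)"
proof -
  have S: "fob (der_shift B) X = shift 1 X" "fob (der_shift A) X' = shift 1 X'" for X :: "('b, 'u) rcpx" and X' :: "('a, 'u) rcpx" by (simp_all add: der_shift_def SA.F_ob SB.F_ob)
  have Ro: "fob R.F X = res X" for X by (rule R.F_ob)
  have comm: "far R.F (far (der_shift B) \<alpha>) = far (der_shift A) (far R.F \<alpha>)" if al: "\<alpha> \<in> B.Hom X Y" for X Y \<alpha>
  proof -
    obtain s W f where r: "(X, s, W, f, Y) \<in> B.RR" and e: "\<alpha> = roof_class B (X, s, W, f, Y)" by (rule B.Hom_frac[OF al])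
    show ?thesis
      unfolding e der_shift_def SB.F_class[OF r] R.F_class[OF r] SA.F_class[OF R.F_roof[OF r]] R.F_class[OF SB.F_roof[OF r]] res_shift ..
  qed
  have Rm: "far R.F \<alpha> \<in> A.Hom (res X) (res Y)" if "\<alpha> \<in> B.Hom X Y" for \<alpha> X Y
    using is_functor_hom[OF R.F_functor B.is_cat_D that] unfolding Ro .
  have Rc: "far R.F (roof_comp B \<beta> \<alpha>) = roof_comp A (far R.F \<beta>) (far R.F \<alpha>)" if "\<alpha> \<in> B.Hom X Y" "\<beta> \<in> B.Hom Y Z" for \<alpha> \<beta> X Y Z
    using is_functor_comp[OF R.F_functor B.is_cat_D that] unfolding A.D_sel B.D_sel .
  have Ri: "is_iso A.D (res X) (res Y) (far R.F \<alpha>)" if "is_iso B.D X Y \<alpha>" for X Y \<alpha>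
    using functor_iso[OF R.F_functor B.is_cat_D that] unfolding Ro .
  have Sm: "far (der_shift B) \<alpha> \<in> B.Hom (shift 1 X) (shift 1 Y)" if "\<alpha> \<in> B.Hom X Y" for \<alpha> X Y
    using is_functor_hom[OF SB.F_functor B.is_cat_D that] unfolding SB.F_ob der_shift_def .
  let ?\<theta> = "\<lambda>X. Idn A.D (shift 1 (res X))"
  have so: "shift 1 (res X) \<in> Obj A.D" if "is_cpx B X" for X using SA.Fo[OF R.Fo[OF that]] by (simp add: A.D_sel)
  have id_iso: "is_iso A.D X X (Idn A.D X)" if X: "X \<in> Obj A.D" for X
    using is_cat_Idn[OF A.is_cat_D X] is_cat_id(1)[OF A.is_cat_D is_cat_Idn[OF A.is_cat_D X]] by (auto simp: is_iso_def)
  have \<theta>: "is_nat_iso B.D A.D (R.F \<cdot>\<^sub>F der_shift B) (der_shift A \<cdot>\<^sub>F R.F) ?\<theta>"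
    unfolding is_nat_iso_def is_nat_def comp_funct_sel S Ro res_shift
  proof (intro conjI ballI)
    fix X assume "X \<in> Obj B.D" then have X: "is_cpx B X" by (simp add: B.D_sel)
    show "?\<theta> X \<in> A.Hom (shift 1 (res X)) (shift 1 (res X))" by (rule is_cat_Idn[OF A.is_cat_D so[OF X]])
    show "is_iso A.D (shift 1 (res X)) (shift 1 (res X)) (?\<theta> X)" by (rule id_iso[OF so[OF X]])
  next
    fix X Y \<alpha> assume al: "\<alpha> \<in> B.Hom X Y"
    note m = Rm[OF Sm[OF al], unfolded res_shift]
    show "Cmp A.D (?\<theta> Y) (far R.F (far (der_shift B) \<alpha>)) = Cmp A.D (far (der_shift A) (far R.F \<alpha>)) (?\<theta> X)"
      unfolding comm[OF al, symmetric] is_cat_id(1,2)[OF A.is_cat_D m] ..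
  qed
  have tri: "(res x, res y, res z, far R.F u, far R.F v, roof_comp A (?\<theta> x) (far R.F w)) \<in> der_triangles A"
    if t: "(x, y, z, u, v, w) \<in> der_triangles B" for x y z :: "('b, 'u) rcpx" and u v w
  proof -
    obtain X Y :: "('b, 'u) rcpx" and f x' y' z' u' v' w' a b c where u: "u \<in> B.Hom x y" and v: "v \<in> B.Hom y z" and w: "w \<in> B.Hom z (shift 1 x)"
      and X: "is_cpx B X" and Y: "is_cpx B Y" and f: "chain_map B X Y f" and st: "standard_triangle B X Y f = (x', y', z', u', v', w')"
      and a: "is_iso B.D x x' a" and b: "is_iso B.D y y' b" and c: "is_iso B.D z z' c"
      and e1: "roof_comp B u' a = roof_comp B b u" and e2: "roof_comp B v' b = roof_comp B c v"
      and e3: "roof_comp B w' c = roof_comp B (far (der_shift B) a) w"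
      using t unfolding der_triangles_def mem_Collect_eq prod.case by (elim conjE exE) (rule that)
    let ?C = "enc_cpx (cone X Y f) :: ('b, 'u) rcpx"
    interpret E: enc_loc "TYPE('u \<times> 'u)" "TYPE('u)" by (rule enc_loc.intro[OF B.inj_pair])
    have C: "is_cpx B ?C" by (rule E.enc_cpx_cpx[OF cone_cpx[OF X Y f]])
    have xyz: "x' = X" "y' = Y" "z' = ?C" and u': "u' = B.locU X Y f" and v': "v' = B.locU Y ?C (\<lambda>n y. enc (y, \<zero>[X,n + 1]))"
      and w': "w' = B.locU ?C (shift 1 X) (\<lambda>n z. snd (dec z :: 'u \<times> 'u))"
      using st unfolding standard_triangle_def Let_def prod.inject by - (elim conjE, rule sym, assumption)+
    note f' = R.Fm[OF X Y f]
    have v'': "far R.F v' = A.locU (res Y) (res ?C) (\<lambda>n y. enc (y, \<zero>[res X,n + 1]))"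
      unfolding v' by (subst R.F_loc[OF Y C cm_comp[OF cone_incl_cm[OF X Y f] E.enc_cm]]) simp
    have w'': "far R.F w' = A.locU (res ?C) (shift 1 (res X)) (\<lambda>n z. snd (dec z :: 'u \<times> 'u))"
      unfolding w' by (subst R.F_loc[OF C shift_cpx[OF X] cm_comp[OF E.dec_cm cone_proj_cm[OF X]]]) (simp add: res_shift)
    have st': "standard_triangle A (res X) (res Y) f = (res x', res y', res z', far R.F u', far R.F v', far R.F w')"
      unfolding xyz v'' w'' by (simp add: standard_triangle_def Let_def res_enc_cone u' R.F_loc[OF X Y f])
    have ah: "a \<in> B.Hom x x'" and bh: "b \<in> B.Hom y y'" and ch: "c \<in> B.Hom z z'" using a b c by (simp_all add: is_iso_def)
    have uh: "u' \<in> B.Hom x' y'" unfolding u' xyz by (rule B.loc_Hom[OF X Y f])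
    have vh: "v' \<in> B.Hom y' z'" unfolding v' xyz by (rule B.loc_Hom[OF Y C cm_comp[OF cone_incl_cm[OF X Y f] E.enc_cm]])
    have wh: "w' \<in> B.Hom z' (shift 1 x')" unfolding w' xyz
      by (rule B.loc_Hom[OF C shift_cpx[OF X] cm_comp[OF E.dec_cm cone_proj_cm[OF X]]])
    have th: "roof_comp A (?\<theta> x) (far R.F w) = far R.F w"
      using is_cat_id(2)[OF A.is_cat_D Rm[OF w, unfolded res_shift]] unfolding A.D_sel .
    show ?thesis unfolding der_triangles_def mem_Collect_eq prod.case th
    proof (intro exI conjI)
      show "far R.F u \<in> A.Hom (res x) (res y)" "far R.F v \<in> A.Hom (res y) (res z)" by (rule Rm[OF u], rule Rm[OF v])
      show "far R.F w \<in> A.Hom (res z) (shift 1 (res x))" using Rm[OF w] unfolding res_shift .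
      show "is_cpx A (res X)" "is_cpx A (res Y)" by (rule R.Fo[OF X], rule R.Fo[OF Y])
      show "chain_map A (res X) (res Y) f" by (rule f')
      show "standard_triangle A (res X) (res Y) f = (res x', res y', res z', far R.F u', far R.F v', far R.F w')" by (rule st')
      show "is_iso A.D (res x) (res x') (far R.F a)" "is_iso A.D (res y) (res y') (far R.F b)" "is_iso A.D (res z) (res z') (far R.F c)"
        by (rule Ri[OF a], rule Ri[OF b], rule Ri[OF c])
      show "roof_comp A (far R.F u') (far R.F a) = roof_comp A (far R.F b) (far R.F u)"
        unfolding Rc[OF ah uh, symmetric] Rc[OF u bh, symmetric] e1 ..
      show "roof_comp A (far R.F v') (far R.F b) = roof_comp A (far R.F c) (far R.F v)"
        unfolding Rc[OF bh vh, symmetric] Rc[OF v ch, symmetric] e2 ..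
      show "roof_comp A (far R.F w') (far R.F c) = roof_comp A (far (der_shift A) (far R.F a)) (far R.F w)"
        unfolding comm[OF ah, symmetric] Rc[OF ch wh, symmetric] Rc[OF w Sm[OF ah], symmetric] e3 ..
    qed
  qed
  show ?thesis unfolding is_exact_functor_def dercat_functor dercat_nat_iso dercat_sel der_restr_def
    using R.F_functor \<theta> tri unfolding Ro A.D_sel by blast
qed

end

context derived begin

lemma loc_RC_comp:
  assumes K: "Kp X P s" and Y: "is_cpx A Y" and Z: "is_cpx A Z" and a: "chain_map A P Y a" and g: "chain_map A Y Z g"
  shows "roof_comp A (locU Y Z g) (RC X s P a Y) = RC X s P (\<lambda>n x. g n (a n x)) Z"
proof -
  note P = KpD(4)[OF K]
  have r: "(X, s, P, a, Y) \<in> RR" by (rule roofsI[OF P Y K KpD(3)[OF K] a])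
  have r': "(Y, \<lambda>n x. x, Y, g, Z) \<in> RR" using Y Z g qi_id[OF Y] by (simp add: roofs_def)
  show ?thesis unfolding loc_def by (rule roof_comp_eq[OF r r' P qi_id[OF P] a hmt_refl[OF P Y a]])
qed

end

section \<open>The left adjoint of restriction\<close>

context ring_mor begin

text \<open>The universal arrow at X is the roof X <- P -> \<open>res Z\<close>, where Z extends the
  scalars of a K-projective resolution P. Since maps and homotopies out of Z correspond to those out
  of P, Z is K-projective; arrows out of Z are then homotopy classes, and the bijection is that of
  \<open>tensor_cpx\<close>.\<close>

lemma der_restr_left_adjoint:
  "\<exists>L \<eta> \<epsilon>. is_adjunction (dercat A :: ('a, 'u) dcat) (dercat B :: ('b, 'u) dcat) L (der_restr A p) \<eta> \<epsilon>"
  unfolding dercat_adjunction der_restr_def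
proof (rule left_adjointI[OF B.is_cat_D A.is_cat_D R.F_functor])
  fix X assume "X \<in> Obj A.D" then have X: "is_cpx A X" by (simp add: A.D_sel)
  obtain P s where K: "A.Kp X P s" by (rule A.Kp_ex[OF X])
  note Kpr = A.KpD(2)[OF K] and P = A.KpD(4)[OF K]
  obtain Z :: "('b, 'u) rcpx" and un where Z: "is_cpx B Z" and un: "chain_map A P (res Z) un"
    and ext: "\<And>(Y :: ('b, 'u) rcpx) g. \<lbrakk>is_cpx B Y; chain_map A P (res Y) g\<rbrakk> \<Longrightarrow>
      \<exists>k. chain_map B Z Y k \<and> (\<forall>n. \<forall>x \<in> el P n. k n (un n x) = g n x)"
    and uniq: "\<And>(Y :: ('b, 'u) rcpx) k k'. \<lbrakk>is_cpx B Y; chain_map B Z Y k; chain_map B Z Y k';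
      homotopic A P (res Y) (\<lambda>n x. k n (un n x)) (\<lambda>n x. k' n (un n x))\<rbrakk> \<Longrightarrow> homotopic B Z Y k k'"
    by (rule tensor_cpx[OF B.large B.A.ring_axioms p P]) (rule that)
  have ZK: "K_projective B Z" unfolding K_projective_def
  proof (intro conjI allI impI Z, elim conjE)
    fix N :: "('b, 'u) rcpx" and f assume N: "is_cpx B N" and ac: "acyclic_cpx N" and f: "chain_map B Z N f"
    note rN = R.Fo[OF N] and c = cm_comp[OF un R.Fm[OF Z N f]]
    have "homotopic A P (res N) (\<lambda>n x. f n (un n x)) (\<lambda>n x. \<zero>[N,n])" using K_projectiveD[OF Kpr rN _ c] ac by simp
    then show "homotopic B Z N f (\<lambda>n x. \<zero>[N,n])" by (rule uniq[OF N f cm_zero_map[OF N]])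
  qed
  let ?h = "A.RC X s P un (res Z)"
  have comp: "Cmp A.D (far R.F (B.locU Z Y k)) ?h = A.RC X s P (\<lambda>n x. k n (un n x)) (res Y)"
    if Y: "is_cpx B Y" and k: "chain_map B Z Y k" for Y k
    unfolding A.D_sel R.F_loc[OF Z Y k] by (rule A.loc_RC_comp[OF K R.Fo[OF Z] R.Fo[OF Y] un R.Fm[OF Z Y k]])
  show "\<exists>Z h. Z \<in> Obj B.D \<and> h \<in> A.Hom X (fob R.F Z) \<and>
      (\<forall>Y f. Y \<in> Obj B.D \<longrightarrow> f \<in> A.Hom X (fob R.F Y) \<longrightarrow> (\<exists>!g. g \<in> B.Hom Z Y \<and> Cmp A.D (far R.F g) h = f))" unfolding R.F_ob
  proof (rule exI, rule exI, intro conjI allI impI)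
    show "Z \<in> Obj B.D" using Z by (simp add: B.D_sel)
    show "?h \<in> A.Hom X (res Z)" by (rule A.RC_Hom[OF K R.Fo[OF Z] un])
  next
    fix Y :: "('b, 'u) rcpx" and f assume "Y \<in> Obj B.D" and f: "f \<in> A.Hom X (res Y)"
    then have Y: "is_cpx B Y" by (simp add: B.D_sel)
    note rY = R.Fo[OF Y]
    obtain a where a: "chain_map A P (res Y) a" "f = A.RC X s P a (res Y)" by (rule A.Hom_RC[OF K f])
    from ext[OF Y a(1)] obtain k where k: "chain_map B Z Y k" and ka: "\<forall>n. \<forall>x \<in> el P n. k n (un n x) = a n x" by (elim exE conjE)
    have kc: "chain_map A P (res Y) (\<lambda>n x. k n (un n x))" by (rule cm_comp[OF un R.Fm[OF Z Y k]])
    show "\<exists>!g. g \<in> B.Hom Z Y \<and> Cmp A.D (far R.F g) ?h = f"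
    proof (rule ex1I, rule conjI)
      show "B.locU Z Y k \<in> B.Hom Z Y" by (rule B.loc_Hom[OF Z Y k])
      show "Cmp A.D (far R.F (B.locU Z Y k)) ?h = f"
        unfolding comp[OF Y k] a(2) A.RC_eq_iff[OF K rY kc a(1)] by (rule hmt_eqI[OF rY kc a(1) P]) (simp add: ka)
    next
      fix g assume g: "g \<in> B.Hom Z Y \<and> Cmp A.D (far R.F g) ?h = f"
      obtain k' where k': "chain_map B Z Y k'" "g = B.locU Z Y k'" by (rule B.Kp_loc_surj[OF ZK conjunct1[OF g]])
      have k'c: "chain_map A P (res Y) (\<lambda>n x. k' n (un n x))" by (rule cm_comp[OF un R.Fm[OF Z Y k'(1)]])
      have "A.RC X s P (\<lambda>n x. k' n (un n x)) (res Y) = A.RC X s P a (res Y)" using conjunct2[OF g] unfolding k'(2) comp[OF Y k'(1)] a(2) .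
      then have h: "homotopic A P (res Y) (\<lambda>n x. k' n (un n x)) a" unfolding A.RC_eq_iff[OF K rY k'c a(1)] .
      have h': "homotopic A P (res Y) a (\<lambda>n x. k n (un n x))" by (rule hmt_eqI[OF rY a(1) kc P]) (simp add: ka)
      have "homotopic B Z Y k' k" by (rule uniq[OF Y k'(1) k hmt_trans[OF h h' rY k'c a(1) kc P]])
      then show "g = B.locU Z Y k" unfolding k'(2) by (rule B.loc_hmt[OF Z Y k'(1) k])
    qed
  qed
qed

end

section \<open>Hom complexes\<close>

lemma (in abelian_group) four_term:
  assumes "a \<in> carrier G" "b \<in> carrier G" "c \<in> carrier G" "d \<in> carrier G"
  shows "(a \<oplus> b) \<ominus> (c \<oplus> d) = (a \<ominus> c) \<oplus> (b \<ominus> d)" "(a \<oplus> b) \<oplus> (c \<oplus> d) = (a \<oplus> c) \<oplus> (b \<oplus> d)"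
    "(a \<ominus> c) \<oplus> (b \<oplus> c) = a \<oplus> b" "(a \<oplus> c) \<oplus> (b \<ominus> c) = a \<oplus> b" using assms by algebra+

lemma rl_restrict:
  assumes "right_module A M" "rlinear A M N f" shows "rlinear A M N (\<lambda>x\<in>carrier M. f x)" by (rule rl_cong[OF assms(2) _ assms(1)]) simp

locale bicpx_loc = C: ring C + M: cpx_loc A M
  for A :: "('a, 'x) ring_scheme" and C :: "('c, 'y) ring_scheme" and M :: "('c, 'a, 'v) bicpx" +
  assumes lact_lin: "c \<in> carrier C \<Longrightarrow> rlinear A (cob M i) (cob M i) (lact (cob M i) c)"
    and lact_add: "\<lbrakk>c \<in> carrier C; c' \<in> carrier C; m \<in> el M i\<rbrakk> \<Longrightarrow>
      lact (cob M i) (c \<oplus>[C] c') m = lact (cob M i) c m \<oplus>[M,i] lact (cob M i) c' m"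
    and lact_mult: "\<lbrakk>c \<in> carrier C; c' \<in> carrier C; m \<in> el M i\<rbrakk> \<Longrightarrow>
      lact (cob M i) (c \<otimes>[C] c') m = lact (cob M i) c (lact (cob M i) c' m)"
    and lact_one: "m \<in> el M i \<Longrightarrow> lact (cob M i) \<one>[C] m = m" and lact_d: "\<lbrakk>c \<in> carrier C; m \<in> el M i\<rbrakk> \<Longrightarrow>
      cdf M i (lact (cob M i) c m) = lact (cob M (i + 1)) c (cdf M i m)"
begin

abbreviation H :: "('a, 'u) rcpx \<Rightarrow> ('c, ('v, 'u) gmap) rcpx" where "H X \<equiv> hom_cpx A M X"
abbreviation HM :: "('u, 'u) gmap \<Rightarrow> int \<Rightarrow> ('v, 'u) gmap \<Rightarrow> ('v, 'u) gmap" where "HM \<equiv> hom_cpx_map M"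

lemma lact_closed: "\<lbrakk>c \<in> carrier C; m \<in> el M i\<rbrakk> \<Longrightarrow> lact (cob M i) c m \<in> el M i" by (rule rl_closed[OF lact_lin])

lemma H_carrier:
  "f \<in> el (H X) n \<longleftrightarrow> (\<forall>i. rlinear A (cob M i) (cob X (i + n)) (f i) \<and> f i \<in> extensional (el M i))" by (simp add: hom_cpx_def)

lemma H_lin: "f \<in> el (H X) n \<Longrightarrow> rlinear A (cob M i) (cob X (i + n)) (f i)" by (simp add: H_carrier)

lemma H_closed: "f \<in> el (H X) n \<Longrightarrow> m \<in> el M i \<Longrightarrow> f i m \<in> el X (i + n)" by (rule rl_closed[OF H_lin])

text \<open>Cochains are extensional in every component, so agreement on the modules is equality of
  functions and the module laws can be checked at each point.\<close>

lemma H_eqI: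
  assumes "f \<in> el (H X) n" "g \<in> el (H X) n'" "\<And>i m. m \<in> el M i \<Longrightarrow> f i m = g i m"
  shows "f = g"
proof (rule ext)
  fix i show "f i = g i" by (rule extensionalityI[of _ "el M i"]) (use assms in \<open>auto simp: H_carrier\<close>)
qed

lemma H_I:
  assumes "\<And>i. rlinear A (cob M i) (cob X (i + n)) (g i)"
  shows "(\<lambda>i. \<lambda>m\<in>el M i. g i m) \<in> el (H X) n" using rl_restrict[OF M.M.right_module_axioms assms] by (simp add: H_carrier)

lemma H_app [simp]:
  assumes "m \<in> el M i"
  shows "(f \<oplus>[H X,n] g) i m = f i m \<oplus>[X,i + n] g i m"
    "\<zero>[H X,n] i m = \<zero>[X,i + n]"
    "ract (cob (H X) n) f c i m = f i (lact (cob M i) c m)" using assms by (simp_all add: hom_cpx_def)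

lemma H_d:
  assumes "m \<in> el M i"
  shows "cdf (H X) n f i m = (if even n then cdf X (i + n) (f i m) \<ominus>[X,i + n + 1] f (i + 1) (cdf M i m)
       else cdf X (i + n) (f i m) \<oplus>[X,i + n + 1] f (i + 1) (cdf M i m))" using assms by (simp add: hom_cpx_def)

lemma HM_app: "m \<in> el M i \<Longrightarrow> HM \<phi> n f i m = \<phi> (i + n) (f i m)" by (simp add: hom_cpx_map_def)

context
  fixes X :: "('a, 'u) rcpx" assumes X: "is_cpx A X"
begin

interpretation X: cpx_loc A X by standard (rule X)

lemma H_add_closed: "\<lbrakk>f \<in> el (H X) n; g \<in> el (H X) n\<rbrakk> \<Longrightarrow> f \<oplus>[H X,n] g \<in> el (H X) n"
  using H_I[OF rl_plus[OF X.M.right_module_axioms H_lin H_lin]] by (simp add: hom_cpx_def)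

lemma H_zero_closed: "\<zero>[H X,n] \<in> el (H X) n" using H_I[OF rl_const_zero[OF X.M.right_module_axioms]] by (simp add: hom_cpx_def)

lemma H_ract_closed: "\<lbrakk>f \<in> el (H X) n; c \<in> carrier C\<rbrakk> \<Longrightarrow> ract (cob (H X) n) f c \<in> el (H X) n"
  using H_I[OF rl_comp[OF lact_lin H_lin]] by (simp add: hom_cpx_def)

lemma H_module: "right_module C (cob (H X) n)"
proof (rule right_moduleI')
  show "ring C" by (rule C.ring_axioms)
  show "abelian_group (cob (H X) n)"
  proof (rule abelian_groupI)
    fix f g h assume f: "f \<in> el (H X) n" and g: "g \<in> el (H X) n" and h: "h \<in> el (H X) n"
    show "f \<oplus>[H X,n] g \<in> el (H X) n" by (rule H_add_closed[OF f g])
    show "f \<oplus>[H X,n] g \<oplus>[H X,n] h = f \<oplus>[H X,n] (g \<oplus>[H X,n] h)"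
      by (rule H_eqI[OF H_add_closed[OF H_add_closed[OF f g] h] H_add_closed[OF f H_add_closed[OF g h]]])
        (simp add: X.M.M.a_assoc H_closed[OF f] H_closed[OF g] H_closed[OF h])
    show "f \<oplus>[H X,n] g = g \<oplus>[H X,n] f" by (rule H_eqI[OF H_add_closed[OF f g] H_add_closed[OF g f]])
        (simp add: X.M.M.a_comm H_closed[OF f] H_closed[OF g])
  next
    show "\<zero>[H X,n] \<in> el (H X) n" by (rule H_zero_closed)
  next
    fix f assume f: "f \<in> el (H X) n"
    show "\<zero>[H X,n] \<oplus>[H X,n] f = f" by (rule H_eqI[OF H_add_closed[OF H_zero_closed f] f]) (simp add: H_closed[OF f])
    let ?g = "\<lambda>i. \<lambda>m\<in>el M i. \<ominus>[X,i + n] f i m"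
    have g: "?g \<in> el (H X) n" by (rule H_I[OF rl_uminus[OF X.M.right_module_axioms H_lin[OF f]]])
    have "?g \<oplus>[H X,n] f = \<zero>[H X,n]" by (rule H_eqI[OF H_add_closed[OF g f] H_zero_closed]) (simp add: X.M.M.l_neg H_closed[OF f])
    then show "\<exists>g\<in>el (H X) n. g \<oplus>[H X,n] f = \<zero>[H X,n]" by (rule bexI[OF _ g])
  qed
next
  fix f g c c' assume f: "f \<in> el (H X) n"
  note rc = H_ract_closed
  { assume c: "c \<in> carrier C"
    show "ract (cob (H X) n) f c \<in> el (H X) n" by (rule rc[OF f c])
    show "ract (cob (H X) n) (f \<oplus>[H X,n] g) c = ract (cob (H X) n) f c \<oplus>[H X,n] ract (cob (H X) n) g c"
      if g: "g \<in> el (H X) n"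
      by (rule H_eqI[OF rc[OF H_add_closed[OF f g] c] H_add_closed[OF rc[OF f c] rc[OF g c]]]) (simp add: lact_closed[OF c])
    assume c': "c' \<in> carrier C"
    show "ract (cob (H X) n) f (c \<oplus>[C] c') = ract (cob (H X) n) f c \<oplus>[H X,n] ract (cob (H X) n) f c'"
      by (rule H_eqI[OF rc[OF f C.a_closed[OF c c']] H_add_closed[OF rc[OF f c] rc[OF f c']]])
        (simp add: lact_add[OF c c'] rl_add[OF H_lin[OF f]] lact_closed c c')
    show "ract (cob (H X) n) f (c \<otimes>[C] c') = ract (cob (H X) n) (ract (cob (H X) n) f c) c'"
      by (rule H_eqI[OF rc[OF f C.m_closed[OF c c']] rc[OF rc[OF f c] c']]) (simp add: lact_mult[OF c c'] lact_closed c c') }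
  show "ract (cob (H X) n) f \<one>[C] = f" by (rule H_eqI[OF rc[OF f C.one_closed] f]) (simp add: lact_one)
qed

text \<open>The degree of a value occurs as a sum inside \<open>cob X _\<close>; these rewrites
  bring such sums to a common form so that carriers match syntactically.\<close>

lemma idx: "i + (n + 1) = i + n + (1::int)" "i + 1 + n = i + n + 1" "i + (n + 2) = i + n + 2" "i + n + 1 + 1 = i + n + 2"
  "i + 1 + 1 = i + 2" "i + 2 + n = i + n + 2" "i + 1 + (n + 1) = i + n + 2" by simp_all

lemma H_fd: assumes f: "f \<in> el (H X) n"
  shows "rlinear A (cob M i) (cob X (i + n + 1)) (\<lambda>m. f (i + 1) (cdf M i m))"
    "rlinear A (cob M i) (cob X (i + n + 1)) (\<lambda>m. cdf X (i + n) (f i m))"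
  using rl_comp[OF M.d_lin H_lin[OF f, of "i + 1"]] rl_comp[OF H_lin[OF f] X.d_lin] unfolding idx by simp_all

lemma H_d_closed: assumes f: "f \<in> el (H X) n" shows "cdf (H X) n f \<in> el (H X) (n + 1)"
proof -
  have "rlinear A (cob M i) (cob X (i + (n + 1))) (\<lambda>m. if even n then cdf X (i + n) (f i m) \<ominus>[X,i + n + 1] f (i + 1) (cdf M i m)
       else cdf X (i + n) (f i m) \<oplus>[X,i + n + 1] f (i + 1) (cdf M i m))" for i
    unfolding idx using rl_diff[OF X.M.right_module_axioms H_fd(2)[OF f] H_fd(1)[OF f], of i]
      rl_plus[OF X.M.right_module_axioms H_fd(2)[OF f] H_fd(1)[OF f], of i] by (cases "even n") simp_all
  from H_I[OF this] show ?thesis by (simp add: hom_cpx_def)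
qed

lemma H_cpx: "is_cpx C (H X)"
proof (rule is_cpxI)
  fix n
  show "right_module C (cob (H X) n)" by (rule H_module)
  show "rlinear C (cob (H X) n) (cob (H X) (n + 1)) (cdf (H X) n)"
  proof (rule rlinearI)
    fix f g c assume f: "f \<in> el (H X) n"
    show "cdf (H X) n f \<in> el (H X) (n + 1)" by (rule H_d_closed[OF f])
    show "cdf (H X) n (f \<oplus>[H X,n] g) = cdf (H X) n f \<oplus>[H X,n + 1] cdf (H X) n g" if g: "g \<in> el (H X) n"
    proof (rule H_eqI[OF H_d_closed[OF H_add_closed[OF f g]] H_add_closed[OF H_d_closed[OF f] H_d_closed[OF g]]])
      fix i m assume m: "m \<in> el M i"
      note cl = rl_closed[OF H_fd(1)[OF f] m] rl_closed[OF H_fd(2)[OF f] m] rl_closed[OF H_fd(1)[OF g] m] rl_closed[OF H_fd(2)[OF g] m]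
      have fg: "(f \<oplus>[H X,n] g) (i + 1) (cdf M i m) = f (i + 1) (cdf M i m) \<oplus>[X,i + n + 1] g (i + 1) (cdf M i m)"
        using H_app(1)[OF M.d_closed[OF m], where f = f and g = g and X = X and n = n] unfolding idx .
      have df: "cdf X (i + n) (f i m \<oplus>[X,i + n] g i m) = cdf X (i + n) (f i m) \<oplus>[X,i + n + 1] cdf X (i + n) (g i m)"
        by (rule X.d_add[OF H_closed[OF f m] H_closed[OF g m]])
      show "cdf (H X) n (f \<oplus>[H X,n] g) i m = (cdf (H X) n f \<oplus>[H X,n + 1] cdf (H X) n g) i m"
        unfolding H_d[OF m] H_app[OF m] fg df idx(1)[of i n] using abelian_group.four_term[OF X.grp cl(2,4,1,3)] by (cases "even n") simp_all
    qed
    show "cdf (H X) n (ract (cob (H X) n) f c) = ract (cob (H X) (n + 1)) (cdf (H X) n f) c" if c: "c \<in> carrier C"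
      by (rule H_eqI[OF H_d_closed[OF H_ract_closed[OF f c]] H_ract_closed[OF H_d_closed[OF f] c]])
        (simp add: H_d lact_closed[OF c] lact_d[OF c] M.d_closed)
  qed
  fix f assume f: "f \<in> el (H X) n"
  show "cdf (H X) (n + 1) (cdf (H X) n f) = \<zero>[H X,n + 2]"
  proof (rule H_eqI[OF H_d_closed[OF H_d_closed[OF f]] H_zero_closed])
    fix i m assume m: "m \<in> el M i"
    have 1: "cdf X (i + n + 1) (cdf X (i + n) (f i m)) = \<zero>[X,i + n + 2]" by (rule X.dd[OF H_closed[OF f m]])
    have "f (i + 2) \<zero>[M,i + 2] = \<zero>[X,i + 2 + n]" by (rule rl_zero[OF H_lin[OF f] M.grp X.grp])
    then have 2: "f (i + 2) (cdf M (i + 1) (cdf M i m)) = \<zero>[X,i + n + 2]" unfolding M.dd[OF m] idx .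
    note c1 = rl_closed[OF H_fd(2)[OF f] m] and c2 = rl_closed[OF H_fd(1)[OF f] m]
    have c3: "cdf X (i + n + 1) (f (i + 1) (cdf M i m)) \<in> el X (i + n + 2)" using X.d_closed[OF c2] unfolding idx(4) .
    have 3: "cdf X (i + n + 1) (cdf X (i + n) (f i m) \<ominus>[X,i + n + 1] f (i + 1) (cdf M i m)) = \<zero>[X,i + n + 2] \<ominus>[X,i + n + 2] cdf X (i + n + 1) (f (i + 1) (cdf M i m))"
      "cdf X (i + n + 1) (cdf X (i + n) (f i m) \<oplus>[X,i + n + 1] f (i + 1) (cdf M i m)) = \<zero>[X,i + n + 2] \<oplus>[X,i + n + 2] cdf X (i + n + 1) (f (i + 1) (cdf M i m))"
      using X.d_minus[OF c1 c2] X.d_add[OF c1 c2] unfolding 1 idx(4) by simp_all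
    \<comment> \<open>The terms \<open>d d f\<close> and \<open>f d d\<close> vanish, and the two
      mixed terms \<open>d f d\<close> carry opposite signs because the parity of the degree
      changes.\<close>
    show "cdf (H X) (n + 1) (cdf (H X) n f) i m = \<zero>[H X,n + 2] i m"
      unfolding H_d[OF m] H_d[OF M.d_closed[OF m]] H_app[OF m] idx(1,2,3,4)[of i n] idx(5)[of i] 2
      using c3 by (cases "even n") (simp_all add: 3, simp_all add: a_minus_def X.M.M.r_neg X.M.M.l_neg X.M.M.a_inv_zero)
  qed
qed

end

lemma HM_cm:
  fixes X Y :: "('a, 'u) rcpx"
  assumes X: "is_cpx A X" and Y: "is_cpx A Y" and p: "chain_map A X Y \<phi>"
  shows "chain_map C (H X) (H Y) (HM \<phi>)"
proof (rule chain_mapI)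
  interpret X: cpx_loc A X by standard (rule X)
  interpret Y: cpx_loc A Y by standard (rule Y)
  fix n
  have cl: "HM \<phi> n f \<in> el (H Y) n" if f: "f \<in> el (H X) n" for f n
    using H_I[OF rl_comp[OF H_lin[OF f] cm_lin[OF p]]] by (simp add: hom_cpx_map_def)
  show "rlinear C (cob (H X) n) (cob (H Y) n) (HM \<phi> n)"
  proof (rule rlinearI)
    fix f g c assume f: "f \<in> el (H X) n"
    show "HM \<phi> n f \<in> el (H Y) n" by (rule cl[OF f])
    show "HM \<phi> n (f \<oplus>[H X,n] g) = HM \<phi> n f \<oplus>[H Y,n] HM \<phi> n g" if g: "g \<in> el (H X) n"
      by (rule H_eqI[OF cl[OF H_add_closed[OF X f g]] H_add_closed[OF Y cl[OF f] cl[OF g]]])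
        (simp add: HM_app rl_add[OF cm_lin[OF p]] H_closed[OF f] H_closed[OF g])
    show "HM \<phi> n (ract (cob (H X) n) f c) = ract (cob (H Y) n) (HM \<phi> n f) c" if c: "c \<in> carrier C"
      by (rule H_eqI[OF cl[OF H_ract_closed[OF X f c]] H_ract_closed[OF Y cl[OF f] c]]) (simp add: HM_app lact_closed[OF c])
  qed
  fix f assume f: "f \<in> el (H X) n"
  show "HM \<phi> (n + 1) (cdf (H X) n f) = cdf (H Y) n (HM \<phi> n f)"
  proof (rule H_eqI[OF cl[OF H_d_closed[OF X f]] H_d_closed[OF Y cl[OF f]]])
    fix i m assume m: "m \<in> el M i"
    note c1 = rl_closed[OF H_fd(2)[OF X f] m] and c2 = rl_closed[OF H_fd(1)[OF X f] m]
    show "HM \<phi> (n + 1) (cdf (H X) n f) i m = cdf (H Y) n (HM \<phi> n f) i m"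
      unfolding HM_app[OF m] H_d[OF m] HM_app[OF M.d_closed[OF m]] idx(1,2)[OF X, of i n]
      using rl_minus[OF cm_lin[OF p] X.grp Y.grp c1 c2] rl_add[OF cm_lin[OF p] c1 c2]
        cm_d[OF p H_closed[OF f m]] by simp
  qed
qed

lemma HM_id: "f \<in> el (H X) n \<Longrightarrow> HM (\<lambda>n x. x) n f = f" by (rule ext) (auto simp: hom_cpx_map_def H_carrier intro!: extensional_restrict)

lemma HM_comp: "HM (\<lambda>n x. \<psi> n (\<phi> n x)) n f = HM \<psi> n (HM \<phi> n f)" by (auto simp: hom_cpx_map_def fun_eq_iff restrict_def)

lemma HM_hmt:
  fixes X Y :: "('a, 'u) rcpx"
  assumes X: "is_cpx A X" and Y: "is_cpx A Y" and p: "chain_map A X Y \<phi>" and q: "chain_map A X Y \<psi>" and h: "homotopic A X Y \<phi> \<psi>"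
  shows "homotopic C (H X) (H Y) (HM \<phi>) (HM \<psi>)"
proof -
  interpret X: cpx_loc A X by standard (rule X)
  interpret Y: cpx_loc A Y by standard (rule Y)
  obtain k where k: "is_htpy A X Y k \<phi> \<psi>" by (rule homotopicE[OF h Y p q X])
  have idm: "i + n - 1 = i + (n - 1)" for i n :: int by simp
  have cl: "HM k n f \<in> el (H Y) (n - 1)" if f: "f \<in> el (H X) n" for f n
  proof -
    have "rlinear A (cob M i) (cob Y (i + (n - 1))) (\<lambda>m. k (i + n) (f i m))" for i
      using rl_comp[OF H_lin[OF f] htpyD(1)[OF k], of i] unfolding idm .
    from H_I[OF this] show ?thesis by (simp add: hom_cpx_map_def)
  qed
  note cp = cm_closed[OF HM_cm[OF X Y p]] and cq = cm_closed[OF HM_cm[OF X Y q]]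
  have lin: "rlinear C (cob (H X) n) (cob (H Y) (n - 1)) (HM k n)" for n
  proof (rule rlinearI)
    fix f g c assume f: "f \<in> el (H X) n"
    show "HM k n f \<in> el (H Y) (n - 1)" by (rule cl[OF f])
    show "HM k n (f \<oplus>[H X,n] g) = HM k n f \<oplus>[H Y,n - 1] HM k n g" if g: "g \<in> el (H X) n"
      by (rule H_eqI[OF cl[OF H_add_closed[OF X f g]] H_add_closed[OF Y cl[OF f] cl[OF g]]])
        (simp add: HM_app rl_add[OF htpyD(1)[OF k]] H_closed[OF f] H_closed[OF g] idm)
    show "HM k n (ract (cob (H X) n) f c) = ract (cob (H Y) (n - 1)) (HM k n f) c" if c: "c \<in> carrier C"
      by (rule H_eqI[OF cl[OF H_ract_closed[OF X f c]] H_ract_closed[OF Y cl[OF f] c]]) (simp add: HM_app lact_closed[OF c])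
  qed
  show ?thesis
  proof (rule homotopicI[OF H_cpx[OF Y] HM_cm[OF X Y p] HM_cm[OF X Y q] H_cpx[OF X] lin])
    fix n f assume f: "f \<in> el (H X) n"
    note df = H_d_closed[OF X f]
    have c: "HM k (n + 1) (cdf (H X) n f) \<in> el (H Y) n" using cl[OF df] by simp
    have c': "cdf (H Y) (n - 1) (HM k n f) \<in> el (H Y) n" using H_d_closed[OF Y cl[OF f]] by simp
    show "HM \<phi> n f = HM \<psi> n f \<oplus>[H Y,n] (cdf (H Y) (n - 1) (HM k n f) \<oplus>[H Y,n] HM k (n + 1) (cdf (H X) n f))"
    proof (rule H_eqI[OF cp[OF f] H_add_closed[OF Y cq[OF f] H_add_closed[OF Y c' c]]])
      fix i m assume m: "m \<in> el M i"
      note c1 = rl_closed[OF H_fd(2)[OF X f] m] and c2 = rl_closed[OF H_fd(1)[OF X f] m] and fm = H_closed[OF f m]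
      have kl: "rlinear A (cob X (i + n + 1)) (cob Y (i + n)) (k (i + n + 1))" using htpyD(1)[OF k, of "i + n + 1"] by simp
      note kc = rl_closed[OF kl c1] rl_closed[OF kl c2]
      have dk: "cdf Y (i + n - 1) (k (i + n) (f i m)) \<in> el Y (i + n)" by (rule Y.d_closed'[OF rl_closed[OF htpyD(1)[OF k] fm]])
      note pq = cm_closed[OF q fm]
      \<comment> \<open>The homotopy lowers the degree by one, so the two terms \<open>k f d\<close>
        enter with opposite signs and cancel.\<close>
      have ev: "even (n - 1) = odd n" by simp
      have ix: "i + (n - 1) = i + n - 1" "i + n - 1 + 1 = i + n" by simp_all
      show "HM \<phi> n f i m = (HM \<psi> n f \<oplus>[H Y,n] (cdf (H Y) (n - 1) (HM k n f) \<oplus>[H Y,n] HM k (n + 1) (cdf (H X) n f))) i m"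
        unfolding H_app[OF m] H_d[OF m] HM_app[OF m] HM_app[OF M.d_closed[OF m]] idx(1,2)[OF X, of i n] ev ix htpyD(3)[OF k fm]
        using rl_minus[OF kl X.grp Y.grp c1 c2] rl_add[OF kl c1 c2] abelian_group.four_term(3,4)[OF Y.grp dk kc kc(1)]
        by (cases "even n") simp_all
    qed
  qed
qed

end

section \<open>The functor RHom\<close>

context derived begin

abbreviation "KI \<equiv> K_inj A :: ('a, 'u) rcpx \<Rightarrow> ('a, 'u) rcpx"
abbreviation "ki \<equiv> \<lambda>X :: ('a, 'u) rcpx. snd (K_injective_resolution A X)"

lemma KI:
  assumes "is_cpx A X"
  shows "K_injective A (KI X)" "quasi_iso A X (KI X) (ki X)" "is_cpx A (KI X)" "chain_map A X (KI X) (ki X)"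
proof -
  obtain I :: "('a, 'u) rcpx" and i where "K_injective A I \<and> quasi_iso A X I i" using K_injective_resolution_exists[OF large assms] by blast
  then have "case (I, i) of (I, i) \<Rightarrow> K_injective A I \<and> quasi_iso A X I i" by simp
  from someI[of "\<lambda>(I, i). K_injective A I \<and> quasi_iso A X I i", OF this]
  show "K_injective A (KI X)" and "quasi_iso A X (KI X) (ki X)" unfolding K_injective_resolution_def by (simp_all add: case_prod_beta)
  then show "is_cpx A (KI X)" and "chain_map A X (KI X) (ki X)" by (simp_all add: K_inj_cpx qi_cm)
qed

abbreviation "lki X \<equiv> locU X (KI X) (ki X)"

lemma lki: assumes "is_cpx A X" shows "lki X \<in> Hom X (KI X)" "is_iso D X (KI X) (lki X)"
  by (rule loc_Hom[OF assms KI(3,4)[OF assms]], rule loc_qi[OF assms KI(3,2)[OF assms]])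

text \<open>A lift is only characterised after composition with the arrow X -> \<open>KI X\<close>.
  That arrow is invertible and the target is K-injective, so two lifts are homotopic; this makes the
  choice in \<open>K_inj_lift\<close> harmless.\<close>

lemma lift_unique:
  assumes X: "is_cpx A X" and I: "K_injective A I" and p: "chain_map A (KI X) I \<phi>" and q: "chain_map A (KI X) I \<psi>"
    and e: "roof_comp A (locU (KI X) I \<phi>) (lki X) = roof_comp A (locU (KI X) I \<psi>) (lki X)"
  shows "hmt (KI X) I \<phi> \<psi>"
proof -
  note Ic = K_inj_cpx[OF I]
  have "locU (KI X) I \<phi> = locU (KI X) I \<psi>"
    by (rule iso_cancel_right[OF lki(2)[OF X] loc_Hom[OF KI(3)[OF X] Ic p] loc_Hom[OF KI(3)[OF X] Ic q] e])
  then show ?thesis unfolding Ki_loc_eq_iff[OF I KI(3)[OF X] p q] .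
qed

text \<open>The arrow \<open>lki Y\<close> after \<alpha>, precomposed with an inverse of
  \<open>lki X\<close>, goes from \<open>KI X\<close> into a K-injective complex and is therefore
  given by a chain map.\<close>

lemma lift:
  assumes al: "\<alpha> \<in> Hom X Y"
  shows "chain_map A (KI X) (KI Y) (K_inj_lift A \<alpha>)"
    "roof_comp A (locU (KI X) (KI Y) (K_inj_lift A \<alpha>)) (lki X) = roof_comp A (lki Y) \<alpha>"
proof -
  note X = Hom_obj(1)[OF al] and Y = Hom_obj(2)[OF al]
  obtain g where g: "g \<in> Hom (KI X) X" and gi: "roof_comp A g (lki X) = locU X X (\<lambda>n x. x)"
    using lki(2)[OF X] unfolding is_iso_def D_sel by (elim conjE bexE)
  note m = D_comp[OF al lki(1)[OF Y]]
  obtain \<phi> where p: "chain_map A (KI X) (KI Y) \<phi>" "roof_comp A (roof_comp A (lki Y) \<alpha>) g = locU (KI X) (KI Y) \<phi>"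
    by (rule Ki_loc_surj[OF KI(1)[OF Y] D_comp[OF g m]])
  have "roof_comp A (locU (KI X) (KI Y) \<phi>) (lki X) = roof_comp A (lki Y) \<alpha>"
    unfolding p(2)[symmetric] D_assoc[OF lki(1)[OF X] g m, symmetric] gi D_id(1)[OF m] ..
  with p(1) have "chain_map A (KI X) (KI Y) \<phi> \<and> roof_comp A (locU (KI X) (KI Y) \<phi>) (lki X) = roof_comp A (lki Y) \<alpha>" ..
  from someI[of "\<lambda>\<phi>. chain_map A (KI X) (KI Y) \<phi> \<and> roof_comp A (locU (KI X) (KI Y) \<phi>) (lki X) = roof_comp A (lki Y) \<alpha>", OF this]
  show "chain_map A (KI X) (KI Y) (K_inj_lift A \<alpha>)"
    "roof_comp A (locU (KI X) (KI Y) (K_inj_lift A \<alpha>)) (lki X) = roof_comp A (lki Y) \<alpha>"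
    unfolding K_inj_lift_def Let_def Hom_dom_cod[OF al] by simp_all
qed

lemma lift_id:
  assumes X: "is_cpx A X" shows "hmt (KI X) (KI X) (K_inj_lift A (locU X X (\<lambda>n x. x))) (\<lambda>n x. x)"
proof -
  note i = loc_Hom[OF X X cm_id]
  show ?thesis by (rule lift_unique[OF X KI(1)[OF X] lift(1)[OF i] cm_id]) (simp only: lift(2)[OF i] D_id[OF lki(1)[OF X]])
qed

lemma lift_comp:
  assumes al: "\<alpha> \<in> Hom X Y" and be: "\<beta> \<in> Hom Y Z"
  shows "hmt (KI X) (KI Z) (K_inj_lift A (roof_comp A \<beta> \<alpha>)) (\<lambda>n x. K_inj_lift A \<beta> n (K_inj_lift A \<alpha> n x))"
proof -
  note X = Hom_obj(1)[OF al] and Y = Hom_obj(2)[OF al] and Z = Hom_obj(2)[OF be]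
  note a = lift(1)[OF al] and b = lift(1)[OF be] and ba = D_comp[OF al be]
  note la = loc_Hom[OF KI(3)[OF X] KI(3)[OF Y] a] and lb = loc_Hom[OF KI(3)[OF Y] KI(3)[OF Z] b]
  show ?thesis
  proof (rule lift_unique[OF X KI(1)[OF Z] lift(1)[OF ba] cm_comp[OF a b]])
    show "roof_comp A (locU (KI X) (KI Z) (K_inj_lift A (roof_comp A \<beta> \<alpha>))) (lki X) =
      roof_comp A (locU (KI X) (KI Z) (\<lambda>n x. K_inj_lift A \<beta> n (K_inj_lift A \<alpha> n x))) (lki X)"
      unfolding lift(2)[OF ba] loc_comp[OF KI(3)[OF X] KI(3)[OF Y] KI(3)[OF Z] a b, symmetric]
        D_assoc[OF lki(1)[OF X] la lb, symmetric] lift(2)[OF al] D_assoc[OF al lki(1)[OF Y] lb] lift(2)[OF be]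
      by (rule D_assoc[OF al be lki(1)[OF Z]])
  qed
qed

end

text \<open>\<open>inj_hom\<close> says that the cochains of Hom complexes fit into the universe, so
  the Hom complex can be renamed to the complex \<open>HE X\<close> over \<open>'u\<close>.\<close>

locale rhom = A: derived A U + C: derived C U + bicpx_loc A C M
  for A :: "('a, 'x) ring_scheme" and C :: "('c, 'y) ring_scheme" and U :: "'u itself" and M :: "('c, 'a, 'v) bicpx" +
  assumes inj_hom: "inj (enc :: ('v, 'u) gmap \<Rightarrow> 'u)"
begin

sublocale E: enc_loc "TYPE(('v, 'u) gmap)" "TYPE('u)" by (rule enc_loc.intro[OF inj_hom])

definition HE :: "('a, 'u) rcpx \<Rightarrow> ('c, 'u) rcpx" where "HE X = enc_cpx (H X)"
definition HEm :: "('u, 'u) gmap \<Rightarrow> ('u, 'u) gmap" where "HEm \<phi> = (\<lambda>n x. enc (HM \<phi> n (dec x)))"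

lemma HE_cpx: "is_cpx A X \<Longrightarrow> is_cpx C (HE X)" unfolding HE_def by (rule E.enc_cpx_cpx[OF H_cpx])

lemma HE_carrier: "x \<in> el (HE X) n \<longleftrightarrow> (\<exists>f \<in> el (H X) n. x = enc f)" unfolding HE_def by auto

lemma HEm_cm: "\<lbrakk>is_cpx A X; is_cpx A Y; chain_map A X Y \<phi>\<rbrakk> \<Longrightarrow> chain_map C (HE X) (HE Y) (HEm \<phi>)"
  unfolding HE_def HEm_def by (rule cm_comp[OF cm_comp[OF E.dec_cm HM_cm] E.enc_cm])

lemma HEm_hmt:
  assumes X: "is_cpx A X" and Y: "is_cpx A Y" and p: "chain_map A X Y \<phi>" and q: "chain_map A X Y \<psi>" and h: "homotopic A X Y \<phi> \<psi>"
  shows "homotopic C (HE X) (HE Y) (HEm \<phi>) (HEm \<psi>)" unfolding HEm_def HE_def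
  by (rule hmt_comp_left[OF hmt_comp_right[OF HM_hmt[OF X Y p q h] H_cpx[OF X] H_cpx[OF Y] E.enc_cpx_cpx[OF H_cpx[OF X]]
        HM_cm[OF X Y p] HM_cm[OF X Y q] E.dec_cm] E.enc_cpx_cpx[OF H_cpx[OF X]] H_cpx[OF Y] E.enc_cpx_cpx[OF H_cpx[OF Y]]
      cm_comp[OF E.dec_cm HM_cm[OF X Y p]] cm_comp[OF E.dec_cm HM_cm[OF X Y q]] E.enc_cm])

lemma HEm_id: "x \<in> el (HE X) n \<Longrightarrow> HEm (\<lambda>n x. x) n x = x" by (auto simp: HE_carrier HEm_def HM_id)

lemma HEm_comp: "HEm (\<lambda>n x. \<psi> n (\<phi> n x)) n x = HEm \<psi> n (HEm \<phi> n x)" by (simp add: HEm_def HM_comp)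

abbreviation "RH \<equiv> RHom A C M :: (('a, 'u) rcpx, ('a, 'u) roof set, ('c, 'u) rcpx, ('c, 'u) roof set) funct"

lemma RH_ob: "fob RH X = HE (A.KI X)" by (simp add: RHom_def HE_def)

lemma RH_ar: "\<alpha> \<in> A.Hom X Y \<Longrightarrow> far RH \<alpha> = C.locU (HE (A.KI X)) (HE (A.KI Y)) (HEm (K_inj_lift A \<alpha>))"
  by (simp add: RHom_def HE_def HEm_def A.Hom_dom_cod)

lemma loc_HEm_eqI:
  assumes X: "is_cpx A X" and Y: "is_cpx A Y" and p: "chain_map A X Y \<phi>" and q: "chain_map A X Y \<psi>" and h: "homotopic A X Y \<phi> \<psi>"
  shows "C.locU (HE X) (HE Y) (HEm \<phi>) = C.locU (HE X) (HE Y) (HEm \<psi>)"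
  by (rule C.loc_hmt[OF HE_cpx[OF X] HE_cpx[OF Y] HEm_cm[OF X Y p] HEm_cm[OF X Y q] HEm_hmt[OF assms]])

text \<open>Lifts respect identities and composition only up to homotopy; Hom complexes preserve
  homotopies, and these become equalities of arrows.\<close>

lemma RH_functor: "is_functor A.D C.D RH" unfolding is_functor_def RH_ob
proof (intro conjI ballI)
  fix X assume "X \<in> Obj A.D" then have X: "is_cpx A X" by (simp add: A.D_sel)
  note I = A.KI(3)[OF X] note HI = HE_cpx[OF I] and i = A.loc_Hom[OF X X cm_id]
  show "HE (A.KI X) \<in> Obj C.D" using HI by (simp add: C.D_sel)
  show "far RH (Idn A.D X) = Idn C.D (HE (A.KI X))"
    unfolding A.D_sel C.D_sel RH_ar[OF i] loc_HEm_eqI[OF I I A.lift(1)[OF i] cm_id A.lift_id[OF X]]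
    by (rule C.loc_hmt[OF HI HI HEm_cm[OF I I cm_id] cm_id hmt_eqI[OF HI HEm_cm[OF I I cm_id] cm_id HI HEm_id]])
next
  fix X Y \<alpha> assume al: "\<alpha> \<in> A.Hom X Y"
  note X = A.KI(3)[OF A.Hom_obj(1)[OF al]] and Y = A.KI(3)[OF A.Hom_obj(2)[OF al]]
  show "far RH \<alpha> \<in> C.Hom (HE (A.KI X)) (HE (A.KI Y))" unfolding RH_ar[OF al]
    by (rule C.loc_Hom[OF HE_cpx[OF X] HE_cpx[OF Y] HEm_cm[OF X Y A.lift(1)[OF al]]])
next
  fix X Y Z \<alpha> \<beta> assume al: "\<alpha> \<in> A.Hom X Y" and be: "\<beta> \<in> A.Hom Y Z"
  note X = A.KI(3)[OF A.Hom_obj(1)[OF al]] and Y = A.KI(3)[OF A.Hom_obj(2)[OF al]] and Z = A.KI(3)[OF A.Hom_obj(2)[OF be]]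
  note a = A.lift(1)[OF al] and b = A.lift(1)[OF be] and ba = A.D_comp[OF al be]
  show "far RH (Cmp A.D \<beta> \<alpha>) = Cmp C.D (far RH \<beta>) (far RH \<alpha>)" unfolding A.D_sel C.D_sel RH_ar[OF al] RH_ar[OF be] RH_ar[OF ba]
      loc_HEm_eqI[OF X Z A.lift(1)[OF ba] cm_comp[OF a b] A.lift_comp[OF al be]] HEm_comp[abs_def]
    by (rule C.loc_comp[OF HE_cpx[OF X] HE_cpx[OF Y] HE_cpx[OF Z] HEm_cm[OF X Y a] HEm_cm[OF Y Z b], symmetric])
qed

end

section \<open>Bimodules and the right adjoint\<close>

locale bimod = C: ring C + N: right_module A N
  for A :: "('a, 'x) ring_scheme" and C :: "('c, 'y) ring_scheme" and N :: "('c, 'a, 'v) bimodule" +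
  assumes lact_lin: "c \<in> carrier C \<Longrightarrow> rlinear A N N (lact N c)"
    and lact_add: "\<lbrakk>c \<in> carrier C; c' \<in> carrier C; m \<in> carrier N\<rbrakk> \<Longrightarrow> lact N (c \<oplus>[C] c') m = lact N c m \<oplus>[N] lact N c' m"
    and lact_mult: "\<lbrakk>c \<in> carrier C; c' \<in> carrier C; m \<in> carrier N\<rbrakk> \<Longrightarrow> lact N (c \<otimes>[C] c') m = lact N c (lact N c' m)"
    and lact_one: "m \<in> carrier N \<Longrightarrow> lact N \<one>[C] m = m"

lemma conc_simps [simp]:
  "cob (conc N) 0 = N" "n \<noteq> 0 \<Longrightarrow> el (conc N) n = {\<zero>[N]}" "zero (cob (conc N) n) = zero N"
  "add (cob (conc N) n) = add N" "cdf (conc N) n x = \<zero>[N]" by (simp_all add: conc_def)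

lemma conc_ract [simp]: "ract (cob (conc (N :: ('a, 'u, 'z) rmodule_scheme)) n) = ract N" by (simp add: conc_def)

lemma conc_lact [simp]: "lact (cob (conc N) n) = lact N" by (simp add: conc_def)

lemma conc_cpx:
  assumes "right_module A N" shows "is_cpx A (conc N)"
proof -
  interpret N: right_module A N by fact
  have g: "abelian_group (cob (conc N) n)" if "n \<noteq> 0" for n by (rule abelian_groupI) (use that in auto)
  have "right_module A (cob (conc N) n)" for n
  proof (cases "n = 0")
    case False
    then show ?thesis by (intro right_moduleI' N.A.ring_axioms g) (auto simp: N.ract_zero_left)
  qed (simp add: assms)
  moreover have "\<zero>[N] \<in> el (conc N) n" for n by (cases "n = 0") auto
  ultimately show ?thesis by (intro is_cpxI rlinearI) (simp_all add: N.ract_zero_left)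
qed

lemma conc_carrier: "m \<in> el (conc N) n \<Longrightarrow> abelian_group N \<Longrightarrow> m \<in> carrier N"
  by (cases "n = 0") (auto simp: abelian_group.axioms abelian_monoid.zero_closed)

lemma (in bimod) conc_bicpx: "bicpx_loc A C (conc N)"
proof (intro bicpx_loc.intro bicpx_loc_axioms.intro cpx_loc.intro)
  show "ring C" by (rule C.ring_axioms)
  show "is_cpx A (conc N)" by (rule conc_cpx[OF N.right_module_axioms])
  note z = rl_zero[OF lact_lin N.M.abelian_group_axioms N.M.abelian_group_axioms]
  fix c c' m and i :: int assume c: "c \<in> carrier C"
  show "rlinear A (cob (conc N) i) (cob (conc N) i) (lact (cob (conc N) i) c)"
    by (cases "i = 0") (auto simp: lact_lin[OF c] z[OF c] N.ract_zero_left intro!: rlinearI)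
  { assume m: "m \<in> el (conc N) i"
    note m' = conc_carrier[OF m N.M.abelian_group_axioms]
    show "cdf (conc N) i (lact (cob (conc N) i) c m) = lact (cob (conc N) (i + 1)) c (cdf (conc N) i m)" by (simp add: z[OF c])
    assume c': "c' \<in> carrier C"
    show "lact (cob (conc N) i) (c \<oplus>[C] c') m = lact (cob (conc N) i) c m \<oplus>[conc N,i] lact (cob (conc N) i) c' m"
      "lact (cob (conc N) i) (c \<otimes>[C] c') m = lact (cob (conc N) i) c (lact (cob (conc N) i) c' m)"
      using lact_add[OF c c' m'] lact_mult[OF c c' m'] by simp_all }
next
  fix m and i :: int assume m: "m \<in> el (conc N) i"
  show "lact (cob (conc N) i) \<one>[C] m = m" using lact_one[OF conc_carrier[OF m N.M.abelian_group_axioms]] by simp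
qed

lemma ring_bimodule_simps [simp]:
  "carrier (ring_bimodule R l r) = carrier R" "add (ring_bimodule R l r) = add R" "zero (ring_bimodule R l r) = \<zero>[R]"
  "ract (ring_bimodule R l r) x a = x \<otimes>[R] r a" "lact (ring_bimodule R l r) c x = l c \<otimes>[R] x"
  by (simp_all add: ring_bimodule_def add_lact_def mk_rmodule_def rmodule.defs bimodule.defs)

lemma ring_bimod:
  assumes A: "ring A" and C: "ring C" and R: "ring R" and l: "l \<in> ring_hom C R" and r: "r \<in> ring_hom A R"
  shows "bimod A C (ring_bimodule R l r)"
proof -
  interpret A: ring A by fact
  interpret C: ring C by fact
  interpret R: ring R by fact
  note cl = ring_hom_closed[OF l] ring_hom_closed[OF r]
  have "abelian_group (ring_bimodule R l r)" by (rule abelian_groupI) (auto simp: R.a_ac R.l_neg intro!: bexI[of _ "\<ominus>[R] _"])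
  then have "right_module A (ring_bimodule R l r)" by (intro right_moduleI' A.ring_axioms)
      (simp_all add: cl R.l_distr R.r_distr R.m_assoc ring_hom_add[OF r] ring_hom_mult[OF r] ring_hom_one[OF r])
  then show ?thesis by (intro bimod.intro bimod_axioms.intro C.ring_axioms rlinearI)
      (simp_all add: cl R.l_distr R.r_distr R.m_assoc ring_hom_add[OF l] ring_hom_mult[OF l] ring_hom_one[OF l])
qed

context derived begin

text \<open>The evaluation map ends in the resolution \<open>KI X\<close>, while the counit of the
  adjunction has to end in X; this inverse carries it back.\<close>

definition lkinv :: "('a, 'u) rcpx \<Rightarrow> ('a, 'u) roof set" where
  "lkinv X = (SOME g. g \<in> Hom (KI X) X \<and> roof_comp A g (lki X) = locU X X (\<lambda>n x. x) \<and> roof_comp A (lki X) g = locU (KI X) (KI X) (\<lambda>n x. x))"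

lemma lkinv:
  assumes X: "is_cpx A X"
  shows "lkinv X \<in> Hom (KI X) X" "roof_comp A (lkinv X) (lki X) = locU X X (\<lambda>n x. x)"
    "roof_comp A (lki X) (lkinv X) = locU (KI X) (KI X) (\<lambda>n x. x)"
proof -
  have "\<exists>g. g \<in> Hom (KI X) X \<and> roof_comp A g (lki X) = locU X X (\<lambda>n x. x) \<and> roof_comp A (lki X) g = locU (KI X) (KI X) (\<lambda>n x. x)"
    using lki(2)[OF X] unfolding is_iso_def D_sel by (elim conjE bexE) (intro exI conjI)
  from someI_ex[OF this] show "lkinv X \<in> Hom (KI X) X" "roof_comp A (lkinv X) (lki X) = locU X X (\<lambda>n x. x)"
    "roof_comp A (lki X) (lkinv X) = locU (KI X) (KI X) (\<lambda>n x. x)" unfolding lkinv_def by - (elim conjE, assumption)+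
qed

lemma lki_lkinv: assumes X: "is_cpx A X" and b: "\<beta> \<in> Hom W (KI X)" shows "roof_comp A (lki X) (roof_comp A (lkinv X) \<beta>) = \<beta>"
  unfolding D_assoc[OF b lkinv(1)[OF X] lki(1)[OF X]] lkinv(3)[OF X] by (rule D_id(2)[OF b])

lemma lki_cancel:
  assumes X: "is_cpx A X" and a: "\<alpha> \<in> Hom W X" and b: "\<beta> \<in> Hom W X" and e: "roof_comp A (lki X) \<alpha> = roof_comp A (lki X) \<beta>"
  shows "\<alpha> = \<beta>"
proof -
  have *: "roof_comp A (lkinv X) (roof_comp A (lki X) \<gamma>) = \<gamma>" if g: "\<gamma> \<in> Hom W X" for \<gamma>
    unfolding D_assoc[OF g lki(1)[OF X] lkinv(1)[OF X]] lkinv(2)[OF X] by (rule D_id(2)[OF g])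
  show ?thesis by (rule trans[OF *[OF a, symmetric] trans[OF _ *[OF b]]]) (simp only: e)
qed

end

section \<open>The right adjoint of restriction\<close>

context ring_mor begin

abbreviation "N \<equiv> ring_bimodule B id p"

lemma ring_hom_id: "id \<in> ring_hom B B" by (rule ring_hom_memI) simp_all

sublocale N: bimod A B N by (rule ring_bimod[OF A.A.ring_axioms B.A.ring_axioms B.A.ring_axioms ring_hom_id p])

sublocale Q: rhom A B U "conc N"
proof (intro rhom.intro rhom_axioms.intro A.derived_axioms B.derived_axioms N.conc_bicpx)
  show "inj (enc :: ('b, 'u) gmap \<Rightarrow> 'u)" by (rule embeds_enc[OF universe_fun_countable[OF B.large]])
qed

text \<open>The bimodule \<open>N\<close> sits in degree 0, so a cochain of degree \<open>j\<close>
  amounts to one linear map \<open>q\<close> from B; its other components start at zero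
  modules.\<close>

definition qh :: "('a, 'u) rcpx \<Rightarrow> int \<Rightarrow> ('b \<Rightarrow> 'u) \<Rightarrow> ('b, 'u) gmap" where
  "qh I j q = (\<lambda>i. \<lambda>b\<in>el (conc N) i. if i = 0 then q b else \<zero>[I,i + j])"

lemma qh_app: "b \<in> el (conc N) i \<Longrightarrow> qh I j q i b = (if i = 0 then q b else \<zero>[I,i + j])" by (simp add: qh_def)

lemma qh_closed:
  assumes I: "is_cpx A I" and q: "rlinear A N (cob I j) q"
  shows "qh I j q \<in> el (Q.H I) j" unfolding qh_def
proof (rule Q.H_I)
  interpret I: cpx_loc A I by standard (rule I)
  fix i
  show "rlinear A (cob (conc N) i) (cob I (i + j)) (\<lambda>b. if i = 0 then q b else \<zero>[I,i + j])"
    using q rl_const_zero[OF I.M.right_module_axioms] by (cases "i = 0") simp_all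
qed

lemma qh_eta:
  assumes I: "is_cpx A I" and f: "f \<in> el (Q.H I) j"
  shows "qh I j (f 0) = f"
proof -
  interpret I: cpx_loc A I by standard (rule I)
  have "rlinear A N (cob I j) (f 0)" using Q.H_lin[OF f, of 0] by simp
  from qh_closed[OF I this] show ?thesis
  proof (rule Q.H_eqI[OF _ f])
    fix i m assume m: "m \<in> el (conc N) i"
    show "qh I j (f 0) i m = f i m" using m rl_zero[OF Q.H_lin[OF f, of i] Q.M.grp I.grp] by (cases "i = 0") (auto simp: qh_app)
  qed
qed

lemma qh_d:
  assumes I: "is_cpx A I" and q: "rlinear A N (cob I j) q"
  shows "cdf (Q.H I) j (qh I j q) = qh I (j + 1) (\<lambda>b. cdf I j (q b))"
proof -
  interpret I: cpx_loc A I by standard (rule I)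
  note c = qh_closed[OF I q]
  show ?thesis
  proof (rule Q.H_eqI[OF Q.H_d_closed[OF I c] qh_closed[OF I rl_comp[OF q I.d_lin]]])
    fix i m assume m: "m \<in> el (conc N) i"
    have 1: "qh I j q (i + 1) (cdf (conc N) i m) = \<zero>[I,i + j + 1]"
      using rl_zero[OF Q.H_lin[OF c, of "i + 1"] Q.M.grp I.grp] by (simp add: add_ac)
    show "cdf (Q.H I) j (qh I j q) i m = qh I (j + 1) (\<lambda>b. cdf I j (q b)) i m"
      unfolding Q.H_d[OF m] 1 using I.d_closed[OF Q.H_closed[OF c m]] I.d_zero[of "i + j"] m
      by (cases "i = 0") (simp_all add: qh_app[OF m] qh_app a_minus_def I.M.M.a_inv_zero add.assoc)
  qed
qed

text \<open>The transpose under the adjunction between restriction and Hom: y is sent to the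
  function \<open>q (y b)\<close> of b. Evaluation at \<open>1\<close> inverts it.\<close>

definition hat :: "('b, 'u) rmodule \<Rightarrow> ('a, 'u) rcpx \<Rightarrow> int \<Rightarrow> ('u \<Rightarrow> 'u) \<Rightarrow> 'u \<Rightarrow> ('b, 'u) gmap" where
  "hat Y I j q y = qh I j (\<lambda>b. q (ract Y y b))"

lemma hat_app: "b \<in> el (conc N) i \<Longrightarrow> hat Y I j q y i b = (if i = 0 then q (ract Y y b) else \<zero>[I,i + j])" by (simp add: hat_def qh_app)

lemma hat_rl:
  assumes Y: "right_module B Y" and q: "rlinear A (restr_mod p Y) (cob I j) q" and y: "y \<in> carrier Y"
  shows "rlinear A N (cob I j) (\<lambda>b. q (ract Y y b))"
proof (rule rlinearI)
  interpret Y: right_module B Y by fact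
  fix b b' a assume b: "b \<in> carrier N"
  show "q (ract Y y b) \<in> el I j" using rl_closed[OF q] Y.ract_closed[OF y] b by simp
  show "q (ract Y y (b \<oplus>[N] b')) = q (ract Y y b) \<oplus>[I,j] q (ract Y y b')" if "b' \<in> carrier N"
    using rl_add[OF q] Y.ract_closed[OF y] Y.ract_add_right[OF y] b that by simp
  show "q (ract Y y (ract N b a)) = ract (cob I j) (q (ract Y y b)) a" if "a \<in> carrier A"
    using rl_ract[OF q, of "ract Y y b" a] Y.ract_closed[OF y] Y.ract_mult[OF y] ring_hom_closed[OF p] b that by simp
qed

lemma hat_closed:
  "\<lbrakk>is_cpx A I; right_module B Y; rlinear A (restr_mod p Y) (cob I j) q; y \<in> carrier Y\<rbrakk> \<Longrightarrow> hat Y I j q y \<in> el (Q.H I) j"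
  unfolding hat_def by (rule qh_closed[OF _ hat_rl])

lemma hat_lin:
  assumes I: "is_cpx A I" and Y: "right_module B Y" and q: "rlinear A (restr_mod p Y) (cob I j) q"
  shows "rlinear B Y (cob (Q.HE I) j) (\<lambda>y. enc (hat Y I j q y))"
proof -
  interpret I: cpx_loc A I by standard (rule I)
  interpret Y: right_module B Y by fact
  note cl = hat_closed[OF I Y q] and ac = Q.H_add_closed[OF I] and rc = Q.H_ract_closed[OF I]
  have "rlinear B Y (cob (Q.H I) j) (hat Y I j q)"
  proof (rule rlinearI)
    fix x y b assume x: "x \<in> carrier Y"
    show "hat Y I j q x \<in> el (Q.H I) j" by (rule cl[OF x])
    show "hat Y I j q (x \<oplus>[Y] y) = hat Y I j q x \<oplus>[Q.H I,j] hat Y I j q y" if y: "y \<in> carrier Y"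
    proof (rule Q.H_eqI[OF cl[OF Y.M.a_closed[OF x y]] ac[OF cl[OF x] cl[OF y]]])
      fix i m assume m: "m \<in> el (conc N) i"
      have mB: "m \<in> carrier B" using conc_carrier[OF m N.N.M.abelian_group_axioms] by simp
      show "hat Y I j q (x \<oplus>[Y] y) i m = (hat Y I j q x \<oplus>[Q.H I,j] hat Y I j q y) i m"
        using rl_add[OF q, of "ract Y x m" "ract Y y m"] Y.ract_closed x y mB Y.ract_add_left[OF x y mB]
        by (simp add: Q.H_app[OF m] hat_app[OF m])
    qed
    show "hat Y I j q (ract Y x b) = ract (cob (Q.H I) j) (hat Y I j q x) b" if b: "b \<in> carrier B"
    proof (rule Q.H_eqI[OF cl[OF Y.ract_closed[OF x b]] rc[OF cl[OF x] b]])
      fix i m assume m: "m \<in> el (conc N) i"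
      have mB: "m \<in> carrier B" using conc_carrier[OF m N.N.M.abelian_group_axioms] by simp
      show "hat Y I j q (ract Y x b) i m = ract (cob (Q.H I) j) (hat Y I j q x) b i m"
        using Y.ract_mult[OF x b mB] Q.lact_closed[OF b m] by (simp add: Q.H_app[OF m] hat_app[OF m] hat_app)
    qed
  qed
  from rl_comp[OF this Q.E.enc_rl] show ?thesis by (simp add: Q.HE_def)
qed

lemma hat_d:
  "\<lbrakk>is_cpx A I; right_module B Y; rlinear A (restr_mod p Y) (cob I j) q; y \<in> carrier Y\<rbrakk> \<Longrightarrow>
    cdf (Q.H I) j (hat Y I j q y) = hat Y I (j + 1) (\<lambda>y. cdf I j (q y)) y" unfolding hat_def by (rule qh_d[OF _ hat_rl])

definition ev :: "('u, 'u) gmap" where "ev n x = (dec x :: ('b, 'u) gmap) 0 \<one>[B]"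

lemma one_N: "\<one>[B] \<in> el (conc N) 0" by simp

lemma ev_cm:
  assumes I: "is_cpx A I" shows "chain_map A (res (Q.HE I)) I ev"
proof (rule chain_mapI)
  interpret I: cpx_loc A I by standard (rule I)
  fix n
  note m = one_N
  show "rlinear A (cob (res (Q.HE I)) n) (cob I n) (ev n)"
  proof (rule rlinearI)
    fix x y a assume "x \<in> el (res (Q.HE I)) n"
    then obtain f where f: "f \<in> el (Q.H I) n" and x: "x = enc f" by (auto simp: Q.HE_carrier)
    show "ev n x \<in> el I n" using Q.H_closed[OF f m] by (simp add: x ev_def)
    show "ev n (x \<oplus>[res (Q.HE I),n] y) = ev n x \<oplus>[I,n] ev n y" if "y \<in> el (res (Q.HE I)) n"
      using that by (auto simp: Q.HE_carrier x ev_def Q.HE_def Q.E.enc_add Q.H_app[OF m])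
    show "ev n (ract (cob (res (Q.HE I)) n) x a) = ract (cob I n) (ev n x) a" if a: "a \<in> carrier A"
      using rl_ract[OF Q.H_lin[OF f, of 0], of "\<one>[B]" a] a ring_hom_closed[OF p a]
      by (simp add: x ev_def Q.HE_def Q.E.enc_ract Q.H_app[OF m])
  qed
  fix x assume "x \<in> el (res (Q.HE I)) n"
  then obtain f where f: "f \<in> el (Q.H I) n" and x: "x = enc f" by (auto simp: Q.HE_carrier)
  have 1: "f 1 \<zero>[B] = \<zero>[I,n + 1]" using rl_zero[OF Q.H_lin[OF f, of 1] Q.M.grp I.grp] by (simp add: add.commute)
  show "ev (n + 1) (cdf (res (Q.HE I)) n x) = cdf I n (ev n x)"
    using I.d_closed[OF Q.H_closed[OF f m]] by (simp add: x ev_def Q.HE_def Q.H_d[OF m] 1 a_minus_def I.M.M.a_inv_zero)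
qed

lemma ev_hat: "right_module B Y \<Longrightarrow> y \<in> carrier Y \<Longrightarrow> ev n (enc (hat Y I j q y)) = q y" by (simp add: ev_def hat_app right_module.ract_one)

text \<open>As \<open>k\<close> is B-linear, the cochain \<open>k y\<close> at b is the value at
  \<open>1\<close> of \<open>k (y b)\<close>, so \<open>k\<close> is determined by its
  evaluations.\<close>

lemma hat_ev:
  assumes I: "is_cpx A I" and Y: "is_cpx B Y" and k: "rlinear B (cob Y n) (cob (Q.HE I) j) k" and y: "y \<in> el Y n"
  shows "enc (hat (cob Y n) I j (\<lambda>y. ev j (k y)) y) = k y"
proof -
  interpret I: cpx_loc A I by standard (rule I)
  interpret Y: cpx_loc B Y by standard (rule Y)
  obtain f where f: "f \<in> el (Q.H I) j" and kf: "k y = enc f" using rl_closed[OF k y] by (auto simp: Q.HE_carrier)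
  have "hat (cob Y n) I j (\<lambda>y. ev j (k y)) y = qh I j (f 0)" unfolding hat_def
  proof (rule Q.H_eqI[OF qh_closed[OF I] qh_closed[OF I]])
    show f0: "rlinear A N (cob I j) (f 0)" using Q.H_lin[OF f, of 0] by simp
    have e: "ev j (k (ract (cob Y n) y b)) = f 0 b" if b: "b \<in> carrier B" for b
    proof -
      have "k (ract (cob Y n) y b) = enc (ract (cob (Q.H I) j) f b)" using rl_ract[OF k y b] by (simp add: kf Q.HE_def Q.E.enc_ract)
      then show ?thesis using b by (simp add: ev_def Q.H_app[OF one_N])
    qed
    then show "rlinear A N (cob I j) (\<lambda>b. ev j (k (ract (cob Y n) y b)))" by (intro rl_cong[OF f0 _ N.N.right_module_axioms]) simp
    fix i m assume m: "m \<in> el (conc N) i"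
    then show "qh I j (\<lambda>b. ev j (k (ract (cob Y n) y b))) i m = qh I j (f 0) i m" by (cases "i = 0") (simp_all add: qh_app e)
  qed
  also have "\<dots> = f" by (rule qh_eta[OF I f])
  finally have "hat (cob Y n) I j (\<lambda>y. ev j (k y)) y = f" .
  then show ?thesis by (simp add: kf)
qed

lemma hat_cm:
  assumes I: "is_cpx A I" and Y: "is_cpx B Y" and g: "chain_map A (res Y) I g"
  shows "chain_map B Y (Q.HE I) (\<lambda>n y. enc (hat (cob Y n) I n (g n) y))"
proof (rule chain_mapI)
  interpret Y: cpx_loc B Y by standard (rule Y)
  have gl: "rlinear A (restr_mod p (cob Y n)) (cob I n) (g n)" for n using cm_lin[OF g] by simp
  fix n
  show "rlinear B (cob Y n) (cob (Q.HE I) n) (\<lambda>y. enc (hat (cob Y n) I n (g n) y))" by (rule hat_lin[OF I Y.M.right_module_axioms gl])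
  fix y assume y: "y \<in> el Y n"
  have "hat (cob Y (n + 1)) I (n + 1) (g (n + 1)) (cdf Y n y) = hat (cob Y n) I (n + 1) (\<lambda>y. cdf I n (g n y)) y"
  proof (intro ext)
    fix i b
    have "g (n + 1) (ract (cob Y (n + 1)) (cdf Y n y) b) = cdf I n (g n (ract (cob Y n) y b))" if b: "b \<in> carrier B"
      using cm_d[OF g, of "ract (cob Y n) y b" n] rl_ract[OF Y.d_lin y b] Y.M.ract_closed[OF y b] by simp
    then show "hat (cob Y (n + 1)) I (n + 1) (g (n + 1)) (cdf Y n y) i b = hat (cob Y n) I (n + 1) (\<lambda>y. cdf I n (g n y)) y i b"
      by (cases "i = 0") (auto simp: hat_def qh_def)
  qed
  then show "enc (hat (cob Y (n + 1)) I (n + 1) (g (n + 1)) (cdf Y n y)) = cdf (Q.HE I) n (enc (hat (cob Y n) I n (g n) y))"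
    by (simp add: Q.HE_def hat_d[OF I Y.M.right_module_axioms gl y])
qed

text \<open>The homotopy is transposed by \<open>hat\<close> in each degree. B-linear maps into the
  Hom complex agree once their evaluations do, which reduces the new homotopy equation to the given
  one.\<close>

lemma hat_hmt:
  assumes I: "is_cpx A I" and Y: "is_cpx B Y" and k: "chain_map B Y (Q.HE I) k" and k': "chain_map B Y (Q.HE I) k'"
    and h: "homotopic A (res Y) I (\<lambda>n y. ev n (k n y)) (\<lambda>n y. ev n (k' n y))"
  shows "homotopic B Y (Q.HE I) k k'"
proof -
  interpret I: cpx_loc A I by standard (rule I)
  interpret Y: cpx_loc B Y by standard (rule Y)
  interpret H: cpx_loc B "Q.HE I" by (rule cpx_loc.intro[OF Q.HE_cpx[OF I]])
  note rY = R.Fo[OF Y] and evc = ev_cm[OF I]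
  note c = cm_comp[OF R.Fm[OF Y Q.HE_cpx[OF I] k] evc] and c' = cm_comp[OF R.Fm[OF Y Q.HE_cpx[OF I] k'] evc]
  obtain s where s: "is_htpy A (res Y) I s (\<lambda>n y. ev n (k n y)) (\<lambda>n y. ev n (k' n y))" by (rule homotopicE[OF h I c c' rY])
  have sl: "rlinear A (restr_mod p (cob Y n)) (cob I (n - 1)) (s n)" for n using htpyD(1)[OF s, of n] by simp
  have sl': "rlinear A (restr_mod p (cob Y (n + 1))) (cob I n) (s (n + 1))" for n using sl[of "n + 1"] by simp
  let ?s = "\<lambda>n y. enc (hat (cob Y n) I (n - 1) (s n) y) :: 'u"
  note hl = hat_lin[OF I Y.M.right_module_axioms]
  show ?thesis
  proof (rule homotopicI[OF Q.HE_cpx[OF I] k k' Y])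
    fix n show "rlinear B (cob Y n) (cob (Q.HE I) (n - 1)) (?s n)" by (rule hl[OF sl])
  next
    fix n y assume y: "y \<in> el Y n"
    let ?R = "\<lambda>y. k' n y \<oplus>[Q.HE I,n] (cdf (Q.HE I) (n - 1) (?s n y) \<oplus>[Q.HE I,n] ?s (n + 1) (cdf Y n y))"
    have dl: "rlinear A (restr_mod p (cob Y n)) (cob I n) (\<lambda>y. s (n + 1) (cdf Y n y))" by (rule rl_comp[OF restr_rl[OF p Y.d_lin] sl'])
    have l1: "rlinear B (cob Y n) (cob (Q.HE I) n) (\<lambda>y. cdf (Q.HE I) (n - 1) (?s n y))" by (rule rl_comp[OF hl[OF sl] H.d_lin'])
    have l2: "rlinear B (cob Y n) (cob (Q.HE I) n) (\<lambda>y. ?s (n + 1) (cdf Y n y))" using rl_comp[OF Y.d_lin hl[OF sl'], of n] by simp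
    have R: "rlinear B (cob Y n) (cob (Q.HE I) n) ?R"
      by (rule rl_plus[OF H.M.right_module_axioms cm_lin[OF k'] rl_plus[OF H.M.right_module_axioms l1 l2]])
    have evl: "ev n (x \<oplus>[Q.HE I,n] x') = ev n x \<oplus>[I,n] ev n x'" if "x \<in> el (Q.HE I) n" "x' \<in> el (Q.HE I) n" for x x'
      using rl_add[OF cm_lin[OF evc, of n], of x x'] that by simp
    have evR: "ev n (?R z) = ev n (k n z)" if z: "z \<in> el Y n" for z
    proof -
      note a = rl_closed[OF l1 z] rl_closed[OF l2 z]
      have 1: "ev n (cdf (Q.HE I) (n - 1) (?s n z)) = cdf I (n - 1) (s n z)"
        using cm_d'[OF evc, of "?s n z" n] rl_closed[OF hl[OF sl] z] ev_hat[OF Y.M.right_module_axioms z, of "n - 1" I "n - 1" "s n"] by simp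
      have 2: "ev n (?s (n + 1) (cdf Y n z)) = s (n + 1) (cdf Y n z)"
        using ev_hat[OF Y.M.right_module_axioms Y.d_closed[OF z], of n I n "s (n + 1)"] by simp
      show ?thesis using htpyD(3)[OF s, of z n] z a 1 2 by (simp add: evl H.M.M.a_closed cm_closed[OF k' z])
    qed
    have "k n y = enc (hat (cob Y n) I n (\<lambda>y. ev n (k n y)) y)" by (rule hat_ev[OF I Y cm_lin[OF k] y, symmetric])
    also have "hat (cob Y n) I n (\<lambda>y. ev n (k n y)) y = hat (cob Y n) I n (\<lambda>y. ev n (?R y)) y"
      using evR Y.M.ract_closed[OF y] by (auto simp: hat_def qh_def fun_eq_iff restrict_def)
    also have "enc \<dots> = ?R y" by (rule hat_ev[OF I Y R y])
    finally show "k n y = ?R y" .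
  qed
qed

text \<open>Restriction preserves acyclicity, so after evaluation the map is null-homotopic because
  I is K-injective, and \<open>hat_hmt\<close> transposes this back.\<close>

lemma HE_K_injective:
  assumes I: "K_injective A I" shows "K_injective B (Q.HE I)"
proof -
  note Ic = K_inj_cpx[OF I] note HI = Q.HE_cpx[OF Ic] and evc = ev_cm[OF Ic]
  interpret I: cpx_loc A I by standard (rule Ic)
  interpret H: cpx_loc B "Q.HE I" by standard (rule HI)
  interpret rH: cpx_loc A "res (Q.HE I)" by (rule cpx_loc.intro[OF R.Fo[OF HI]])
  show ?thesis unfolding K_injective_def
  proof (intro conjI allI impI HI, elim conjE)
    fix Y :: "('b, 'u) rcpx" and k assume Y: "is_cpx B Y" and ac: "acyclic_cpx Y" and k: "chain_map B Y (Q.HE I) k"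
    have "homotopic A (res Y) I (\<lambda>n y. ev n (k n y)) (\<lambda>n y. \<zero>[I,n])"
      by (rule K_injectiveD[OF I R.Fo[OF Y] _ cm_comp[OF R.Fm[OF Y HI k] evc]]) (simp add: ac)
    moreover have "ev n \<zero>[Q.HE I,n] = \<zero>[I,n]" for n using rl_zero[OF cm_lin[OF evc, of n] rH.grp I.grp] by simp
    ultimately show "homotopic B Y (Q.HE I) k (\<lambda>n x. \<zero>[Q.HE I,n])" by (intro hat_hmt[OF Ic Y k cm_zero_map[OF HI]]) simp
  qed
qed

definition eps :: "('a, 'u) rcpx \<Rightarrow> ('a, 'u) roof set" where
  "eps X = roof_comp A (A.lkinv X) (A.locU (res (Q.HE (A.KI X))) (A.KI X) ev)"

lemma eps_lki:
  assumes X: "is_cpx A X"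
  shows "eps X \<in> A.Hom (res (Q.HE (A.KI X))) X"
    "roof_comp A (A.lki X) (eps X) = A.locU (res (Q.HE (A.KI X))) (A.KI X) ev"
proof -
  note I = A.KI(3)[OF X] note e = A.loc_Hom[OF R.Fo[OF Q.HE_cpx[OF I]] I ev_cm[OF I]]
  show "eps X \<in> A.Hom (res (Q.HE (A.KI X))) X" unfolding eps_def by (rule A.D_comp[OF e A.lkinv(1)[OF X]])
  show "roof_comp A (A.lki X) (eps X) = A.locU (res (Q.HE (A.KI X))) (A.KI X) ev" unfolding eps_def by (rule A.lki_lkinv[OF X e])
qed

text \<open>Identities involving the counit are checked after composition with the invertible
  \<open>lki X\<close>, where the counit becomes the chain map \<open>ev\<close>.\<close>

lemma lki_eps_comp:
  assumes X: "is_cpx A X" and Y: "is_cpx B Y" and k: "chain_map B Y (Q.HE (A.KI X)) k"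
  shows "roof_comp A (A.lki X) (roof_comp A (eps X) (far R.F (B.locU Y (Q.HE (A.KI X)) k))) = A.locU (res Y) (A.KI X) (\<lambda>n y. ev n (k n y))"
proof -
  note I = A.KI(3)[OF X] note HI = Q.HE_cpx[OF I] note rk = R.Fm[OF Y HI k] note kh = A.loc_Hom[OF R.Fo[OF Y] R.Fo[OF HI] rk]
  show ?thesis unfolding R.F_loc[OF Y HI k] A.D_assoc[OF kh eps_lki(1)[OF X] A.lki(1)[OF X]] eps_lki(2)[OF X]
    by (rule A.loc_comp[OF R.Fo[OF Y] R.Fo[OF HI] I rk ev_cm[OF I]])
qed

lemma eps_nat: "is_nat A.D A.D (R.F \<cdot>\<^sub>F Q.RH) id_funct eps" unfolding is_nat_def comp_funct_sel id_funct_sel Q.RH_ob R.F_ob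
proof (intro conjI ballI)
  fix X assume "X \<in> Obj A.D" then have X: "is_cpx A X" by (simp add: A.D_sel)
  show "eps X \<in> A.Hom (res (Q.HE (A.KI X))) X" by (rule eps_lki(1)[OF X])
next
  fix X Y \<alpha> assume al: "\<alpha> \<in> A.Hom X Y"
  note X = A.Hom_obj(1)[OF al] and Y = A.Hom_obj(2)[OF al]
  note IX = A.KI(3)[OF X] and IY = A.KI(3)[OF Y] and f = A.lift(1)[OF al]
  note HX = Q.HE_cpx[OF IX] and HY = Q.HE_cpx[OF IY] and Hf = Q.HEm_cm[OF IX IY f]
  note eX = eps_lki[OF X] and eY = eps_lki[OF Y]
  have Rf: "far R.F (far Q.RH \<alpha>) \<in> A.Hom (res (Q.HE (A.KI X))) (res (Q.HE (A.KI Y)))"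
    unfolding Q.RH_ar[OF al] R.F_loc[OF HX HY Hf] by (rule A.loc_Hom[OF R.Fo[OF HX] R.Fo[OF HY] R.Fm[OF HX HY Hf]])
  show "Cmp A.D (eps Y) (far R.F (far Q.RH \<alpha>)) = Cmp A.D \<alpha> (eps X)" unfolding A.D_sel
  proof (rule A.lki_cancel[OF Y A.D_comp[OF Rf eY(1)] A.D_comp[OF eX(1) al]])
    have 1: "roof_comp A (A.lki Y) (roof_comp A (eps Y) (far R.F (far Q.RH \<alpha>))) =
        A.locU (res (Q.HE (A.KI X))) (A.KI Y) (\<lambda>n y. ev n (Q.HEm (K_inj_lift A \<alpha>) n y))"
      unfolding Q.RH_ar[OF al] by (rule lki_eps_comp[OF Y HX Hf])
    have 2: "roof_comp A (A.lki Y) (roof_comp A \<alpha> (eps X)) = A.locU (res (Q.HE (A.KI X))) (A.KI Y) (\<lambda>n x. K_inj_lift A \<alpha> n (ev n x))"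
      unfolding A.D_assoc[OF eX(1) al A.lki(1)[OF Y]] A.lift(2)[OF al, symmetric]
        A.D_assoc[OF eX(1) A.lki(1)[OF X] A.loc_Hom[OF IX IY f], symmetric] eX(2)
      by (rule A.loc_comp[OF R.Fo[OF HX] IX IY ev_cm[OF IX] f])
    have e: "ev n (Q.HEm (K_inj_lift A \<alpha>) n y) = K_inj_lift A \<alpha> n (ev n y)" for n y by (simp add: ev_def Q.HEm_def Q.HM_app[OF one_N])
    show "roof_comp A (A.lki Y) (roof_comp A (eps Y) (far R.F (far Q.RH \<alpha>))) = roof_comp A (A.lki Y) (roof_comp A \<alpha> (eps X))"
      unfolding 1 2 e ..
  qed
qed

text \<open>The Hom complex of \<open>KI X\<close> is K-injective over B, so arrows into it are
  homotopy classes of chain maps. Transposition matches them with homotopy classes of maps from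
  \<open>res Y\<close> to \<open>KI X\<close>, that is, with arrows from \<open>res Y\<close> to
  X.\<close>

lemma der_restr_right_adjoint: "\<exists>\<eta>. is_adjunction B.D A.D R.F Q.RH \<eta> eps"
proof (rule right_adjointI[OF B.is_cat_D A.is_cat_D R.F_functor Q.RH_functor eps_nat])
  fix Y X f assume "Y \<in> Obj B.D" and f: "f \<in> A.Hom (fob R.F Y) X"
  then have Y: "is_cpx B Y" by (simp add: B.D_sel)
  note f = f[unfolded R.F_ob] note X = A.Hom_obj(2)[OF f] note I = A.KI(3)[OF X]
  obtain a where a: "chain_map A (res Y) (A.KI X) a" "roof_comp A (A.lki X) f = A.locU (res Y) (A.KI X) a"
    by (rule A.Ki_loc_surj[OF A.KI(1)[OF X] A.D_comp[OF f A.lki(1)[OF X]]])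
  interpret Y: cpx_loc B Y by standard (rule Y)
  let ?k = "\<lambda>n y. enc (hat (cob Y n) (A.KI X) n (a n) y)"
  note k = hat_cm[OF I Y a(1)]
  note g = B.loc_Hom[OF Y Q.HE_cpx[OF I] k]
  have Fg: "far R.F (B.locU Y (Q.HE (A.KI X)) ?k) \<in> A.Hom (res Y) (res (Q.HE (A.KI X)))"
    using is_functor_hom[OF R.F_functor B.is_cat_D g] unfolding R.F_ob .
  have "roof_comp A (eps X) (far R.F (B.locU Y (Q.HE (A.KI X)) ?k)) = f"
  proof (rule A.lki_cancel[OF X A.D_comp[OF Fg eps_lki(1)[OF X]] f])
    have "A.locU (res Y) (A.KI X) (\<lambda>n y. ev n (?k n y)) = A.locU (res Y) (A.KI X) a"
      by (rule A.loc_hmt[OF R.Fo[OF Y] I cm_comp[OF R.Fm[OF Y Q.HE_cpx[OF I] k] ev_cm[OF I]] a(1)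
        hmt_eqI[OF I cm_comp[OF R.Fm[OF Y Q.HE_cpx[OF I] k] ev_cm[OF I]] a(1) R.Fo[OF Y]]]) (simp add: ev_hat[OF Y.M.right_module_axioms])
    then show "roof_comp A (A.lki X) (roof_comp A (eps X) (far R.F (B.locU Y (Q.HE (A.KI X)) ?k))) = roof_comp A (A.lki X) f"
      unfolding lki_eps_comp[OF X Y k] a(2) .
  qed
  with g show "\<exists>g. g \<in> B.Hom Y (fob Q.RH X) \<and> Cmp A.D (eps X) (far R.F g) = f" unfolding Q.RH_ob A.D_sel by (intro exI conjI)
next
  fix Y X g h assume g: "g \<in> B.Hom Y (fob Q.RH X)" and h: "h \<in> B.Hom Y (fob Q.RH X)" and "X \<in> Obj A.D"
    and e: "Cmp A.D (eps X) (far R.F g) = Cmp A.D (eps X) (far R.F h)"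
  then have X: "is_cpx A X" by (simp add: A.D_sel)
  note g = g[unfolded Q.RH_ob] and h = h[unfolded Q.RH_ob] and e = e[unfolded A.D_sel]
  note Y = B.Hom_obj(1)[OF g] and I = A.KI(3)[OF X] and KI = A.KI(1)[OF X]
  note HI = Q.HE_cpx[OF I] and HK = HE_K_injective[OF KI]
  obtain k where k: "chain_map B Y (Q.HE (A.KI X)) k" "g = B.locU Y (Q.HE (A.KI X)) k" by (rule B.Ki_loc_surj[OF HK g])
  obtain k' where k': "chain_map B Y (Q.HE (A.KI X)) k'" "h = B.locU Y (Q.HE (A.KI X)) k'" by (rule B.Ki_loc_surj[OF HK h])
  note c = cm_comp[OF R.Fm[OF Y HI k(1)] ev_cm[OF I]] and c' = cm_comp[OF R.Fm[OF Y HI k'(1)] ev_cm[OF I]]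
  have "A.locU (res Y) (A.KI X) (\<lambda>n y. ev n (k n y)) = A.locU (res Y) (A.KI X) (\<lambda>n y. ev n (k' n y))"
    unfolding lki_eps_comp[OF X Y k(1), symmetric] lki_eps_comp[OF X Y k'(1), symmetric] k(2)[symmetric] k'(2)[symmetric] e ..
  then have "homotopic A (res Y) (A.KI X) (\<lambda>n y. ev n (k n y)) (\<lambda>n y. ev n (k' n y))" unfolding A.Ki_loc_eq_iff[OF KI R.Fo[OF Y] c c'] .
  from hat_hmt[OF I Y k(1) k'(1) this] show "g = h" unfolding k(2) k'(2) by (rule B.loc_hmt[OF Y HI k(1) k'(1)])
qed

end

section \<open>The twist triangle\<close>

lemma (in right_module) ract_zero_right: "x \<in> carrier M \<Longrightarrow> ract M x \<zero>[A] = \<zero>[M]"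
  by (metis A.add.r_one A.zero_closed M.add_self_imp_zero ract_add_right ract_closed)

lemma (in derived) loc_eqI:
  assumes "is_cpx A X" "is_cpx A Y" "chain_map A X Y f" "chain_map A X Y g" "\<And>n x. x \<in> el X n \<Longrightarrow> f n x = g n x"
  shows "locU X Y f = locU X Y g" by (rule loc_hmt[OF assms(1-4) hmt_eqI[OF assms(2-4,1,5)]])

section \<open>The bimodule complex cone(p)[-1]\<close>

locale ring_mor_large = ring_mor A B U p for A :: "('a, 'x) ring_scheme" and B :: "('b, 'y) ring_scheme" and U :: "'u itself" and p +
  assumes large2: "large_universe TYPE('a \<times> 'b) TYPE('u)"
begin

text \<open>Only degrees 0 and 1 are nontrivial: A sits in degree 0 and B in degree 1. As the shift
  is odd, the differential between them is -p.\<close>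

definition cn :: "('a, 'a, 'b \<times> 'a) bicpx" where "cn = shift (-1) (ring_bicone A B p)"

lemma dsum_bimodule_simps [simp]:
  "carrier (dsum_bimodule M M') = carrier M \<times> carrier M'" "zero (dsum_bimodule M M') = (\<zero>[M], \<zero>[M'])"
  "add (dsum_bimodule M M') = (\<lambda>(x, y) (x', y'). (x \<oplus>[M] x', y \<oplus>[M'] y'))"
  "ract (dsum_bimodule M M') = (\<lambda>(x, y) a. (ract M x a, ract M' y a))" "lact (dsum_bimodule M M') = (\<lambda>c (x, y). (lact M c x, lact M' c y))"
  by (simp_all add: dsum_bimodule_def dsum_rmodule_def add_lact_def mk_rmodule_def rmodule.defs bimodule.defs)

lemma cn_simps [simp]:
  "el cn n = (if n = 1 then carrier B else {\<zero>[B]}) \<times> (if n = 0 then carrier A else {\<zero>[A]})"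
  "zero (cob cn n) = (\<zero>[B], \<zero>[A])" "(b, a) \<oplus>[cn,n] (b', a') = (b \<oplus>[B] b', a \<oplus>[A] a')"
  "ract (cob cn n) (b, a) c = (b \<otimes>[B] p c, a \<otimes>[A] c)" "lact (cob cn n) c (b, a) = (p c \<otimes>[B] b, c \<otimes>[A] a)"
  by (simp_all add: cn_def ring_bicone_def bicone_def)

lemma cn_group: "abelian_group (cob cn n)" by (rule abelian_groupI)
    (auto simp: A.A.a_ac B.A.a_ac A.A.l_neg B.A.l_neg split: if_splits intro!: bexI[of _ "(\<ominus>[B] _, \<ominus>[A] _)"])

lemma cn_d: "(b, a) \<in> el cn n \<Longrightarrow> cdf cn n (b, a) = (if n = 0 then \<ominus>[B] p a else \<zero>[B], \<zero>[A])"
proof -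
  assume m: "(b, a) \<in> el cn n"
  interpret D: abelian_group "cob cn (n + 1)" by (rule cn_group)
  interpret AA: bimod A A "ring_bimodule A id id" by (rule ring_bimod) (auto intro: A.A.ring_axioms ring_hom_memI)
  interpret CA: cpx_loc A "conc (ring_bimodule A id id)" by (rule cpx_loc.intro[OF conc_cpx[OF AA.N.right_module_axioms]])
  have e: "n = 0 \<Longrightarrow> p a \<in> carrier B" using m ring_hom_closed[OF p] by simp
  have "cdf (ring_bicone A B p) (n - 1) (b, a) = (if n = 0 then p a else \<zero>[B], \<zero>[A])"
    using e CA.M.M.a_inv_zero[of "1 + n"] by (simp add: ring_bicone_def bicone_def cone_diff_def)
  moreover have "cdf cn n (b, a) = \<ominus>[cn,n + 1] cdf (ring_bicone A B p) (n - 1) (b, a)" by (simp add: cn_def)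
  ultimately have "cdf cn n (b, a) = \<ominus>[cn,n + 1] (if n = 0 then p a else \<zero>[B], \<zero>[A])" by simp
  also have "\<ominus>[cn,n + 1] (if n = 0 then p a else \<zero>[B], \<zero>[A]) = (if n = 0 then \<ominus>[B] p a else \<zero>[B], \<zero>[A])"
    by (rule D.minus_equality) (use e in \<open>auto simp: B.A.l_neg\<close>)
  finally show ?thesis .
qed

lemma cn_mem:
  assumes "m \<in> el cn i"
  obtains "i = 0" "fst m = \<zero>[B]" "snd m \<in> carrier A" | "i = 1" "fst m \<in> carrier B" "snd m = \<zero>[A]" | "i \<noteq> 0" "i \<noteq> 1" "m = (\<zero>[B], \<zero>[A])"
  using assms by (auto split: if_splits)

lemma cn_bicpx: "bicpx_loc A A cn"
proof (intro bicpx_loc.intro bicpx_loc_axioms.intro cpx_loc.intro A.A.ring_axioms is_cpxI)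
  note pc = ring_hom_closed[OF p] and h = ring_hom_add[OF p] ring_hom_mult[OF p] ring_hom_one[OF p]
  note r = A.A.l_distr A.A.r_distr B.A.l_distr B.A.r_distr A.A.m_assoc B.A.m_assoc pc h
  fix n :: int
  show "right_module A (cob cn n)" by (rule right_moduleI'[OF A.A.ring_axioms cn_group]) (auto simp: r split: if_splits)
  have p0: "p \<zero>[A] = \<zero>[B]" by (rule ring_hom_zero[OF p A.A.ring_axioms B.A.ring_axioms])
  show "rlinear A (cob cn n) (cob cn (n + 1)) (cdf cn n)"
    by (rule rlinearI) (auto simp: cn_d r p0 B.A.minus_add B.A.l_minus split: if_splits)
  show "cdf cn (n + 1) (cdf cn n x) = \<zero>[cn,n + 2]" if "x \<in> el cn n" for x using that by (auto simp: cn_d r p0 split: if_splits)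
  fix c assume c: "c \<in> carrier A"
  show "rlinear A (cob cn n) (cob cn n) (lact (cob cn n) c)" by (rule rlinearI) (use c in \<open>auto simp: r split: if_splits\<close>)
  fix m assume m: "m \<in> el cn n"
  show "cdf cn n (lact (cob cn n) c m) = lact (cob cn (n + 1)) c (cdf cn n m)"
    using c m by (cases m) (auto simp: cn_d r B.A.r_minus split: if_splits)
  fix c' assume c': "c' \<in> carrier A"
  show "lact (cob cn n) (c \<oplus>[A] c') m = lact (cob cn n) c m \<oplus>[cn,n] lact (cob cn n) c' m"
    "lact (cob cn n) (c \<otimes>[A] c') m = lact (cob cn n) c (lact (cob cn n) c' m)" using c c' m by (cases m; auto simp: r split: if_splits)+
next
  fix n m assume "m \<in> el cn n"
  then show "lact (cob cn n) \<one>[A] m = m" by (cases m) (auto simp: ring_hom_one[OF p] split: if_splits)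
qed

sublocale T: rhom A A U cn
proof (intro rhom.intro rhom_axioms.intro A.derived_axioms cn_bicpx)
  have "embeds TYPE('b \<times> 'a) TYPE('a \<times> 'b)" by (rule embedsI[of prod.swap]) simp
  then show "inj (enc :: (int \<Rightarrow> 'b \<times> 'a \<Rightarrow> 'u) \<Rightarrow> 'u)" by (intro embeds_enc universe_fun_countable large_universe_mono[OF large2])
qed

lemma one_cn: "(\<zero>[B], a) \<in> el cn 0 \<longleftrightarrow> a \<in> carrier A" "(b, \<zero>[A]) \<in> el cn 1 \<longleftrightarrow> b \<in> carrier B" by simp_all

text \<open>A cochain of degree \<open>n\<close> on the shifted cone is a pair of an element of \<open>I\<^sup>n\<close> and a linear map
  \<open>B \<rightarrow> I\<^sup>n\<^sup>+\<^sup>1\<close>.\<close>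

definition mk :: "('a, 'u) rcpx \<Rightarrow> int \<Rightarrow> 'u \<Rightarrow> ('b \<Rightarrow> 'u) \<Rightarrow> int \<Rightarrow> 'b \<times> 'a \<Rightarrow> 'u" where
  "mk I n y q = (\<lambda>i. \<lambda>m\<in>el cn i. if i = 0 then ract (cob I n) y (snd m) else if i = 1 then q (fst m) else \<zero>[I,i + n])"

lemma mk_closed:
  assumes I: "is_cpx A I" and y: "y \<in> el I n" and q: "rlinear A N (cob I (n + 1)) q"
  shows "mk I n y q \<in> el (T.H I) n" unfolding mk_def
proof (rule T.H_I)
  interpret I: cpx_loc A I by standard (rule I)
  fix i :: int
  consider "i = 0" | "i = 1" | "i \<noteq> 0" "i \<noteq> 1" by blast
  then show "rlinear A (cob cn i) (cob I (i + n)) (\<lambda>m. if i = 0 then ract (cob I n) y (snd m) else if i = 1 then q (fst m) else \<zero>[I,i + n])"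
  proof cases
    case 1
    have "rlinear A (cob cn 0) (cob I n) (\<lambda>m. ract (cob I n) y (snd m))"
      by (rule rlinearI) (auto simp: I.M.ract_closed[OF y] I.M.ract_add_right[OF y] I.M.ract_mult[OF y])
    then show ?thesis by (simp add: 1)
  next
    case 2
    have "rlinear A (cob cn 1) N fst" by (rule rlinearI) auto
    from rl_comp[OF this q] show ?thesis by (simp add: 2 add.commute)
  next
    case 3
    then show ?thesis using rl_const_zero[OF I.M.right_module_axioms] by simp
  qed
qed

abbreviation "at1 f \<equiv> f 0 (\<zero>[B], \<one>[A])"
abbreviation "onB f \<equiv> \<lambda>b. f 1 (b, \<zero>[A])"

lemma T_parts:
  assumes f: "f \<in> el (T.H I) n"
  shows "at1 f \<in> el I n" "rlinear A N (cob I (n + 1)) (onB f)"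
proof -
  show "at1 f \<in> el I n" using T.H_closed[OF f, of "(\<zero>[B], \<one>[A])" 0] by simp
  have "rlinear A N (cob cn 1) (\<lambda>b. (b, \<zero>[A]))" by (rule rlinearI) auto
  from rl_comp[OF this T.H_lin[OF f]] show "rlinear A N (cob I (n + 1)) (onB f)" by (simp add: add.commute)
qed

text \<open>A linear map out of A is determined by its value at \<open>1\<close>, and all components
  outside degrees 0 and 1 start at zero modules.\<close>

lemma mk_eta:
  assumes I: "is_cpx A I" and f: "f \<in> el (T.H I) n"
  shows "mk I n (at1 f) (onB f) = f"
proof (rule T.H_eqI[OF mk_closed[OF I T_parts[OF f]] f])
  interpret I: cpx_loc A I by standard (rule I)
  fix i m assume m: "m \<in> el cn i"
  have z: "f i (\<zero>[B], \<zero>[A]) = \<zero>[I,i + n]" using rl_zero[OF T.H_lin[OF f, of i] T.M.grp I.grp] by simp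
  have l: "f 0 (\<zero>[B], a) = ract (cob I n) (at1 f) a" if "a \<in> carrier A" for a
    using rl_ract[OF T.H_lin[OF f, of 0], of "(\<zero>[B], \<one>[A])" a] that ring_hom_closed[OF p that] by simp
  show "mk I n (at1 f) (onB f) i m = f i m"
  proof (rule cn_mem[OF m])
    assume "i = 0" "fst m = \<zero>[B]" "snd m \<in> carrier A"
    then show ?thesis using l[of "snd m"] m by (cases m) (simp add: mk_def)
  next
    assume "i = 1" "fst m \<in> carrier B" "snd m = \<zero>[A]"
    then show ?thesis using m by (cases m) (simp add: mk_def)
  next
    assume "i \<noteq> 0" "i \<noteq> 1" "m = (\<zero>[B], \<zero>[A])"
    then show ?thesis using z by (simp add: mk_def)
  qed
qed

section \<open>Comparison with the cone of the evaluation\<close>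

definition sg :: "('a, 'u) rcpx \<Rightarrow> ('u, 'u) gmap" where "sg I n x = (if even n then x else \<ominus>[I,n + 1] x)"

text \<open>A cochain \<open>(y, q)\<close> of degree n has differential
  \<open>(d y + (-1)^n q(1), d q)\<close>, whereas the cone of the evaluation has
  \<open>(d y + ev g, - d g)\<close>. Setting \<open>g = (-1)^n q\<close> matches both
  components.\<close>

definition psi :: "('a, 'u) rcpx \<Rightarrow> ('u, 'u) gmap" where
  "psi I n x = enc (qh I (n + 1) (\<lambda>b. sg I n ((dec x :: int \<Rightarrow> 'b \<times> 'a \<Rightarrow> 'u) 1 (b, \<zero>[A]))))"

definition cc :: "('a, 'u) rcpx \<Rightarrow> int \<Rightarrow> 'u \<Rightarrow> 'u \<times> 'u" where
  "cc I n x = ((dec x :: int \<Rightarrow> 'b \<times> 'a \<Rightarrow> 'u) 0 (\<zero>[B], \<one>[A]), psi I n x)"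

text \<open>Includes I as the cochains with vanishing B-component; under the comparison
  \<open>cc\<close> it becomes the inclusion of I into the cone.\<close>

definition jj :: "('a, 'u) rcpx \<Rightarrow> ('u, 'u) gmap" where
  "jj I n y = enc (mk I n y (\<lambda>b. \<zero>[I,n + 1]))"

abbreviation "sp I n f \<equiv> \<lambda>b. sg I n (f 1 (b, \<zero>[A]))"
abbreviation "CV I \<equiv> cone (res (Q.HE I)) I ev"
abbreviation "kl \<equiv> K_inj_lift A"

context
  fixes I :: "('a, 'u) rcpx" assumes I: "is_cpx A I"
begin

interpretation I: cpx_loc A I by standard (rule I)

lemma sg_lin: "rlinear A N (cob I (n + 1)) q \<Longrightarrow> rlinear A N (cob I (n + 1)) (\<lambda>b. sg I n (q b))"
  using rl_uminus[OF I.M.right_module_axioms, of N "n + 1" q] by (cases "even n") (simp_all add: sg_def)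

lemma sg_sg: "x \<in> el I (n + 1) \<Longrightarrow> sg I n (sg I n x) = x" by (simp add: sg_def)

lemma qh_add:
  assumes q: "rlinear A N (cob I j) q" and r: "rlinear A N (cob I j) r"
  shows "qh I j (\<lambda>b. q b \<oplus>[I,j] r b) = qh I j q \<oplus>[Q.H I,j] qh I j r"
  by (rule Q.H_eqI[OF qh_closed[OF I rl_plus[OF I.M.right_module_axioms q r]] Q.H_add_closed[OF I qh_closed[OF I q] qh_closed[OF I r]]])
    (auto simp: qh_app Q.H_app)

lemma qh_zero: "qh I j (\<lambda>b. \<zero>[I,j]) = \<zero>[Q.H I,j]"
  by (rule Q.H_eqI[OF qh_closed[OF I rl_const_zero[OF I.M.right_module_axioms]] Q.H_zero_closed[OF I]]) (auto simp: qh_app Q.H_app)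

lemma qh_neg:
  assumes q: "rlinear A N (cob I j) q"
  shows "qh I j (\<lambda>b. \<ominus>[I,j] q b) = \<ominus>[Q.H I,j] qh I j q"
proof -
  interpret H: cpx_loc B "Q.H I" by (rule cpx_loc.intro[OF Q.H_cpx[OF I]])
  note q' = rl_uminus[OF I.M.right_module_axioms q]
  have "qh I j (\<lambda>b. \<ominus>[I,j] q b) \<oplus>[Q.H I,j] qh I j q = \<zero>[Q.H I,j]" unfolding qh_add[OF q' q, symmetric] qh_zero[symmetric]
    using rl_closed[OF q] by (auto simp: qh_def fun_eq_iff I.M.M.l_neg restrict_def)
  from H.M.M.minus_equality[OF this qh_closed[OF I q] qh_closed[OF I q']] show ?thesis ..
qed

lemma jj_cm: "chain_map A I (T.HE I) (jj I)"
proof -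
  have z: "rlinear A N (cob I n) (\<lambda>b. \<zero>[I,n])" for n by (rule rl_const_zero[OF I.M.right_module_axioms])
  let ?m = "\<lambda>n y. mk I n y (\<lambda>b. \<zero>[I,n + 1])"
  note cl = mk_closed[OF I _ z]
  have app: "?m n y i m = (if i = 0 then ract (cob I n) y (snd m) else \<zero>[I,i + n])" if "m \<in> el cn i" for n y i m
    using that by (simp add: mk_def add.commute)
  have "chain_map A I (T.H I) ?m"
  proof (rule chain_mapI, rule rlinearI)
    fix n x y c assume x: "x \<in> el I n"
    show "?m n x \<in> el (T.H I) n" by (rule cl[OF x])
    show "?m n (x \<oplus>[I,n] y) = ?m n x \<oplus>[T.H I,n] ?m n y" if y: "y \<in> el I n"
      by (rule T.H_eqI[OF cl[OF I.M.M.a_closed[OF x y]] T.H_add_closed[OF I cl[OF x] cl[OF y]]])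
        (auto simp: T.H_app app I.M.ract_add_left[OF x y])
    show "?m n (ract (cob I n) x c) = ract (cob (T.H I) n) (?m n x) c" if c: "c \<in> carrier A"
    proof (rule T.H_eqI[OF cl[OF I.M.ract_closed[OF x c]] T.H_ract_closed[OF I cl[OF x] c]])
      fix i m assume m: "m \<in> el cn i"
      show "?m n (ract (cob I n) x c) i m = ract (cob (T.H I) n) (?m n x) c i m"
        unfolding T.H_app[OF m] app[OF m] app[OF T.lact_closed[OF c m]] using m I.M.ract_mult[OF x c] by (cases m) (auto split: if_splits)
    qed
    show "?m (n + 1) (cdf I n x) = cdf (T.H I) n (?m n x)"
    proof (rule T.H_eqI[OF cl[OF I.d_closed[OF x]] T.H_d_closed[OF I cl[OF x]]])
      fix i m assume m: "m \<in> el cn i"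
      \<comment> \<open>The part \<open>f d\<close> of the Hom differential vanishes on these
        cochains: the differential of \<open>cn\<close> has no A-component, and the cochain is zero
        on B.\<close>
      have s0: "snd (cdf cn i m) = \<zero>[A]" using m by (cases m) (simp add: cn_d)
      have "i + 1 = 0 \<Longrightarrow> n = i + n + 1" "i + 1 + n = i + n + 1" by simp_all
      then have e: "?m n x (i + 1) (cdf cn i m) = \<zero>[I,i + n + 1]"
        unfolding app[OF T.M.d_closed[OF m]] s0 I.M.ract_zero_right[OF x] by metis
      have e': "ract (cob I (n + 1)) (cdf I n x) (snd m) = cdf I n (ract (cob I n) x (snd m))" if "i = 0"
        using rl_ract[OF I.d_lin x, of "snd m"] m that by auto
      show "?m (n + 1) (cdf I n x) i m = cdf (T.H I) n (?m n x) i m"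
      proof (cases "i = 0")
        case True
        then have "snd m \<in> carrier A" using m by auto
        from I.d_closed[OF I.M.ract_closed[OF x this]] show ?thesis
          unfolding T.H_d[OF m] e app[OF m] using e' by (simp add: True a_minus_def I.M.M.a_inv_zero)
      next
        case False
        have "i + (n + 1) = i + n + 1" by simp
        with False show ?thesis
          unfolding T.H_d[OF m] e app[OF m] by (simp only: if_False I.d_zero a_minus_def I.M.M.a_inv_zero I.M.M.l_zero I.M.M.zero_closed if_cancel)
      qed
    qed
  qed
  from cm_comp[OF this T.E.enc_cm] show ?thesis by (simp add: T.HE_def jj_def[abs_def])
qed

lemma cc_enc:
  assumes f: "f \<in> el (T.H I) n"
  shows "cc I n (enc f) = (at1 f, enc (qh I (n + 1) (sp I n f)))"
    "qh I (n + 1) (sp I n f) \<in> el (Q.H I) (n + 1)" by (simp add: cc_def psi_def, rule qh_closed[OF I sg_lin[OF T_parts(2)[OF f]]])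

text \<open>The term \<open>- (-1)^n f (d m)\<close> of the Hom differential meets
  \<open>d (0, 1) = (- 1, 0)\<close>. The two minus signs cancel, and the remaining (-1)^n is what
  \<open>sg\<close> records.\<close>

lemma T_d:
  assumes f: "f \<in> el (T.H I) n"
  shows "at1 (cdf (T.H I) n f) = cdf I n (at1 f) \<oplus>[I,n + 1] sg I n (f 1 (\<one>[B], \<zero>[A]))"
    "b \<in> carrier B \<Longrightarrow> cdf (T.H I) n f 1 (b, \<zero>[A]) = cdf I (n + 1) (f 1 (b, \<zero>[A]))"
proof -
  note q = T_parts[OF f]
  have 1: "(\<zero>[B], \<one>[A]) \<in> el cn 0" by simp
  have "f 1 (\<ominus>[B] \<one>[B], \<zero>[A]) = \<ominus>[I,n + 1] f 1 (\<one>[B], \<zero>[A])"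
  proof -
    have "\<ominus>[N] \<one>[B] = \<ominus>[B] \<one>[B]" by (rule N.N.M.minus_equality) (simp_all add: B.A.l_neg)
    then show ?thesis using rl_neg[OF q(2) N.N.M.abelian_group_axioms I.grp, of "\<one>[B]"] by simp
  qed
  moreover have "f 1 (\<one>[B], \<zero>[A]) \<in> el I (n + 1)" using rl_closed[OF q(2), of "\<one>[B]"] by simp
  ultimately show "at1 (cdf (T.H I) n f) = cdf I n (at1 f) \<oplus>[I,n + 1] sg I n (f 1 (\<one>[B], \<zero>[A]))"
    unfolding T.H_d[OF 1] by (simp add: cn_d ring_hom_one[OF p] sg_def a_minus_def)
  assume b: "b \<in> carrier B"
  then have m: "(b, \<zero>[A]) \<in> el cn 1" by simp
  have "f 2 (\<zero>[B], \<zero>[A]) = \<zero>[I,2 + n]" using rl_zero[OF T.H_lin[OF f, of 2] T.M.grp I.grp] by simp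
  then show "cdf (T.H I) n f 1 (b, \<zero>[A]) = cdf I (n + 1) (f 1 (b, \<zero>[A]))"
    unfolding T.H_d[OF m] using b I.d_closed[OF rl_closed[OF q(2)], of b] by (simp add: cn_d a_minus_def I.M.M.a_inv_zero add_ac)
qed

lemma cc_cm: "chain_map A (T.HE I) (CV I) (cc I)"
proof (rule chain_mapI, rule rlinearI)
  fix n x y c assume "x \<in> el (T.HE I) n"
  then obtain f where f: "f \<in> el (T.H I) n" and x: "x = enc f" by (auto simp: T.HE_carrier)
  note q = T_parts[OF f] and qf = sg_lin[OF T_parts(2)[OF f]]
  show "cc I n x \<in> el (CV I) n" using q(1) cc_enc(2)[OF f] by (auto simp: x cc_enc[OF f] Q.HE_carrier)
  show "cc I n (x \<oplus>[T.HE I,n] y) = cc I n x \<oplus>[CV I,n] cc I n y" if hy: "y \<in> el (T.HE I) n"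
  proof -
    obtain g where g: "g \<in> el (T.H I) n" and y: "y = enc g" using hy by (auto simp: T.HE_carrier)
    note r = T_parts[OF g] and rg = sg_lin[OF T_parts(2)[OF g]]
    have "qh I (n + 1) (sp I n (f \<oplus>[T.H I,n] g)) =
      qh I (n + 1) (\<lambda>b. sg I n (f 1 (b, \<zero>[A])) \<oplus>[I,n + 1] sg I n (g 1 (b, \<zero>[A])))" using rl_closed[OF q(2)] rl_closed[OF r(2)]
      by (auto simp: qh_def fun_eq_iff restrict_def sg_def I.M.M.minus_add add.commute[of 1 n])
    then show ?thesis using cc_enc(1)[OF T.H_add_closed[OF I f g]]
      by (simp add: x y T.HE_def Q.HE_def T.E.enc_add Q.E.enc_add cc_enc[OF f] cc_enc[OF g] qh_add[OF qf rg])
  qed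
  show "cc I n (ract (cob (T.HE I) n) x c) = ract (cob (CV I) n) (cc I n x) c" if c: "c \<in> carrier A"
  proof -
    have 0: "f 0 (\<zero>[B], c) = ract (cob I n) (at1 f) c"
      using rl_ract[OF T.H_lin[OF f, of 0], of "(\<zero>[B], \<one>[A])" c] c ring_hom_closed[OF p c] by simp
    have "qh I (n + 1) (sp I n (ract (cob (T.H I) n) f c)) = ract (cob (Q.H I) (n + 1)) (qh I (n + 1) (sp I n f)) (p c)"
    proof (rule Q.H_eqI[OF cc_enc(2)[OF T.H_ract_closed[OF I f c]] Q.H_ract_closed[OF I cc_enc(2)[OF f] ring_hom_closed[OF p c]]])
      fix i m assume m: "m \<in> el (conc N) i"
      have mB: "m \<in> carrier B" using conc_carrier[OF m N.N.M.abelian_group_axioms] by simp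
      show "qh I (n + 1) (sp I n (ract (cob (T.H I) n) f c)) i m = ract (cob (Q.H I) (n + 1)) (qh I (n + 1) (sp I n f)) (p c) i m"
        unfolding Q.H_app[OF m] qh_app[OF m] qh_app[OF Q.lact_closed[OF ring_hom_closed[OF p c] m]] using mB c
        by (simp add: T.H_app one_cn)
    qed
    then show ?thesis using cc_enc(1)[OF T.H_ract_closed[OF I f c]] c ring_hom_closed[OF p c]
      by (simp add: x T.HE_def Q.HE_def T.E.enc_ract Q.E.enc_ract cc_enc[OF f] 0)
  qed
  note qd = rl_comp[OF qf I.d_lin]
  have H: "right_module B (cob (Q.H I) k)" for k by (rule Q.H_module[OF I])
  have e: "\<ominus>[Q.HE I,n + 2] cdf (Q.HE I) (n + 1) (enc (qh I (n + 1) (sp I n f))) =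
    enc (qh I (n + 2) (\<lambda>b. \<ominus>[I,n + 2] cdf I (n + 1) (sg I n (f 1 (b, \<zero>[A])))))"
    using qh_neg[OF qd] qh_d[OF I qf] Q.E.enc_a_inv[OF H qh_closed[OF I qd]] by (simp add: Q.HE_def add.commute[of n 2])
  \<comment> \<open>Passing to the next degree flips the sign in \<open>sg\<close>, which is the
    minus that the cone puts on its second component.\<close>
  have q: "qh I (n + 2) (\<lambda>b. sg I (n + 1) (cdf (T.H I) n f 1 (b, \<zero>[A]))) = qh I (n + 2) (\<lambda>b. \<ominus>[I,n + 2] cdf I (n + 1) (sg I n (f 1 (b, \<zero>[A]))))"
    using rl_closed[OF q(2)] I.d_closed[of _ "n + 1"] I.d_neg[of _ "n + 1"]
    by (auto simp: qh_def fun_eq_iff restrict_def T_d(2)[OF f] sg_def add.commute[of n 2])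
  show "cc I (n + 1) (cdf (T.HE I) n x) = cdf (CV I) n (cc I n x)" using cc_enc(1)[OF T.H_d_closed[OF I f]] q e
    by (simp add: x T.HE_def cc_enc[OF f] T_d(1)[OF f] ev_def qh_app one_N add.commute[of n 2])
qed

text \<open>Up to the involution \<open>sg\<close>, the map \<open>mk\<close> is inverse to taking
  the two coordinates of a cochain.\<close>

lemma cc_bij: "bij_betw (cc I n) (el (T.HE I) n) (el (CV I) n)"
proof (rule bij_betw_imageI)
  show "inj_on (cc I n) (el (T.HE I) n)"
  proof (rule inj_onI)
    fix x y assume "x \<in> el (T.HE I) n" "y \<in> el (T.HE I) n" and e: "cc I n x = cc I n y"
    then obtain f g where f: "f \<in> el (T.H I) n" "x = enc f" and g: "g \<in> el (T.H I) n" "y = enc g" by (auto simp: T.HE_carrier)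
    note cf = rl_closed[OF T_parts(2)[OF f(1)]] and cg = rl_closed[OF T_parts(2)[OF g(1)]]
    have e0: "at1 f = at1 g" and e1: "qh I (n + 1) (sp I n f) = qh I (n + 1) (sp I n g)"
      using e by (simp_all add: f(2) g(2) cc_enc[OF f(1)] cc_enc[OF g(1)] Q.E.enc_eq_iff)
    have "f 1 (b, \<zero>[A]) = g 1 (b, \<zero>[A])" if b: "b \<in> carrier B" for b
    proof -
      have "sg I n (f 1 (b, \<zero>[A])) = sg I n (g 1 (b, \<zero>[A]))" using fun_cong[OF fun_cong[OF e1, of 0], of b] b by (simp add: qh_app)
      then have "sg I n (sg I n (f 1 (b, \<zero>[A]))) = sg I n (sg I n (g 1 (b, \<zero>[A])))" by simp
      then show ?thesis using sg_sg[OF cf, of b] sg_sg[OF cg, of b] b by simp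
    qed
    then have "mk I n (at1 f) (onB f) = mk I n (at1 g) (onB g)" by (auto simp: mk_def fun_eq_iff restrict_def e0)
    then show "x = y" unfolding mk_eta[OF I f(1)] mk_eta[OF I g(1)] f(2) g(2) by simp
  qed
  show "cc I n ` el (T.HE I) n = el (CV I) n"
  proof (intro Set.set_eqI iffI)
    fix z assume "z \<in> cc I n ` el (T.HE I) n"
    then show "z \<in> el (CV I) n" using cm_closed[OF cc_cm] by blast
  next
    fix z assume "z \<in> el (CV I) n"
    then obtain y g where y: "y \<in> el I n" and g: "g \<in> el (Q.H I) (n + 1)" and z: "z = (y, enc g)" by (auto simp: Q.HE_carrier)
    have g0: "rlinear A N (cob I (n + 1)) (g 0)" using Q.H_lin[OF g, of 0] by simp
    let ?f = "mk I n y (\<lambda>b. sg I n (g 0 b))"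
    have f: "?f \<in> el (T.H I) n" by (rule mk_closed[OF I y sg_lin[OF g0]])
    have "qh I (n + 1) (\<lambda>b. sg I n (?f 1 (b, \<zero>[A]))) = qh I (n + 1) (g 0)"
      using sg_sg[OF rl_closed[OF g0]] by (auto simp: qh_def mk_def fun_eq_iff restrict_def)
    then have "cc I n (enc ?f) = z" unfolding cc_enc(1)[OF f] z qh_eta[OF I g] using y by (simp add: mk_def I.M.ract_one)
    moreover have "enc ?f \<in> el (T.HE I) n" using f by (auto simp: T.HE_carrier)
    ultimately show "z \<in> cc I n ` el (T.HE I) n" by blast
  qed
qed

end

section \<open>The natural transformations of the twist triangle\<close>

definition phi :: "('a, 'u) rcpx \<Rightarrow> ('a, 'u) roof set" where
  "phi X = A.locU X (T.HE (A.KI X)) (\<lambda>n x. jj (A.KI X) n (A.ki X n x))"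

definition Psi :: "('a, 'u) rcpx \<Rightarrow> ('a, 'u) roof set" where
  "Psi X = A.locU (T.HE (A.KI X)) (shift 1 (res (Q.HE (A.KI X)))) (psi (A.KI X))"

lemma psi_cm:
  assumes I: "is_cpx A I" shows "chain_map A (T.HE I) (shift 1 (res (Q.HE I))) (psi I)"
  using cm_comp[OF cc_cm[OF I] cone_proj_cm[OF R.Fo[OF Q.HE_cpx[OF I]]]] by (simp add: cc_def)

text \<open>On elements of the modules \<open>jj\<close> commutes exactly with chain maps between
  the resolutions, so the square reduces to the equation that characterises
  \<open>K_inj_lift\<close>.\<close>

lemma phi_nat: "is_nat A.D A.D id_funct T.RH phi" unfolding is_nat_def id_funct_sel T.RH_ob
proof (intro conjI ballI)
  fix X assume "X \<in> Obj A.D" then have X: "is_cpx A X" by (simp add: A.D_sel)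
  note I = A.KI(3)[OF X]
  show "phi X \<in> A.Hom X (T.HE (A.KI X))" unfolding phi_def by (rule A.loc_Hom[OF X T.HE_cpx[OF I] cm_comp[OF A.KI(4)[OF X] jj_cm[OF I]]])
next
  fix X Y \<alpha> assume al: "\<alpha> \<in> A.Hom X Y"
  note X = A.Hom_obj(1)[OF al] and Y = A.Hom_obj(2)[OF al]
  note IX = A.KI(3)[OF X] and IY = A.KI(3)[OF Y] and f = A.lift(1)[OF al] and kX = A.KI(4)[OF X] and kY = A.KI(4)[OF Y]
  note HX = T.HE_cpx[OF IX] and HY = T.HE_cpx[OF IY] and Hf = T.HEm_cm[OF IX IY f] and jX = jj_cm[OF IX] and jY = jj_cm[OF IY]
  interpret IX: cpx_loc A "A.KI X" by standard (rule IX)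
  interpret IY: cpx_loc A "A.KI Y" by standard (rule IY)
  have "roof_comp A (far T.RH \<alpha>) (phi X) = A.locU X (T.HE (A.KI Y)) (\<lambda>n x. T.HEm (kl \<alpha>) n (jj (A.KI X) n (A.ki X n x)))"
    unfolding phi_def T.RH_ar[OF al] by (rule A.loc_comp[OF X HX HY cm_comp[OF kX jX] Hf])
  also have "\<dots> = A.locU X (T.HE (A.KI Y)) (\<lambda>n x. jj (A.KI Y) n (kl \<alpha> n (A.ki X n x)))"
  proof (rule A.loc_eqI[OF X HY cm_comp[OF cm_comp[OF kX jX] Hf] cm_comp[OF cm_comp[OF kX f] jY]])
    fix n x assume x: "x \<in> el X n"
    note y = cm_closed[OF kX x]
    have "kl \<alpha> k \<zero>[A.KI X,k] = \<zero>[A.KI Y,k]" for k by (rule rl_zero[OF cm_lin[OF f] IX.grp IY.grp])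
    then have "T.HM (kl \<alpha>) n (mk (A.KI X) n (A.ki X n x) (\<lambda>b. \<zero>[A.KI X,n + 1])) =
        mk (A.KI Y) n (kl \<alpha> n (A.ki X n x)) (\<lambda>b. \<zero>[A.KI Y,n + 1])"
      using rl_ract[OF cm_lin[OF f] y] by (auto simp: hom_cpx_map_def mk_def fun_eq_iff restrict_def add.commute[of 1 n])
    then show "T.HEm (kl \<alpha>) n (jj (A.KI X) n (A.ki X n x)) = jj (A.KI Y) n (kl \<alpha> n (A.ki X n x))" by (simp add: T.HEm_def jj_def)
  qed
  also have "\<dots> = roof_comp A (A.locU (A.KI Y) (T.HE (A.KI Y)) (jj (A.KI Y))) (roof_comp A (A.locU (A.KI X) (A.KI Y) (kl \<alpha>)) (A.lki X))"
    unfolding A.loc_comp[OF X IX IY kX f] by (rule A.loc_comp[OF X IY HY cm_comp[OF kX f] jY, symmetric])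
  also have "\<dots> = roof_comp A (phi Y) \<alpha>"
    unfolding A.lift(2)[OF al] A.D_assoc[OF al A.lki(1)[OF Y] A.loc_Hom[OF IY HY jY]] A.loc_comp[OF Y IY HY kY jY] phi_def ..
  finally show "Cmp A.D (phi Y) \<alpha> = Cmp A.D (far T.RH \<alpha>) (phi X)" unfolding A.D_sel by (rule sym)
qed

text \<open>Postcomposition with a lift commutes with taking the B-component and with its sign, so
  the square holds already for cochains.\<close>

lemma Psi_nat: "is_nat A.D A.D T.RH (der_shift A \<cdot>\<^sub>F R.F \<cdot>\<^sub>F Q.RH) Psi"
  unfolding is_nat_def comp_funct_sel T.RH_ob Q.RH_ob R.F_ob der_shift_def SA.F_ob
proof (intro conjI ballI)
  fix X assume "X \<in> Obj A.D" then have X: "is_cpx A X" by (simp add: A.D_sel)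
  note I = A.KI(3)[OF X]
  show "Psi X \<in> A.Hom (T.HE (A.KI X)) (shift 1 (res (Q.HE (A.KI X))))"
    unfolding Psi_def by (rule A.loc_Hom[OF T.HE_cpx[OF I] SA.Fo[OF R.Fo[OF Q.HE_cpx[OF I]]] psi_cm[OF I]])
next
  fix X Y \<alpha> assume al: "\<alpha> \<in> A.Hom X Y"
  note X = A.KI(3)[OF A.Hom_obj(1)[OF al]] and Y = A.KI(3)[OF A.Hom_obj(2)[OF al]] and f = A.lift(1)[OF al]
  note TX = T.HE_cpx[OF X] and TY = T.HE_cpx[OF Y] and QX = Q.HE_cpx[OF X] and QY = Q.HE_cpx[OF Y]
  note Tf = T.HEm_cm[OF X Y f] and Qf = Q.HEm_cm[OF X Y f]
  note SX = SA.Fo[OF R.Fo[OF QX]] and SY = SA.Fo[OF R.Fo[OF QY]] and Sf = SA.Fm[OF R.Fo[OF QX] R.Fo[OF QY] R.Fm[OF QX QY Qf]]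
  interpret IX: cpx_loc A "A.KI X" by standard (rule X)
  interpret IY: cpx_loc A "A.KI Y" by standard (rule Y)
  have "roof_comp A (Psi Y) (far T.RH \<alpha>) = A.locU (T.HE (A.KI X)) (shift 1 (res (Q.HE (A.KI Y)))) (\<lambda>n x. psi (A.KI Y) n (T.HEm (kl \<alpha>) n x))"
    unfolding Psi_def T.RH_ar[OF al] by (rule A.loc_comp[OF TX TY SY Tf psi_cm[OF Y]])
  also have "\<dots> = A.locU (T.HE (A.KI X)) (shift 1 (res (Q.HE (A.KI Y)))) (\<lambda>n x. shift_map (Q.HEm (kl \<alpha>)) n (psi (A.KI X) n x))"
  proof (rule A.loc_eqI[OF TX SY cm_comp[OF Tf psi_cm[OF Y]] cm_comp[OF psi_cm[OF X] Sf]])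
    fix n x assume "x \<in> el (T.HE (A.KI X)) n"
    then obtain g where g: "g \<in> el (T.H (A.KI X)) n" "x = enc g" by (auto simp: T.HE_carrier)
    have sgf: "sg (A.KI Y) n (kl \<alpha> (n + 1) (g 1 (b, \<zero>[A]))) = kl \<alpha> (n + 1) (sg (A.KI X) n (g 1 (b, \<zero>[A])))" if "b \<in> carrier B" for b
      using rl_neg[OF cm_lin[OF f] IX.grp IY.grp] rl_closed[OF T_parts(2)[OF g(1)], of b] that by (simp add: sg_def)
    have z: "kl \<alpha> k \<zero>[A.KI X,k] = \<zero>[A.KI Y,k]" for k by (rule rl_zero[OF cm_lin[OF f] IX.grp IY.grp])
    have "qh (A.KI Y) (n + 1) (sp (A.KI Y) n (T.HM (kl \<alpha>) n g)) =
      Q.HM (kl \<alpha>) (n + 1) (qh (A.KI X) (n + 1) (sp (A.KI X) n g))"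
      using sgf z by (auto simp: hom_cpx_map_def qh_def fun_eq_iff restrict_def add.commute[of 1 n])
    then show "psi (A.KI Y) n (T.HEm (kl \<alpha>) n x) = shift_map (Q.HEm (kl \<alpha>)) n (psi (A.KI X) n x)"
      by (simp add: psi_def T.HEm_def Q.HEm_def shift_map_def g)
  qed
  also have "\<dots> = roof_comp A (A.locU (shift 1 (res (Q.HE (A.KI X)))) (shift 1 (res (Q.HE (A.KI Y)))) (shift_map (Q.HEm (kl \<alpha>)))) (Psi X)"
    unfolding Psi_def by (rule A.loc_comp[OF TX SX SY psi_cm[OF X] Sf, symmetric])
  finally show "Cmp A.D (Psi Y) (far T.RH \<alpha>) = Cmp A.D (far SA.F (far R.F (far Q.RH \<alpha>))) (Psi X)"
    unfolding A.D_sel Q.RH_ar[OF al] R.F_loc[OF QX QY Qf] SA.F_loc[OF R.Fo[OF QX] R.Fo[OF QY] R.Fm[OF QX QY Qf]] .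
qed

text \<open>The standard triangle of \<open>ev\<close> is reached by the identity, by
  \<open>lki X\<close> and by the comparison \<open>cc\<close>. The left square is the defining
  property of \<open>eps\<close>; the other two hold for elements.\<close>

lemma twist_triangle:
  assumes X: "is_cpx A X"
  shows "(res (Q.HE (A.KI X)), X, T.HE (A.KI X), eps X, phi X, Psi X) \<in> der_triangles A"
proof -
  let ?I = "A.KI X" let ?Q = "res (Q.HE ?I)" let ?C = "enc_cpx (cone ?Q ?I ev) :: ('a, 'u) rcpx"
  note I = A.KI(3)[OF X] note Q = R.Fo[OF Q.HE_cpx[OF I]] and T = T.HE_cpx[OF I] and e = ev_cm[OF I]
  interpret E: enc_loc "TYPE('u \<times> 'u)" "TYPE('u)" by (rule enc_loc.intro[OF A.inj_pair])
  note cone = cone_cpx[OF Q I e] note C = E.enc_cpx_cpx[OF cone]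
  note incl = cm_comp[OF cone_incl_cm[OF Q I e] E.enc_cm] and proj = cm_comp[OF E.dec_cm cone_proj_cm[OF Q]]
  note ccq = qi_comp[OF T cone C qi_of_bij[OF T cone cc_cm[OF I] cc_bij[OF I]] E.enc_qi[OF cone]]
  note c = qi_cm[OF ccq] and j = jj_cm[OF I] and kX = A.KI(4)[OF X]
  interpret I: cpx_loc A ?I by standard (rule I)
  have S: "far (der_shift A) (Idn A.D ?Q) = Idn A.D (shift 1 ?Q)"
    using is_functorD(2)[OF SA.F_functor, of ?Q] Q unfolding SA.F_ob der_shift_def by (simp add: A.D_sel)
  note pn = A.loc_Hom[OF T SA.Fo[OF Q] psi_cm[OF I], folded Psi_def] and en = eps_lki(1)[OF X]
  have i: "Idn A.D ?Q \<in> A.Hom ?Q ?Q" unfolding A.D_sel by (rule A.loc_Hom[OF Q Q cm_id])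
  show ?thesis unfolding der_triangles_def mem_Collect_eq prod.case
  proof (intro exI conjI)
    show "eps X \<in> A.Hom ?Q X" by (rule en)
    show "phi X \<in> A.Hom X (T.HE ?I)" unfolding phi_def by (rule A.loc_Hom[OF X T cm_comp[OF kX j]])
    show "Psi X \<in> A.Hom (T.HE ?I) (shift 1 ?Q)" by (rule pn)
    show "is_cpx A ?Q" "is_cpx A ?I" "chain_map A ?Q ?I ev" by (rule Q, rule I, rule e)
    show "standard_triangle A ?Q ?I ev = (?Q, ?I, ?C, A.locU ?Q ?I ev, A.locU ?I ?C (\<lambda>n y. enc (y, \<zero>[?Q,n + 1])),
        A.locU ?C (shift 1 ?Q) (\<lambda>n z. snd (dec z :: 'u \<times> 'u)))" by (simp add: standard_triangle_def Let_def)
    show "is_iso A.D ?Q ?Q (Idn A.D ?Q)" unfolding is_iso_def using i is_cat_id(1)[OF A.is_cat_D i] by blast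
    show "is_iso A.D X ?I (A.lki X)" by (rule A.lki(2)[OF X])
    show "is_iso A.D (T.HE ?I) ?C (A.locU (T.HE ?I) ?C (\<lambda>n x. enc (cc ?I n x)))" by (rule A.loc_qi[OF T C ccq])
    show "roof_comp A (A.locU ?Q ?I ev) (Idn A.D ?Q) = roof_comp A (A.lki X) (eps X)"
      unfolding eps_lki(2)[OF X] A.D_sel by (rule A.D_id(1)[OF A.loc_Hom[OF Q I e]])
    show "roof_comp A (A.locU ?I ?C (\<lambda>n y. enc (y, \<zero>[?Q,n + 1]))) (A.lki X) = roof_comp A (A.locU (T.HE ?I) ?C (\<lambda>n x. enc (cc ?I n x))) (phi X)"
      unfolding phi_def A.loc_comp[OF X I C kX incl] A.loc_comp[OF X T C cm_comp[OF kX j] c]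
    proof (rule A.loc_eqI[OF X C cm_comp[OF kX incl] cm_comp[OF cm_comp[OF kX j] c]])
      fix n x assume "x \<in> el X n"
      note y = cm_closed[OF kX this]
      note z = rl_const_zero[OF I.M.right_module_axioms]
      have 0: "qh ?I (n + 1) (\<lambda>b. sg ?I n (mk ?I n (A.ki X n x) (\<lambda>b. \<zero>[?I,n + 1]) 1 (b, \<zero>[A]))) = \<zero>[Q.H ?I,n + 1]"
        unfolding qh_zero[OF I, symmetric] by (auto simp: qh_def mk_def sg_def fun_eq_iff restrict_def I.M.M.a_inv_zero)
      have "cc ?I n (jj ?I n (A.ki X n x)) = (A.ki X n x, \<zero>[?Q,n + 1])" unfolding jj_def cc_enc(1)[OF I mk_closed[OF I y z]]
        using y by (simp add: 0 Q.HE_def) (simp add: mk_def I.M.ract_one)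
      then show "enc (A.ki X n x, \<zero>[?Q,n + 1]) = enc (cc ?I n (jj ?I n (A.ki X n x)))" by simp
    qed
    show "roof_comp A (A.locU ?C (shift 1 ?Q) (\<lambda>n z. snd (dec z :: 'u \<times> 'u))) (A.locU (T.HE ?I) ?C (\<lambda>n x. enc (cc ?I n x))) =
        roof_comp A (far (der_shift A) (Idn A.D ?Q)) (Psi X)"
      unfolding S A.loc_comp[OF T C SA.Fo[OF Q] c proj] using is_cat_id(2)[OF A.is_cat_D pn] by (simp add: cc_def Psi_def A.D_sel(2))
  qed
qed

lemma twist: "is_twist (dercat B :: ('b, 'u) dcat) (dercat A :: ('a, 'u) dcat) (der_restr A p) (RHom A A cn)"
proof -
  obtain \<eta> where \<eta>: "is_adjunction B.D A.D R.F Q.RH \<eta> eps" using der_restr_right_adjoint by blast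
  let ?A = "dercat A :: ('a, 'u) dcat" and ?B = "dercat B :: ('b, 'u) dcat"
  show ?thesis unfolding is_twist_def
  proof (intro conjI der_restr_exact der_restr_left_adjoint)
    show "is_functor ?A ?A (RHom A A cn)" unfolding dercat_functor by (rule T.RH_functor)
    show "\<exists>R \<eta> \<epsilon> \<phi> \<psi>. is_adjunction ?B ?A (der_restr A p) R \<eta> \<epsilon> \<and>
        is_nat ?A ?A id_funct (RHom A A cn) \<phi> \<and>
        is_nat ?A ?A (RHom A A cn) (shf ?A \<cdot>\<^sub>F der_restr A p \<cdot>\<^sub>F R) \<psi> \<and>
        (\<forall>b \<in> Obj ?A. (fob (der_restr A p) (fob R b), b, fob (RHom A A cn) b, \<epsilon> b, \<phi> b, \<psi> b) \<in> dtri (dercat A))"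
      unfolding dercat_adjunction dercat_nat dercat_sel der_restr_def
    proof (intro exI conjI ballI)
      show "is_adjunction B.D A.D R.F Q.RH \<eta> eps" by (rule \<eta>)
      show "is_nat A.D A.D id_funct T.RH phi" by (rule phi_nat)
      show "is_nat A.D A.D T.RH (der_shift A \<cdot>\<^sub>F R.F \<cdot>\<^sub>F Q.RH) Psi" by (rule Psi_nat)
      fix X assume "X \<in> Obj A.D"
      then show "(fob R.F (fob Q.RH X), X, fob T.RH X, eps X, phi X, Psi X) \<in> der_triangles A"
        unfolding R.F_ob Q.RH_ob T.RH_ob by (intro twist_triangle) (simp add: A.D_sel)
    qed
  qed
qed

end

section \<open>Quasi-isomorphic bimodules have isomorphic RHom\<close>

text \<open>After reindexing, a chain map from N to I[k] is one from N[-k] to I, the sign of the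
  shift sitting on one side or the other, and acyclicity is invariant under shifts. For odd k the
  homotopy changes sign with the differential.\<close>

lemma shift_K_injective:
  fixes I :: "('a, 'u) rcpx"
  assumes I: "K_injective A I" shows "K_injective A (shift k I)" unfolding K_injective_def
proof (intro conjI allI impI, rule shift_cpx[OF K_inj_cpx[OF I]], elim conjE)
  note Ic = K_inj_cpx[OF I]
  fix N :: "('a, 'u) rcpx" and f assume N: "is_cpx A N" and ac: "acyclic_cpx N" and f: "chain_map A N (shift k I) f"
  interpret I: cpx_loc A I by standard (rule Ic)
  interpret N: cpx_loc A N by standard (rule N)
  note SN = shift_cpx[OF N, of "- k"]
  have fl: "rlinear A (cob N n) (cob I (n + k)) (f n)" for n using cm_lin[OF f] by simp
  have fd: "f (n + 1) (cdf N n x) = cdf (shift k I) n (f n x)" if "x \<in> el N n" for n x by (rule cm_d[OF f that])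
  have f': "chain_map A (shift (- k) N) I (\<lambda>n. f (n - k))"
  proof (rule chain_mapI)
    fix n show "rlinear A (cob (shift (- k) N) n) (cob I n) (f (n - k))" using fl[of "n - k"] by simp
    fix x assume "x \<in> el (shift (- k) N) n"
    then have x: "x \<in> el N (n - k)" by simp
    have ix: "n + 1 - k = n - k + 1" by simp
    have l: "rlinear A (cob N (n - k + 1)) (cob I (n + 1)) (f (n - k + 1))" using fl[of "n - k + 1"] by simp
    have c: "cdf I n (f (n - k) x) \<in> el I (n + 1)" using I.d_closed[OF rl_closed[OF fl x]] by simp
    show "f (n + 1 - k) (cdf (shift (- k) N) n x) = cdf I n (f (n - k) x)"
      unfolding ix using fd[OF x] rl_neg[OF l N.grp I.grp N.d_closed[OF x]] I.M.M.minus_minus[OF c] by simp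
  qed
  obtain h where h: "is_htpy A (shift (- k) N) I h (\<lambda>n. f (n - k)) (\<lambda>n x. \<zero>[I,n])"
    by (rule homotopicE[OF K_injectiveD[OF I SN shift_acyclic[OF N ac] f'] Ic f' cm_zero_map[OF Ic] SN])
  let ?h = "\<lambda>n x. if even k then h (n + k) x else \<ominus>[I,n + k - 1] h (n + k) x"
  have hl: "rlinear A (cob N n) (cob I (n + k - 1)) (h (n + k))" for n using htpyD(1)[OF h, of "n + k"] by simp
  show "homotopic A N (shift k I) f (\<lambda>n x. \<zero>[shift k I,n])"
  proof (rule homotopicI[OF shift_cpx[OF Ic] f cm_zero_map[OF shift_cpx[OF Ic]] N])
    fix n
    have ix: "n - 1 + k = n + k - 1" "n + 1 + k = n + k + 1" by simp_all
    show "rlinear A (cob N n) (cob (shift k I) (n - 1)) (?h n)"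
      using hl[of n] rl_uminus[OF I.M.right_module_axioms hl, of n] by (cases "even k") (simp_all add: ix)
    fix x assume x: "x \<in> el N n"
    have l: "rlinear A (cob N (n + 1)) (cob I (n + k)) (h (n + k + 1))" using hl[of "n + 1"] unfolding ix by simp
    note c = rl_closed[OF hl x] and c' = rl_closed[OF l N.d_closed[OF x]]
    show "f n x = \<zero>[shift k I,n] \<oplus>[shift k I,n] (cdf (shift k I) (n - 1) (?h (n) x) \<oplus>[shift k I,n] ?h (n + 1) (cdf N n x))"
      using htpyD(3)[OF h, of x "n + k"] x rl_neg[OF l N.grp I.grp N.d_closed[OF x]] c' I.d_closed'[OF c] I.d_neg'[OF c]
      by (cases "even k") (simp_all add: ix I.d_closed' c)
  qed
qed

text \<open>Forgets the left action. Renaming and K-injectivity are formulated for plain right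
  modules, whereas a bimodule is a longer record.\<close>

definition fg :: "('c, 'a, 'v) bicpx \<Rightarrow> ('a, 'v) rcpx" where
  "fg M = \<lparr>cob = (\<lambda>n. mk_rmodule (el M n) (add (cob M n)) \<zero>[M,n] (ract (cob M n))), cdf = cdf M\<rparr>"

lemma fg_simps [simp]:
  "el (fg M) n = el M n" "add (cob (fg M) n) = add (cob M n)" "zero (cob (fg M) n) = zero (cob M n)"
  "ract (cob (fg M) n) = ract (cob M n)" "cdf (fg M) = cdf M" by (simp_all add: fg_def)

lemma fg_lin [simp]: "rlinear A (cob (fg M) n) N f = rlinear A (cob M n) N f" and fg_lin' [simp]: "rlinear A N (cob (fg M) n) g = rlinear A N (cob M n) g"
  by (simp_all add: rlinear_def)

lemma fg_cm: "chain_map A (fg M) Y f = chain_map A M Y f" "homotopic A (fg M) Y f g = homotopic A M Y f g"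
  by (simp_all add: chain_map_def homotopic_def)

lemma fg_cpx:
  assumes "is_cpx A M" shows "is_cpx A (fg M)"
proof (rule is_cpxI)
  interpret M: cpx_loc A M by standard (rule assms)
  fix n
  have "abelian_group (cob (fg M) n)" by (rule abelian_groupI) (auto simp: M.M.M.a_ac M.M.M.l_neg intro!: bexI[of _ "\<ominus>[M,n] _"])
  then show "right_module A (cob (fg M) n)"
    by (intro right_moduleI' M.ring_axioms) (simp_all add: M.M.ract_closed M.M.ract_add_left M.M.ract_add_right M.M.ract_mult M.M.ract_one)
qed (use assms in \<open>simp_all add: is_cpx_def\<close>)

text \<open>The sign in the Hom differential agrees with that in \<open>shift n\<close>. With
  \<open>hmt_coboundary\<close> and \<open>coboundary_hmt\<close> this identifies the cohomology of
  the Hom complex in degree n with homotopy classes of maps from M to I[n].\<close>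

lemma (in bicpx_loc) cocycle_cm:
  fixes I :: "('a, 'u) rcpx"
  assumes I: "is_cpx A I"
  shows "f \<in> cocycles (H I) n \<longleftrightarrow> f \<in> el (H I) n \<and> chain_map A M (shift n I) f"
proof (cases "f \<in> el (H I) n")
  case f: True
  interpret I: cpx_loc A I by standard (rule I)
  have "cdf (H I) n f = \<zero>[H I,n + 1] \<longleftrightarrow> (\<forall>i. \<forall>m\<in>el M i. cdf (H I) n f i m = \<zero>[I,i + n + 1])"
    using H_eqI[OF H_d_closed[OF I f] H_zero_closed[OF I]] H_app(2) by (metis idx(1)[OF I])
  also have "\<dots> \<longleftrightarrow> (\<forall>i. \<forall>m\<in>el M i. f (i + 1) (cdf M i m) = cdf (shift n I) i (f i m))"
  proof (intro all_cong1 ball_cong refl)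
    fix i m assume m: "m \<in> el M i"
    note c1 = rl_closed[OF H_fd(1)[OF I f] m] and c2 = rl_closed[OF H_fd(2)[OF I f] m]
    show "cdf (H I) n f i m = \<zero>[I,i + n + 1] \<longleftrightarrow> f (i + 1) (cdf M i m) = cdf (shift n I) i (f i m)"
    proof (cases "even n")
      case True
      then show ?thesis unfolding H_d[OF m] using I.M.M.minus_eq_zero_iff[OF c2 c1] by (simp add: eq_commute)
    next
      case False
      then show ?thesis unfolding H_d[OF m] using I.M.M.minus_eq_zero_iff[OF c1 I.M.M.a_inv_closed[OF c2]]
        by (simp add: a_minus_def I.M.M.minus_minus[OF c2] I.M.M.a_comm[OF c1 c2])
    qed
  qed
  finally show ?thesis using f H_lin[OF f] by (simp add: cocycles_def chain_map_def)
qed (simp add: cocycles_def)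

lemma (in bicpx_loc) hmt_coboundary:
  fixes I :: "('a, 'u) rcpx"
  assumes I: "is_cpx A I" and f: "f \<in> el (H I) n" and g: "g \<in> el (H I) n" and h: "homotopic A M (shift n I) f g"
  shows "f \<ominus>[H I,n] g \<in> coboundaries (H I) n"
proof -
  interpret I: cpx_loc A I by standard (rule I)
  interpret HI: cpx_loc C "H I" by (rule cpx_loc.intro[OF H_cpx[OF I]])
  obtain h where hl: "\<And>i. rlinear A (cob M i) (cob (shift n I) (i - 1)) (h i)" and he: "\<And>i m. m \<in> el M i \<Longrightarrow>
        f i m \<ominus>[shift n I,i] g i m = cdf (shift n I) (i - 1) (h i m) \<oplus>[shift n I,i] h (i + 1) (cdf M i m)"
    using h unfolding homotopic_def by blast
  have ix: "i - 1 + n = i + (n - 1)" "i + (n - 1) + 1 = i + n" "i + 1 + (n - 1) = i + n" "i + 1 - 1 + n = i + n" for i by simp_all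
  \<comment> \<open>A homotopy into I[n] satisfies \<open>f - g = (-1)^n d h + h d\<close>, while
    the Hom differential of a cochain k of degree \<open>n - 1\<close> is
    \<open>d k + (-1)^n k d\<close>; hence \<open>k = (-1)^n h\<close>.\<close>
  let ?s = "\<lambda>i m. if even n then h i m else \<ominus>[I,i + (n - 1)] h i m"
  have hl': "rlinear A (cob M i) (cob I (i + (n - 1))) (h i)" for i using hl[of i] unfolding shift_simps ix .
  have sl: "rlinear A (cob M i) (cob I (i + (n - 1))) (?s i)" for i
    using hl'[of i] rl_uminus[OF I.M.right_module_axioms hl'] by (cases "even n") simp_all
  let ?k = "\<lambda>i. \<lambda>m\<in>el M i. ?s i m"
  have k: "?k \<in> el (H I) (n - 1)" by (rule H_I[OF sl])
  have dk: "cdf (H I) (n - 1) ?k \<in> el (H I) n" using H_d_closed[OF I k] by simp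
  have "f = g \<oplus>[H I,n] cdf (H I) (n - 1) ?k"
  proof (rule H_eqI[OF f H_add_closed[OF I g dk]])
    fix i m assume m: "m \<in> el M i"
    note dm = M.d_closed[OF m]
    have c1: "h i m \<in> el I (i + (n - 1))" by (rule rl_closed[OF hl' m])
    have c2: "h (i + 1) (cdf M i m) \<in> el I (i + n)" using rl_closed[OF hl' dm] unfolding ix .
    have c3: "cdf I (i + (n - 1)) (h i m) \<in> el I (i + n)" using I.d_closed[OF c1] unfolding ix .
    have d: "cdf I (i + (n - 1)) (\<ominus>[I,i + (n - 1)] h i m) = \<ominus>[I,i + n] cdf I (i + (n - 1)) (h i m)" using I.d_neg[OF c1] unfolding ix .
    have ev: "even (n - 1) = odd n" by simp
    have "cdf (H I) (n - 1) ?k i m = f i m \<ominus>[I,i + n] g i m"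
      unfolding H_d[OF m] he[OF m, unfolded shift_simps ix] ix ev using m dm c2 c3 d I.M.M.minus_minus[OF c2]
      by (cases "even n") (simp_all add: ix a_minus_def)
    then show "f i m = (g \<oplus>[H I,n] cdf (H I) (n - 1) ?k) i m"
      unfolding H_app[OF m] using I.M.M.minus_eq_iff[OF H_closed[OF f m] H_closed[OF g m] I.M.M.minus_closed[OF H_closed[OF f m] H_closed[OF g m]]] by simp
  qed
  then have "f \<ominus>[H I,n] g = cdf (H I) (n - 1) ?k" using HI.M.M.minus_eq_iff[OF f g dk] by simp
  then show ?thesis using HI.coboundariesI[OF k] by simp
qed

lemma (in bicpx_loc) coboundary_hmt:
  fixes I :: "('a, 'u) rcpx"
  assumes I: "is_cpx A I" and f: "f \<in> coboundaries (H I) n"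
  shows "homotopic A M (shift n I) f (\<lambda>i m. \<zero>[shift n I,i])"
proof -
  interpret I: cpx_loc A I by standard (rule I)
  interpret HI: cpx_loc C "H I" by (rule cpx_loc.intro[OF H_cpx[OF I]])
  obtain k where k: "k \<in> el (H I) (n - 1)" and fk: "f = cdf (H I) (n - 1) k" using f by (auto simp: coboundaries_def)
  note SI = shift_cpx[OF I]
  have fc: "chain_map A M (shift n I) f" using HI.cobs_subset f cocycle_cm[OF I] by blast
  have ix: "i - 1 + n = i + (n - 1)" "i + (n - 1) + 1 = i + n" "i + 1 + (n - 1) = i + n" for i by simp_all
  let ?s = "\<lambda>i m. if even n then k i m else \<ominus>[I,i + (n - 1)] k i m"
  show ?thesis
  proof (rule homotopicI[OF SI fc cm_zero_map[OF SI] M.cpx])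
    fix i
    show "rlinear A (cob M i) (cob (shift n I) (i - 1)) (?s i)"
      unfolding shift_simps ix using H_lin[OF k, of i] rl_uminus[OF I.M.right_module_axioms H_lin[OF k]] by (cases "even n") simp_all
    fix m assume m: "m \<in> el M i"
    note c1 = H_closed[OF k m]
    have c2: "k (i + 1) (cdf M i m) \<in> el I (i + n)" using H_closed[OF k M.d_closed[OF m]] unfolding ix .
    have c3: "cdf I (i + (n - 1)) (k i m) \<in> el I (i + n)" using I.d_closed[OF c1] unfolding ix .
    have d: "cdf I (i + (n - 1)) (\<ominus>[I,i + (n - 1)] k i m) = \<ominus>[I,i + n] cdf I (i + (n - 1)) (k i m)" using I.d_neg[OF c1] unfolding ix .
    have ev: "even (n - 1) = odd n" by simp
    show "f i m = \<zero>[shift n I,i] \<oplus>[shift n I,i] (cdf (shift n I) (i - 1) (?s i m) \<oplus>[shift n I,i] ?s (i + 1) (cdf M i m))"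
      unfolding fk H_d[OF m] shift_simps ix ev using c2 c3 d by (cases "even n") (simp_all add: a_minus_def)
  qed
qed

locale bicpx_quasi_iso = M: rhom A C U M + M': rhom A C U M'
  for A :: "('a, 'x) ring_scheme" and C :: "('c, 'y) ring_scheme" and U :: "'u itself" and M :: "('c, 'a, 'v) bicpx" and M' :: "('c, 'a, 'w) bicpx" +
  fixes \<iota> :: "('w, 'v) gmap"
  assumes iq: "quasi_iso A (fg M') (fg M) \<iota>" and il: "\<lbrakk>c \<in> carrier C; m \<in> el M' i\<rbrakk> \<Longrightarrow> \<iota> i (lact (cob M' i) c m) = lact (cob M i) c (\<iota> i m)"
    and inj_v: "inj (enc :: 'v \<Rightarrow> 'u)" and inj_w: "inj (enc :: 'w \<Rightarrow> 'u)"
begin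

definition pre :: "int \<Rightarrow> ('v, 'u) gmap \<Rightarrow> ('w, 'u) gmap" where
  "pre n f = (\<lambda>i. \<lambda>m\<in>el M' i. f i (\<iota> i m))"

definition preE :: "('u, 'u) gmap" where "preE n x = enc (pre n (dec x))"

lemma ic: "chain_map A M' (fg M) \<iota>" using qi_cm[OF iq] by (simp add: fg_cm)

lemma i_lin: "rlinear A (cob M' i) (cob M i) (\<iota> i)" using cm_lin[OF ic] by simp

lemma i_d: "m \<in> el M' i \<Longrightarrow> \<iota> (i + 1) (cdf M' i m) = cdf M i (\<iota> i m)" using cm_d[OF ic] by simp

lemma pre_closed: "f \<in> el (M.H I) n \<Longrightarrow> pre n f \<in> el (M'.H I) n" unfolding pre_def by (rule M'.H_I[OF rl_comp[OF i_lin M.H_lin]])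

lemma pre_cm:
  fixes I :: "('a, 'u) rcpx"
  assumes I: "is_cpx A I" shows "chain_map C (M.H I) (M'.H I) pre"
proof (rule chain_mapI, rule rlinearI)
  fix n f g c assume f: "f \<in> el (M.H I) n"
  note ic = rl_closed[OF i_lin]
  show "pre n f \<in> el (M'.H I) n" by (rule pre_closed[OF f])
  show "pre n (f \<oplus>[M.H I,n] g) = pre n f \<oplus>[M'.H I,n] pre n g" if g: "g \<in> el (M.H I) n"
    by (rule M'.H_eqI[OF pre_closed[OF M.H_add_closed[OF I f g]] M'.H_add_closed[OF I pre_closed[OF f] pre_closed[OF g]]])
      (simp add: pre_def ic)
  show "pre n (ract (cob (M.H I) n) f c) = ract (cob (M'.H I) n) (pre n f) c" if c: "c \<in> carrier C"
    by (rule M'.H_eqI[OF pre_closed[OF M.H_ract_closed[OF I f c]] M'.H_ract_closed[OF I pre_closed[OF f] c]])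
      (simp add: pre_def ic M'.lact_closed[OF c] il[OF c])
  show "pre (n + 1) (cdf (M.H I) n f) = cdf (M'.H I) n (pre n f)"
    by (rule M'.H_eqI[OF pre_closed[OF M.H_d_closed[OF I f]] M'.H_d_closed[OF I pre_closed[OF f]]])
      (simp add: pre_def ic M.H_d M'.H_d M'.M.d_closed i_d)
qed

text \<open>On cohomology, precomposition with \<iota> is the induced map between homotopy classes
  of maps into I[n], bijective because I[n] is K-injective. The bimodules have their own carrier
  types and are renamed into \<open>'u\<close> before the lifting lemmas apply.\<close>

lemma pre_qi:
  fixes I :: "('a, 'u) rcpx"
  assumes KI: "K_injective A I" shows "quasi_iso C (M.H I) (M'.H I) pre"
proof -
  note I = K_inj_cpx[OF KI] note pc = pre_cm[OF I]
  interpret I: cpx_loc A I by standard (rule I)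
  interpret V: enc_loc "TYPE('v)" "TYPE('u)" by (rule enc_loc.intro[OF inj_v])
  interpret W: enc_loc "TYPE('w)" "TYPE('u)" by (rule enc_loc.intro[OF inj_w])
  let ?W = "enc_cpx (fg M') :: ('a, 'u) rcpx" let ?X = "enc_cpx (fg M) :: ('a, 'u) rcpx"
  note fM = fg_cpx[OF M.M.cpx] and fM' = fg_cpx[OF M'.M.cpx]
  note W = W.enc_cpx_cpx[OF fM'] and X = V.enc_cpx_cpx[OF fM]
  let ?s = "\<lambda>n x. enc (\<iota> n (dec x)) :: 'u"
  have s: "quasi_iso A ?W ?X ?s" by (rule qi_comp[OF W fM X qi_comp[OF W fM' fM W.dec_qi[OF fM'] iq] V.enc_qi[OF fM]])
  note iqc = qi_cm[OF iq]
  interpret MH: cpx_loc C "M.H I" by (rule cpx_loc.intro[OF M.H_cpx[OF I]])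
  note SK = shift_K_injective[OF KI] and S = shift_cpx[OF I]
  show ?thesis
  proof (rule quasi_isoI[OF M.H_cpx[OF I] M'.H_cpx[OF I] pc])
    fix n f assume fc: "f \<in> cocycles (M.H I) n" and pf: "pre n f \<in> coboundaries (M'.H I) n"
      let ?z = "\<lambda>i x. \<zero>[shift n I,i]"
      have f: "f \<in> el (M.H I) n" and cf: "chain_map A (fg M) (shift n I) f" using fc by (simp_all add: M.cocycle_cm[OF I] fg_cm)
      have z: "chain_map A ?X (shift n I) ?z" by (rule cm_zero_map[OF S])
      have z': "chain_map A (fg M') (shift n I) ?z" by (rule cm_zero_map[OF S])
      have p: "chain_map A (fg M') (shift n I) (\<lambda>i m. f i (\<iota> i m))" by (rule cm_comp[OF iqc cf])
      have p': "chain_map A (fg M') (shift n I) (pre n f)"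
        using M'.cocycle_cm[OF I] cm_cocs[OF M.H_cpx[OF I] M'.H_cpx[OF I] pc fc] by (simp add: fg_cm)
      have h1: "homotopic A (fg M') (shift n I) (\<lambda>i m. f i (\<iota> i m)) (pre n f)" by (rule hmt_eqI[OF S p p' fM']) (simp add: pre_def)
      have h2: "homotopic A (fg M') (shift n I) (\<lambda>i m. f i (\<iota> i m)) ?z"
        by (rule hmt_trans[OF h1 M'.coboundary_hmt[OF I pf, folded fg_cm] S p p' z' fM'])
      have "homotopic A ?W (shift n I) (\<lambda>i x. f i (dec (?s i x))) ?z" using hmt_comp_right[OF h2 fM' S W p z' W.dec_cm] by simp
      then have "homotopic A ?X (shift n I) (\<lambda>i x. f i (dec x)) ?z"
        by (intro K_injective_lift_unique[OF M.A.inj_pair SK W X s cm_comp[OF V.dec_cm cf] z])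
      from hmt_comp_right[OF this X S fM cm_comp[OF V.dec_cm cf] z V.enc_cm]
      have "homotopic A (fg M) (shift n I) f ?z" by simp
      then have "homotopic A M (shift n I) f \<zero>[M.H I,n]" by (simp add: homotopic_def fg_cm)
      from M.hmt_coboundary[OF I f M.H_zero_closed[OF I] this] show "f \<in> coboundaries (M.H I) n"
        using MH.M.M.a_inv_zero f by (simp add: a_minus_def)
  next
    fix n g assume gc: "g \<in> cocycles (M'.H I) n"
    have g: "g \<in> el (M'.H I) n" and cg: "chain_map A (fg M') (shift n I) g" using gc by (simp_all add: M'.cocycle_cm[OF I] fg_cm)
    obtain k where k: "chain_map A ?X (shift n I) k" and h: "homotopic A ?W (shift n I) (\<lambda>i x. k i (?s i x)) (\<lambda>i x. g i (dec x))"
      by (rule K_injective_lift[OF M.A.inj_pair SK W X s cm_comp[OF W.dec_cm cg]])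
    note ks = cm_comp[OF qi_cm[OF s] k] and ke = cm_comp[OF V.enc_cm k]
    have h': "homotopic A M' (shift n I) (\<lambda>i m. k i (enc (\<iota> i m))) g"
      using hmt_comp_right[OF h W S fM' ks cm_comp[OF W.dec_cm cg] W.enc_cm] by (simp add: fg_cm)
    let ?f = "\<lambda>i. \<lambda>m\<in>el M i. k i (enc m)"
    have f: "?f \<in> el (M.H I) n" using cm_lin[OF ke] by (intro M.H_I) simp
    have "chain_map A M (shift n I) ?f"
      using cm_d[OF ke] M.H_lin[OF f] by (intro chain_mapI) (simp_all add: M.M.d_closed del: shift_simps(2))
    then have "?f \<in> cocycles (M.H I) n" using f by (simp add: M.cocycle_cm[OF I])
    moreover have "homotopic A M' (shift n I) (pre n ?f) g" using h' by (simp add: homotopic_def pre_def rl_closed[OF i_lin])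
    then have "pre n ?f \<ominus>[M'.H I,n] g \<in> coboundaries (M'.H I) n" by (rule M'.hmt_coboundary[OF I pre_closed[OF f] g])
    ultimately show "\<exists>f\<in>cocycles (M.H I) n. pre n f \<ominus>[M'.H I,n] g \<in> coboundaries (M'.H I) n" by blast
  qed
qed

lemma pre_HM: "pre n (M.HM \<phi> n f) = M'.HM \<phi> n (pre n f)"
  using rl_closed[OF i_lin] by (auto simp: pre_def hom_cpx_map_def fun_eq_iff restrict_def)

lemma preE_qi:
  fixes I :: "('a, 'u) rcpx"
  assumes KI: "K_injective A I" shows "quasi_iso C (M.HE I) (M'.HE I) preE"
proof -
  note X = M.H_cpx[OF K_inj_cpx[OF KI]] and Y = M'.H_cpx[OF K_inj_cpx[OF KI]]
  note EX = M.E.enc_cpx_cpx[OF X] and EY = M'.E.enc_cpx_cpx[OF Y]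
  show ?thesis unfolding preE_def[abs_def] M.HE_def M'.HE_def
    by (rule qi_comp[OF EX Y EY qi_comp[OF EX X Y M.E.dec_qi[OF X] pre_qi[OF KI]] M'.E.enc_qi[OF Y]])
qed

text \<open>Precomposition with \<iota> commutes with postcomposition by lifts, so naturality is
  strict on cochains.\<close>

lemma RHom_iso: "isomorphic_functors (dercat A :: ('a, 'u) dcat) (dercat C :: ('c, 'u) dcat) (RHom A C M) (RHom A C M')"
  unfolding isomorphic_functors_def dercat_functor dercat_nat_iso is_nat_iso_def is_nat_def M.RH_ob M'.RH_ob
proof (intro conjI M.RH_functor M'.RH_functor exI ballI)
  let ?t = "\<lambda>X. M.C.locU (M.HE (M.A.KI X)) (M'.HE (M.A.KI X)) preE"
  fix X assume "X \<in> Obj M.A.D" then have X: "is_cpx A X" by (simp add: M.A.D_sel)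
  note I = M.A.KI(3)[OF X]
  show i: "is_iso M.C.D (M.HE (M.A.KI X)) (M'.HE (M.A.KI X)) (?t X)"
    by (rule M.C.loc_qi[OF M.HE_cpx[OF I] M'.HE_cpx[OF I] preE_qi[OF M.A.KI(1)[OF X]]])
  show "?t X \<in> M.C.Hom (M.HE (M.A.KI X)) (M'.HE (M.A.KI X))" using i by (simp add: is_iso_def)
next
  fix X Y \<alpha> assume al: "\<alpha> \<in> M.A.Hom X Y"
  note X = M.A.Hom_obj(1)[OF al] and Y = M.A.Hom_obj(2)[OF al]
  note IX = M.A.KI(3)[OF X] and IY = M.A.KI(3)[OF Y] and f = M.A.lift(1)[OF al]
  note pX = qi_cm[OF preE_qi[OF M.A.KI(1)[OF X]]] and pY = qi_cm[OF preE_qi[OF M.A.KI(1)[OF Y]]]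
  note MX = M.HE_cpx[OF IX] and MY = M.HE_cpx[OF IY] and NX = M'.HE_cpx[OF IX] and NY = M'.HE_cpx[OF IY]
  note Mf = M.HEm_cm[OF IX IY f] and Nf = M'.HEm_cm[OF IX IY f]
  show "Cmp M.C.D (M.C.locU (M.HE (M.A.KI Y)) (M'.HE (M.A.KI Y)) preE) (far M.RH \<alpha>) =
      Cmp M.C.D (far M'.RH \<alpha>) (M.C.locU (M.HE (M.A.KI X)) (M'.HE (M.A.KI X)) preE)"
    unfolding M.C.D_sel M.RH_ar[OF al] M'.RH_ar[OF al] M.C.loc_comp[OF MX MY NY Mf pY] M.C.loc_comp[OF MX NX NY pX Nf]
    by (rule M.C.loc_eqI[OF MX NY cm_comp[OF Mf pY] cm_comp[OF pX Nf]]) (simp add: preE_def M.HEm_def M'.HEm_def pre_HM)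
qed

end

section \<open>The kernel of a surjective ring homomorphism\<close>

context ring_mor_large
begin

abbreviation "ker \<equiv> kernel_bimodule A B p"

lemma ker_simps [simp]:
  "carrier ker = a_kernel A B p" "add ker = add A" "zero ker = \<zero>[A]" "ract ker x a = x \<otimes>[A] a" "lact ker c x = c \<otimes>[A] x"
  by (simp_all add: kernel_bimodule_def ring_bimodule_def add_lact_def mk_rmodule_def rmodule.defs bimodule.defs)

lemma ker_mem: "x \<in> a_kernel A B p \<longleftrightarrow> x \<in> carrier A \<and> p x = \<zero>[B]" by (simp add: a_kernel_def kernel_def)

lemma ker_bimod: "bimod A A ker"
proof -
  note h = ring_hom_add[OF p] ring_hom_mult[OF p] ring_hom_closed[OF p] ring_hom_zero[OF p A.A.ring_axioms B.A.ring_axioms]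
  interpret ph: ring_hom_ring A B p by (rule ring_hom_ringI2[OF A.A.ring_axioms B.A.ring_axioms p])
  have "abelian_group ker" by (rule abelian_groupI) (auto simp: ker_mem h A.A.a_ac A.A.r_neg intro!: bexI[of _ "\<ominus>[A] _"])
  then have "right_module A ker" by (intro right_moduleI' A.A.ring_axioms) (auto simp: ker_mem h A.A.l_distr A.A.r_distr A.A.m_assoc)
  then show ?thesis by (intro bimod.intro bimod_axioms.intro A.A.ring_axioms rlinearI)
      (auto simp: ker_mem h A.A.l_distr A.A.r_distr A.A.m_assoc)
qed

text \<open>For surjective p the cohomology of \<open>cone(p)[-1]\<close> is the kernel of p, in
  degree 0, and sending k to \<open>(0, k)\<close> is linear on both sides.\<close>

lemma RHom_ker:
  assumes surj: "p ` carrier A = carrier B"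
  shows "isomorphic_functors (dercat A :: ('a, 'u) dcat) (dercat A :: ('a, 'u) dcat) (RHom A A cn) (RHom A A (conc ker))"
proof -
  interpret K: bimod A A ker by (rule ker_bimod)
  interpret rhom A A U "conc ker"
    by (intro rhom.intro rhom_axioms.intro A.derived_axioms K.conc_bicpx embeds_enc universe_fun_countable[OF A.large])
  interpret ph: ring_hom_ring A B p by (rule ring_hom_ringI2[OF A.A.ring_axioms B.A.ring_axioms p])
  let ?K = "fg (conc ker)" let ?i = "\<lambda>i k. (\<zero>[B], k) :: 'b \<times> 'a"
  note fK = fg_cpx[OF M.cpx] and fC = fg_cpx[OF T.M.cpx]
  interpret C: cpx_loc A "fg cn" by standard (rule fC)
  interpret FK: cpx_loc A "?K" by standard (rule fK)
  have mem: "(\<zero>[B], k) \<in> el cn n" "k \<in> carrier A" "p k = \<zero>[B]" if "k \<in> el (conc ker) n" for k n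
    using that by (cases "n = 0"; auto simp: ker_mem)+
  have c: "chain_map A ?K (fg cn) ?i" by (rule chain_mapI, rule rlinearI) (auto simp: mem cn_d[OF mem(1)])
  have "quasi_iso A ?K (fg cn) ?i"
  proof (rule quasi_isoI[OF fK fC c])
    fix n z assume "z \<in> cocycles ?K n" "(\<zero>[B], z) \<in> coboundaries (fg cn) n"
    \<comment> \<open>Coboundaries of \<open>cn\<close> have vanishing A-component.\<close>
    then have "z = \<zero>[A]" by (auto simp: coboundaries_def cn_d simp del: cn_simps(1))
    then show "z \<in> coboundaries ?K n" using FK.cobs_zero[of n] by simp
  next
    fix n y assume y: "y \<in> cocycles (fg cn) n"
    obtain b a where ba: "y = (b, a)" by (cases y)
    have m: "(b, a) \<in> el cn n" and d: "cdf cn n (b, a) = (\<zero>[B], \<zero>[A])" using y by (simp_all add: ba cocycles_def del: cn_simps(1))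
    show "\<exists>z\<in>cocycles ?K n. (\<zero>[B], z) \<ominus>[fg cn,n] y \<in> coboundaries (fg cn) n"
    proof (cases "n = 0")
      case True
      have a: "a \<in> carrier A" "b = \<zero>[B]" using m True by auto
      have "p a = \<zero>[B]" using d m a(1) True B.A.minus_minus[of "p a"] B.A.a_inv_zero ph.hom_closed by (simp add: cn_d)
      then have "a \<in> cocycles ?K n" using a by (simp add: cocycles_def ker_mem True)
      moreover have "(\<zero>[B], a) \<ominus>[fg cn,n] y = \<zero>[fg cn,n]" using C.M.M.r_neg[of y n] m by (simp add: ba a(2) a_minus_def)
      ultimately show ?thesis using C.cobs_zero[of n] by (metis (no_types))
    next
      case False
      have "y \<in> coboundaries (fg cn) n"
      proof (cases "n = 1")
        case True
        have "b \<in> p ` carrier A" "a = \<zero>[A]" using m True surj by auto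
        then obtain a' where a': "a' \<in> carrier A" "b = p a'" "a = \<zero>[A]" by blast
        \<comment> \<open>The preimage \<open>a'\<close> of b is negated because the differential of
          the shifted cone is -p.\<close>
        have "cdf (fg cn) 0 (\<zero>[B], \<ominus>[A] a') = y" using a' by (simp add: cn_d ba)
        then show ?thesis using C.coboundariesI[of "(\<zero>[B], \<ominus>[A] a')" n] a' True by simp
      next
        case F: False
        then have "y = \<zero>[fg cn,n]" using m False by (simp add: ba)
        then show ?thesis using C.cobs_zero[of n] by simp
      qed
      then have "\<zero>[fg cn,n] \<ominus>[fg cn,n] y \<in> coboundaries (fg cn) n"
        using C.cobs_neg C.cobs_carrier by (simp add: a_minus_def del: fg_simps)
      moreover have "\<zero>[A] \<in> cocycles ?K n" using False by (simp add: cocycles_def)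
      ultimately show ?thesis by (intro bexI[of _ "\<zero>[A]"]) simp_all
    qed
  qed
  moreover have "large_universe TYPE('b \<times> 'a) TYPE('u)" by (rule large_universe_mono[OF large2 embedsI[of prod.swap]]) simp
  ultimately interpret bicpx_quasi_iso A A U cn "conc ker" ?i
    by (intro bicpx_quasi_iso.intro bicpx_quasi_iso_axioms.intro T.rhom_axioms rhom_axioms embeds_enc universe_ring[OF A.large] universe_ring)
      (simp_all add: ring_hom_closed[OF p])
  show ?thesis by (rule RHom_iso)
qed

end

theorem theorem1:
  fixes A :: "('a, 'x) ring_scheme" and B :: "('b, 'y) ring_scheme" and p :: "'a \<Rightarrow> 'b"
  assumes universe: "large_universe TYPE('a \<times> 'b) TYPE('u)"
    and A: "ring A" and B: "ring B" and p: "p \<in> ring_hom A B"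
    and perfect: "perfect A (ring_bimodule B p p)"
  shows "is_twist (dercat B :: ('b, 'u) dcat) (dercat A :: ('a, 'u) dcat) (der_restr A p)
           (RHom A A (shift (-1) (ring_bicone A B p)))
       \<and> (p ` carrier A = carrier B \<longrightarrow>
            isomorphic_functors (dercat A :: ('a, 'u) dcat) (dercat A :: ('a, 'u) dcat)
              (RHom A A (shift (-1) (ring_bicone A B p)))
              (RHom A A (conc (kernel_bimodule A B p))))"
proof -
  \<comment> \<open>Each carrier type embeds into the product by fixing the other entry, and a
    universe that is large for a type is large for whatever embeds into it.\<close>
  have "large_universe TYPE('a) TYPE('u)"
    by (rule large_universe_mono[OF universe embedsI[of "\<lambda>a. (a, undefined)"]]) (simp add: inj_def)
  moreover have "large_universe TYPE('b) TYPE('u)"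
    by (rule large_universe_mono[OF universe embedsI[of "\<lambda>b. (undefined, b)"]]) (simp add: inj_def)
  ultimately interpret ring_mor_large A B "TYPE('u)" p
    by (intro ring_mor_large.intro ring_mor_large_axioms.intro ring_mor.intro ring_mor_axioms.intro
      derived.intro derived_axioms.intro A B p universe)
  show ?thesis
    using twist RHom_ker unfolding cn_def by blast
qed

end
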